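(* $\mathbf{EL^+}+\mathrm{CF_d}$ is a conservative (in fact definitional) extension of $\mathbf{M}$.
   Context: All systems are based on two-sorted intuitionistic predicate logic with number variables (natural numbers) and function variables (one-place number-theoretic functions); number equality is primitive, $u=v:\equiv\forall x\,u(x)=v(x)$; $\exists! y\,B(y)$ abbreviates $\exists y[B(y)\,\&\,\forall z(B(z)\to y=z)]$. $\mathbf{IA_1}$: language with $0,',+,\cdot$ and finitely many further primitive recursive function(al) constants $f_4,\dots,f_{26}$ (exponentiation, factorial, predecessor, cut-off subtraction, min, max, $\mathrm{sg}$, $\overline{\mathrm{sg}}$, $|a-b|$, remainder, quotient, bounded sums/products/min/max of function values, prime enumeration, exponent $(a)_i$, length, concatenation, $\overline{\alpha}(x)$, $\widetilde{\alpha}(x)$, $a\circ b$, Kleene's $\mathrm{ccp}$), application and $\lambda$-abstraction; axioms: Peano axioms for $0,',+,\cdot$, equality axioms, the defining equations of the $f_i$, $x=y\to\alpha(x)=\alpha(y)$, $\lambda$-conversion, induction for all formulas. $\mathbf{M}=\mathbf{IA_1}+\mathrm{AC_{00}!}$. $\mathbf{HA_1}$: $0$, a constant for each primitive recursive description, application, $\lambda$, recursor $\mathrm{rec}$; axioms $x=x$, $A(x)\,\&\,x=y\to A(y)$, induction, $\neg S(0)=0$, defining equations, $\lambda$-conversion, $\mathrm{rec}(t,u,0)=t$, $\mathrm{rec}(t,u,S(s))=u(\langle\mathrm{rec}(t,u,s),s\rangle)$ with $\langle a,b\rangle=2^a3^b$. $\mathbf{EL}=\mathbf{HA_1}+\mathrm{QF\text{-}AC_{00}}$.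 $\mathbf{EL^+}$ is obtained from $\mathbf{EL}$ by adding all the (finitely many) function(al) constants of $\mathbf{M}$ with their defining axioms, all axiom schemata being extended to the new language. $\mathrm{AC_{00}!}$: $\forall x\exists! y\,A(x,y)\to\exists\alpha\forall x\,A(x,\alpha(x))$. $\mathrm{QF\text{-}AC_{00}}$: same without $!$, $A$ quantifier-free. $\mathrm{CF_d}$: $\forall x(B(x)\vee\neg B(x))\to\exists\beta\forall x[\beta(x)\le 1\,\&\,(\beta(x)=0\leftrightarrow B(x))]$. $S_2$ (whose language and theorems contain those of $S_1$) is a conservative extension of $S_1$ if the theorems of $S_2$ in the language of $S_1$ are exactly those of $S_1$. $S_2$ is a definitional extension of $S_1$ if there is an effective translation $E\mapsto E'$ of formulas of $S_2$ into formulas of $S_1$ such that: $E'\equiv E$ for $E$ in the language of $S_1$; $S_2\vdash E'\leftrightarrow E$; if $\Gamma\vdash_{S_2}E$ then $\Gamma'\vdash_{S_1}E'$; and $'$ commutes with the logical operations. *)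

theory Defs
  imports Main "HOL-Library.Nat_Bijection"
begin

section \<open>Constants\<close>

text \<open>Descriptions of primitive recursive functions. \<open>ZeroD n\<close> describes the \<open>n\<close>-place function
  with constant value 0, \<open>ProjD n i\<close> the projection to the \<open>i\<close>-th of \<open>n\<close> arguments (counted from 0),
  \<open>CompD n h gs\<close> the composition of \<open>h\<close> with a list of \<open>n\<close>-place functions, and \<open>RecD g h\<close> recursion
  on the first argument. Arity 0 is allowed, so that \<open>RecD\<close> covers recursion without parameters.\<close>

datatype prd =
    ZeroD nat
  | SuccD
  | ProjD nat nat
  | CompD nat prd "prd list"
  | RecD prd prd

fun arity_prd :: "prd \<Rightarrow> nat" where
  "arity_prd (ZeroD n) = n"
| "arity_prd SuccD = 1"
| "arity_prd (ProjD n i) = n"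
| "arity_prd (CompD n h gs) = n"
| "arity_prd (RecD g h) = Suc (arity_prd g)"

fun wf_prd :: "prd \<Rightarrow> bool" where
  "wf_prd (ZeroD n) \<longleftrightarrow> True"
| "wf_prd SuccD \<longleftrightarrow> True"
| "wf_prd (ProjD n i) \<longleftrightarrow> i < n"
| "wf_prd (CompD n h gs) \<longleftrightarrow>
     wf_prd h \<and> arity_prd h = length gs \<and> (\<forall>g\<in>set gs. wf_prd g \<and> arity_prd g = n)"
| "wf_prd (RecD g h) \<longleftrightarrow> wf_prd g \<and> wf_prd h \<and> arity_prd h = arity_prd g + 2"

text \<open>Kleene's \<open>f\<^sub>2, \<dots>, f\<^sub>2\<^sub>6\<close>, in this order: \<open>+\<close>, \<open>\<cdot>\<close>, exponentiation, factorial, predecessor, cut-off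
  subtraction, min, max, \<open>\<^bold>s\<^bold>g\<close> with a bar, \<open>\<^bold>s\<^bold>g\<close>, \<open>\<bar>a - b\<bar>\<close>, remainder, quotient,
  \<open>\<Sum>\<^sub>y\<^sub><\<^sub>z \<alpha>(y)\<close>, \<open>\<Prod>\<^sub>y\<^sub><\<^sub>z \<alpha>(y)\<close>, \<open>min\<^sub>y\<^sub>\<le>\<^sub>z \<alpha>(y)\<close>, \<open>max\<^sub>y\<^sub>\<le>\<^sub>z \<alpha>(y)\<close>, the \<open>a\<close>-th prime, the exponent
  \<open>(a)\<^sub>i\<close>, length, concatenation, course of values \<open>\<alpha>\<close>-bar, \<open>\<alpha>\<close>-tilde, \<open>a \<circ> b\<close>, and the continued
  \<open>\<circ>\<close>-product \<open>ccp\<^sub>y\<^sub><\<^sub>z \<alpha>(y)\<close>.\<close>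

datatype klc =
    KAdd | KMul | KExp | KFact | KPd | KMonus | KMin | KMax | KSgb | KSg | KDiff | KRm | KQuot
  | KSum | KProd | KBMin | KBMax | KPrime | KExpo | KLh | KCat | KBar | KTilde | KCirc | KCcp

text \<open>The recursor is treated as a constant with two number arguments and one function argument.
  The zero and successor symbols, \<open>Zero\<close> and \<open>Fn SuccD\<close>, are common to all the systems.\<close>

datatype cst = Zero | Fn prd | Kl klc | Rec

fun arity_klc :: "klc \<Rightarrow> nat \<times> nat" where
  "arity_klc KFact = (1, 0)"
| "arity_klc KPd = (1, 0)"
| "arity_klc KSgb = (1, 0)"
| "arity_klc KSg = (1, 0)"
| "arity_klc KPrime = (1, 0)"
| "arity_klc KLh = (1, 0)"
| "arity_klc KSum = (1, 1)"
| "arity_klc KProd = (1, 1)"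
| "arity_klc KBMin = (1, 1)"
| "arity_klc KBMax = (1, 1)"
| "arity_klc KBar = (1, 1)"
| "arity_klc KTilde = (1, 1)"
| "arity_klc KCcp = (1, 1)"
| "arity_klc _ = (2, 0)"

text \<open>Number of number arguments and number of function arguments.\<close>

fun arity :: "cst \<Rightarrow> nat \<times> nat" where
  "arity Zero = (0, 0)"
| "arity (Fn d) = (arity_prd d, 0)"
| "arity (Kl k) = arity_klc k"
| "arity Rec = (2, 1)"


section \<open>Terms, functors and formulas\<close>

text \<open>Variables are de Bruijn indices, counted separately for the two sorts; \<open>Lam\<close>, \<open>All0\<close>, \<open>Ex0\<close>
  bind the number variable 0, and \<open>All1\<close>, \<open>Ex1\<close> bind the function variable 0. Thus formulas are
  identified up to the names of bound variables.

  A constant of arity \<open>(1, 0)\<close> is itself a functor \<open>FC c\<close>, and its value at \<open>t\<close> is \<open>App (FC c) t\<close>;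
  the form \<open>Cst\<close> is reserved by the well-formedness predicates below for the other arities, so that
  \<open>c(t)\<close> has only one representation.\<close>

datatype trm = NVar nat | Cst cst "trm list" "fct list" | App fct trm
  and fct = FVar nat | FC cst | Lam trm

datatype fm =
    Eq trm trm          (infix "\<doteq>" 60)
  | Neg fm              ("\<^bold>\<not> _" [59] 59)
  | And fm fm           (infixr "\<^bold>\<and>" 58)
  | Or fm fm            (infixr "\<^bold>\<or>" 57)
  | Imp fm fm           (infixr "\<^bold>\<longrightarrow>" 56)
  | All0 fm | Ex0 fm | All1 fm | Ex1 fm

definition Iff :: "fm \<Rightarrow> fm \<Rightarrow> fm"  (infixr "\<^bold>\<longleftrightarrow>" 55) where
  "A \<^bold>\<longleftrightarrow> B = ((A \<^bold>\<longrightarrow> B) \<^bold>\<and> (B \<^bold>\<longrightarrow> A))"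

fun quantifier_free :: "fm \<Rightarrow> bool" where
  "quantifier_free (s \<doteq> t) \<longleftrightarrow> True"
| "quantifier_free (\<^bold>\<not> A) \<longleftrightarrow> quantifier_free A"
| "quantifier_free (A \<^bold>\<and> B) \<longleftrightarrow> quantifier_free A \<and> quantifier_free B"
| "quantifier_free (A \<^bold>\<or> B) \<longleftrightarrow> quantifier_free A \<and> quantifier_free B"
| "quantifier_free (A \<^bold>\<longrightarrow> B) \<longleftrightarrow> quantifier_free A \<and> quantifier_free B"
| "quantifier_free _ \<longleftrightarrow> False"

text \<open>A language is given by its set of constants.\<close>

fun wf_trm :: "cst set \<Rightarrow> trm \<Rightarrow> bool" and wf_fct :: "cst set \<Rightarrow> fct \<Rightarrow> bool" where
  "wf_trm L (NVar n) \<longleftrightarrow> True"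
| "wf_trm L (Cst c ts us) \<longleftrightarrow>
     c \<in> L \<and> arity c = (length ts, length us) \<and> arity c \<noteq> (1, 0) \<and>
     (\<forall>t\<in>set ts. wf_trm L t) \<and> (\<forall>u\<in>set us. wf_fct L u)"
| "wf_trm L (App u t) \<longleftrightarrow> wf_fct L u \<and> wf_trm L t"
| "wf_fct L (FVar n) \<longleftrightarrow> True"
| "wf_fct L (FC c) \<longleftrightarrow> c \<in> L \<and> arity c = (1, 0)"
| "wf_fct L (Lam t) \<longleftrightarrow> wf_trm L t"

fun wf_fm :: "cst set \<Rightarrow> fm \<Rightarrow> bool" where
  "wf_fm L (s \<doteq> t) \<longleftrightarrow> wf_trm L s \<and> wf_trm L t"
| "wf_fm L (\<^bold>\<not> A) \<longleftrightarrow> wf_fm L A"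
| "wf_fm L (A \<^bold>\<and> B) \<longleftrightarrow> wf_fm L A \<and> wf_fm L B"
| "wf_fm L (A \<^bold>\<or> B) \<longleftrightarrow> wf_fm L A \<and> wf_fm L B"
| "wf_fm L (A \<^bold>\<longrightarrow> B) \<longleftrightarrow> wf_fm L A \<and> wf_fm L B"
| "wf_fm L (All0 A) \<longleftrightarrow> wf_fm L A"
| "wf_fm L (Ex0 A) \<longleftrightarrow> wf_fm L A"
| "wf_fm L (All1 A) \<longleftrightarrow> wf_fm L A"
| "wf_fm L (Ex1 A) \<longleftrightarrow> wf_fm L A"


section \<open>Renaming and substitution\<close>

definition up_ren :: "(nat \<Rightarrow> nat) \<Rightarrow> nat \<Rightarrow> nat" where
  "up_ren r n = (case n of 0 \<Rightarrow> 0 | Suc m \<Rightarrow> Suc (r m))"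

fun ren_trm :: "(nat \<Rightarrow> nat) \<Rightarrow> (nat \<Rightarrow> nat) \<Rightarrow> trm \<Rightarrow> trm"
  and ren_fct :: "(nat \<Rightarrow> nat) \<Rightarrow> (nat \<Rightarrow> nat) \<Rightarrow> fct \<Rightarrow> fct" where
  "ren_trm r q (NVar n) = NVar (r n)"
| "ren_trm r q (Cst c ts us) = Cst c (map (ren_trm r q) ts) (map (ren_fct r q) us)"
| "ren_trm r q (App u t) = App (ren_fct r q u) (ren_trm r q t)"
| "ren_fct r q (FVar n) = FVar (q n)"
| "ren_fct r q (FC c) = FC c"
| "ren_fct r q (Lam t) = Lam (ren_trm (up_ren r) q t)"

fun ren_fm :: "(nat \<Rightarrow> nat) \<Rightarrow> (nat \<Rightarrow> nat) \<Rightarrow> fm \<Rightarrow> fm" where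
  "ren_fm r q (s \<doteq> t) = (ren_trm r q s \<doteq> ren_trm r q t)"
| "ren_fm r q (\<^bold>\<not> A) = (\<^bold>\<not> ren_fm r q A)"
| "ren_fm r q (A \<^bold>\<and> B) = (ren_fm r q A \<^bold>\<and> ren_fm r q B)"
| "ren_fm r q (A \<^bold>\<or> B) = (ren_fm r q A \<^bold>\<or> ren_fm r q B)"
| "ren_fm r q (A \<^bold>\<longrightarrow> B) = (ren_fm r q A \<^bold>\<longrightarrow> ren_fm r q B)"
| "ren_fm r q (All0 A) = All0 (ren_fm (up_ren r) q A)"
| "ren_fm r q (Ex0 A) = Ex0 (ren_fm (up_ren r) q A)"
| "ren_fm r q (All1 A) = All1 (ren_fm r (up_ren q) A)"
| "ren_fm r q (Ex1 A) = Ex1 (ren_fm r (up_ren q) A)"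

abbreviation lift0 :: "fm \<Rightarrow> fm" where "lift0 \<equiv> ren_fm Suc id"
abbreviation lift1 :: "fm \<Rightarrow> fm" where "lift1 \<equiv> ren_fm id Suc"

text \<open>Simultaneous substitution of terms for number variables and functors for function variables.
  The operations \<open>up0\<close>, \<open>up1\<close> on pairs of substitutions serve to pass under a binder of the
  respective sort.\<close>

definition up0_trm :: "(nat \<Rightarrow> trm) \<Rightarrow> nat \<Rightarrow> trm" where
  "up0_trm \<sigma> n = (case n of 0 \<Rightarrow> NVar 0 | Suc m \<Rightarrow> ren_trm Suc id (\<sigma> m))"

definition up0_fct :: "(nat \<Rightarrow> fct) \<Rightarrow> nat \<Rightarrow> fct" where
  "up0_fct \<tau> n = ren_fct Suc id (\<tau> n)"

definition up1_trm :: "(nat \<Rightarrow> trm) \<Rightarrow> nat \<Rightarrow> trm" where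
  "up1_trm \<sigma> n = ren_trm id Suc (\<sigma> n)"

definition up1_fct :: "(nat \<Rightarrow> fct) \<Rightarrow> nat \<Rightarrow> fct" where
  "up1_fct \<tau> n = (case n of 0 \<Rightarrow> FVar 0 | Suc m \<Rightarrow> ren_fct id Suc (\<tau> m))"

fun sub_trm :: "(nat \<Rightarrow> trm) \<Rightarrow> (nat \<Rightarrow> fct) \<Rightarrow> trm \<Rightarrow> trm"
  and sub_fct :: "(nat \<Rightarrow> trm) \<Rightarrow> (nat \<Rightarrow> fct) \<Rightarrow> fct \<Rightarrow> fct" where
  "sub_trm \<sigma> \<tau> (NVar n) = \<sigma> n"
| "sub_trm \<sigma> \<tau> (Cst c ts us) = Cst c (map (sub_trm \<sigma> \<tau>) ts) (map (sub_fct \<sigma> \<tau>) us)"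
| "sub_trm \<sigma> \<tau> (App u t) = App (sub_fct \<sigma> \<tau> u) (sub_trm \<sigma> \<tau> t)"
| "sub_fct \<sigma> \<tau> (FVar n) = \<tau> n"
| "sub_fct \<sigma> \<tau> (FC c) = FC c"
| "sub_fct \<sigma> \<tau> (Lam t) = Lam (sub_trm (up0_trm \<sigma>) (up0_fct \<tau>) t)"

fun sub_fm :: "(nat \<Rightarrow> trm) \<Rightarrow> (nat \<Rightarrow> fct) \<Rightarrow> fm \<Rightarrow> fm" where
  "sub_fm \<sigma> \<tau> (s \<doteq> t) = (sub_trm \<sigma> \<tau> s \<doteq> sub_trm \<sigma> \<tau> t)"
| "sub_fm \<sigma> \<tau> (\<^bold>\<not> A) = (\<^bold>\<not> sub_fm \<sigma> \<tau> A)"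
| "sub_fm \<sigma> \<tau> (A \<^bold>\<and> B) = (sub_fm \<sigma> \<tau> A \<^bold>\<and> sub_fm \<sigma> \<tau> B)"
| "sub_fm \<sigma> \<tau> (A \<^bold>\<or> B) = (sub_fm \<sigma> \<tau> A \<^bold>\<or> sub_fm \<sigma> \<tau> B)"
| "sub_fm \<sigma> \<tau> (A \<^bold>\<longrightarrow> B) = (sub_fm \<sigma> \<tau> A \<^bold>\<longrightarrow> sub_fm \<sigma> \<tau> B)"
| "sub_fm \<sigma> \<tau> (All0 A) = All0 (sub_fm (up0_trm \<sigma>) (up0_fct \<tau>) A)"
| "sub_fm \<sigma> \<tau> (Ex0 A) = Ex0 (sub_fm (up0_trm \<sigma>) (up0_fct \<tau>) A)"
| "sub_fm \<sigma> \<tau> (All1 A) = All1 (sub_fm (up1_trm \<sigma>) (up1_fct \<tau>) A)"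
| "sub_fm \<sigma> \<tau> (Ex1 A) = Ex1 (sub_fm (up1_trm \<sigma>) (up1_fct \<tau>) A)"

text \<open>\<open>inst0 t\<close>, \<open>inst1 u\<close>: substitution for variable 0 on removal of a binder. \<open>step0 t\<close>: substitution
  of \<open>t\<close> for the number variable 0 when the binder is kept, so that \<open>t\<close> may contain that variable.\<close>

definition inst0 :: "trm \<Rightarrow> nat \<Rightarrow> trm" where
  "inst0 t n = (case n of 0 \<Rightarrow> t | Suc m \<Rightarrow> NVar m)"

definition inst1 :: "fct \<Rightarrow> nat \<Rightarrow> fct" where
  "inst1 u n = (case n of 0 \<Rightarrow> u | Suc m \<Rightarrow> FVar m)"

definition step0 :: "trm \<Rightarrow> nat \<Rightarrow> trm" where
  "step0 t n = (case n of 0 \<Rightarrow> t | Suc m \<Rightarrow> NVar (Suc m))"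

abbreviation sub0 :: "trm \<Rightarrow> fm \<Rightarrow> fm" where "sub0 t \<equiv> sub_fm (inst0 t) FVar"
abbreviation sub1 :: "fct \<Rightarrow> fm \<Rightarrow> fm" where "sub1 u \<equiv> sub_fm NVar (inst1 u)"


section \<open>Formal systems and derivability\<close>

datatype system = System (lang: "cst set") (axms: "fm set")

text \<open>Natural deduction for two-sorted intuitionistic predicate logic with primitive negation. All
  formulas of a derivation belong to the language of the system; the free variables of the open
  assumptions \<open>\<Gamma>\<close> are held constant, while axioms may be generalized. Equality is governed by the
  axioms of the systems only.\<close>

inductive deriv :: "system \<Rightarrow> fm set \<Rightarrow> fm \<Rightarrow> bool" for S :: system where
  Ass: "A \<in> \<Gamma> \<Longrightarrow> wf_fm (lang S) A \<Longrightarrow> deriv S \<Gamma> A"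
| Axm: "A \<in> axms S \<Longrightarrow> wf_fm (lang S) A \<Longrightarrow> deriv S \<Gamma> A"
| AndI: "deriv S \<Gamma> A \<Longrightarrow> deriv S \<Gamma> B \<Longrightarrow> deriv S \<Gamma> (A \<^bold>\<and> B)"
| AndE1: "deriv S \<Gamma> (A \<^bold>\<and> B) \<Longrightarrow> deriv S \<Gamma> A"
| AndE2: "deriv S \<Gamma> (A \<^bold>\<and> B) \<Longrightarrow> deriv S \<Gamma> B"
| OrI1: "deriv S \<Gamma> A \<Longrightarrow> wf_fm (lang S) B \<Longrightarrow> deriv S \<Gamma> (A \<^bold>\<or> B)"
| OrI2: "deriv S \<Gamma> B \<Longrightarrow> wf_fm (lang S) A \<Longrightarrow> deriv S \<Gamma> (A \<^bold>\<or> B)"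
| OrE: "deriv S \<Gamma> (A \<^bold>\<or> B) \<Longrightarrow> deriv S (insert A \<Gamma>) C \<Longrightarrow> deriv S (insert B \<Gamma>) C \<Longrightarrow> deriv S \<Gamma> C"
| ImpI: "wf_fm (lang S) A \<Longrightarrow> deriv S (insert A \<Gamma>) B \<Longrightarrow> deriv S \<Gamma> (A \<^bold>\<longrightarrow> B)"
| ImpE: "deriv S \<Gamma> (A \<^bold>\<longrightarrow> B) \<Longrightarrow> deriv S \<Gamma> A \<Longrightarrow> deriv S \<Gamma> B"
| NegI: "wf_fm (lang S) A \<Longrightarrow> deriv S (insert A \<Gamma>) B \<Longrightarrow> deriv S (insert A \<Gamma>) (\<^bold>\<not> B) \<Longrightarrow>
    deriv S \<Gamma> (\<^bold>\<not> A)"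
| NegE: "deriv S \<Gamma> A \<Longrightarrow> deriv S \<Gamma> (\<^bold>\<not> A) \<Longrightarrow> wf_fm (lang S) B \<Longrightarrow> deriv S \<Gamma> B"
| All0I: "deriv S (lift0 ` \<Gamma>) A \<Longrightarrow> deriv S \<Gamma> (All0 A)"
| All0E: "deriv S \<Gamma> (All0 A) \<Longrightarrow> wf_trm (lang S) t \<Longrightarrow> deriv S \<Gamma> (sub0 t A)"
| Ex0I: "wf_fm (lang S) A \<Longrightarrow> wf_trm (lang S) t \<Longrightarrow> deriv S \<Gamma> (sub0 t A) \<Longrightarrow> deriv S \<Gamma> (Ex0 A)"
| Ex0E: "deriv S \<Gamma> (Ex0 A) \<Longrightarrow> deriv S (insert A (lift0 ` \<Gamma>)) (lift0 B) \<Longrightarrow> deriv S \<Gamma> B"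
| All1I: "deriv S (lift1 ` \<Gamma>) A \<Longrightarrow> deriv S \<Gamma> (All1 A)"
| All1E: "deriv S \<Gamma> (All1 A) \<Longrightarrow> wf_fct (lang S) u \<Longrightarrow> deriv S \<Gamma> (sub1 u A)"
| Ex1I: "wf_fm (lang S) A \<Longrightarrow> wf_fct (lang S) u \<Longrightarrow> deriv S \<Gamma> (sub1 u A) \<Longrightarrow> deriv S \<Gamma> (Ex1 A)"
| Ex1E: "deriv S \<Gamma> (Ex1 A) \<Longrightarrow> deriv S (insert A (lift1 ` \<Gamma>)) (lift1 B) \<Longrightarrow> deriv S \<Gamma> B"

definition formulas :: "system \<Rightarrow> fm set" where
  "formulas S = {A. wf_fm (lang S) A}"

definition theorems :: "system \<Rightarrow> fm set" where
  "theorems S = {A. deriv S {} A}"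


section \<open>Notation for terms\<close>

text \<open>Application of a constant to a list of number terms, in the form required by its arity.\<close>

definition app_cst :: "cst \<Rightarrow> trm list \<Rightarrow> trm" where
  "app_cst c ts = (if length ts = 1 then App (FC c) (hd ts) else Cst c ts [])"

abbreviation zero :: trm  ("\<^bold>0") where "\<^bold>0 \<equiv> Cst Zero [] []"
abbreviation succ :: "trm \<Rightarrow> trm" where "succ t \<equiv> App (FC (Fn SuccD)) t"
abbreviation one :: trm  ("\<^bold>1") where "\<^bold>1 \<equiv> succ \<^bold>0"
abbreviation two :: trm  ("\<^bold>2") where "\<^bold>2 \<equiv> succ \<^bold>1"

abbreviation k1 :: "klc \<Rightarrow> trm \<Rightarrow> trm" where "k1 k t \<equiv> App (FC (Kl k)) t"
abbreviation k2 :: "klc \<Rightarrow> trm \<Rightarrow> trm \<Rightarrow> trm" where "k2 k s t \<equiv> Cst (Kl k) [s, t] []"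
abbreviation kf :: "klc \<Rightarrow> trm \<Rightarrow> fct \<Rightarrow> trm" where "kf k t u \<equiv> Cst (Kl k) [t] [u]"

abbreviation add :: "trm \<Rightarrow> trm \<Rightarrow> trm"  (infixl "\<^bold>+" 65) where "s \<^bold>+ t \<equiv> k2 KAdd s t"
abbreviation mul :: "trm \<Rightarrow> trm \<Rightarrow> trm"  (infixl "\<^bold>\<cdot>" 70) where "s \<^bold>\<cdot> t \<equiv> k2 KMul s t"
abbreviation exp :: "trm \<Rightarrow> trm \<Rightarrow> trm"  (infixr "\<^bold>\<up>" 75) where "s \<^bold>\<up> t \<equiv> k2 KExp s t"
abbreviation monus :: "trm \<Rightarrow> trm \<Rightarrow> trm"  (infixl "\<^bold>-" 65) where "s \<^bold>- t \<equiv> k2 KMonus s t"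

text \<open>Kleene's \<open>\<mu>y\<^sub>y\<^sub><\<^sub>z r(y) = 0\<close>, i.e. \<open>\<Sum>\<^sub>x\<^sub><\<^sub>z \<Prod>\<^sub>y\<^sub>\<le>\<^sub>x sg(r(y))\<close>: the least \<open>y < z\<close> with \<open>r(y) = 0\<close>, and \<open>z\<close> if
  there is none. In \<open>r\<close> the number variable 0 stands for \<open>y\<close>.\<close>

definition bmu :: "trm \<Rightarrow> trm \<Rightarrow> trm" where
  "bmu z r = kf KSum z (Lam (kf KProd (succ (NVar 0)) (Lam (k1 KSg (ren_trm (up_ren Suc) id r)))))"

text \<open>\<open>a < b\<close> is \<open>\<exists>c. c' + a = b\<close> and \<open>a \<le> b\<close> is \<open>a < b \<or> a = b\<close>.\<close>

definition Less :: "trm \<Rightarrow> trm \<Rightarrow> fm" where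
  "Less s t = Ex0 (succ (NVar 0) \<^bold>+ ren_trm Suc id s \<doteq> ren_trm Suc id t)"

definition LessEq :: "trm \<Rightarrow> trm \<Rightarrow> fm" where
  "LessEq s t = (Less s t \<^bold>\<or> s \<doteq> t)"

text \<open>\<open>\<exists>!y B(y)\<close>, i.e. \<open>\<exists>y (B(y) \<and> \<forall>z (B(z) \<longrightarrow> y = z))\<close>, where \<open>y\<close> is the number variable 0 of \<open>B\<close>.\<close>

definition ExU0 :: "fm \<Rightarrow> fm" where
  "ExU0 B = Ex0 (B \<^bold>\<and> All0 (ren_fm (up_ren Suc) id B \<^bold>\<longrightarrow> NVar 1 \<doteq> NVar 0))"


section \<open>Axioms\<close>

text \<open>Axioms without schematic letters are stated with free variables.\<close>

definition peano_succ :: "fm set" where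
  "peano_succ =
     {succ (NVar 0) \<doteq> succ (NVar 1) \<^bold>\<longrightarrow> NVar 0 \<doteq> NVar 1,
      \<^bold>\<not> succ (NVar 0) \<doteq> \<^bold>0}"

definition equality_axioms :: "fm set" where
  "equality_axioms =
     {NVar 0 \<doteq> NVar 0,
      NVar 0 \<doteq> NVar 1 \<^bold>\<longrightarrow> (NVar 0 \<doteq> NVar 2 \<^bold>\<longrightarrow> NVar 1 \<doteq> NVar 2),
      NVar 0 \<doteq> NVar 1 \<^bold>\<longrightarrow> succ (NVar 0) \<doteq> succ (NVar 1)}"

definition function_ext :: fm where
  "function_ext = (NVar 0 \<doteq> NVar 1 \<^bold>\<longrightarrow> App (FVar 0) (NVar 0) \<doteq> App (FVar 0) (NVar 1))"

definition lambda_conversion :: "cst set \<Rightarrow> fm set" where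
  "lambda_conversion L =
     {App (Lam t) s \<doteq> sub_trm (inst0 s) FVar t | t s. wf_trm L t \<and> wf_trm L s}"

definition induction_schema :: "cst set \<Rightarrow> fm set" where
  "induction_schema L =
     {sub0 \<^bold>0 A \<^bold>\<and> All0 (A \<^bold>\<longrightarrow> sub_fm (step0 (succ (NVar 0))) FVar A) \<^bold>\<longrightarrow> All0 A | A. wf_fm L A}"

text \<open>The defining equations of Kleene's constants. In those of the prime enumeration,
  \<open>p\<^sub>i\<^sub>' = \<mu>b\<^sub>b\<^sub><\<^sub>c (p\<^sub>i < b and b has no divisor d with 1 < d < b)\<close> for \<open>c = p\<^sub>i! + 2\<close>, and
  \<open>(a)\<^sub>i = \<mu>x\<^sub>x\<^sub><\<^sub>a (p\<^sub>i\<^sup>x divides a and p\<^sub>i\<^sup>x\<^sup>' does not)\<close>; the conditions are expressed by the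
  vanishing of a term.\<close>

definition kleene_equations :: "fm set" where
  "kleene_equations = (let a = NVar 0; b = NVar 1; \<alpha> = FVar 0 in
     {a \<^bold>+ \<^bold>0 \<doteq> a,
      a \<^bold>+ succ b \<doteq> succ (a \<^bold>+ b),
      a \<^bold>\<cdot> \<^bold>0 \<doteq> \<^bold>0,
      a \<^bold>\<cdot> succ b \<doteq> a \<^bold>\<cdot> b \<^bold>+ a,
      a \<^bold>\<up> \<^bold>0 \<doteq> \<^bold>1,
      a \<^bold>\<up> succ b \<doteq> a \<^bold>\<up> b \<^bold>\<cdot> a,
      k1 KFact \<^bold>0 \<doteq> \<^bold>1,
      k1 KFact (succ a) \<doteq> k1 KFact a \<^bold>\<cdot> succ a,
      k1 KPd \<^bold>0 \<doteq> \<^bold>0,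
      k1 KPd (succ a) \<doteq> a,
      a \<^bold>- \<^bold>0 \<doteq> a,
      a \<^bold>- succ b \<doteq> k1 KPd (a \<^bold>- b),
      k2 KMin a b \<doteq> b \<^bold>- (b \<^bold>- a),
      k2 KMax a b \<doteq> (a \<^bold>- b) \<^bold>+ b,
      k1 KSgb \<^bold>0 \<doteq> \<^bold>1,
      k1 KSgb (succ a) \<doteq> \<^bold>0,
      k1 KSg \<^bold>0 \<doteq> \<^bold>0,
      k1 KSg (succ a) \<doteq> \<^bold>1,
      k2 KDiff a b \<doteq> (a \<^bold>- b) \<^bold>+ (b \<^bold>- a),
      k2 KRm \<^bold>0 b \<doteq> \<^bold>0,
      k2 KRm (succ a) b \<doteq> succ (k2 KRm a b) \<^bold>\<cdot> k1 KSg (k2 KDiff b (succ (k2 KRm a b))),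
      k2 KQuot \<^bold>0 b \<doteq> \<^bold>0,
      k2 KQuot (succ a) b \<doteq> k2 KQuot a b \<^bold>+ k1 KSgb (k2 KDiff b (succ (k2 KRm a b))),
      kf KSum \<^bold>0 \<alpha> \<doteq> \<^bold>0,
      kf KSum (succ a) \<alpha> \<doteq> kf KSum a \<alpha> \<^bold>+ App \<alpha> a,
      kf KProd \<^bold>0 \<alpha> \<doteq> \<^bold>1,
      kf KProd (succ a) \<alpha> \<doteq> kf KProd a \<alpha> \<^bold>\<cdot> App \<alpha> a,
      kf KBMin \<^bold>0 \<alpha> \<doteq> App \<alpha> \<^bold>0,
      kf KBMin (succ a) \<alpha> \<doteq> k2 KMin (kf KBMin a \<alpha>) (App \<alpha> (succ a)),
      kf KBMax \<^bold>0 \<alpha> \<doteq> App \<alpha> \<^bold>0,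
      kf KBMax (succ a) \<alpha> \<doteq> k2 KMax (kf KBMax a \<alpha>) (App \<alpha> (succ a)),
      k1 KPrime \<^bold>0 \<doteq> \<^bold>2,
      k1 KPrime (succ a) \<doteq>
        bmu (succ (succ (k1 KFact (k1 KPrime a))))
          ((succ (k1 KPrime (NVar 1)) \<^bold>- NVar 0) \<^bold>+
           kf KSum (NVar 0) (Lam (k1 KPd (NVar 0) \<^bold>\<cdot> k1 KSgb (k2 KRm (NVar 1) (NVar 0))))),
      k2 KExpo a b \<doteq>
        bmu a
          (k2 KRm (NVar 1) (k1 KPrime (NVar 2) \<^bold>\<up> NVar 0) \<^bold>+
           k1 KSgb (k2 KRm (NVar 1) (k1 KPrime (NVar 2) \<^bold>\<up> succ (NVar 0)))),
      k1 KLh a \<doteq> kf KSum a (Lam (k1 KSg (k2 KExpo (NVar 1) (NVar 0)))),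
      k2 KCat a b \<doteq>
        a \<^bold>\<cdot> kf KProd (k1 KLh b)
              (Lam (k1 KPrime (k1 KLh (NVar 1) \<^bold>+ NVar 0) \<^bold>\<up> k2 KExpo (NVar 2) (NVar 0))),
      kf KBar a \<alpha> \<doteq> kf KProd a (Lam (k1 KPrime (NVar 0) \<^bold>\<up> succ (App \<alpha> (NVar 0)))),
      kf KTilde a \<alpha> \<doteq> kf KProd a (Lam (k1 KPrime (NVar 0) \<^bold>\<up> App \<alpha> (NVar 0))),
      k2 KCirc a b \<doteq>
        kf KProd (k2 KMax a b)
          (Lam (k1 KPrime (NVar 0) \<^bold>\<up>
                  k2 KMax (k2 KExpo (NVar 1) (NVar 0)) (k2 KExpo (NVar 2) (NVar 0)))),
      kf KCcp \<^bold>0 \<alpha> \<doteq> \<^bold>1,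
      kf KCcp (succ a) \<alpha> \<doteq> k2 KCirc (kf KCcp a \<alpha>) (App \<alpha> a)})"

text \<open>\<open>A(x) \<and> x = y \<longrightarrow> A(y)\<close> for arbitrary number variables \<open>x\<close>, \<open>y\<close>.\<close>

definition replacement_schema :: "cst set \<Rightarrow> fm set" where
  "replacement_schema L =
     {sub0 (NVar i) A \<^bold>\<and> NVar i \<doteq> NVar j \<^bold>\<longrightarrow> sub0 (NVar j) A | A i j. wf_fm L A}"

text \<open>\<open>vars m n\<close> is the list of the variables \<open>m, \<dots>, m + n - 1\<close>. The successor has no defining
  equation.\<close>

definition vars :: "nat \<Rightarrow> nat \<Rightarrow> trm list" where
  "vars m n = map NVar [m..<m + n]"

fun prd_equations :: "prd \<Rightarrow> fm set" where
  "prd_equations (ZeroD n) = {app_cst (Fn (ZeroD n)) (vars 0 n) \<doteq> \<^bold>0}"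
| "prd_equations SuccD = {}"
| "prd_equations (ProjD n i) = {app_cst (Fn (ProjD n i)) (vars 0 n) \<doteq> NVar i}"
| "prd_equations (CompD n h gs) =
     {app_cst (Fn (CompD n h gs)) (vars 0 n) \<doteq>
      app_cst (Fn h) (map (\<lambda>g. app_cst (Fn g) (vars 0 n)) gs)}"
| "prd_equations (RecD g h) =
     (let n = arity_prd g; f = app_cst (Fn (RecD g h)) in
      {f (\<^bold>0 # vars 1 n) \<doteq> app_cst (Fn g) (vars 1 n),
       f (succ (NVar 0) # vars 1 n) \<doteq>
         app_cst (Fn h) (NVar 0 # f (NVar 0 # vars 1 n) # vars 1 n)})"

text \<open>Descriptions of addition, multiplication and exponentiation; the exponent is the first argument
  of \<open>expD\<close>. They are used for the pairing \<open>\<langle>a, b\<rangle> = 2\<^sup>a \<cdot> 3\<^sup>b\<close>.\<close>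

definition addD :: prd where
  "addD = RecD (ProjD 1 0) (CompD 3 SuccD [ProjD 3 1])"

definition mulD :: prd where
  "mulD = RecD (ZeroD 1) (CompD 3 addD [ProjD 3 1, ProjD 3 2])"

definition expD :: prd where
  "expD = RecD (CompD 1 SuccD [ZeroD 1]) (CompD 3 mulD [ProjD 3 1, ProjD 3 2])"

definition pair :: "trm \<Rightarrow> trm \<Rightarrow> trm" where
  "pair s t =
     Cst (Fn mulD) [Cst (Fn expD) [s, \<^bold>2] [], Cst (Fn expD) [t, succ \<^bold>2] []] []"

abbreviation rec :: "trm \<Rightarrow> fct \<Rightarrow> trm \<Rightarrow> trm" where "rec t u s \<equiv> Cst Rec [t, s] [u]"

definition recursor_axioms :: "cst set \<Rightarrow> fm set" where
  "recursor_axioms L =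
     {rec t u \<^bold>0 \<doteq> t | t u. wf_trm L t \<and> wf_fct L u} \<union>
     {rec t u (succ s) \<doteq> App u (pair (rec t u s) s) | t u s. wf_trm L t \<and> wf_fct L u \<and> wf_trm L s}"

text \<open>The choice schemata. In \<open>A\<close> the number variables 1 and 0 stand for \<open>x\<close> and \<open>y\<close>, in the
  conclusion \<open>\<exists>\<alpha> \<forall>x A(x, \<alpha>(x))\<close> the new function variable 0 stands for \<open>\<alpha>\<close>.\<close>

definition choice_conclusion :: "fm \<Rightarrow> fm" where
  "choice_conclusion A =
     Ex1 (All0 (sub_fm (inst0 (App (FVar 0) (NVar 0))) (\<lambda>n. FVar (Suc n)) A))"

definition AC00_unique :: "cst set \<Rightarrow> fm set" where
  "AC00_unique L = {All0 (ExU0 A) \<^bold>\<longrightarrow> choice_conclusion A | A. wf_fm L A}"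

definition QF_AC00 :: "cst set \<Rightarrow> fm set" where
  "QF_AC00 L = {All0 (Ex0 A) \<^bold>\<longrightarrow> choice_conclusion A | A. wf_fm L A \<and> quantifier_free A}"

definition CFd :: "cst set \<Rightarrow> fm set" where
  "CFd L =
     {All0 (B \<^bold>\<or> \<^bold>\<not> B) \<^bold>\<longrightarrow>
        Ex1 (All0 (LessEq (App (FVar 0) (NVar 0)) \<^bold>1 \<^bold>\<and>
                   (App (FVar 0) (NVar 0) \<doteq> \<^bold>0 \<^bold>\<longleftrightarrow> lift1 B))) | B. wf_fm L B}"


section \<open>The systems\<close>

definition lang_M :: "cst set" where
  "lang_M = {Zero, Fn SuccD} \<union> range Kl"

definition lang_HA1 :: "cst set" where
  "lang_HA1 = {Zero, Rec} \<union> {Fn d | d. wf_prd d}"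

definition lang_EL_plus :: "cst set" where
  "lang_EL_plus = lang_HA1 \<union> range Kl"

definition IA1 :: system where
  "IA1 = System lang_M
     (peano_succ \<union> equality_axioms \<union> kleene_equations \<union> {function_ext} \<union>
      lambda_conversion lang_M \<union> induction_schema lang_M)"

definition sys_M :: system where
  "sys_M = System lang_M (axms IA1 \<union> AC00_unique lang_M)"

text \<open>The axioms of \<open>HA\<^sub>1\<close> and \<open>EL\<close>, with schemata for a language \<open>L\<close> extending that of \<open>HA\<^sub>1\<close>.\<close>

definition axms_HA1 :: "cst set \<Rightarrow> fm set" where
  "axms_HA1 L =
     {NVar 0 \<doteq> NVar 0, \<^bold>\<not> \<^bold>1 \<doteq> \<^bold>0} \<union> replacement_schema L \<union> induction_schema L \<union>
     (\<Union>d\<in>{d. wf_prd d}. prd_equations d) \<union> lambda_conversion L \<union> recursor_axioms L"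

definition axms_EL :: "cst set \<Rightarrow> fm set" where
  "axms_EL L = axms_HA1 L \<union> QF_AC00 L"

definition sys_EL_plus :: system where
  "sys_EL_plus = System lang_EL_plus (axms_EL lang_EL_plus \<union> kleene_equations)"

definition sys_EL_plus_CFd :: system where
  "sys_EL_plus_CFd = System lang_EL_plus (axms sys_EL_plus \<union> CFd lang_EL_plus)"


text \<open>No axiom is excluded by the restriction of derivations to formulas of the language.\<close>

lemma wf_ren:
  "wf_trm L (ren_trm r q t) \<longleftrightarrow> wf_trm L t" "wf_fct L (ren_fct r q u) \<longleftrightarrow> wf_fct L u"
  by (induct t and u arbitrary: r q and r q) auto

lemma wf_ren_fm: "wf_fm L (ren_fm r q A) \<longleftrightarrow> wf_fm L A"
  by (induct A arbitrary: r q) (auto simp: wf_ren)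

lemma wf_sub:
  "\<forall>n. wf_trm L (\<sigma> n) \<Longrightarrow> \<forall>n. wf_fct L (\<tau> n) \<Longrightarrow> wf_trm L t \<longrightarrow> wf_trm L (sub_trm \<sigma> \<tau> t)"
  "\<forall>n. wf_trm L (\<sigma> n) \<Longrightarrow> \<forall>n. wf_fct L (\<tau> n) \<Longrightarrow> wf_fct L u \<longrightarrow> wf_fct L (sub_fct \<sigma> \<tau> u)"
  by (induct t and u arbitrary: \<sigma> \<tau> and \<sigma> \<tau> rule: trm.induct fct.induct)
    (auto simp: up0_trm_def up0_fct_def wf_ren split: nat.split)

lemma wf_sub_fm:
  "\<forall>n. wf_trm L (\<sigma> n) \<Longrightarrow> \<forall>n. wf_fct L (\<tau> n) \<Longrightarrow> wf_fm L A \<Longrightarrow> wf_fm L (sub_fm \<sigma> \<tau> A)"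
  by (induct A arbitrary: \<sigma> \<tau>)
    (auto simp: up0_trm_def up0_fct_def up1_trm_def up1_fct_def wf_ren wf_sub split: nat.split)

lemma wf_app_cst:
  "Fn d \<in> L \<Longrightarrow> arity_prd d = length ts \<Longrightarrow> \<forall>t\<in>set ts. wf_trm L t \<Longrightarrow> wf_trm L (app_cst (Fn d) ts)"
  by (cases ts) (auto simp: app_cst_def)

lemma wf_prd_equations: "wf_prd d \<Longrightarrow> A \<in> prd_equations d \<Longrightarrow> wf_fm lang_EL_plus A"
  by (cases d) (auto simp: Let_def vars_def lang_EL_plus_def lang_HA1_def intro!: wf_app_cst)

lemma wf_kleene_equations:
  assumes "{Zero, Fn SuccD} \<union> range Kl \<subseteq> L" and "A \<in> kleene_equations"
  shows "wf_fm L A"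
  using assms unfolding kleene_equations_def Let_def by (auto simp: bmu_def up_ren_def subset_iff)

lemma axms_M_wf: "axms sys_M \<subseteq> formulas sys_M"
proof -
  have "wf_fm lang_M A" if "A \<in> kleene_equations" for A
    using that by (intro wf_kleene_equations) (auto simp: lang_M_def)
  then show ?thesis
    apply (auto simp: formulas_def sys_M_def IA1_def peano_succ_def equality_axioms_def
        function_ext_def lambda_conversion_def induction_schema_def AC00_unique_def ExU0_def
        choice_conclusion_def wf_ren_fm)
     apply (auto simp: lang_M_def inst0_def step0_def intro!: wf_sub_fm wf_sub[rule_format]
        split: nat.split)
    done
qed

lemma axms_EL_plus_CFd_wf: "axms sys_EL_plus_CFd \<subseteq> formulas sys_EL_plus_CFd"
proof -
  have "wf_fm lang_EL_plus A" if "A \<in> kleene_equations" for A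
    using that by (intro wf_kleene_equations) (auto simp: lang_EL_plus_def lang_HA1_def)
  then show ?thesis
    apply (auto simp: formulas_def sys_EL_plus_CFd_def sys_EL_plus_def axms_EL_def axms_HA1_def
        wf_prd_equations lambda_conversion_def induction_schema_def replacement_schema_def
        recursor_axioms_def QF_AC00_def CFd_def Iff_def choice_conclusion_def wf_ren_fm LessEq_def
        Less_def wf_ren pair_def)
     apply (auto simp: lang_EL_plus_def lang_HA1_def inst0_def step0_def mulD_def addD_def expD_def
        less_Suc_eq numeral_eq_Suc intro!: wf_sub_fm wf_sub[rule_format] split: nat.split)
    done
qed


section \<open>Effective translations\<close>

text \<open>The general recursive functions of \<open>n\<close> arguments, as functions on lists (of length \<open>n\<close>).\<close>

inductive recursive :: "nat \<Rightarrow> (nat list \<Rightarrow> nat) \<Rightarrow> bool" where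
  Zero: "recursive n (\<lambda>xs. 0)"
| Succ: "recursive 1 (\<lambda>xs. Suc (xs ! 0))"
| Proj: "i < n \<Longrightarrow> recursive n (\<lambda>xs. xs ! i)"
| Comp: "recursive (length gs) f \<Longrightarrow> (\<And>g. g \<in> set gs \<Longrightarrow> recursive n g) \<Longrightarrow>
    recursive n (\<lambda>xs. f (map (\<lambda>g. g xs) gs))"
| Prim: "recursive n g \<Longrightarrow> recursive (n + 2) h \<Longrightarrow>
    recursive (Suc n) (\<lambda>xs. rec_nat (g (tl xs)) (\<lambda>k r. h (k # r # tl xs)) (hd xs))"
| Minim: "recursive (Suc n) f \<Longrightarrow> (\<And>xs. length xs = n \<Longrightarrow> \<exists>y. f (y # xs) = 0) \<Longrightarrow>
    recursive n (\<lambda>xs. LEAST y. f (y # xs) = 0)"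

text \<open>A Goedel numbering of the syntax.\<close>

definition tag :: "nat \<Rightarrow> nat \<Rightarrow> nat" where
  "tag k n = prod_encode (k, n)"

fun gn_prd :: "prd \<Rightarrow> nat" where
  "gn_prd (ZeroD n) = tag 0 n"
| "gn_prd SuccD = tag 1 0"
| "gn_prd (ProjD n i) = tag 2 (prod_encode (n, i))"
| "gn_prd (CompD n h gs) = tag 3 (list_encode (n # gn_prd h # map gn_prd gs))"
| "gn_prd (RecD g h) = tag 4 (prod_encode (gn_prd g, gn_prd h))"

fun gn_klc :: "klc \<Rightarrow> nat" where
  "gn_klc KAdd = 2" | "gn_klc KMul = 3" | "gn_klc KExp = 4" | "gn_klc KFact = 5"
| "gn_klc KPd = 6" | "gn_klc KMonus = 7" | "gn_klc KMin = 8" | "gn_klc KMax = 9"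
| "gn_klc KSgb = 10" | "gn_klc KSg = 11" | "gn_klc KDiff = 12" | "gn_klc KRm = 13"
| "gn_klc KQuot = 14" | "gn_klc KSum = 15" | "gn_klc KProd = 16" | "gn_klc KBMin = 17"
| "gn_klc KBMax = 18" | "gn_klc KPrime = 19" | "gn_klc KExpo = 20" | "gn_klc KLh = 21"
| "gn_klc KCat = 22" | "gn_klc KBar = 23" | "gn_klc KTilde = 24" | "gn_klc KCirc = 25"
| "gn_klc KCcp = 26"

fun gn_cst :: "cst \<Rightarrow> nat" where
  "gn_cst Zero = tag 0 0"
| "gn_cst (Fn d) = tag 1 (gn_prd d)"
| "gn_cst (Kl k) = tag 2 (gn_klc k)"
| "gn_cst Rec = tag 3 0"

fun gn_trm :: "trm \<Rightarrow> nat" and gn_fct :: "fct \<Rightarrow> nat" where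
  "gn_trm (NVar n) = tag 0 n"
| "gn_trm (Cst c ts us) =
     tag 1 (prod_encode (gn_cst c, prod_encode (list_encode (map gn_trm ts), list_encode (map gn_fct us))))"
| "gn_trm (App u t) = tag 2 (prod_encode (gn_fct u, gn_trm t))"
| "gn_fct (FVar n) = tag 0 n"
| "gn_fct (FC c) = tag 1 (gn_cst c)"
| "gn_fct (Lam t) = tag 2 (gn_trm t)"

fun gn_fm :: "fm \<Rightarrow> nat" where
  "gn_fm (s \<doteq> t) = tag 0 (prod_encode (gn_trm s, gn_trm t))"
| "gn_fm (\<^bold>\<not> A) = tag 1 (gn_fm A)"
| "gn_fm (A \<^bold>\<and> B) = tag 2 (prod_encode (gn_fm A, gn_fm B))"
| "gn_fm (A \<^bold>\<or> B) = tag 3 (prod_encode (gn_fm A, gn_fm B))"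
| "gn_fm (A \<^bold>\<longrightarrow> B) = tag 4 (prod_encode (gn_fm A, gn_fm B))"
| "gn_fm (All0 A) = tag 5 (gn_fm A)"
| "gn_fm (Ex0 A) = tag 6 (gn_fm A)"
| "gn_fm (All1 A) = tag 7 (gn_fm A)"
| "gn_fm (Ex1 A) = tag 8 (gn_fm A)"

lemma tag_eq [simp]: "tag k m = tag l n \<longleftrightarrow> k = l \<and> m = n"
  by (simp add: tag_def)

lemma gn_prd_inj: "gn_prd d = gn_prd e \<Longrightarrow> d = e"
proof (induct d arbitrary: e)
  case (CompD n h gs)
  have "gs = hs" if "map gn_prd gs = map gn_prd hs" for hs
    using that by (rule list.inj_map_strong[rotated]) (rule CompD(2))
  with CompD(1,3) show ?case by (cases e) (auto simp: list_encode_eq)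
next
  case (RecD g h)
  then show ?case by (cases e) auto
next
  case (ZeroD n) then show ?case by (cases e) auto
next
  case SuccD then show ?case by (cases e) auto
next
  case (ProjD n i) then show ?case by (cases e) auto
qed

lemma gn_klc_inj: "gn_klc k = gn_klc l \<Longrightarrow> k = l"
  by (cases k; cases l) auto

lemma gn_cst_inj: "gn_cst c = gn_cst d \<Longrightarrow> c = d"
  by (cases c; cases d) (auto dest: gn_prd_inj gn_klc_inj)

lemma gn_trm_inj: "gn_trm s = gn_trm t \<Longrightarrow> s = t"
  and gn_fct_inj: "gn_fct u = gn_fct v \<Longrightarrow> u = v"
proof (induct s and u arbitrary: t and v rule: trm.induct fct.induct)
  case (Cst c ts us)
  have "ts = ts'" if "map gn_trm ts = map gn_trm ts'" for ts'
    using that by (rule list.inj_map_strong[rotated]) (rule Cst(1))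
  moreover have "us = us'" if "map gn_fct us = map gn_fct us'" for us'
    using that by (rule list.inj_map_strong[rotated]) (rule Cst(2))
  ultimately show ?case using Cst(3)
    by (cases t) (auto simp: list_encode_eq dest: gn_cst_inj)
next
  case (NVar n) then show ?case by (cases t) auto
next
  case (App u s) then show ?case by (cases t) auto
next
  case (FVar n) then show ?case by (cases v) auto
next
  case (FC c) then show ?case by (cases v) (auto dest: gn_cst_inj)
next
  case (Lam s) then show ?case by (cases v) auto
qed

lemma gn_fm_inj: "gn_fm A = gn_fm B \<Longrightarrow> A = B"
proof (induct A arbitrary: B)
  case (Eq s t) then show ?case by (cases B) (auto dest: gn_trm_inj)
next
  case (Neg A) then show ?case by (cases B) auto
next
  case (And A1 A2) then show ?case by (cases B) auto
next
  case (Or A1 A2) then show ?case by (cases B) auto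
next
  case (Imp A1 A2) then show ?case by (cases B) auto
next
  case (All0 A) then show ?case by (cases B) auto
next
  case (Ex0 A) then show ?case by (cases B) auto
next
  case (All1 A) then show ?case by (cases B) auto
next
  case (Ex1 A) then show ?case by (cases B) auto
qed

definition effective_on :: "fm set \<Rightarrow> (fm \<Rightarrow> fm) \<Rightarrow> bool" where
  "effective_on D tr \<longleftrightarrow> (\<exists>F. recursive 1 F \<and> (\<forall>E\<in>D. F [gn_fm E] = gn_fm (tr E)))"


section \<open>Conservative and definitional extensions\<close>

definition extension :: "system \<Rightarrow> system \<Rightarrow> bool" where
  "extension S2 S1 \<longleftrightarrow> lang S1 \<subseteq> lang S2 \<and> theorems S1 \<subseteq> theorems S2"

definition conservative_extension :: "system \<Rightarrow> system \<Rightarrow> bool" where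
  "conservative_extension S2 S1 \<longleftrightarrow>
     extension S2 S1 \<and> theorems S2 \<inter> formulas S1 = theorems S1"

definition commutes_with_logic :: "fm set \<Rightarrow> (fm \<Rightarrow> fm) \<Rightarrow> bool" where
  "commutes_with_logic D tr \<longleftrightarrow>
     (\<forall>A\<in>D. tr (\<^bold>\<not> A) = (\<^bold>\<not> tr A) \<and>
            tr (All0 A) = All0 (tr A) \<and> tr (Ex0 A) = Ex0 (tr A) \<and>
            tr (All1 A) = All1 (tr A) \<and> tr (Ex1 A) = Ex1 (tr A)) \<and>
     (\<forall>A\<in>D. \<forall>B\<in>D. tr (A \<^bold>\<and> B) = (tr A \<^bold>\<and> tr B) \<and>
                  tr (A \<^bold>\<or> B) = (tr A \<^bold>\<or> tr B) \<and>
                  tr (A \<^bold>\<longrightarrow> B) = (tr A \<^bold>\<longrightarrow> tr B))"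

definition definitional_extension :: "system \<Rightarrow> system \<Rightarrow> bool" where
  "definitional_extension S2 S1 \<longleftrightarrow>
     extension S2 S1 \<and>
     (\<exists>tr. effective_on (formulas S2) tr \<and>
        tr ` formulas S2 \<subseteq> formulas S1 \<and>
        (\<forall>E\<in>formulas S1. tr E = E) \<and>
        (\<forall>E\<in>formulas S2. (tr E \<^bold>\<longleftrightarrow> E) \<in> theorems S2) \<and>
        (\<forall>\<Gamma> E. \<Gamma> \<subseteq> formulas S2 \<longrightarrow> E \<in> formulas S2 \<longrightarrow> deriv S2 \<Gamma> E \<longrightarrow> deriv S1 (tr ` \<Gamma>) (tr E)) \<and>
        commutes_with_logic (formulas S2) tr)"

end

theory Submission
  imports Defs
begin

text \<open>The proof is semantic. For every system there is a canonical Kripke model whose worlds are the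
  prime theories with witnesses in the language of the system, and forcing in all worlds is
  provability. Over every world of a system extending \<open>M\<close>, \<open>AC\<^sub>0\<^sub>0!\<close> yields the functions defined by
  primitive recursion, so that the constants of \<open>HA\<^sub>1\<close> and the recursor get values there; the model
  expanded by these values satisfies \<open>QF-AC\<^sub>0\<^sub>0\<close>, by choice of least witnesses, and \<open>CF\<^sub>d\<close>. The translation
  replaces an equation between terms not in the language of \<open>M\<close> by a formula that defines the graphs of
  these values, and truth of a formula in the expanded model is truth of its translation. Starting from
  the canonical model of \<open>M\<close> this shows that derivations are translated into derivations.

  Conversely, \<open>EL\<^sup>+ + CF\<^sub>d\<close> proves \<open>AC\<^sub>0\<^sub>0!\<close>: if for every \<open>x\<close> there is exactly one \<open>y\<close> with \<open>A(x, y)\<close>, then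
  \<open>A\<close> is decidable at all pairs, so it has a characteristic function by \<open>CF\<^sub>d\<close>, and \<open>QF-AC\<^sub>0\<^sub>0\<close> applied to
  the latter gives the choice function. Hence the canonical model of \<open>EL\<^sup>+ + CF\<^sub>d\<close> can be expanded
  in the same way, and the new values agree with the old ones by the uniqueness of functions defined
  by recursion; so every formula is equivalent to its translation.\<close>


section \<open>Substitution calculus\<close>

text \<open>The translation has to fix all formulas of \<open>M\<close> and to commute with the
  logical operations, so only equations can change. There are infinitely many constants to be
  eliminated, hence their graph formulas must be produced by one recursion. As \<open>M\<close> has
  one-place function variables only, a list of arguments is passed as a function read at numerals;
  no arithmetical coding of sequences is needed inside \<open>M\<close>.

  Arguing in worlds replaces formal derivations in \<open>M\<close> of totality and functionality
  for every graph. The obstacle there is that a new value is named in a world only through a chosen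
  witness, whereas the interpretation of terms must not depend on the world. This is why elements of
  the expansion are families of classes indexed by worlds, and why uniqueness of values matters as
  much as existence.

  A second obstacle is extensionality. Functions obtained by unique choice are known by their values
  only, but no axiom of \<open>M\<close> says that equal functions give equal values of the
  functionals; this has to be proved for each of them from its defining equations.\<close>

lemma inst0_case: "inst0 t = case_nat t NVar"
  by (rule ext) (simp add: inst0_def split: nat.split)

lemma inst1_case: "inst1 u = case_nat u FVar"
  by (rule ext) (simp add: inst1_def split: nat.split)

lemma up_ren_simps [simp]: "up_ren r 0 = 0" "up_ren r (Suc n) = Suc (r n)"
  by (simp_all add: up_ren_def)

lemma up0_trm_simps [simp]: "up0_trm \<sigma> 0 = NVar 0" "up0_trm \<sigma> (Suc n) = ren_trm Suc id (\<sigma> n)"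
  by (simp_all add: up0_trm_def)

lemma up1_fct_simps [simp]: "up1_fct \<tau> 0 = FVar 0" "up1_fct \<tau> (Suc n) = ren_fct id Suc (\<tau> n)"
  by (simp_all add: up1_fct_def)

lemma up0_trm_NVar: "up0_trm (\<lambda>n. NVar (r n)) = (\<lambda>n. NVar (up_ren r n))"
  by (rule ext) (simp add: up0_trm_def up_ren_def split: nat.split)

lemma up0_fct_FVar: "up0_fct (\<lambda>n. FVar (q n)) = (\<lambda>n. FVar (q n))"
  by (rule ext) (simp add: up0_fct_def)

lemma up1_trm_NVar: "up1_trm (\<lambda>n. NVar (r n)) = (\<lambda>n. NVar (r n))"
  by (rule ext) (simp add: up1_trm_def)

lemma up1_fct_FVar: "up1_fct (\<lambda>n. FVar (q n)) = (\<lambda>n. FVar (up_ren q n))"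
  by (rule ext) (simp add: up1_fct_def up_ren_def split: nat.split)

lemma up_ren_id: "up_ren (\<lambda>n. n) = (\<lambda>n. n)"
  by (rule ext) (simp add: up_ren_def split: nat.split)

lemma ren_sub:
  "ren_trm r q t = sub_trm (\<lambda>n. NVar (r n)) (\<lambda>n. FVar (q n)) t"
  "ren_fct r q u = sub_fct (\<lambda>n. NVar (r n)) (\<lambda>n. FVar (q n)) u"
  by (induct t and u arbitrary: r q and r q rule: trm.induct fct.induct)
    (auto simp: up0_trm_NVar up0_fct_FVar)

lemma ren_fm_sub: "ren_fm r q A = sub_fm (\<lambda>n. NVar (r n)) (\<lambda>n. FVar (q n)) A"
  by (induct A arbitrary: r q)
    (auto simp: up0_trm_NVar up0_fct_FVar up1_trm_NVar up1_fct_FVar ren_sub)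

lemma sub_id:
  "sub_trm NVar FVar t = t" "sub_fct NVar FVar u = u"
proof (induct t and u rule: trm.induct fct.induct)
  case (Lam t)
  then show ?case
    using up0_trm_NVar[of "\<lambda>n. n"] up0_fct_FVar[of "\<lambda>n. n"] by (simp add: up_ren_id)
qed (auto simp: map_idI)

lemma sub_fm_id: "sub_fm NVar FVar A = A"
  using up0_trm_NVar[of "\<lambda>n. n"] up0_fct_FVar[of "\<lambda>n. n"] up1_trm_NVar[of "\<lambda>n. n"]
    up1_fct_FVar[of "\<lambda>n. n"]
  by (induct A) (auto simp: sub_id up_ren_id)

text \<open>Passing under a binder lifts by renaming. This dictates the order of the fusion laws:
  substitution after renaming, renaming after renaming, renaming after substitution, and only then
  substitution after substitution.\<close>

lemma sub_ren:
  "sub_trm \<sigma> \<tau> (ren_trm r q t) = sub_trm (\<lambda>n. \<sigma> (r n)) (\<lambda>n. \<tau> (q n)) t"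
  "sub_fct \<sigma> \<tau> (ren_fct r q u) = sub_fct (\<lambda>n. \<sigma> (r n)) (\<lambda>n. \<tau> (q n)) u"
proof (induct t and u arbitrary: \<sigma> \<tau> r q and \<sigma> \<tau> r q rule: trm.induct fct.induct)
  case (Lam t)
  have "(\<lambda>n. up0_trm \<sigma> (up_ren r n)) = up0_trm (\<lambda>n. \<sigma> (r n))"
    by (rule ext) (simp add: up0_trm_def up_ren_def split: nat.split)
  moreover have "(\<lambda>n. up0_fct \<tau> (q n)) = up0_fct (\<lambda>n. \<tau> (q n))"
    by (rule ext) (simp add: up0_fct_def)
  ultimately show ?case by (simp add: Lam)
qed auto

lemma ren_ren:
  "ren_trm r q (ren_trm r' q' t) = ren_trm (\<lambda>n. r (r' n)) (\<lambda>n. q (q' n)) t"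
  "ren_fct r q (ren_fct r' q' u) = ren_fct (\<lambda>n. r (r' n)) (\<lambda>n. q (q' n)) u"
  by (simp_all add: ren_sub(1)[of r q] ren_sub(2)[of r q] sub_ren) (simp_all add: ren_sub)

lemma ren_sub_comm:
  "ren_trm r q (sub_trm \<sigma> \<tau> t) = sub_trm (\<lambda>n. ren_trm r q (\<sigma> n)) (\<lambda>n. ren_fct r q (\<tau> n)) t"
  "ren_fct r q (sub_fct \<sigma> \<tau> u) = sub_fct (\<lambda>n. ren_trm r q (\<sigma> n)) (\<lambda>n. ren_fct r q (\<tau> n)) u"
proof (induct t and u arbitrary: \<sigma> \<tau> r q and \<sigma> \<tau> r q rule: trm.induct fct.induct)
  case (Lam t)
  have "(\<lambda>n. ren_trm (up_ren r) q (up0_trm \<sigma> n)) = up0_trm (\<lambda>n. ren_trm r q (\<sigma> n))"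
    by (rule ext) (simp add: up0_trm_def ren_ren split: nat.split)
  moreover have "(\<lambda>n. ren_fct (up_ren r) q (up0_fct \<tau> n)) = up0_fct (\<lambda>n. ren_fct r q (\<tau> n))"
    by (rule ext) (simp add: up0_fct_def ren_ren)
  ultimately show ?case by (simp add: Lam)
qed auto

lemma sub_sub:
  "sub_trm \<sigma> \<tau> (sub_trm \<sigma>' \<tau>' t) = sub_trm (\<lambda>n. sub_trm \<sigma> \<tau> (\<sigma>' n)) (\<lambda>n. sub_fct \<sigma> \<tau> (\<tau>' n)) t"
  "sub_fct \<sigma> \<tau> (sub_fct \<sigma>' \<tau>' u) = sub_fct (\<lambda>n. sub_trm \<sigma> \<tau> (\<sigma>' n)) (\<lambda>n. sub_fct \<sigma> \<tau> (\<tau>' n)) u"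
proof (induct t and u arbitrary: \<sigma> \<tau> \<sigma>' \<tau>' and \<sigma> \<tau> \<sigma>' \<tau>' rule: trm.induct fct.induct)
  case (Lam t)
  have "(\<lambda>n. sub_trm (up0_trm \<sigma>) (up0_fct \<tau>) (up0_trm \<sigma>' n)) = up0_trm (\<lambda>n. sub_trm \<sigma> \<tau> (\<sigma>' n))"
    by (rule ext) (simp add: up0_trm_def up0_fct_def sub_ren ren_sub_comm split: nat.split)
  moreover have "(\<lambda>n. sub_fct (up0_trm \<sigma>) (up0_fct \<tau>) (up0_fct \<tau>' n)) = up0_fct (\<lambda>n. sub_fct \<sigma> \<tau> (\<tau>' n))"
    by (rule ext) (simp add: up0_fct_def sub_ren ren_sub_comm)
  ultimately show ?case by (simp add: Lam)
qed auto

lemma sub_up0: "(\<lambda>n. sub_trm (up0_trm \<sigma>) (up0_fct \<tau>) (up0_trm \<sigma>' n)) = up0_trm (\<lambda>n. sub_trm \<sigma> \<tau> (\<sigma>' n))"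
  "(\<lambda>n. sub_fct (up0_trm \<sigma>) (up0_fct \<tau>) (up0_fct \<tau>' n)) = up0_fct (\<lambda>n. sub_fct \<sigma> \<tau> (\<tau>' n))"
  "(\<lambda>n. sub_trm (up1_trm \<sigma>) (up1_fct \<tau>) (up1_trm \<sigma>' n)) = up1_trm (\<lambda>n. sub_trm \<sigma> \<tau> (\<sigma>' n))"
  "(\<lambda>n. sub_fct (up1_trm \<sigma>) (up1_fct \<tau>) (up1_fct \<tau>' n)) = up1_fct (\<lambda>n. sub_fct \<sigma> \<tau> (\<tau>' n))"
  by (rule ext, simp add: up0_trm_def up0_fct_def up1_trm_def up1_fct_def sub_ren ren_sub_comm
      split: nat.split)+

lemma sub_fm_sub_fm:
  "sub_fm \<sigma> \<tau> (sub_fm \<sigma>' \<tau>' A) = sub_fm (\<lambda>n. sub_trm \<sigma> \<tau> (\<sigma>' n)) (\<lambda>n. sub_fct \<sigma> \<tau> (\<tau>' n)) A"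
  by (induct A arbitrary: \<sigma> \<tau> \<sigma>' \<tau>') (simp_all add: sub_sub sub_up0)

lemma sub_fm_ren: "sub_fm \<sigma> \<tau> (ren_fm r q A) = sub_fm (\<lambda>n. \<sigma> (r n)) (\<lambda>n. \<tau> (q n)) A"
  by (simp add: ren_fm_sub sub_fm_sub_fm)

lemma case_up0: "(\<lambda>n. sub_trm (case_nat t NVar) FVar (up0_trm \<sigma> n)) = case_nat t \<sigma>"
  "(\<lambda>n. sub_fct (case_nat t NVar) FVar (up0_fct \<tau> n)) = \<tau>"
  "(\<lambda>n. sub_trm NVar (case_nat u FVar) (up1_trm \<sigma> n)) = \<sigma>"
  "(\<lambda>n. sub_fct NVar (case_nat u FVar) (up1_fct \<tau> n)) = case_nat u \<tau>"
  by (rule ext, simp add: up0_trm_def up0_fct_def up1_trm_def up1_fct_def sub_ren sub_id split: nat.split)+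

text \<open>In the canonical model environments are substitutions; this law says that instantiating
  the body of a substituted quantifier amounts to extending the environment by the value of the
  bound variable.\<close>

lemma sub0_up0: "sub0 t (sub_fm (up0_trm \<sigma>) (up0_fct \<tau>) A) = sub_fm (case_nat t \<sigma>) \<tau> A"
  by (simp add: inst0_case sub_fm_sub_fm case_up0)

lemma sub1_up1: "sub1 u (sub_fm (up1_trm \<sigma>) (up1_fct \<tau>) A) = sub_fm \<sigma> (case_nat u \<tau>) A"
  by (simp add: inst1_case sub_fm_sub_fm case_up0)

lemma sub_fm_sub0: "sub_fm \<sigma> \<tau> (sub0 t A) = sub_fm (case_nat (sub_trm \<sigma> \<tau> t) \<sigma>) \<tau> A"
proof -
  have "(\<lambda>n. sub_trm \<sigma> \<tau> (inst0 t n)) = case_nat (sub_trm \<sigma> \<tau> t) \<sigma>"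
    by (rule ext) (simp add: inst0_def split: nat.split)
  then show ?thesis by (simp add: sub_fm_sub_fm)
qed

lemma sub_fm_sub1: "sub_fm \<sigma> \<tau> (sub1 u A) = sub_fm \<sigma> (case_nat (sub_fct \<sigma> \<tau> u) \<tau>) A"
proof -
  have "(\<lambda>n. sub_fct \<sigma> \<tau> (inst1 u n)) = case_nat (sub_fct \<sigma> \<tau> u) \<tau>"
    by (rule ext) (simp add: inst1_def split: nat.split)
  then show ?thesis by (simp add: sub_fm_sub_fm)
qed

lemma sub_fm_lift0: "sub_fm (up0_trm \<sigma>) (up0_fct \<tau>) (lift0 A) = lift0 (sub_fm \<sigma> \<tau> A)"
proof -
  have "(\<lambda>n. up0_trm \<sigma> (Suc n)) = (\<lambda>n. ren_trm Suc id (\<sigma> n))"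
    "(\<lambda>n. up0_fct \<tau> (id n)) = (\<lambda>n. ren_fct Suc id (\<tau> n))"
    by (rule ext, simp add: up0_fct_def)+
  then show ?thesis by (simp only: sub_fm_ren) (simp only: ren_fm_sub sub_fm_sub_fm ren_sub)
qed

lemma sub_fm_lift1: "sub_fm (up1_trm \<sigma>) (up1_fct \<tau>) (lift1 A) = lift1 (sub_fm \<sigma> \<tau> A)"
proof -
  have "(\<lambda>n. up1_trm \<sigma> (id n)) = (\<lambda>n. ren_trm id Suc (\<sigma> n))"
    "(\<lambda>n. up1_fct \<tau> (Suc n)) = (\<lambda>n. ren_fct id Suc (\<tau> n))"
    by (rule ext, simp add: up1_trm_def)+
  then show ?thesis by (simp only: sub_fm_ren) (simp only: ren_fm_sub sub_fm_sub_fm ren_sub)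
qed


section \<open>Variable conditions\<close>

text \<open>Predicates on variables take the place of sets of free variables. One notion then
  expresses that the variables lie below a bound, avoid a fresh variable, or belong to a world, and
  monotonicity passes from one to another.\<close>

fun vt :: "(nat \<Rightarrow> bool) \<Rightarrow> (nat \<Rightarrow> bool) \<Rightarrow> trm \<Rightarrow> bool"
  and vu :: "(nat \<Rightarrow> bool) \<Rightarrow> (nat \<Rightarrow> bool) \<Rightarrow> fct \<Rightarrow> bool" where
  "vt P Q (NVar n) = P n"
| "vt P Q (Cst c ts us) = ((\<forall>t\<in>set ts. vt P Q t) \<and> (\<forall>u\<in>set us. vu P Q u))"
| "vt P Q (App u t) = (vu P Q u \<and> vt P Q t)"
| "vu P Q (FVar n) = Q n"
| "vu P Q (FC c) = True"
| "vu P Q (Lam t) = vt (case_nat True P) Q t"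

fun vf :: "(nat \<Rightarrow> bool) \<Rightarrow> (nat \<Rightarrow> bool) \<Rightarrow> fm \<Rightarrow> bool" where
  "vf P Q (s \<doteq> t) = (vt P Q s \<and> vt P Q t)"
| "vf P Q (\<^bold>\<not> A) = vf P Q A"
| "vf P Q (A \<^bold>\<and> B) = (vf P Q A \<and> vf P Q B)"
| "vf P Q (A \<^bold>\<or> B) = (vf P Q A \<and> vf P Q B)"
| "vf P Q (A \<^bold>\<longrightarrow> B) = (vf P Q A \<and> vf P Q B)"
| "vf P Q (All0 A) = vf (case_nat True P) Q A"
| "vf P Q (Ex0 A) = vf (case_nat True P) Q A"
| "vf P Q (All1 A) = vf P (case_nat True Q) A"
| "vf P Q (Ex1 A) = vf P (case_nat True Q) A"

lemma case_mono: "P \<le> P' \<Longrightarrow> case_nat True P \<le> case_nat True P'"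
  by (auto simp: le_fun_def split: nat.split)

lemma vt_le:
  "P \<le> P' \<Longrightarrow> Q \<le> Q' \<Longrightarrow> vt P Q t \<Longrightarrow> vt P' Q' t"
  "P \<le> P' \<Longrightarrow> Q \<le> Q' \<Longrightarrow> vu P Q u \<Longrightarrow> vu P' Q' u"
proof (induct t and u arbitrary: P P' and P P' rule: trm.induct fct.induct)
  case (Lam t)
  show ?case using Lam(1)[OF case_mono[OF Lam(2)] Lam(3)] Lam(4) by simp
next
  case (Cst c ts us)
  show ?case using Cst(1,2)[OF _ Cst(3,4)] Cst(5) by simp
next
  case (App u t)
  show ?case using App(1,2)[OF App(3,4)] App(5) by simp
qed auto

lemma vf_le: "P \<le> P' \<Longrightarrow> Q \<le> Q' \<Longrightarrow> vf P Q A \<Longrightarrow> vf P' Q' A"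
  by (induct A arbitrary: P P' Q Q') (auto dest: vt_le case_mono)

lemma vt_mono:
  "(\<And>n. P n \<Longrightarrow> P' n) \<Longrightarrow> (\<And>n. Q n \<Longrightarrow> Q' n) \<Longrightarrow> vt P Q t \<Longrightarrow> vt P' Q' t"
  "(\<And>n. P n \<Longrightarrow> P' n) \<Longrightarrow> (\<And>n. Q n \<Longrightarrow> Q' n) \<Longrightarrow> vu P Q u \<Longrightarrow> vu P' Q' u"
  by (rule vt_le; auto)+

lemma vf_mono:
  "(\<And>n. P n \<Longrightarrow> P' n) \<Longrightarrow> (\<And>n. Q n \<Longrightarrow> Q' n) \<Longrightarrow> vf P Q A \<Longrightarrow> vf P' Q' A"
  by (rule vf_le; auto)

lemma vt_True: "vt (\<lambda>_. True) (\<lambda>_. True) t" "vu (\<lambda>_. True) (\<lambda>_. True) u"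
proof (induct t and u rule: trm.induct fct.induct)
  case (Lam t)
  have "case_nat True (\<lambda>_. True) = (\<lambda>_. True)" by (rule ext) (simp split: nat.split)
  with Lam show ?case by simp
qed auto

lemma vt_ren:
  "vt P Q (ren_trm r q t) = vt (\<lambda>n. P (r n)) (\<lambda>n. Q (q n)) t"
  "vu P Q (ren_fct r q u) = vu (\<lambda>n. P (r n)) (\<lambda>n. Q (q n)) u"
proof (induct t and u arbitrary: P Q r q and P Q r q rule: trm.induct fct.induct)
  case (Lam t)
  have "(\<lambda>n. case_nat True P (up_ren r n)) = case_nat True (\<lambda>n. P (r n))"
    by (rule ext) (simp add: up_ren_def split: nat.split)
  with Lam show ?case by simp
qed auto

lemma sub_cong:
  "vt P Q t \<Longrightarrow> (\<And>n. P n \<Longrightarrow> \<sigma> n = \<sigma>' n) \<Longrightarrow> (\<And>n. Q n \<Longrightarrow> \<tau> n = \<tau>' n) \<Longrightarrow>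
     sub_trm \<sigma> \<tau> t = sub_trm \<sigma>' \<tau>' t"
  "vu P Q u \<Longrightarrow> (\<And>n. P n \<Longrightarrow> \<sigma> n = \<sigma>' n) \<Longrightarrow> (\<And>n. Q n \<Longrightarrow> \<tau> n = \<tau>' n) \<Longrightarrow>
     sub_fct \<sigma> \<tau> u = sub_fct \<sigma>' \<tau>' u"
proof (induct t and u arbitrary: P Q \<sigma> \<sigma>' \<tau> \<tau>' and P Q \<sigma> \<sigma>' \<tau> \<tau>' rule: trm.induct fct.induct)
  case (Lam t)
  have "sub_trm (up0_trm \<sigma>) (up0_fct \<tau>) t = sub_trm (up0_trm \<sigma>') (up0_fct \<tau>') t"
    by (rule Lam(1)[of "case_nat True P" Q]) (use Lam in \<open>auto simp: up0_trm_def up0_fct_def split: nat.splits\<close>)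
  then show ?case by simp
next
  case (Cst c ts us)
  show ?case using Cst(3) by (auto intro!: Cst(1,2)[of _ P Q] Cst(4,5))
next
  case (App u t)
  show ?case using App(3) by (auto intro!: App(1,2)[of P Q] App(4,5))
qed auto

lemma sub_fm_cong:
  "vf P Q A \<Longrightarrow> (\<And>n. P n \<Longrightarrow> \<sigma> n = \<sigma>' n) \<Longrightarrow> (\<And>n. Q n \<Longrightarrow> \<tau> n = \<tau>' n) \<Longrightarrow>
     sub_fm \<sigma> \<tau> A = sub_fm \<sigma>' \<tau>' A"
proof (induct A arbitrary: P Q \<sigma> \<sigma>' \<tau> \<tau>')
  case (Eq s t) then show ?case by (auto intro: sub_cong[of P Q])
next
  case (Neg A) show ?case using Neg(2) by (auto intro!: Neg(1)[of P Q] Neg(3,4))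
next
  case (And A B) show ?case using And(3) by (auto intro!: And(1,2)[of P Q] And(4,5))
next
  case (Or A B) show ?case using Or(3) by (auto intro!: Or(1,2)[of P Q] Or(4,5))
next
  case (Imp A B) show ?case using Imp(3) by (auto intro!: Imp(1,2)[of P Q] Imp(4,5))
next
  case (All0 A)
  show ?case
    by simp (rule All0(1)[of "case_nat True P" Q],
        use All0 in \<open>auto simp: up0_trm_def up0_fct_def split: nat.splits\<close>)
next
  case (Ex0 A)
  show ?case
    by simp (rule Ex0(1)[of "case_nat True P" Q],
        use Ex0 in \<open>auto simp: up0_trm_def up0_fct_def split: nat.splits\<close>)
next
  case (All1 A)
  show ?case
    by simp (rule All1(1)[of P "case_nat True Q"],
        use All1 in \<open>auto simp: up1_trm_def up1_fct_def split: nat.splits\<close>)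
next
  case (Ex1 A)
  show ?case
    by simp (rule Ex1(1)[of P "case_nat True Q"],
        use Ex1 in \<open>auto simp: up1_trm_def up1_fct_def split: nat.splits\<close>)
qed

lemma vt_sub:
  "vt P Q t \<Longrightarrow> (\<And>n. P n \<Longrightarrow> vt P' Q' (\<sigma> n)) \<Longrightarrow> (\<And>n. Q n \<Longrightarrow> vu P' Q' (\<tau> n)) \<Longrightarrow>
     vt P' Q' (sub_trm \<sigma> \<tau> t)"
  "vu P Q u \<Longrightarrow> (\<And>n. P n \<Longrightarrow> vt P' Q' (\<sigma> n)) \<Longrightarrow> (\<And>n. Q n \<Longrightarrow> vu P' Q' (\<tau> n)) \<Longrightarrow>
     vu P' Q' (sub_fct \<sigma> \<tau> u)"
proof (induct t and u arbitrary: P Q P' Q' \<sigma> \<tau> and P Q P' Q' \<sigma> \<tau> rule: trm.induct fct.induct)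
  case (Lam t)
  show ?case
    by simp (rule Lam(1)[of "case_nat True P" Q],
        use Lam in \<open>auto simp: up0_trm_def up0_fct_def vt_ren split: nat.splits\<close>)
next
  case (Cst c ts us)
  show ?case using Cst(3) by (auto intro!: Cst(1,2)[of _ P Q] Cst(4,5))
next
  case (App u t)
  show ?case using App(3) by (auto intro!: App(1,2)[of P Q] App(4,5))
qed auto

lemma vf_sub:
  "vf P Q A \<Longrightarrow> (\<And>n. P n \<Longrightarrow> vt P' Q' (\<sigma> n)) \<Longrightarrow> (\<And>n. Q n \<Longrightarrow> vu P' Q' (\<tau> n)) \<Longrightarrow>
     vf P' Q' (sub_fm \<sigma> \<tau> A)"
proof (induct A arbitrary: P Q P' Q' \<sigma> \<tau>)
  case (Eq s t) then show ?case by (auto intro: vt_sub[of P Q])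
next
  case (Neg A) show ?case using Neg(2) by (auto intro!: Neg(1)[of P Q] Neg(3,4))
next
  case (And A B) show ?case using And(3) by (auto intro!: And(1,2)[of P Q] And(4,5))
next
  case (Or A B) show ?case using Or(3) by (auto intro!: Or(1,2)[of P Q] Or(4,5))
next
  case (Imp A B) show ?case using Imp(3) by (auto intro!: Imp(1,2)[of P Q] Imp(4,5))
next
  case (All0 A)
  show ?case
    by simp (rule All0(1)[of "case_nat True P" Q],
        use All0 in \<open>auto simp: up0_trm_def up0_fct_def vt_ren split: nat.splits\<close>)
next
  case (Ex0 A)
  show ?case
    by simp (rule Ex0(1)[of "case_nat True P" Q],
        use Ex0 in \<open>auto simp: up0_trm_def up0_fct_def vt_ren split: nat.splits\<close>)
next
  case (All1 A)
  show ?case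
    by simp (rule All1(1)[of P "case_nat True Q"],
        use All1 in \<open>auto simp: up1_trm_def up1_fct_def vt_ren split: nat.splits\<close>)
next
  case (Ex1 A)
  show ?case
    by simp (rule Ex1(1)[of P "case_nat True Q"],
        use Ex1 in \<open>auto simp: up1_trm_def up1_fct_def vt_ren split: nat.splits\<close>)
qed

abbreviation below :: "nat \<Rightarrow> nat \<Rightarrow> bool" where "below N \<equiv> (\<lambda>n. n < N)"

lemma vt_below_mono: "vt (below N) (below N) t \<Longrightarrow> N \<le> M \<Longrightarrow> vt (below M) (below M) t"
  "vu (below N) (below N) u \<Longrightarrow> N \<le> M \<Longrightarrow> vu (below M) (below M) u"
  by (auto elim!: vt_mono[rotated 2])

lemma vf_below_mono: "vf (below N) (below N) A \<Longrightarrow> N \<le> M \<Longrightarrow> vf (below M) (below M) A"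
  by (auto elim!: vf_mono[rotated 2])

lemma bound_list:
  fixes R :: "nat \<Rightarrow> 'a \<Rightarrow> bool"
  assumes "\<And>N M x. R N x \<Longrightarrow> N \<le> M \<Longrightarrow> R M x" and "finite X" and "\<And>x. x \<in> X \<Longrightarrow> \<exists>N. R N x"
  shows "\<exists>N. \<forall>x\<in>X. R N x"
proof -
  from assms(3) obtain f where f: "\<And>x. x \<in> X \<Longrightarrow> R (f x) x" by metis
  have "R (Max (f ` X)) x" if "x \<in> X" for x
    using assms(1)[OF f[OF that]] assms(2) that by auto
  then show ?thesis by blast
qed

lemma vt_bound: "\<exists>N. vt (below N) (below N) t" "\<exists>N. vu (below N) (below N) u"
proof (induct t and u rule: trm.induct fct.induct)
  case (Cst c ts us)
  obtain N where N: "\<forall>t\<in>set ts. vt (below N) (below N) t"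
    using bound_list[of "\<lambda>N. vt (below N) (below N)" "set ts"] vt_below_mono(1) Cst(1) by blast
  obtain M where M: "\<forall>u\<in>set us. vu (below M) (below M) u"
    using bound_list[of "\<lambda>N. vu (below N) (below N)" "set us"] vt_below_mono(2) Cst(2) by blast
  show ?case
    by (rule exI[of _ "max N M"]) (use N M in \<open>auto intro: vt_below_mono\<close>)
next
  case (App u t)
  then obtain N M where "vu (below N) (below N) u" "vt (below M) (below M) t" by blast
  then show ?case by (intro exI[of _ "max N M"]) (auto intro: vt_below_mono)
next
  case (Lam t)
  then obtain N where "vt (below N) (below N) t" by blast
  then have "vt (case_nat True (below N)) (below N) t"
    by (rule vt_mono(1)[rotated 2]) (auto split: nat.split)
  then show ?case by (intro exI[of _ N]) simp
qed auto

lemma vf_bound: "\<exists>N. vf (below N) (below N) A"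
proof (induct A)
  case (Eq s t)
  obtain N M where "vt (below N) (below N) s" "vt (below M) (below M) t" using vt_bound by blast
  then show ?case by (intro exI[of _ "max N M"]) (auto intro: vt_below_mono)
next
  case (And A B)
  then obtain N M where "vf (below N) (below N) A" "vf (below M) (below M) B" by blast
  then show ?case by (intro exI[of _ "max N M"]) (auto intro: vf_below_mono)
next
  case (Or A B)
  then obtain N M where "vf (below N) (below N) A" "vf (below M) (below M) B" by blast
  then show ?case by (intro exI[of _ "max N M"]) (auto intro: vf_below_mono)
next
  case (Imp A B)
  then obtain N M where "vf (below N) (below N) A" "vf (below M) (below M) B" by blast
  then show ?case by (intro exI[of _ "max N M"]) (auto intro: vf_below_mono)
next
  case (All0 A)
  then obtain N where "vf (below N) (below N) A" by blast
  then have "vf (case_nat True (below N)) (below N) A"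
    by (rule vf_mono[rotated 2]) (auto split: nat.split)
  then show ?case by (intro exI[of _ N]) simp
next
  case (Ex0 A)
  then obtain N where "vf (below N) (below N) A" by blast
  then have "vf (case_nat True (below N)) (below N) A"
    by (rule vf_mono[rotated 2]) (auto split: nat.split)
  then show ?case by (intro exI[of _ N]) simp
next
  case (All1 A)
  then obtain N where "vf (below N) (below N) A" by blast
  then have "vf (below N) (case_nat True (below N)) A"
    by (rule vf_mono[rotated 2]) (auto split: nat.split)
  then show ?case by (intro exI[of _ N]) simp
next
  case (Ex1 A)
  then obtain N where "vf (below N) (below N) A" by blast
  then have "vf (below N) (case_nat True (below N)) A"
    by (rule vf_mono[rotated 2]) (auto split: nat.split)
  then show ?case by (intro exI[of _ N]) simp
qed auto

lemma vf_bound_set: "finite F \<Longrightarrow> \<exists>N. \<forall>A\<in>F. vf (below N) (below N) A"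
  using bound_list[of "\<lambda>N. vf (below N) (below N)" F] vf_below_mono vf_bound by blast


section \<open>Derivations\<close>

lemma deriv_wf: "deriv S \<Gamma> A \<Longrightarrow> wf_fm (lang S) A"
  by (induct rule: deriv.induct)
    (auto simp: wf_ren_fm inst0_def inst1_def intro!: wf_sub_fm split: nat.split)

lemma deriv_weaken: "deriv S \<Gamma> A \<Longrightarrow> \<Gamma> \<subseteq> \<Gamma>' \<Longrightarrow> deriv S \<Gamma>' A"
proof (induct arbitrary: \<Gamma>' rule: deriv.induct)
  case (OrE \<Gamma> A B C) then show ?case by (meson deriv.OrE insert_mono)
next
  case (NegI A \<Gamma> B) then show ?case by (meson deriv.NegI insert_mono)
next
  case (Ex0E \<Gamma> A B) then show ?case by (meson deriv.Ex0E insert_mono image_mono)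
next
  case (Ex1E \<Gamma> A B) then show ?case by (meson deriv.Ex1E insert_mono image_mono)
next
  case (AndE1 \<Gamma> A B) then show ?case by (metis deriv.AndE1)
next
  case (AndE2 \<Gamma> A B) then show ?case by (metis deriv.AndE2)
next
  case (OrI1 \<Gamma> A B) then show ?case by (metis deriv.OrI1)
next
  case (OrI2 \<Gamma> A B) then show ?case by (metis deriv.OrI2)
next
  case (All0E \<Gamma> A t) then show ?case by (metis deriv.All0E)
next
  case (Ex0I A t \<Gamma>) then show ?case by (metis deriv.Ex0I)
next
  case (All1E \<Gamma> A u) then show ?case by (metis deriv.All1E)
next
  case (Ex1I A u \<Gamma>) then show ?case by (metis deriv.Ex1I)
next
  case (Ass A \<Gamma>) then show ?case by (metis deriv.Ass subsetD)
next
  case (Axm A \<Gamma>) then show ?case by (metis deriv.Axm)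
next
  case (AndI \<Gamma> A B) then show ?case by (metis deriv.AndI)
next
  case (ImpI A \<Gamma> B) then show ?case by (metis deriv.ImpI insert_mono)
next
  case (ImpE \<Gamma> A B) then show ?case by (metis deriv.ImpE)
next
  case (NegE \<Gamma> A B) then show ?case by (metis deriv.NegE)
next
  case (All0I \<Gamma> A) then show ?case by (metis deriv.All0I image_mono)
next
  case (All1I \<Gamma> A) then show ?case by (metis deriv.All1I image_mono)
qed

text \<open>Serves twice: the limit of a chain of theories still omits the chosen formula, and an
  arbitrary set of assumptions reduces to a finite one, for which the variables are bounded.\<close>

lemma deriv_compact: "deriv S \<Gamma> A \<Longrightarrow> \<exists>F. finite F \<and> F \<subseteq> \<Gamma> \<and> deriv S F A"
proof (induct rule: deriv.induct)
  case (Ass A \<Gamma>) then show ?case by (intro exI[of _ "{A}"]) (auto intro: deriv.Ass)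
next
  case (Axm A \<Gamma>) then show ?case by (intro exI[of _ "{}"]) (auto intro: deriv.Axm)
next
  case (AndI \<Gamma> A B)
  then obtain F G where F: "finite F" "F \<subseteq> \<Gamma>" "deriv S F A"
    and G: "finite G" "G \<subseteq> \<Gamma>" "deriv S G B" by blast
  have "deriv S (F \<union> G) (A \<^bold>\<and> B)"
    by (rule deriv.AndI[OF deriv_weaken[OF F(3)] deriv_weaken[OF G(3)]]) auto
  then show ?case using F G by (intro exI[of _ "F \<union> G"]) simp
next
  case (OrE \<Gamma> A B C)
  then obtain F G H where F: "finite F" "F \<subseteq> \<Gamma>" "deriv S F (A \<^bold>\<or> B)"
    and G: "finite G" "G \<subseteq> insert A \<Gamma>" "deriv S G C"
    and H: "finite H" "H \<subseteq> insert B \<Gamma>" "deriv S H C" by blast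
  let ?D = "F \<union> (G - {A}) \<union> (H - {B})"
  have "deriv S ?D C"
  proof (rule deriv.OrE[of _ _ A B])
    show "deriv S ?D (A \<^bold>\<or> B)" by (rule deriv_weaken[OF F(3)]) blast
    show "deriv S (insert A ?D) C" by (rule deriv_weaken[OF G(3)]) blast
    show "deriv S (insert B ?D) C" by (rule deriv_weaken[OF H(3)]) blast
  qed
  moreover have "finite ?D" using F G H by simp
  moreover have "?D \<subseteq> \<Gamma>" using F(2) G(2) H(2) by blast
  ultimately show ?case by (intro exI[of _ ?D] conjI)
next
  case (ImpI A \<Gamma> B)
  then obtain G where G: "finite G" "G \<subseteq> insert A \<Gamma>" "deriv S G B" by blast
  have "deriv S (G - {A}) (A \<^bold>\<longrightarrow> B)"
    by (rule deriv.ImpI[OF ImpI(1) deriv_weaken[OF G(3)]]) blast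
  then show ?case using G by (intro exI[of _ "G - {A}"]) auto
next
  case (ImpE \<Gamma> A B)
  then obtain F G where F: "finite F" "F \<subseteq> \<Gamma>" "deriv S F (A \<^bold>\<longrightarrow> B)"
    and G: "finite G" "G \<subseteq> \<Gamma>" "deriv S G A" by blast
  have "deriv S (F \<union> G) B"
    by (rule deriv.ImpE[OF deriv_weaken[OF F(3)] deriv_weaken[OF G(3)]]) auto
  then show ?case using F G by (intro exI[of _ "F \<union> G"]) simp
next
  case (NegI A \<Gamma> B)
  then obtain G H where G: "finite G" "G \<subseteq> insert A \<Gamma>" "deriv S G B"
    and H: "finite H" "H \<subseteq> insert A \<Gamma>" "deriv S H (\<^bold>\<not> B)" by blast
  have "deriv S ((G - {A}) \<union> (H - {A})) (\<^bold>\<not> A)"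
    by (rule deriv.NegI[OF NegI(1) deriv_weaken[OF G(3)] deriv_weaken[OF H(3)]]) blast+
  moreover have "(G - {A}) \<union> (H - {A}) \<subseteq> \<Gamma>" using G(2) H(2) by blast
  ultimately show ?case using G(1) H(1) by (intro exI[of _ "(G - {A}) \<union> (H - {A})"]) simp
next
  case (NegE \<Gamma> A B)
  then obtain F G where F: "finite F" "F \<subseteq> \<Gamma>" "deriv S F A"
    and G: "finite G" "G \<subseteq> \<Gamma>" "deriv S G (\<^bold>\<not> A)" by blast
  have "deriv S (F \<union> G) B"
    by (rule deriv.NegE[OF deriv_weaken[OF F(3)] deriv_weaken[OF G(3)] NegE(5)]) auto
  then show ?case using F G by (intro exI[of _ "F \<union> G"]) simp
next
  case (All0I \<Gamma> A) then show ?case by (metis deriv.All0I finite_subset_image)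
next
  case (All1I \<Gamma> A) then show ?case by (metis deriv.All1I finite_subset_image)
next
  case (Ex0E \<Gamma> A B)
  then obtain F G where F: "finite F" "F \<subseteq> \<Gamma>" "deriv S F (Ex0 A)"
    and G: "finite G" "G \<subseteq> insert A (lift0 ` \<Gamma>)" "deriv S G (lift0 B)" by blast
  have "finite (G - {A})" "G - {A} \<subseteq> lift0 ` \<Gamma>" using G by auto
  then obtain H where H: "H \<subseteq> \<Gamma>" "finite H" "G - {A} = lift0 ` H" by (metis finite_subset_image)
  have "G \<subseteq> insert A (lift0 ` (F \<union> H))" using H by auto
  then have "deriv S (F \<union> H) B"
    by (rule deriv.Ex0E[OF deriv_weaken[OF F(3)] deriv_weaken[OF G(3)], rotated]) simp
  then show ?case using F G H by (intro exI[of _ "F \<union> H"]) auto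
next
  case (Ex1E \<Gamma> A B)
  then obtain F G where F: "finite F" "F \<subseteq> \<Gamma>" "deriv S F (Ex1 A)"
    and G: "finite G" "G \<subseteq> insert A (lift1 ` \<Gamma>)" "deriv S G (lift1 B)" by blast
  have "finite (G - {A})" "G - {A} \<subseteq> lift1 ` \<Gamma>" using G by auto
  then obtain H where H: "H \<subseteq> \<Gamma>" "finite H" "G - {A} = lift1 ` H" by (metis finite_subset_image)
  have "G \<subseteq> insert A (lift1 ` (F \<union> H))" using H by auto
  then have "deriv S (F \<union> H) B"
    by (rule deriv.Ex1E[OF deriv_weaken[OF F(3)] deriv_weaken[OF G(3)], rotated]) simp
  then show ?case using F G H by (intro exI[of _ "F \<union> H"]) auto
next
  case (AndE1 \<Gamma> A B) then show ?case by (metis deriv.AndE1)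
next
  case (AndE2 \<Gamma> A B) then show ?case by (metis deriv.AndE2)
next
  case (OrI1 \<Gamma> A B) then show ?case by (metis deriv.OrI1)
next
  case (OrI2 \<Gamma> A B) then show ?case by (metis deriv.OrI2)
next
  case (All0E \<Gamma> A t) then show ?case by (metis deriv.All0E)
next
  case (Ex0I A t \<Gamma>) then show ?case by (metis deriv.Ex0I)
next
  case (All1E \<Gamma> A u) then show ?case by (metis deriv.All1E)
next
  case (Ex1I A u \<Gamma>) then show ?case by (metis deriv.Ex1I)
qed

text \<open>Apart from the language, only the axiom rule depends on the system, and a theorem put in
  place of an axiom holds under any assumptions by weakening.\<close>

lemma deriv_extend:
  assumes "deriv S1 \<Gamma> A" and "lang S1 \<subseteq> lang S2" and "axms S1 \<inter> formulas S1 \<subseteq> theorems S2"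
  shows "deriv S2 \<Gamma> A"
proof -
  have wt: "wf_trm (lang S1) t \<Longrightarrow> wf_trm (lang S2) t" "wf_fct (lang S1) u \<Longrightarrow> wf_fct (lang S2) u" for t u
    using assms(2) by (induct t and u rule: trm.induct fct.induct) auto
  have wfm: "wf_fm (lang S1) B \<Longrightarrow> wf_fm (lang S2) B" for B by (induct B) (auto intro: wt)
  from assms(1) show ?thesis
  proof (induct rule: deriv.induct)
    case (Axm A \<Gamma>)
    then have "A \<in> theorems S2" using assms(3) by (auto simp: formulas_def)
    then show ?case by (auto simp: theorems_def elim: deriv_weaken)
  qed (blast intro: deriv.intros wt wfm)+
qed

section \<open>Substitution in derivations\<close>

lemma deriv_gen0: "deriv S {} A \<Longrightarrow> deriv S {} ((All0 ^^ n) A)"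
  by (induct n) (auto intro: deriv.All0I)

lemma deriv_gen1: "deriv S {} A \<Longrightarrow> deriv S {} ((All1 ^^ n) A)"
  by (induct n) (auto intro: deriv.All1I)

text \<open>The \<open>n\<close> quantifiers bind the variables below \<open>n\<close>; when they
  are removed, the remaining variables move down by \<open>n\<close>.\<close>

lemma deriv_spec0:
  "deriv S {} ((All0 ^^ n) A) \<Longrightarrow> \<forall>i. wf_trm (lang S) (\<sigma> i) \<Longrightarrow>
     deriv S {} (sub_fm (\<lambda>i. if i < n then \<sigma> i else NVar (i - n)) FVar A)"
proof (induct n arbitrary: A \<sigma>)
  case 0 then show ?case using sub_fm_id by simp
next
  case (Suc n)
  have "deriv S {} ((All0 ^^ n) (All0 A))" using Suc(2) by (metis funpow_Suc_right comp_apply)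
  then have "deriv S {} (sub_fm (\<lambda>i. if i < n then \<sigma> (Suc i) else NVar (i - n)) FVar (All0 A))"
    using Suc(1)[of "All0 A" "\<lambda>i. \<sigma> (Suc i)"] Suc(3) by simp
  from deriv.All0E[OF this[unfolded sub_fm.simps], of "\<sigma> 0"] Suc(3)
  have "deriv S {} (sub_fm (case_nat (\<sigma> 0) (\<lambda>i. if i < n then \<sigma> (Suc i) else NVar (i - n))) FVar A)"
    by (simp add: sub0_up0)
  moreover have "case_nat (\<sigma> 0) (\<lambda>i. if i < n then \<sigma> (Suc i) else NVar (i - n)) =
      (\<lambda>i. if i < Suc n then \<sigma> i else NVar (i - Suc n))"
    by (rule ext) (simp split: nat.split)
  ultimately show ?case by simp
qed

lemma deriv_spec1:
  "deriv S {} ((All1 ^^ n) A) \<Longrightarrow> \<forall>i. wf_fct (lang S) (\<tau> i) \<Longrightarrow>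
     deriv S {} (sub_fm NVar (\<lambda>i. if i < n then \<tau> i else FVar (i - n)) A)"
proof (induct n arbitrary: A \<tau>)
  case 0 then show ?case using sub_fm_id by simp
next
  case (Suc n)
  have "deriv S {} ((All1 ^^ n) (All1 A))" using Suc(2) by (metis funpow_Suc_right comp_apply)
  then have "deriv S {} (sub_fm NVar (\<lambda>i. if i < n then \<tau> (Suc i) else FVar (i - n)) (All1 A))"
    using Suc(1)[of "All1 A" "\<lambda>i. \<tau> (Suc i)"] Suc(3) by simp
  from deriv.All1E[OF this[unfolded sub_fm.simps], of "\<tau> 0"] Suc(3)
  have "deriv S {} (sub_fm NVar (case_nat (\<tau> 0) (\<lambda>i. if i < n then \<tau> (Suc i) else FVar (i - n))) A)"
    by (simp add: sub1_up1)
  moreover have "case_nat (\<tau> 0) (\<lambda>i. if i < n then \<tau> (Suc i) else FVar (i - n)) =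
      (\<lambda>i. if i < Suc n then \<tau> i else FVar (i - Suc n))"
    by (rule ext) (simp split: nat.split)
  ultimately show ?case by simp
qed

text \<open>The function variables are instantiated first, by functors whose number variables are shifted
  out of the way of the number variables of \<open>A\<close>.\<close>

lemma theorem_sub:
  assumes A: "deriv S {} A" and \<sigma>: "\<forall>i. wf_trm (lang S) (\<sigma> i)" and \<tau>: "\<forall>i. wf_fct (lang S) (\<tau> i)"
  shows "deriv S {} (sub_fm \<sigma> \<tau> A)"
proof -
  obtain N where N: "vf (below N) (below N) A" using vf_bound by blast
  let ?\<tau> = "\<lambda>i. ren_fct (\<lambda>n. n + N) id (\<tau> i)"
  let ?\<tau>' = "\<lambda>i. if i < N then ?\<tau> i else FVar (i - N)"
  let ?\<sigma> = "\<lambda>i. if i < N then \<sigma> i else NVar (i - N)"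
  have "deriv S {} (sub_fm NVar ?\<tau>' A)"
    by (rule deriv_spec1[OF deriv_gen1[OF A]]) (use \<tau> in \<open>simp add: wf_ren\<close>)
  then have "deriv S {} (sub_fm ?\<sigma> FVar (sub_fm NVar ?\<tau>' A))"
    by (rule deriv_spec0[OF deriv_gen0 \<sigma>])
  also have "sub_fm ?\<sigma> FVar (sub_fm NVar ?\<tau>' A) = sub_fm \<sigma> \<tau> A"
    unfolding sub_fm_sub_fm by (rule sub_fm_cong[OF N]) (simp_all add: sub_ren sub_id)
  finally show ?thesis .
qed

lemma deriv_sub:
  "deriv S \<Gamma> A \<Longrightarrow> \<forall>i. wf_trm (lang S) (\<sigma> i) \<Longrightarrow> \<forall>i. wf_fct (lang S) (\<tau> i) \<Longrightarrow>
     deriv S (sub_fm \<sigma> \<tau> ` \<Gamma>) (sub_fm \<sigma> \<tau> A)"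
proof (induct arbitrary: \<sigma> \<tau> rule: deriv.induct)
  case (Ass A \<Gamma>) then show ?case by (intro deriv.Ass) (auto intro: wf_sub_fm)
next
  case (Axm A \<Gamma>)
  \<comment> \<open>The set of axioms need not be closed under substitution. An axiom is a theorem,
    though, and instances of theorems are reached through generalization.\<close>
  then have "deriv S {} A" by (intro deriv.Axm)
  from theorem_sub[OF this Axm(3,4)] show ?case by (rule deriv_weaken) simp
next
  case (OrE \<Gamma> A B C)
  show ?case using OrE(2,4,6)[OF OrE(7,8)] by (auto intro: deriv.OrE)
next
  case (ImpI A \<Gamma> B)
  show ?case using ImpI(3)[OF ImpI(4,5)] wf_sub_fm[OF ImpI(4,5,1)] by (auto intro: deriv.ImpI)
next
  case (NegI A \<Gamma> B)
  show ?case using NegI(3,5)[OF NegI(6,7)] wf_sub_fm[OF NegI(6,7,1)] by (auto intro: deriv.NegI)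
next
  case (NegE \<Gamma> A B)
  show ?case using NegE(2,4)[OF NegE(6,7)] wf_sub_fm[OF NegE(6,7,5)] by (auto intro: deriv.NegE)
next
  case (All0I \<Gamma> A)
  have "\<forall>i. wf_trm (lang S) (up0_trm \<sigma> i)" "\<forall>i. wf_fct (lang S) (up0_fct \<tau> i)"
    using All0I(3,4) by (auto simp: up0_trm_def up0_fct_def wf_ren split: nat.split)
  from All0I(2)[OF this] show ?case
    by (auto intro!: deriv.All0I simp: image_image sub_fm_lift0)
next
  case (All0E \<Gamma> A t)
  from All0E(2)[OF All0E(4,5)] have "deriv S (sub_fm \<sigma> \<tau> ` \<Gamma>) (sub0 (sub_trm \<sigma> \<tau> t) (sub_fm (up0_trm \<sigma>) (up0_fct \<tau>) A))"
    using All0E(3-5) by (auto intro!: deriv.All0E wf_sub[rule_format])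
  then show ?case by (simp add: sub0_up0 sub_fm_sub0)
next
  case (Ex0I A t \<Gamma>)
  have "\<forall>i. wf_trm (lang S) (up0_trm \<sigma> i)" "\<forall>i. wf_fct (lang S) (up0_fct \<tau> i)"
    using Ex0I(5,6) by (auto simp: up0_trm_def up0_fct_def wf_ren split: nat.split)
  then show ?case using Ex0I(1,2) Ex0I(4)[OF Ex0I(5,6)] Ex0I(5,6)
    by (auto intro!: deriv.Ex0I[of _ _ "sub_trm \<sigma> \<tau> t"] wf_sub_fm wf_sub[rule_format] simp: sub0_up0 sub_fm_sub0)
next
  case (Ex0E \<Gamma> A B)
  have "\<forall>i. wf_trm (lang S) (up0_trm \<sigma> i)" "\<forall>i. wf_fct (lang S) (up0_fct \<tau> i)"
    using Ex0E(5,6) by (auto simp: up0_trm_def up0_fct_def wf_ren split: nat.split)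
  from Ex0E(4)[OF this] Ex0E(2)[OF Ex0E(5,6)] show ?case
    by (simp add: image_image sub_fm_lift0 deriv.Ex0E[of _ _ "sub_fm (up0_trm \<sigma>) (up0_fct \<tau>) A"])
next
  case (All1I \<Gamma> A)
  have "\<forall>i. wf_trm (lang S) (up1_trm \<sigma> i)" "\<forall>i. wf_fct (lang S) (up1_fct \<tau> i)"
    using All1I(3,4) by (auto simp: up1_trm_def up1_fct_def wf_ren split: nat.split)
  from All1I(2)[OF this] show ?case
    by (auto intro!: deriv.All1I simp: image_image sub_fm_lift1)
next
  case (All1E \<Gamma> A u)
  from All1E(2)[OF All1E(4,5)] have "deriv S (sub_fm \<sigma> \<tau> ` \<Gamma>) (sub1 (sub_fct \<sigma> \<tau> u) (sub_fm (up1_trm \<sigma>) (up1_fct \<tau>) A))"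
    using All1E(3-5) by (auto intro!: deriv.All1E wf_sub[rule_format])
  then show ?case by (simp add: sub1_up1 sub_fm_sub1)
next
  case (Ex1I A u \<Gamma>)
  have "\<forall>i. wf_trm (lang S) (up1_trm \<sigma> i)" "\<forall>i. wf_fct (lang S) (up1_fct \<tau> i)"
    using Ex1I(5,6) by (auto simp: up1_trm_def up1_fct_def wf_ren split: nat.split)
  then show ?case using Ex1I(1,2) Ex1I(4)[OF Ex1I(5,6)] Ex1I(5,6)
    by (auto intro!: deriv.Ex1I[of _ _ "sub_fct \<sigma> \<tau> u"] wf_sub_fm wf_sub[rule_format] simp: sub1_up1 sub_fm_sub1)
next
  case (Ex1E \<Gamma> A B)
  have "\<forall>i. wf_trm (lang S) (up1_trm \<sigma> i)" "\<forall>i. wf_fct (lang S) (up1_fct \<tau> i)"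
    using Ex1E(5,6) by (auto simp: up1_trm_def up1_fct_def wf_ren split: nat.split)
  from Ex1E(4)[OF this] Ex1E(2)[OF Ex1E(5,6)] show ?case
    by (simp add: image_image sub_fm_lift1 deriv.Ex1E[of _ _ "sub_fm (up1_trm \<sigma>) (up1_fct \<tau>) A"])
next
  case (ImpE \<Gamma> A B)
  show ?case using ImpE(2,4)[OF ImpE(5,6)] by (auto intro: deriv.ImpE)
qed (auto intro: deriv.intros wf_sub_fm)

section \<open>Quantifier rules with a named eigenvariable\<close>

abbreviation avoid :: "nat \<Rightarrow> nat \<Rightarrow> bool" where "avoid c \<equiv> (\<lambda>n. n \<noteq> c)"
text \<open>This substitution abstracts from the variable \<open>c\<close>: on formulas without
  \<open>c\<close> it is the lifting, and it turns an instance at \<open>c\<close> back into the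
  body. Applied to a whole derivation it converts the de Bruijn rules into rules with a fresh
  variable, as needed for witnesses that are free variables of a theory.\<close>

abbreviation shift0 :: "nat \<Rightarrow> nat \<Rightarrow> trm" where "shift0 c \<equiv> (\<lambda>n. if n = c then NVar 0 else NVar (Suc n))"
abbreviation shift1 :: "nat \<Rightarrow> nat \<Rightarrow> fct" where "shift1 c \<equiv> (\<lambda>n. if n = c then FVar 0 else FVar (Suc n))"

lemma shift0_fresh: "vf (avoid c) Q A \<Longrightarrow> sub_fm (shift0 c) FVar A = lift0 A"
  unfolding ren_fm_sub by (rule sub_fm_cong[of "avoid c" Q]) auto

lemma shift1_fresh: "vf P (avoid c) A \<Longrightarrow> sub_fm NVar (shift1 c) A = lift1 A"
  unfolding ren_fm_sub by (rule sub_fm_cong[of P "avoid c"]) auto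

lemma case_avoid: "case_nat True (avoid c) = avoid (Suc c)"
  by (rule ext) (simp split: nat.split)

lemma shift0_inst: "vf (case_nat True (avoid c)) Q B \<Longrightarrow> sub_fm (shift0 c) FVar (sub0 (NVar c) B) = B"
  unfolding sub_fm_sub_fm
  by (rule trans[OF sub_fm_cong[of "avoid (Suc c)" Q B _ NVar _ FVar] sub_fm_id])
    (auto simp: case_avoid inst0_def split: nat.splits)

lemma shift1_inst: "vf P (case_nat True (avoid c)) B \<Longrightarrow> sub_fm NVar (shift1 c) (sub1 (FVar c) B) = B"
  unfolding sub_fm_sub_fm
  by (rule trans[OF sub_fm_cong[of P "avoid (Suc c)" B _ NVar _ FVar] sub_fm_id])
    (auto simp: case_avoid inst1_def split: nat.splits)

lemma All0I_fresh:
  assumes "deriv S \<Gamma> (sub0 (NVar c) B)" and "\<forall>A\<in>\<Gamma>. vf (avoid c) (\<lambda>_. True) A"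
    and "vf (case_nat True (avoid c)) (\<lambda>_. True) B"
  shows "deriv S \<Gamma> (All0 B)"
proof -
  have "deriv S (sub_fm (shift0 c) FVar ` \<Gamma>) (sub_fm (shift0 c) FVar (sub0 (NVar c) B))"
    by (rule deriv_sub[OF assms(1)]) auto
  moreover have "sub_fm (shift0 c) FVar ` \<Gamma> = lift0 ` \<Gamma>"
    by (rule image_cong) (use assms(2) shift0_fresh in auto)
  ultimately show ?thesis by (auto intro: deriv.All0I simp: shift0_inst[OF assms(3)])
qed

lemma All1I_fresh:
  assumes "deriv S \<Gamma> (sub1 (FVar c) B)" and "\<forall>A\<in>\<Gamma>. vf (\<lambda>_. True) (avoid c) A"
    and "vf (\<lambda>_. True) (case_nat True (avoid c)) B"
  shows "deriv S \<Gamma> (All1 B)"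
proof -
  have "deriv S (sub_fm NVar (shift1 c) ` \<Gamma>) (sub_fm NVar (shift1 c) (sub1 (FVar c) B))"
    by (rule deriv_sub[OF assms(1)]) auto
  moreover have "sub_fm NVar (shift1 c) ` \<Gamma> = lift1 ` \<Gamma>"
    by (rule image_cong) (use assms(2) shift1_fresh in auto)
  ultimately show ?thesis by (auto intro: deriv.All1I simp: shift1_inst[OF assms(3)])
qed

lemma Ex0E_fresh:
  assumes "deriv S \<Gamma> (Ex0 B)" and "deriv S (insert (sub0 (NVar c) B) \<Gamma>) C"
    and "\<forall>A\<in>insert C \<Gamma>. vf (avoid c) (\<lambda>_. True) A" and "vf (case_nat True (avoid c)) (\<lambda>_. True) B"
  shows "deriv S \<Gamma> C"
proof -
  have "deriv S (sub_fm (shift0 c) FVar ` insert (sub0 (NVar c) B) \<Gamma>) (sub_fm (shift0 c) FVar C)"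
    by (rule deriv_sub[OF assms(2)]) auto
  moreover have "sub_fm (shift0 c) FVar ` \<Gamma> = lift0 ` \<Gamma>"
    by (rule image_cong) (use assms(3) shift0_fresh in auto)
  moreover have "sub_fm (shift0 c) FVar C = lift0 C" using assms(3) shift0_fresh by auto
  ultimately show ?thesis using assms(1) by (auto intro: deriv.Ex0E simp: shift0_inst[OF assms(4)])
qed

lemma Ex1E_fresh:
  assumes "deriv S \<Gamma> (Ex1 B)" and "deriv S (insert (sub1 (FVar c) B) \<Gamma>) C"
    and "\<forall>A\<in>insert C \<Gamma>. vf (\<lambda>_. True) (avoid c) A" and "vf (\<lambda>_. True) (case_nat True (avoid c)) B"
  shows "deriv S \<Gamma> C"
proof -
  have "deriv S (sub_fm NVar (shift1 c) ` insert (sub1 (FVar c) B) \<Gamma>) (sub_fm NVar (shift1 c) C)"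
    by (rule deriv_sub[OF assms(2)]) auto
  moreover have "sub_fm NVar (shift1 c) ` \<Gamma> = lift1 ` \<Gamma>"
    by (rule image_cong) (use assms(3) shift1_fresh in auto)
  moreover have "sub_fm NVar (shift1 c) C = lift1 C" using assms(3) shift1_fresh by auto
  ultimately show ?thesis using assms(1) by (auto intro: deriv.Ex1E simp: shift1_inst[OF assms(4)])
qed

section \<open>Kripke models\<close>

text \<open>The values of terms do not depend on the world; only the equality of values does.\<close>

locale kmodel =
  fixes L :: "cst set"
    and v0 :: "(nat \<Rightarrow> 'd) \<Rightarrow> (nat \<Rightarrow> 'f) \<Rightarrow> trm \<Rightarrow> 'd"
    and v1 :: "(nat \<Rightarrow> 'd) \<Rightarrow> (nat \<Rightarrow> 'f) \<Rightarrow> fct \<Rightarrow> 'f"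
    and le :: "'w \<Rightarrow> 'w \<Rightarrow> bool"
    and D0 :: "'w \<Rightarrow> 'd set" and D1 :: "'w \<Rightarrow> 'f set"
    and eqv :: "'w \<Rightarrow> 'd \<Rightarrow> 'd \<Rightarrow> bool"
  assumes v0_NVar [simp]: "v0 e f (NVar n) = e n"
    and v1_FVar [simp]: "v1 e f (FVar n) = f n"
    and v0_sub: "v0 e f (sub_trm \<sigma> \<tau> t) = v0 (\<lambda>n. v0 e f (\<sigma> n)) (\<lambda>n. v1 e f (\<tau> n)) t"
    and v1_sub: "v1 e f (sub_fct \<sigma> \<tau> u) = v1 (\<lambda>n. v0 e f (\<sigma> n)) (\<lambda>n. v1 e f (\<tau> n)) u"
    and le_trans: "le w w' \<Longrightarrow> le w' w'' \<Longrightarrow> le w w''"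
    and le_refl: "le w w' \<Longrightarrow> le w' w'"
    and D0_mono: "le w w' \<Longrightarrow> x \<in> D0 w \<Longrightarrow> x \<in> D0 w'"
    and D1_mono: "le w w' \<Longrightarrow> z \<in> D1 w \<Longrightarrow> z \<in> D1 w'"
    and eqv_mono: "le w w' \<Longrightarrow> x \<in> D0 w \<Longrightarrow> y \<in> D0 w \<Longrightarrow> eqv w x y \<Longrightarrow> eqv w' x y"
    and v0_closed: "le w w \<Longrightarrow> \<forall>n. e n \<in> D0 w \<Longrightarrow> \<forall>n. f n \<in> D1 w \<Longrightarrow> wf_trm L t \<Longrightarrow> v0 e f t \<in> D0 w"
    and v1_closed: "le w w \<Longrightarrow> \<forall>n. e n \<in> D0 w \<Longrightarrow> \<forall>n. f n \<in> D1 w \<Longrightarrow> wf_fct L u \<Longrightarrow> v1 e f u \<in> D1 w"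
begin

primrec forces :: "fm \<Rightarrow> 'w \<Rightarrow> (nat \<Rightarrow> 'd) \<Rightarrow> (nat \<Rightarrow> 'f) \<Rightarrow> bool" where
  "forces (s \<doteq> t) w e f = eqv w (v0 e f s) (v0 e f t)"
| "forces (\<^bold>\<not> A) w e f = (\<forall>w'. le w w' \<longrightarrow> \<not> forces A w' e f)"
| "forces (A \<^bold>\<and> B) w e f = (forces A w e f \<and> forces B w e f)"
| "forces (A \<^bold>\<or> B) w e f = (forces A w e f \<or> forces B w e f)"
| "forces (A \<^bold>\<longrightarrow> B) w e f = (\<forall>w'. le w w' \<longrightarrow> forces A w' e f \<longrightarrow> forces B w' e f)"
| "forces (All0 A) w e f = (\<forall>w'. le w w' \<longrightarrow> (\<forall>x\<in>D0 w'. forces A w' (case_nat x e) f))"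
| "forces (Ex0 A) w e f = (\<exists>x\<in>D0 w. forces A w (case_nat x e) f)"
| "forces (All1 A) w e f = (\<forall>w'. le w w' \<longrightarrow> (\<forall>y\<in>D1 w'. forces A w' e (case_nat y f)))"
| "forces (Ex1 A) w e f = (\<exists>y\<in>D1 w. forces A w e (case_nat y f))"

definition env :: "'w \<Rightarrow> (nat \<Rightarrow> 'd) \<Rightarrow> (nat \<Rightarrow> 'f) \<Rightarrow> bool" where
  "env w e f \<longleftrightarrow> le w w \<and> (\<forall>n. e n \<in> D0 w) \<and> (\<forall>n. f n \<in> D1 w)"

lemma env_le: "env w e f \<Longrightarrow> le w w' \<Longrightarrow> env w' e f"
  unfolding env_def using le_refl D0_mono D1_mono by blast

lemma env_case0: "env w e f \<Longrightarrow> x \<in> D0 w \<Longrightarrow> env w (case_nat x e) f"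
  unfolding env_def by (auto split: nat.split)

lemma env_case1: "env w e f \<Longrightarrow> y \<in> D1 w \<Longrightarrow> env w e (case_nat y f)"
  unfolding env_def by (auto split: nat.split)

lemma v0_env: "env w e f \<Longrightarrow> wf_trm L t \<Longrightarrow> v0 e f t \<in> D0 w"
  unfolding env_def using v0_closed by blast

lemma v1_env: "env w e f \<Longrightarrow> wf_fct L u \<Longrightarrow> v1 e f u \<in> D1 w"
  unfolding env_def using v1_closed by blast

lemma v_ren:
  "v0 e f (ren_trm r q t) = v0 (\<lambda>n. e (r n)) (\<lambda>n. f (q n)) t"
  "v1 e f (ren_fct r q u) = v1 (\<lambda>n. e (r n)) (\<lambda>n. f (q n)) u"
  by (simp_all add: ren_sub v0_sub v1_sub)

lemma v_up:
  "(\<lambda>n. v0 (case_nat x e) f (up0_trm \<sigma> n)) = case_nat x (\<lambda>n. v0 e f (\<sigma> n))"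
  "(\<lambda>n. v1 (case_nat x e) f (up0_fct \<tau> n)) = (\<lambda>n. v1 e f (\<tau> n))"
  "(\<lambda>n. v0 e (case_nat y f) (up1_trm \<sigma> n)) = (\<lambda>n. v0 e f (\<sigma> n))"
  "(\<lambda>n. v1 e (case_nat y f) (up1_fct \<tau> n)) = case_nat y (\<lambda>n. v1 e f (\<tau> n))"
  by (rule ext, simp add: up0_trm_def up0_fct_def up1_trm_def up1_fct_def v_ren split: nat.split)+

lemma forces_sub:
  "forces (sub_fm \<sigma> \<tau> A) w e f \<longleftrightarrow> forces A w (\<lambda>n. v0 e f (\<sigma> n)) (\<lambda>n. v1 e f (\<tau> n))"
  by (induct A arbitrary: \<sigma> \<tau> w e f) (simp_all add: v0_sub v_up)

lemma forces_ren: "forces (ren_fm r q A) w e f \<longleftrightarrow> forces A w (\<lambda>n. e (r n)) (\<lambda>n. f (q n))"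
  by (simp add: ren_fm_sub forces_sub)

lemma forces_lift0: "forces (lift0 A) w (case_nat x e) f \<longleftrightarrow> forces A w e f"
  by (simp add: forces_ren)

lemma forces_lift1: "forces (lift1 A) w e (case_nat y f) \<longleftrightarrow> forces A w e f"
  by (simp add: forces_ren)

lemma forces_sub0: "forces (sub0 t A) w e f \<longleftrightarrow> forces A w (case_nat (v0 e f t) e) f"
proof -
  have "(\<lambda>n. v0 e f (inst0 t n)) = case_nat (v0 e f t) e"
    by (rule ext) (simp add: inst0_def split: nat.split)
  then show ?thesis by (simp add: forces_sub)
qed

lemma forces_sub1: "forces (sub1 u A) w e f \<longleftrightarrow> forces A w e (case_nat (v1 e f u) f)"
proof -
  have "(\<lambda>n. v1 e f (inst1 u n)) = case_nat (v1 e f u) f"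
    by (rule ext) (simp add: inst1_def split: nat.split)
  then show ?thesis by (simp add: forces_sub)
qed

lemma forces_mono:
  "wf_fm L A \<Longrightarrow> env w e f \<Longrightarrow> forces A w e f \<Longrightarrow> le w w' \<Longrightarrow> forces A w' e f"
proof (induct A arbitrary: w e f w')
  case (Eq s t) then show ?case by (auto intro: eqv_mono v0_env)
next
  case (Ex0 A)
  then obtain x where x: "x \<in> D0 w" "forces A w (case_nat x e) f" by auto
  have "forces A w' (case_nat x e) f"
    by (rule Ex0(1)[OF _ env_case0[OF Ex0(3) x(1)] x(2) Ex0(5)]) (use Ex0(2) in simp)
  then show ?case using D0_mono[OF Ex0(5) x(1)] by auto
next
  case (Ex1 A)
  then obtain y where y: "y \<in> D1 w" "forces A w e (case_nat y f)" by auto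
  have "forces A w' e (case_nat y f)"
    by (rule Ex1(1)[OF _ env_case1[OF Ex1(3) y(1)] y(2) Ex1(5)]) (use Ex1(2) in simp)
  then show ?case using D1_mono[OF Ex1(5) y(1)] by auto
qed (auto intro: le_trans)

text \<open>The axioms are assumed to be forced in all environments, since a derivation moves on to
  larger worlds and to environments extended at bound variables.\<close>

lemma soundness:
  assumes "deriv S \<Gamma> A" and "L = lang S"
    and ax: "\<And>A w e f. A \<in> axms S \<Longrightarrow> wf_fm L A \<Longrightarrow> env w e f \<Longrightarrow> forces A w e f"
  shows "\<forall>B\<in>\<Gamma>. wf_fm L B \<Longrightarrow> env w e f \<Longrightarrow> \<forall>B\<in>\<Gamma>. forces B w e f \<Longrightarrow> forces A w e f"
  using assms(1)
proof (induct arbitrary: w e f rule: deriv.induct)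
  case (Axm A \<Gamma>) then show ?case using ax assms(2) by auto
next
  case (OrE \<Gamma> A B C)
  have "wf_fm L A" "wf_fm L B" using deriv_wf[OF OrE(1)] assms(2) by auto
  then show ?case using OrE(2)[OF OrE(7,8,9)] OrE(4)[of w e f] OrE(6)[of w e f] OrE(7,8,9) by auto
next
  case (ImpI A \<Gamma> B)
  show ?case
  proof (clarsimp)
    fix w' assume w': "le w w'" and A: "forces A w' e f"
    show "forces B w' e f"
      by (rule ImpI(3)[OF _ env_le[OF ImpI(5) w']])
        (use ImpI A w' assms(2) in \<open>auto intro: forces_mono\<close>)
  qed
next
  case (ImpE \<Gamma> A B)
  have "le w w" using ImpE(6) by (simp add: env_def)
  with ImpE(2,4)[OF ImpE(5-7)] show ?case by auto
next
  case (NegI A \<Gamma> B)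
  show ?case
  proof (clarsimp)
    fix w' assume w': "le w w'" and A: "forces A w' e f"
    have "forces B w' e f" "forces (\<^bold>\<not> B) w' e f"
      by (rule NegI(3)[OF _ env_le[OF NegI(7) w']] NegI(5)[OF _ env_le[OF NegI(7) w']];
          use NegI(1,6,7,8) A w' assms(2) in \<open>auto intro: forces_mono\<close>)+
    then show False using w' le_refl by auto
  qed
next
  case (NegE \<Gamma> A B)
  have "le w w" using NegE(7) by (simp add: env_def)
  with NegE(2,4)[OF NegE(6-8)] show ?case by auto
next
  case (All0I \<Gamma> A)
  show ?case
  proof (clarsimp)
    fix w' x assume w': "le w w'" and x: "x \<in> D0 w'"
    have e: "env w' (case_nat x e) f" using env_case0[OF env_le[OF All0I(4) w'] x] .
    show "forces A w' (case_nat x e) f"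
      by (rule All0I(2)[OF _ e]) (use All0I w' in \<open>auto simp: wf_ren_fm forces_lift0 intro: forces_mono\<close>)
  qed
next
  case (All0E \<Gamma> A t)
  have "le w w" "v0 e f t \<in> D0 w"
    using All0E(3,5) v0_env assms(2) by (auto simp: env_def)
  with All0E(2)[OF All0E(4-6)] show ?case by (auto simp: forces_sub0)
next
  case (Ex0I A t \<Gamma>)
  have "v0 e f t \<in> D0 w" using Ex0I(2,6) v0_env assms(2) by auto
  with Ex0I(4)[OF Ex0I(5-7)] show ?case by (auto simp: forces_sub0)
next
  case (Ex0E \<Gamma> A B)
  from Ex0E(2)[OF Ex0E(5-7)] obtain x where x: "x \<in> D0 w" "forces A w (case_nat x e) f" by auto
  have "wf_fm L A" using deriv_wf[OF Ex0E(1)] assms(2) by simp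
  then have "forces (lift0 B) w (case_nat x e) f"
    using x Ex0E(5-7) by (intro Ex0E(4)[OF _ env_case0[OF Ex0E(6) x(1)]]) (auto simp: wf_ren_fm forces_lift0)
  then show ?case by (simp add: forces_lift0)
next
  case (All1I \<Gamma> A)
  show ?case
  proof (clarsimp)
    fix w' y assume w': "le w w'" and y: "y \<in> D1 w'"
    have e: "env w' e (case_nat y f)" using env_case1[OF env_le[OF All1I(4) w'] y] .
    show "forces A w' e (case_nat y f)"
      by (rule All1I(2)[OF _ e]) (use All1I w' in \<open>auto simp: wf_ren_fm forces_lift1 intro: forces_mono\<close>)
  qed
next
  case (All1E \<Gamma> A u)
  have "le w w" "v1 e f u \<in> D1 w"
    using All1E(3,5) v1_env assms(2) by (auto simp: env_def)
  with All1E(2)[OF All1E(4-6)] show ?case by (auto simp: forces_sub1)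
next
  case (Ex1I A u \<Gamma>)
  have "v1 e f u \<in> D1 w" using Ex1I(2,6) v1_env assms(2) by auto
  with Ex1I(4)[OF Ex1I(5-7)] show ?case by (auto simp: forces_sub1)
next
  case (Ex1E \<Gamma> A B)
  from Ex1E(2)[OF Ex1E(5-7)] obtain y where y: "y \<in> D1 w" "forces A w e (case_nat y f)" by auto
  have "wf_fm L A" using deriv_wf[OF Ex1E(1)] assms(2) by simp
  then have "forces (lift1 B) w e (case_nat y f)"
    using y Ex1E(5-7) by (intro Ex1E(4)[OF _ env_case1[OF Ex1E(6) y(1)]]) (auto simp: wf_ren_fm forces_lift1)
  then show ?case by (simp add: forces_lift1)
qed auto

end


section \<open>The canonical model\<close>

lemma vf_True: "vf (\<lambda>_. True) (\<lambda>_. True) A"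
proof -
  obtain N where "vf (below N) (below N) A" using vf_bound by blast
  then show ?thesis by (rule vf_mono[rotated 2]) auto
qed

text \<open>The complement of the set of variables has to be infinite, since the variables outside serve as
  witnesses in larger worlds.\<close>

datatype world = World (wvars: "nat set") (wthy: "fm set")

locale logic =
  fixes S :: system
begin

definition Fm :: "nat set \<Rightarrow> fm set" where
  "Fm V = {A. wf_fm (lang S) A \<and> vf (\<lambda>n. n \<in> V) (\<lambda>n. n \<in> V) A}"

definition T0 :: "world \<Rightarrow> trm set" where
  "T0 w = {t. wf_trm (lang S) t \<and> vt (\<lambda>n. n \<in> wvars w) (\<lambda>n. n \<in> wvars w) t}"

definition T1 :: "world \<Rightarrow> fct set" where
  "T1 w = {u. wf_fct (lang S) u \<and> vu (\<lambda>n. n \<in> wvars w) (\<lambda>n. n \<in> wvars w) u}"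

definition eqw :: "world \<Rightarrow> trm \<Rightarrow> trm \<Rightarrow> bool" where
  "eqw w s t \<longleftrightarrow> (s \<doteq> t) \<in> wthy w"

text \<open>Without a constant for falsity, consistency is expressed by a missing formula: by
  \<open>NegE\<close> a contradictory theory would contain everything. The same set of indices
  limits the variables of both sorts.\<close>

definition world :: "world \<Rightarrow> bool" where
  "world w \<longleftrightarrow> infinite (- wvars w) \<and> wthy w \<subseteq> Fm (wvars w) \<and> (\<exists>C\<in>Fm (wvars w). C \<notin> wthy w) \<and>
     (\<forall>A\<in>Fm (wvars w). deriv S (wthy w) A \<longrightarrow> A \<in> wthy w) \<and>
     (\<forall>A B. (A \<^bold>\<or> B) \<in> wthy w \<longrightarrow> A \<in> wthy w \<or> B \<in> wthy w) \<and>
     (\<forall>A. Ex0 A \<in> wthy w \<longrightarrow> (\<exists>c\<in>wvars w. sub0 (NVar c) A \<in> wthy w)) \<and>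
     (\<forall>A. Ex1 A \<in> wthy w \<longrightarrow> (\<exists>c\<in>wvars w. sub1 (FVar c) A \<in> wthy w))"

definition le :: "world \<Rightarrow> world \<Rightarrow> bool" where
  "le w w' \<longleftrightarrow> world w \<and> world w' \<and> wvars w \<subseteq> wvars w' \<and> wthy w \<subseteq> wthy w'"

lemma T_sub:
  "wf_trm (lang S) t \<Longrightarrow> \<forall>n. \<sigma> n \<in> T0 w \<Longrightarrow> \<forall>n. \<tau> n \<in> T1 w \<Longrightarrow> sub_trm \<sigma> \<tau> t \<in> T0 w"
  "wf_fct (lang S) u \<Longrightarrow> \<forall>n. \<sigma> n \<in> T0 w \<Longrightarrow> \<forall>n. \<tau> n \<in> T1 w \<Longrightarrow> sub_fct \<sigma> \<tau> u \<in> T1 w"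
  unfolding T0_def T1_def by (auto intro: wf_sub[rule_format] vt_sub(1)[OF vt_True(1)] vt_sub(2)[OF vt_True(2)])

lemma Fm_sub:
  "wf_fm (lang S) A \<Longrightarrow> \<forall>n. \<sigma> n \<in> T0 w \<Longrightarrow> \<forall>n. \<tau> n \<in> T1 w \<Longrightarrow> sub_fm \<sigma> \<tau> A \<in> Fm (wvars w)"
  unfolding T0_def T1_def Fm_def by (auto intro: wf_sub_fm vf_sub[OF vf_True])

text \<open>A term model: the value of a term in an environment is its substitution instance, and
  the equations belonging to a world act as equality.\<close>

sublocale kmodel "lang S" sub_trm sub_fct le T0 T1 eqw
proof
  fix w w' :: world and x y
  assume "le w w'"
  then show "x \<in> T0 w \<Longrightarrow> x \<in> T0 w'" for x
    unfolding le_def T0_def by (auto elim!: vt_mono(1)[rotated 2])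
  show "x \<in> T1 w \<Longrightarrow> x \<in> T1 w'" for x
    using \<open>le w w'\<close> unfolding le_def T1_def by (auto elim!: vt_mono(2)[rotated 2])
qed (auto simp: sub_sub le_def eqw_def intro: T_sub)

section \<open>Extending theories to worlds\<close>

lemma world_closed: "world w \<Longrightarrow> deriv S (wthy w) A \<Longrightarrow> A \<in> Fm (wvars w) \<Longrightarrow> A \<in> wthy w"
  unfolding world_def by blast

lemma world_deriv: "world w \<Longrightarrow> A \<in> wthy w \<Longrightarrow> deriv S (wthy w) A"
  by (rule deriv.Ass) (auto simp: world_def Fm_def)

text \<open>\<open>D\<close> may be infinite, so finiteness cannot provide a fresh witness. Instead
  the variables of \<open>D\<close> outside \<open>V\<close> stay below some \<open>N\<close>,
  whereas \<open>X\<close> is infinite and disjoint from \<open>V\<close>. The bound is part of the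
  conclusion in order to survive iteration.\<close>

lemma extend_step:
  assumes X: "infinite X" "X \<subseteq> - V" and C: "C \<in> Fm V"
    and D: "D \<subseteq> Fm (V \<union> X)" "\<not> deriv S D C"
    and N: "\<forall>A\<in>D. vf (\<lambda>n. n \<in> V \<or> n < N) (\<lambda>n. n \<in> V \<or> n < N) A"
  shows "\<exists>D'. (D' \<subseteq> Fm (V \<union> X) \<and> \<not> deriv S D' C \<and>
       (\<exists>N. \<forall>A\<in>D'. vf (\<lambda>n. n \<in> V \<or> n < N) (\<lambda>n. n \<in> V \<or> n < N) A)) \<and> D \<subseteq> D' \<and>
     (A \<in> Fm (V \<union> X) \<longrightarrow> deriv S (insert A D) C \<or> A \<in> D' \<and>
       (\<forall>B. A = Ex0 B \<longrightarrow> (\<exists>c\<in>V \<union> X. sub0 (NVar c) B \<in> D')) \<and>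
       (\<forall>B. A = Ex1 B \<longrightarrow> (\<exists>c\<in>V \<union> X. sub1 (FVar c) B \<in> D')))"
proof (cases "A \<in> Fm (V \<union> X) \<and> \<not> deriv S (insert A D) C")
  case False
  then show ?thesis using D N by (intro exI[of _ D]) auto
next
  case True
  obtain M where M: "vf (below M) (below M) A" using vf_bound by blast
  obtain c where c: "c \<in> X" "max N M \<le> c" using X(1) unfolding finite_nat_set_iff_bounded by (meson not_less)
  have cV: "c \<notin> V" using X(2) c(1) by auto
  let ?c = "\<lambda>n. n \<in> V \<or> n < N"
  have fresh: "vf (avoid c) (avoid c) B" if B: "B \<in> insert C (insert A D)" for B
  proof -
    have "vf (\<lambda>n. n \<in> V \<or> n < c) (\<lambda>n. n \<in> V \<or> n < c) B"
    proof -
      consider "B = C" | "B = A" | "B \<in> D" using B by blast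
      then show ?thesis
      proof cases
        case 1 then show ?thesis using C by (auto simp: Fm_def elim!: vf_mono[rotated 2])
      next
        case 2
        show ?thesis unfolding 2 by (rule vf_mono[OF _ _ M]) (use c(2) in auto)
      next
        case 3
        with N have "vf ?c ?c B" by blast
        then show ?thesis by (rule vf_mono[rotated 2]) (use c(2) in auto)
      qed
    qed
    then show ?thesis by (rule vf_mono[rotated 2]) (use cV in auto)
  qed
  have avoid: "vf (avoid c) (\<lambda>_. True) B" "vf (\<lambda>_. True) (avoid c) B"
    if "B \<in> insert C (insert A D)" for B
    using fresh[OF that] by (auto elim!: vf_mono[rotated 2])
  have bounded: "\<exists>N. \<forall>B\<in>E \<union> D. vf (\<lambda>n. n \<in> V \<or> n < N) (\<lambda>n. n \<in> V \<or> n < N) B" if E: "finite E" for E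
  proof -
    obtain K where K: "\<forall>A\<in>E. vf (below K) (below K) A" using vf_bound_set[OF E] by blast
    have "vf (\<lambda>n. n \<in> V \<or> n < max K N) (\<lambda>n. n \<in> V \<or> n < max K N) B" if "B \<in> E \<union> D" for B
    proof (cases "B \<in> E")
      case True
      show ?thesis by (rule vf_mono[OF _ _ K[rule_format, OF True]]) auto
    next
      case False
      with that N have "vf ?c ?c B" by blast
      then show ?thesis by (rule vf_mono[rotated 2]) auto
    qed
    then show ?thesis by blast
  qed
  have ass: "deriv S (insert A D) A" using True by (intro deriv.Ass) (auto simp: Fm_def)
  consider B where "A = Ex0 B" | B where "A = Ex1 B" | "\<forall>B. A \<noteq> Ex0 B \<and> A \<noteq> Ex1 B" by blast
  then show ?thesis
  proof cases
    case 1
    let ?D = "{sub0 (NVar c) B, A} \<union> D"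
    have "\<not> deriv S ?D C"
      using True Ex0E_fresh[of S "insert A D" B c C] ass avoid(1) avoid(1)[of A] 1
      by (auto simp: insert_commute)
    moreover have "sub0 (NVar c) B \<in> Fm (V \<union> X)"
    proof -
      have "wf_fm (lang S) B" "vf (case_nat True (\<lambda>n. n \<in> V \<union> X)) (\<lambda>n. n \<in> V \<union> X) B"
        using True 1 by (auto simp: Fm_def)
      then show ?thesis using c(1)
        by (auto simp: Fm_def inst0_def intro!: wf_sub_fm vf_sub[of "case_nat True (\<lambda>n. n \<in> V \<union> X)" "\<lambda>n. n \<in> V \<union> X"]
            split: nat.splits)
    qed
    ultimately show ?thesis using bounded[of "{sub0 (NVar c) B, A}"] D(1) True 1 c(1)
      by (intro exI[of _ ?D]) auto
  next
    case 2
    let ?D = "{sub1 (FVar c) B, A} \<union> D"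
    have "\<not> deriv S ?D C"
      using True Ex1E_fresh[of S "insert A D" B c C] ass avoid(2) avoid(2)[of A] 2
      by (auto simp: insert_commute)
    moreover have "sub1 (FVar c) B \<in> Fm (V \<union> X)"
    proof -
      have "wf_fm (lang S) B" "vf (\<lambda>n. n \<in> V \<union> X) (case_nat True (\<lambda>n. n \<in> V \<union> X)) B"
        using True 2 by (auto simp: Fm_def)
      then show ?thesis using c(1)
        by (auto simp: Fm_def inst1_def intro!: wf_sub_fm vf_sub[of "\<lambda>n. n \<in> V \<union> X" "case_nat True (\<lambda>n. n \<in> V \<union> X)"]
            split: nat.splits)
    qed
    ultimately show ?thesis using bounded[of "{sub1 (FVar c) B, A}"] D(1) True 2 c(1)
      by (intro exI[of _ ?D]) auto
  next
    case 3
    then show ?thesis using bounded[of "{A}"] D True by (intro exI[of _ "{A} \<union> D"]) auto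
  qed
qed

lemma deriv_cut: "deriv S \<Gamma> A \<Longrightarrow> deriv S (insert A \<Gamma>) C \<Longrightarrow> deriv S \<Gamma> C"
  by (rule deriv.ImpE[OF deriv.ImpI[OF deriv_wf]])

lemma split_infinite:
  fixes Y :: "nat set"
  assumes "infinite Y"
  shows "\<exists>X. X \<subseteq> Y \<and> infinite X \<and> infinite (Y - X)"
proof -
  obtain f :: "nat \<Rightarrow> nat" where f: "inj f" "range f \<subseteq> Y" using infinite_countable_subset[OF assms] by blast
  let ?X = "range (\<lambda>n. f (2 * n))"
  have "inj (\<lambda>n. f (2 * n))" "inj (\<lambda>n. f (Suc (2 * n)))" by (rule injI, drule injD[OF f(1)], simp)+
  then have "infinite ?X" "infinite (range (\<lambda>n. f (Suc (2 * n))))" by (auto dest: finite_imageD)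
  moreover have "f (Suc (2 * n)) \<noteq> f (2 * m)" for m n
  proof
    assume "f (Suc (2 * n)) = f (2 * m)"
    from injD[OF f(1) this] show False by presburger
  qed
  then have "range (\<lambda>n. f (Suc (2 * n))) \<subseteq> Y - ?X" using f(2) by auto
  ultimately show ?thesis using f(2) by (intro exI[of _ ?X]) (auto dest: infinite_super)
qed

lemma world_extend:
  assumes V: "infinite (- V)" and D: "D \<subseteq> Fm V" and C: "C \<in> Fm V" and nd: "\<not> deriv S D C"
  shows "\<exists>w. world w \<and> V \<subseteq> wvars w \<and> D \<subseteq> wthy w \<and> C \<notin> wthy w"
proof -
  obtain X where X: "X \<subseteq> - V" "infinite X" "infinite (- V - X)" using split_infinite[OF V] by blast
  let ?V = "V \<union> X"
  have Fm_mono: "Fm V \<subseteq> Fm ?V" unfolding Fm_def by (auto elim!: vf_mono[rotated 2])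
  define fmn where "fmn n = (SOME A. gn_fm A = n)" for n
  \<comment> \<open>At numbers that are no codes \<open>fmn\<close> is an arbitrary formula; such a
    stage is harmless.\<close>
  have fmn: "fmn (gn_fm A) = A" for A
    unfolding fmn_def by (rule some1_equality) (auto dest: gn_fm_inj)
  let ?P = "\<lambda>D. D \<subseteq> Fm ?V \<and> \<not> deriv S D C \<and>
       (\<exists>N. \<forall>A\<in>D. vf (\<lambda>n. n \<in> V \<or> n < N) (\<lambda>n. n \<in> V \<or> n < N) A)"
  let ?Q = "\<lambda>A D D'. D \<subseteq> D' \<and> (A \<in> Fm ?V \<longrightarrow> deriv S (insert A D) C \<or> A \<in> D' \<and>
       (\<forall>B. A = Ex0 B \<longrightarrow> (\<exists>c\<in>?V. sub0 (NVar c) B \<in> D')) \<and>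
       (\<forall>B. A = Ex1 B \<longrightarrow> (\<exists>c\<in>?V. sub1 (FVar c) B \<in> D')))"
    \<comment> \<open>The conjunct about \<open>n = 0\<close> is what makes the sequence of
      dependent choice start with \<open>D\<close>.\<close>
    have "\<exists>f. \<forall>n. (?P (f n) \<and> (n = 0 \<longrightarrow> f n = D)) \<and> ?Q (fmn n) (f n) (f (Suc n))"
    proof (rule dependent_nat_choice)
      show "\<exists>x. ?P x \<and> ((0::nat) = 0 \<longrightarrow> x = D)"
        using D Fm_mono nd by (auto simp: Fm_def intro!: exI[of _ 0])
    next
      fix E and n :: nat
      assume "?P E \<and> (n = 0 \<longrightarrow> E = D)"
      then have P: "E \<subseteq> Fm ?V" "\<not> deriv S E C" and
        "\<exists>N. \<forall>A\<in>E. vf (\<lambda>n. n \<in> V \<or> n < N) (\<lambda>n. n \<in> V \<or> n < N) A" by auto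
      then obtain N where "\<forall>A\<in>E. vf (\<lambda>n. n \<in> V \<or> n < N) (\<lambda>n. n \<in> V \<or> n < N) A" by blast
      from extend_step[OF X(2,1) C P this, of "fmn n"]
      obtain D' where D': "?P D' \<and> ?Q (fmn n) E D'" by (elim exE) (rule that)
      show "\<exists>y. (?P y \<and> (Suc n = 0 \<longrightarrow> y = D)) \<and> ?Q (fmn n) E y"
        by (rule exI[of _ D'], rule conjI[OF conjI[OF conjunct1[OF D']] conjunct2[OF D']]) simp
    qed
    then obtain f where f: "\<forall>n. (?P (f n) \<and> (n = 0 \<longrightarrow> f n = D)) \<and> ?Q (fmn n) (f n) (f (Suc n))"
      by (elim exE) (rule that)
  have f0: "f 0 = D" by (rule mp[OF conjunct2[OF conjunct1[OF spec[OF f, of 0]]]]) simp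
  have fP: "?P (f n)" for n by (rule conjunct1[OF conjunct1[OF spec[OF f]]])
  have fQ: "?Q (fmn n) (f n) (f (Suc n))" for n by (rule conjunct2[OF spec[OF f]])
  have mono: "f m \<subseteq> f n" if "m \<le> n" for m n
    using that by (rule lift_Suc_mono_le[rotated]) (use fQ in blast)
  define w where "w = (\<Union>n. f n)"
  have f_w: "f n \<subseteq> w" for n unfolding w_def by blast
  have w_nd: "\<not> deriv S w C"
  proof
    assume d: "deriv S w C"
    obtain F where F: "finite F" "F \<subseteq> w" "deriv S F C" using deriv_compact[OF d] by (elim exE conjE) (rule that)
    have "\<exists>n. F \<subseteq> f n"
      using F(1,2)
    proof (induct F)
      case (insert A F)
      then obtain n m where "F \<subseteq> f n" "A \<in> f m" unfolding w_def by auto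
      then have "insert A F \<subseteq> f (max n m)" using mono[of n "max n m"] mono[of m "max n m"] by auto
      then show ?case by blast
    qed simp
    then obtain n where "F \<subseteq> f n" by blast
    from deriv_weaken[OF F(3) this] fP[of n] show False by blast
  qed
  have key: "A \<in> w \<and> (\<forall>B. A = Ex0 B \<longrightarrow> (\<exists>c\<in>?V. sub0 (NVar c) B \<in> w)) \<and>
       (\<forall>B. A = Ex1 B \<longrightarrow> (\<exists>c\<in>?V. sub1 (FVar c) B \<in> w))"
    if "A \<in> Fm ?V" "\<not> deriv S (insert A w) C" for A
  proof -
    have "\<not> deriv S (insert A (f (gn_fm A))) C"
      using that(2) deriv_weaken insert_mono[OF f_w] by metis
    then show ?thesis using fQ[of "gn_fm A"] that(1) f_w[of "Suc (gn_fm A)"] unfolding fmn by blast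
  qed
  have wF: "w \<subseteq> Fm ?V" unfolding w_def using fP by blast
  have wd: "deriv S w A" if "A \<in> w" for A
    using that wF by (intro deriv.Ass) (auto simp: Fm_def)
  have closed: "A \<in> w" if "A \<in> Fm ?V" "deriv S w A" for A
    using key[OF that(1)] deriv_cut[OF that(2)] w_nd by blast
  have in_w: "\<not> deriv S (insert A w) C" if "A \<in> w" for A using w_nd that by (simp add: insert_absorb)
  have "world (World ?V w)"
    unfolding world_def world.sel
  proof (intro conjI allI ballI impI)
    show "infinite (- ?V)" using X(3) by (simp add: Diff_eq)
    show "w \<subseteq> Fm ?V" by (rule wF)
    show "\<exists>C\<in>Fm ?V. C \<notin> w" using C Fm_mono w_nd wd by blast
    show "A \<in> w" if "A \<in> Fm ?V" "deriv S w A" for A using closed that by blast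
    show "A \<in> w \<or> B \<in> w" if AB: "(A \<^bold>\<or> B) \<in> w" for A B
    proof (rule ccontr)
      assume n: "\<not> (A \<in> w \<or> B \<in> w)"
      have "A \<in> Fm ?V" "B \<in> Fm ?V" using wF AB by (auto simp: Fm_def)
      \<comment> \<open>If both disjuncts were left out, each of them would derive \<open>C\<close>,
        and the disjunction in the limit would give \<open>C\<close> itself.\<close>
      then have "deriv S (insert A w) C" "deriv S (insert B w) C" using n key by blast+
      then show False using deriv.OrE[OF wd[OF AB]] w_nd by blast
    qed
    show "\<exists>c\<in>?V. sub0 (NVar c) A \<in> w" if "Ex0 A \<in> w" for A
      using key[OF _ in_w[OF that]] wF that by blast
    show "\<exists>c\<in>?V. sub1 (FVar c) A \<in> w" if "Ex1 A \<in> w" for A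
      using key[OF _ in_w[OF that]] wF that by blast
  qed
  moreover have "C \<notin> w" using w_nd wd by blast
  moreover have "D \<subseteq> w" using f_w[of 0] f0 by simp
  ultimately show ?thesis by (intro exI[of _ "World ?V w"]) auto
qed

section \<open>Worlds and the logical operations\<close>

lemma world_extend_le:
  assumes w: "world w" and D: "wthy w \<subseteq> D" "D \<subseteq> Fm V" "wvars w \<subseteq> V" "infinite (- V)"
    and C: "C \<in> Fm V" "\<not> deriv S D C"
  shows "\<exists>w'. le w w' \<and> V \<subseteq> wvars w' \<and> D \<subseteq> wthy w' \<and> C \<notin> wthy w'"
  using world_extend[OF D(4,2) C] w D(1,3) unfolding le_def by blast

lemma world_Neg:
  assumes "world w" "(\<^bold>\<not> A) \<in> Fm (wvars w)"
  shows "(\<^bold>\<not> A) \<in> wthy w \<longleftrightarrow> (\<forall>w'. le w w' \<longrightarrow> A \<notin> wthy w')"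
proof
  assume A: "(\<^bold>\<not> A) \<in> wthy w"
  show "\<forall>w'. le w w' \<longrightarrow> A \<notin> wthy w'"
  proof (intro allI impI notI)
    fix w' assume w': "le w w'" "A \<in> wthy w'"
    then have ww: "world w'" and n: "(\<^bold>\<not> A) \<in> wthy w'" using A by (auto simp: le_def)
    obtain C where C: "C \<in> Fm (wvars w')" "C \<notin> wthy w'" using ww unfolding world_def by blast
    have "deriv S (wthy w') C"
      using deriv.NegE[OF world_deriv[OF ww w'(2)] world_deriv[OF ww n]] C by (auto simp: Fm_def)
    with C world_closed[OF ww] show False by blast
  qed
next
  assume r: "\<forall>w'. le w w' \<longrightarrow> A \<notin> wthy w'"
  show "(\<^bold>\<not> A) \<in> wthy w"
  proof (rule ccontr)
    assume n: "(\<^bold>\<not> A) \<notin> wthy w"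
    have A: "A \<in> Fm (wvars w)" using assms(2) by (auto simp: Fm_def)
    \<comment> \<open>In the absence of falsity the negation itself is the formula to be omitted: if
      it followed from the theory with \<open>A\<close>, then \<open>A\<close> would lead to a
      contradiction and \<open>NegI\<close> would put the negation into \<open>w\<close>.\<close>
    have "\<not> deriv S (insert A (wthy w)) (\<^bold>\<not> A)"
    proof
      assume d: "deriv S (insert A (wthy w)) (\<^bold>\<not> A)"
      have wA: "wf_fm (lang S) A" using A by (simp add: Fm_def)
      have "deriv S (wthy w) (\<^bold>\<not> A)"
        by (rule deriv.NegI[OF wA _ d]) (use wA in \<open>auto intro: deriv.Ass\<close>)
      with n world_closed[OF assms(1)] assms(2) show False by blast
    qed
    then have "\<exists>w'. le w w' \<and> wvars w \<subseteq> wvars w' \<and> insert A (wthy w) \<subseteq> wthy w' \<and> (\<^bold>\<not> A) \<notin> wthy w'"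
      using assms A by (intro world_extend_le) (auto simp: world_def)
    then show False using r by blast
  qed
qed

lemma world_Imp:
  assumes "world w" "(A \<^bold>\<longrightarrow> B) \<in> Fm (wvars w)"
  shows "(A \<^bold>\<longrightarrow> B) \<in> wthy w \<longleftrightarrow> (\<forall>w'. le w w' \<longrightarrow> A \<in> wthy w' \<longrightarrow> B \<in> wthy w')"
proof
  assume A: "(A \<^bold>\<longrightarrow> B) \<in> wthy w"
  show "\<forall>w'. le w w' \<longrightarrow> A \<in> wthy w' \<longrightarrow> B \<in> wthy w'"
  proof (intro allI impI)
    fix w' assume w': "le w w'" "A \<in> wthy w'"
    then have ww: "world w'" and n: "(A \<^bold>\<longrightarrow> B) \<in> wthy w'" using A by (auto simp: le_def)
    have "deriv S (wthy w') B" by (rule deriv.ImpE[OF world_deriv[OF ww n] world_deriv[OF ww w'(2)]])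
    moreover have "B \<in> Fm (wvars w')" using n ww by (auto simp: world_def Fm_def)
    ultimately show "B \<in> wthy w'" using world_closed[OF ww] by blast
  qed
next
  assume r: "\<forall>w'. le w w' \<longrightarrow> A \<in> wthy w' \<longrightarrow> B \<in> wthy w'"
  show "(A \<^bold>\<longrightarrow> B) \<in> wthy w"
  proof (rule ccontr)
    assume n: "(A \<^bold>\<longrightarrow> B) \<notin> wthy w"
    have A: "A \<in> Fm (wvars w)" "B \<in> Fm (wvars w)" using assms(2) by (auto simp: Fm_def)
    have "\<not> deriv S (insert A (wthy w)) B"
      using n world_closed[OF assms(1) deriv.ImpI assms(2)] A by (auto simp: Fm_def)
    then have "\<exists>w'. le w w' \<and> wvars w \<subseteq> wvars w' \<and> insert A (wthy w) \<subseteq> wthy w' \<and> B \<notin> wthy w'"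
      using assms A by (intro world_extend_le) (auto simp: world_def)
    then show False using r by blast
  qed
qed

lemma world_fresh: "world w \<Longrightarrow> \<exists>c. c \<notin> wvars w \<and> infinite (- insert c (wvars w))"
proof -
  assume "world w"
  then have i: "infinite (- wvars w)" by (simp add: world_def)
  then obtain c where "c \<in> - wvars w" by (metis finite.emptyI ex_in_conv)
  moreover have "infinite (- wvars w - {c})" using i by simp
  moreover have "- wvars w - {c} = - insert c (wvars w)" by auto
  ultimately show ?thesis by auto
qed

lemma Fm_insert: "A \<in> Fm V \<Longrightarrow> A \<in> Fm (insert c V)"
  unfolding Fm_def by (auto elim!: vf_mono[rotated 2])

lemma Fm_avoid: "A \<in> Fm V \<Longrightarrow> c \<notin> V \<Longrightarrow> vf (avoid c) (\<lambda>_. True) A \<and> vf (\<lambda>_. True) (avoid c) A"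
  unfolding Fm_def by (auto elim!: vf_mono[rotated 2])

lemma sub0_Fm: "All0 A \<in> Fm (wvars w) \<Longrightarrow> t \<in> T0 w \<Longrightarrow> sub0 t A \<in> Fm (wvars w)"
  by (auto simp: Fm_def T0_def inst0_def intro!: wf_sub_fm
      vf_sub[of "case_nat True (\<lambda>n. n \<in> wvars w)" "\<lambda>n. n \<in> wvars w"] split: nat.splits)

lemma sub1_Fm: "All1 A \<in> Fm (wvars w) \<Longrightarrow> u \<in> T1 w \<Longrightarrow> sub1 u A \<in> Fm (wvars w)"
  by (auto simp: Fm_def T1_def inst1_def intro!: wf_sub_fm
      vf_sub[of "\<lambda>n. n \<in> wvars w" "case_nat True (\<lambda>n. n \<in> wvars w)"] split: nat.splits)

lemma world_All0:
  assumes "world w" "All0 A \<in> Fm (wvars w)"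
  shows "All0 A \<in> wthy w \<longleftrightarrow> (\<forall>w'. le w w' \<longrightarrow> (\<forall>t\<in>T0 w'. sub0 t A \<in> wthy w'))"
proof
  assume A: "All0 A \<in> wthy w"
  show "\<forall>w'. le w w' \<longrightarrow> (\<forall>t\<in>T0 w'. sub0 t A \<in> wthy w')"
  proof (intro allI impI ballI)
    fix w' t assume w': "le w w'" "t \<in> T0 w'"
    then have ww: "world w'" and n: "All0 A \<in> wthy w'" using A by (auto simp: le_def)
    have "deriv S (wthy w') (sub0 t A)"
      by (rule deriv.All0E[OF world_deriv[OF ww n]]) (use w'(2) in \<open>simp add: T0_def\<close>)
    moreover have "All0 A \<in> Fm (wvars w')" using n ww by (auto simp: world_def)
    ultimately show "sub0 t A \<in> wthy w'" using world_closed[OF ww] sub0_Fm w'(2) by blast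
  qed
next
  assume r: "\<forall>w'. le w w' \<longrightarrow> (\<forall>t\<in>T0 w'. sub0 t A \<in> wthy w')"
  show "All0 A \<in> wthy w"
  proof (rule ccontr)
    assume n: "All0 A \<notin> wthy w"
    obtain c where c: "c \<notin> wvars w" "infinite (- insert c (wvars w))" using world_fresh[OF assms(1)] by blast
    have wF: "wthy w \<subseteq> Fm (wvars w)" using assms(1) by (simp add: world_def)
    \<comment> \<open>A variable outside the world is a generic counterexample: by the eigenvariable
      rule the instance is no more derivable than the quantified formula. The extended world has to
      own this variable.\<close>
    have "\<not> deriv S (wthy w) (sub0 (NVar c) A)"
      using All0I_fresh[of S "wthy w" c A] n world_closed[OF assms(1) _ assms(2)] Fm_avoid[OF _ c(1)] wF
        Fm_avoid[OF assms(2) c(1)] by auto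
    moreover have "sub0 (NVar c) A \<in> Fm (insert c (wvars w))"
      using sub0_Fm[of A "World (insert c (wvars w)) {}" "NVar c"] Fm_insert[OF assms(2)] by (simp add: T0_def)
    ultimately have "\<exists>w'. le w w' \<and> insert c (wvars w) \<subseteq> wvars w' \<and> wthy w \<subseteq> wthy w' \<and> sub0 (NVar c) A \<notin> wthy w'"
      using assms(1) wF Fm_insert c(2) by (intro world_extend_le) auto
    then show False using r by (auto simp: T0_def)
  qed
qed

lemma world_All1:
  assumes "world w" "All1 A \<in> Fm (wvars w)"
  shows "All1 A \<in> wthy w \<longleftrightarrow> (\<forall>w'. le w w' \<longrightarrow> (\<forall>u\<in>T1 w'. sub1 u A \<in> wthy w'))"
proof
  assume A: "All1 A \<in> wthy w"
  show "\<forall>w'. le w w' \<longrightarrow> (\<forall>u\<in>T1 w'. sub1 u A \<in> wthy w')"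
  proof (intro allI impI ballI)
    fix w' u assume w': "le w w'" "u \<in> T1 w'"
    then have ww: "world w'" and n: "All1 A \<in> wthy w'" using A by (auto simp: le_def)
    have "deriv S (wthy w') (sub1 u A)"
      by (rule deriv.All1E[OF world_deriv[OF ww n]]) (use w'(2) in \<open>simp add: T1_def\<close>)
    moreover have "All1 A \<in> Fm (wvars w')" using n ww by (auto simp: world_def)
    ultimately show "sub1 u A \<in> wthy w'" using world_closed[OF ww] sub1_Fm w'(2) by blast
  qed
next
  assume r: "\<forall>w'. le w w' \<longrightarrow> (\<forall>u\<in>T1 w'. sub1 u A \<in> wthy w')"
  show "All1 A \<in> wthy w"
  proof (rule ccontr)
    assume n: "All1 A \<notin> wthy w"
    obtain c where c: "c \<notin> wvars w" "infinite (- insert c (wvars w))" using world_fresh[OF assms(1)] by blast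
    have wF: "wthy w \<subseteq> Fm (wvars w)" using assms(1) by (simp add: world_def)
    have "\<not> deriv S (wthy w) (sub1 (FVar c) A)"
      using All1I_fresh[of S "wthy w" c A] n world_closed[OF assms(1) _ assms(2)] Fm_avoid[OF _ c(1)] wF
        Fm_avoid[OF assms(2) c(1)] by auto
    moreover have "sub1 (FVar c) A \<in> Fm (insert c (wvars w))"
      using sub1_Fm[of A "World (insert c (wvars w)) {}" "FVar c"] Fm_insert[OF assms(2)] by (simp add: T1_def)
    ultimately have "\<exists>w'. le w w' \<and> insert c (wvars w) \<subseteq> wvars w' \<and> wthy w \<subseteq> wthy w' \<and> sub1 (FVar c) A \<notin> wthy w'"
      using assms(1) wF Fm_insert c(2) by (intro world_extend_le) auto
    then show False using r by (auto simp: T1_def)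
  qed
qed

lemma world_Ex0:
  assumes "world w" "Ex0 A \<in> Fm (wvars w)"
  shows "Ex0 A \<in> wthy w \<longleftrightarrow> (\<exists>t\<in>T0 w. sub0 t A \<in> wthy w)"
proof
  assume "Ex0 A \<in> wthy w"
  then obtain c where "c \<in> wvars w" "sub0 (NVar c) A \<in> wthy w" using assms(1) unfolding world_def by blast
  then show "\<exists>t\<in>T0 w. sub0 t A \<in> wthy w" by (intro bexI[of _ "NVar c"]) (auto simp: T0_def)
next
  assume "\<exists>t\<in>T0 w. sub0 t A \<in> wthy w"
  then obtain t where "t \<in> T0 w" "sub0 t A \<in> wthy w" by blast
  then have "deriv S (wthy w) (Ex0 A)"
    using world_deriv[OF assms(1)] assms(2) by (intro deriv.Ex0I[of _ A t]) (auto simp: T0_def Fm_def)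
  then show "Ex0 A \<in> wthy w" using world_closed[OF assms(1) _ assms(2)] by blast
qed

lemma world_Ex1:
  assumes "world w" "Ex1 A \<in> Fm (wvars w)"
  shows "Ex1 A \<in> wthy w \<longleftrightarrow> (\<exists>u\<in>T1 w. sub1 u A \<in> wthy w)"
proof
  assume "Ex1 A \<in> wthy w"
  then obtain c where "c \<in> wvars w" "sub1 (FVar c) A \<in> wthy w" using assms(1) unfolding world_def by blast
  then show "\<exists>u\<in>T1 w. sub1 u A \<in> wthy w" by (intro bexI[of _ "FVar c"]) (auto simp: T1_def)
next
  assume "\<exists>u\<in>T1 w. sub1 u A \<in> wthy w"
  then obtain u where "u \<in> T1 w" "sub1 u A \<in> wthy w" by blast
  then have "deriv S (wthy w) (Ex1 A)"
    using world_deriv[OF assms(1)] assms(2) by (intro deriv.Ex1I[of _ A u]) (auto simp: T1_def Fm_def)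
  then show "Ex1 A \<in> wthy w" using world_closed[OF assms(1) _ assms(2)] by blast
qed

lemma world_And:
  assumes "world w" "(A \<^bold>\<and> B) \<in> Fm (wvars w)"
  shows "(A \<^bold>\<and> B) \<in> wthy w \<longleftrightarrow> A \<in> wthy w \<and> B \<in> wthy w"
proof -
  have "A \<in> Fm (wvars w)" "B \<in> Fm (wvars w)" using assms(2) by (auto simp: Fm_def)
  then show ?thesis
    using world_deriv[OF assms(1)] world_closed[OF assms(1)] assms(2)
    by (blast intro: deriv.AndI dest: deriv.AndE1 deriv.AndE2)
qed

lemma world_Or:
  assumes "world w" "(A \<^bold>\<or> B) \<in> Fm (wvars w)"
  shows "(A \<^bold>\<or> B) \<in> wthy w \<longleftrightarrow> A \<in> wthy w \<or> B \<in> wthy w"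
proof
  assume "A \<in> wthy w \<or> B \<in> wthy w"
  moreover have "wf_fm (lang S) A" "wf_fm (lang S) B" using assms(2) by (auto simp: Fm_def)
  ultimately have "deriv S (wthy w) (A \<^bold>\<or> B)"
    using world_deriv[OF assms(1)] by (auto intro: deriv.OrI1 deriv.OrI2)
  then show "(A \<^bold>\<or> B) \<in> wthy w" by (rule world_closed[OF assms(1) _ assms(2)])
qed (use assms(1) in \<open>auto simp: world_def\<close>)

section \<open>Truth and completeness\<close>

lemma env_world: "env w \<sigma> \<tau> \<Longrightarrow> world w"
  by (simp only: env_def) (simp add: le_def)

lemma env_T: "env w \<sigma> \<tau> \<Longrightarrow> \<forall>n. \<sigma> n \<in> T0 w" "env w \<sigma> \<tau> \<Longrightarrow> \<forall>n. \<tau> n \<in> T1 w"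
  unfolding env_def by blast+

lemma envI: "world w \<Longrightarrow> \<forall>n. \<sigma> n \<in> T0 w \<Longrightarrow> \<forall>n. \<tau> n \<in> T1 w \<Longrightarrow> env w \<sigma> \<tau>"
  by (simp only: env_def) (simp add: le_def)

text \<open>The truth lemma. Implication, negation and universal quantifiers look at larger worlds,
  so the induction is over all worlds and environments at once.\<close>

lemma truth: "wf_fm (lang S) A \<Longrightarrow> env w \<sigma> \<tau> \<Longrightarrow> forces A w \<sigma> \<tau> \<longleftrightarrow> sub_fm \<sigma> \<tau> A \<in> wthy w"
proof (induct A arbitrary: w \<sigma> \<tau>)
  case (Eq s t) show ?case by (rule trans[OF forces.simps(1)]) (simp add: eqw_def)
next
  case (Neg A)
  have w: "world w" and F: "sub_fm \<sigma> \<tau> (\<^bold>\<not> A) \<in> Fm (wvars w)"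
    using env_world[OF Neg(3)] Fm_sub[OF Neg(2) env_T[OF Neg(3)]] .
  show ?case using Neg(1)[OF _ env_le[OF Neg(3)]] Neg(2) world_Neg[OF w] F by simp
next
  case (And A B)
  have w: "world w" and F: "sub_fm \<sigma> \<tau> (A \<^bold>\<and> B) \<in> Fm (wvars w)"
    using env_world[OF And(4)] Fm_sub[OF And(3) env_T[OF And(4)]] .
  show ?case using And(1,2)[OF _ And(4)] And(3) world_And[OF w] F by simp
next
  case (Or A B)
  have w: "world w" and F: "sub_fm \<sigma> \<tau> (A \<^bold>\<or> B) \<in> Fm (wvars w)"
    using env_world[OF Or(4)] Fm_sub[OF Or(3) env_T[OF Or(4)]] .
  show ?case using Or(1,2)[OF _ Or(4)] Or(3) world_Or[OF w] F by simp
next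
  case (Imp A B)
  have w: "world w" and F: "sub_fm \<sigma> \<tau> (A \<^bold>\<longrightarrow> B) \<in> Fm (wvars w)"
    using env_world[OF Imp(4)] Fm_sub[OF Imp(3) env_T[OF Imp(4)]] .
  show ?case using Imp(1,2)[OF _ env_le[OF Imp(4)]] Imp(3) world_Imp[OF w] F by simp
next
  case (All0 A)
  have w: "world w" and F: "sub_fm \<sigma> \<tau> (All0 A) \<in> Fm (wvars w)"
    using env_world[OF All0(3)] Fm_sub[OF All0(2) env_T[OF All0(3)]] .
  show ?case using All0(1)[OF _ env_case0[OF env_le[OF All0(3)]]] All0(2) world_All0[OF w] F
    by (simp add: sub0_up0)
next
  case (Ex0 A)
  have w: "world w" and F: "sub_fm \<sigma> \<tau> (Ex0 A) \<in> Fm (wvars w)"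
    using env_world[OF Ex0(3)] Fm_sub[OF Ex0(2) env_T[OF Ex0(3)]] .
  show ?case using Ex0(1)[OF _ env_case0[OF Ex0(3)]] Ex0(2) world_Ex0[OF w] F by (simp add: sub0_up0)
next
  case (All1 A)
  have w: "world w" and F: "sub_fm \<sigma> \<tau> (All1 A) \<in> Fm (wvars w)"
    using env_world[OF All1(3)] Fm_sub[OF All1(2) env_T[OF All1(3)]] .
  show ?case using All1(1)[OF _ env_case1[OF env_le[OF All1(3)]]] All1(2) world_All1[OF w] F
    by (simp add: sub1_up1)
next
  case (Ex1 A)
  have w: "world w" and F: "sub_fm \<sigma> \<tau> (Ex1 A) \<in> Fm (wvars w)"
    using env_world[OF Ex1(3)] Fm_sub[OF Ex1(2) env_T[OF Ex1(3)]] .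
  show ?case using Ex1(1)[OF _ env_case1[OF Ex1(3)]] Ex1(2) world_Ex1[OF w] F by (simp add: sub1_up1)
qed

lemma forces_theorem:
  assumes "deriv S {} A" and "env w \<sigma> \<tau>"
  shows "forces A w \<sigma> \<tau>"
proof -
  have w: "world w" and s: "\<forall>n. \<sigma> n \<in> T0 w" "\<forall>n. \<tau> n \<in> T1 w"
    using env_world[OF assms(2)] env_T[OF assms(2)] .
  then have "deriv S {} (sub_fm \<sigma> \<tau> A)"
    by (intro theorem_sub[OF assms(1)]) (auto simp: T0_def T1_def)
  then have "sub_fm \<sigma> \<tau> A \<in> wthy w"
    using world_closed[OF w] Fm_sub[OF deriv_wf[OF assms(1)] s] deriv_weaken by blast
  then show ?thesis using truth[OF deriv_wf[OF assms(1)] assms(2)] by simp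
qed

theorem completeness:
  assumes A: "wf_fm (lang S) A" and G: "\<forall>B\<in>\<Gamma>. wf_fm (lang S) B" "finite \<Gamma>"
    and valid: "\<And>w \<sigma> \<tau>. env w \<sigma> \<tau> \<Longrightarrow> \<forall>B\<in>\<Gamma>. forces B w \<sigma> \<tau> \<Longrightarrow> forces A w \<sigma> \<tau>"
  shows "deriv S \<Gamma> A"
proof (rule ccontr)
  assume n: "\<not> deriv S \<Gamma> A"
  obtain N where N: "\<forall>B\<in>insert A \<Gamma>. vf (below N) (below N) B" using vf_bound_set[of "insert A \<Gamma>"] G(2) by blast
  let ?V = "{..N}"
  have F: "insert A \<Gamma> \<subseteq> Fm ?V"
    using N A G(1) unfolding Fm_def by (auto elim!: vf_mono[rotated 2])
  have "infinite (- ?V)" by (subst finite_compl) simp_all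
  then obtain w where w: "world w" "?V \<subseteq> wvars w" "\<Gamma> \<subseteq> wthy w" "A \<notin> wthy w"
    using world_extend[of ?V \<Gamma> A] F n by blast
  \<comment> \<open>The environment has to take values in the world, which is only known to contain
    the variables up to \<open>N\<close>; the others are sent to \<open>N\<close>. The formulas
    concerned use variables below \<open>N\<close> and remain unchanged. Finiteness of the
    assumptions is what leaves infinitely many variables outside.\<close>
  let ?\<sigma> = "\<lambda>n. NVar (min n N)" and ?\<tau> = "\<lambda>n. FVar (min n N)"
  have e: "env w ?\<sigma> ?\<tau>" using w(1,2) by (intro envI) (auto simp: T0_def T1_def min_def)
  have id: "sub_fm ?\<sigma> ?\<tau> B = B" if "B \<in> insert A \<Gamma>" for B
    by (rule trans[OF sub_fm_cong[OF N[rule_format, OF that]] sub_fm_id]) auto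
  have "forces A w ?\<sigma> ?\<tau>"
    by (rule valid[OF e]) (use truth[OF _ e] G(1) w(3) id in auto)
  then show False using truth[OF A e] id w(4) by simp
qed

end

section \<open>Worlds of extensions of \<open>IA\<^sub>1\<close>\<close>

text \<open>Default values for the variables that do not occur. Being closed terms of
  \<open>M\<close>, they belong to every world of an extension of \<open>IA1\<close>, whatever its
  variables are.\<close>

definition nil0 :: "nat \<Rightarrow> trm" where "nil0 = (\<lambda>_. \<^bold>0)"
definition nil1 :: "nat \<Rightarrow> fct" where "nil1 = (\<lambda>_. Lam \<^bold>0)"

text \<open>Only the instance of the schema at hand is assumed, so that the rule serves the
  induction for formulas of \<open>M\<close> as well as that for the larger language.\<close>

lemma (in logic) induct_gen:
  assumes ax: "forces (sub0 \<^bold>0 A \<^bold>\<and> All0 (A \<^bold>\<longrightarrow> sub_fm (step0 (succ (NVar 0))) FVar A) \<^bold>\<longrightarrow> All0 A) w \<sigma> \<tau>"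
    and e: "env w \<sigma> \<tau>" and z: "forces A w (case_nat \<^bold>0 \<sigma>) \<tau>"
    and s: "\<And>w' t. le w w' \<Longrightarrow> t \<in> T0 w' \<Longrightarrow> forces A w' (case_nat t \<sigma>) \<tau> \<Longrightarrow>
      forces A w' (case_nat (succ t) \<sigma>) \<tau>"
    and t: "t \<in> T0 w"
  shows "forces A w (case_nat t \<sigma>) \<tau>"
proof -
  let ?B = "sub_fm (step0 (succ (NVar 0))) FVar A"
  have w: "le w w" using e by (simp only: env_def)
  have eq: "(\<lambda>n. sub_trm (case_nat x \<sigma>) \<tau> (step0 (succ (NVar 0)) n)) = case_nat (succ x) \<sigma>" for x
    by (rule HOL.ext) (simp add: step0_def split: nat.split)
  have "forces (All0 (A \<^bold>\<longrightarrow> ?B)) w \<sigma> \<tau>"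
    unfolding forces.simps forces_sub eq sub_fct.simps
  proof (intro allI ballI impI)
    fix w' x w'' assume a: "le w w'" "x \<in> T0 w'" "le w' w''" "forces A w'' (case_nat x \<sigma>) \<tau>"
    show "forces A w'' (case_nat (succ x) \<sigma>) \<tau>" by (rule s[OF le_trans[OF a(1,3)] D0_mono[OF a(3,2)] a(4)])
  qed
  moreover have "forces (sub0 \<^bold>0 A) w \<sigma> \<tau>" using z by (simp add: forces_sub0)
  ultimately have "forces (All0 A) w \<sigma> \<tau>"
    using ax w unfolding forces.simps(3,5) by blast
  then show ?thesis using w t unfolding forces.simps(6) by blast
qed

locale ext_IA = logic +
  assumes ext: "extension S IA1"
begin

lemma lang_M_sub: "lang_M \<subseteq> lang S"
  using ext by (simp add: extension_def IA1_def)

lemma wf_M: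
  "wf_trm lang_M t \<Longrightarrow> wf_trm (lang S) t" "wf_fct lang_M u \<Longrightarrow> wf_fct (lang S) u"
  using lang_M_sub by (induct t and u rule: trm.induct fct.induct) auto

lemma wf_fm_M: "wf_fm lang_M A \<Longrightarrow> wf_fm (lang S) A"
  by (induct A) (auto intro: wf_M)

lemma ax_IA:
  assumes "A \<in> axms IA1" and "env w \<sigma> \<tau>"
  shows "forces A w \<sigma> \<tau>"
proof (rule forces_theorem[OF _ assms(2)])
  have "wf_fm (lang IA1) A" using axms_M_wf assms(1) by (auto simp: formulas_def sys_M_def IA1_def)
  then have "A \<in> theorems IA1" using assms(1) by (auto simp: theorems_def intro: deriv.Axm)
  then show "deriv S {} A" using ext by (auto simp: extension_def theorems_def)
qed

lemma T0_zero [simp, intro]: "\<^bold>0 \<in> T0 w"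
  using lang_M_sub by (auto simp: T0_def lang_M_def)

lemma T1_succ [simp, intro]: "FC (Fn SuccD) \<in> T1 w"
  using lang_M_sub by (auto simp: T1_def lang_M_def)

lemma T1_Kl [simp, intro]: "arity_klc k = (1, 0) \<Longrightarrow> FC (Kl k) \<in> T1 w"
  using lang_M_sub by (auto simp: T1_def lang_M_def)

lemma T0_App [simp, intro]: "u \<in> T1 w \<Longrightarrow> t \<in> T0 w \<Longrightarrow> App u t \<in> T0 w"
  by (auto simp: T0_def T1_def)

lemma T0_k2 [simp, intro]: "arity_klc k = (2, 0) \<Longrightarrow> s \<in> T0 w \<Longrightarrow> t \<in> T0 w \<Longrightarrow> k2 k s t \<in> T0 w"
  using lang_M_sub by (auto simp: T0_def lang_M_def)

lemma T0_kf [simp, intro]: "arity_klc k = (1, 1) \<Longrightarrow> t \<in> T0 w \<Longrightarrow> u \<in> T1 w \<Longrightarrow> kf k t u \<in> T0 w"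
  using lang_M_sub by (auto simp: T0_def T1_def lang_M_def)

lemma T1_nil [simp, intro]: "Lam \<^bold>0 \<in> T1 w"
  using lang_M_sub by (auto simp: T1_def lang_M_def)

lemma env_nil: "world w \<Longrightarrow> env w nil0 nil1"
  by (rule envI) (auto simp: nil0_def nil1_def)

lemma le_world: "le w w' \<Longrightarrow> world w" "le w w' \<Longrightarrow> world w'" "world w \<Longrightarrow> le w w"
  by (auto simp: le_def)

lemma le_T0: "le w w' \<Longrightarrow> t \<in> T0 w \<Longrightarrow> t \<in> T0 w'" by (rule D0_mono)
lemma le_T1: "le w w' \<Longrightarrow> u \<in> T1 w \<Longrightarrow> u \<in> T1 w'" by (rule D1_mono)

lemma le_eqw: "le w w' \<Longrightarrow> eqw w s t \<Longrightarrow> eqw w' s t"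
  by (auto simp: le_def eqw_def)

lemma eqw_T0: "world w \<Longrightarrow> eqw w s t \<Longrightarrow> s \<in> T0 w \<and> t \<in> T0 w"
  by (auto simp: world_def eqw_def Fm_def T0_def)

lemmas env_cases = env_case0 env_case1 env_nil

lemma equality_forces: "A \<in> equality_axioms \<Longrightarrow> env w \<sigma> \<tau> \<Longrightarrow> forces A w \<sigma> \<tau>"
  by (rule ax_IA) (simp_all add: IA1_def)

lemma eqw_refl: "world w \<Longrightarrow> t \<in> T0 w \<Longrightarrow> eqw w t t"
  using equality_forces[of "NVar 0 \<doteq> NVar 0" w "case_nat t nil0" nil1]
  by (simp add: equality_axioms_def env_cases)

lemma eqw_trans':
  assumes w: "world w" and e: "eqw w r s" "eqw w r t"
  shows "eqw w s t"
  using equality_forces[of "NVar 0 \<doteq> NVar 1 \<^bold>\<longrightarrow> (NVar 0 \<doteq> NVar 2 \<^bold>\<longrightarrow> NVar 1 \<doteq> NVar 2)" w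
      "case_nat r (case_nat s (case_nat t nil0))" nil1] e eqw_T0[OF w e(1)] eqw_T0[OF w e(2)] le_world(3)[OF w]
  by (auto simp: equality_axioms_def env_cases w numeral_2_eq_2)

lemma eqw_sym: "world w \<Longrightarrow> eqw w s t \<Longrightarrow> eqw w t s"
  using eqw_trans' eqw_refl eqw_T0 by blast

lemma eqw_trans: "world w \<Longrightarrow> eqw w r s \<Longrightarrow> eqw w s t \<Longrightarrow> eqw w r t"
  using eqw_trans' eqw_sym by blast

lemma eqw_cong: "world w \<Longrightarrow> eqw w s s' \<Longrightarrow> eqw w t t' \<Longrightarrow> eqw w s t \<longleftrightarrow> eqw w s' t'"
  using eqw_trans eqw_sym by meson

lemma eqw_App:
  assumes w: "world w" and u: "u \<in> T1 w" and e: "eqw w s t"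
  shows "eqw w (App u s) (App u t)"
proof -
  have "forces function_ext w (case_nat s (case_nat t nil0)) (case_nat u nil1)"
    using w u eqw_T0[OF w e] by (intro ax_IA) (auto simp: IA1_def env_cases)
  then show ?thesis using e le_world(3)[OF w] by (auto simp: function_ext_def)
qed

text \<open>The axiom is taken with a variable as argument and the body shifted past this variable;
  the environment then assigns \<open>s\<close> to it.\<close>

lemma beta:
  assumes e: "env w \<sigma> \<tau>" and t: "wf_trm lang_M t" and s: "s \<in> T0 w"
  shows "eqw w (App (Lam (sub_trm (up0_trm \<sigma>) (up0_fct \<tau>) t)) s) (sub_trm (case_nat s \<sigma>) \<tau> t)"
proof -
  have "forces (App (Lam (ren_trm (up_ren Suc) id t)) (NVar 0) \<doteq> t) w (case_nat s \<sigma>) \<tau>"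
  proof (rule ax_IA[OF _ env_case0[OF e s]])
    have "sub_trm (inst0 (NVar 0)) FVar (ren_trm (up_ren Suc) id t) = sub_trm NVar FVar t"
      unfolding sub_ren by (rule arg_cong2[of _ _ _ _ "\<lambda>a b. sub_trm a b t"])
        (auto simp: inst0_def up_ren_def split: nat.split)
    moreover have "wf_trm lang_M (ren_trm (up_ren Suc) id t)" "wf_trm lang_M (NVar 0)"
      using t by (simp_all add: wf_ren)
    ultimately show "(App (Lam (ren_trm (up_ren Suc) id t)) (NVar 0) \<doteq> t) \<in> axms IA1"
      unfolding IA1_def lambda_conversion_def sub_id system.sel by (intro UnI1 UnI2) force
  qed
  moreover have "(\<lambda>n. up0_trm (case_nat s \<sigma>) (up_ren Suc n)) = up0_trm \<sigma>"
    by (rule HOL.ext) (simp add: up0_trm_def up_ren_def split: nat.split)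
  ultimately show ?thesis by (simp add: sub_ren)
qed

lemma T1_Lam: "env w \<sigma> \<tau> \<Longrightarrow> wf_trm lang_M t \<Longrightarrow> Lam (sub_trm (up0_trm \<sigma>) (up0_fct \<tau>) t) \<in> T1 w"
  using v1_env[of w \<sigma> \<tau> "Lam t"] wf_M by simp

lemma sub_T1: "env w \<sigma> \<tau> \<Longrightarrow> wf_fct lang_M u \<Longrightarrow> sub_fct \<sigma> \<tau> u \<in> T1 w"
  using v1_env wf_M by blast

text \<open>The axioms give congruence just for the successor and for applied functions. Applying
  the latter to the function \<open>\<lambda>x. t\<close> between two conversions yields congruence
  for every term of \<open>M\<close>, in particular for all binary constants.\<close>

lemma eqw_sub0:
  assumes e: "env w \<sigma> \<tau>" and t: "wf_trm lang_M t" and s: "eqw w s s'"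
  shows "eqw w (sub_trm (case_nat s \<sigma>) \<tau> t) (sub_trm (case_nat s' \<sigma>) \<tau> t)"
proof -
  note w = env_world[OF e]
  have "eqw w (App (Lam (sub_trm (up0_trm \<sigma>) (up0_fct \<tau>) t)) s) (App (Lam (sub_trm (up0_trm \<sigma>) (up0_fct \<tau>) t)) s')"
    by (rule eqw_App[OF w T1_Lam[OF e t] s])
  then show ?thesis
    using eqw_cong[OF w beta[OF e t] beta[OF e t]] eqw_T0[OF w s] by blast
qed

lemma eqw_k2:
  assumes w: "world w" and k: "arity_klc k = (2, 0)" and e: "eqw w s s'" "eqw w t t'"
  shows "eqw w (k2 k s t) (k2 k s' t')"
proof -
  have T: "s \<in> T0 w" "s' \<in> T0 w" "t \<in> T0 w" "t' \<in> T0 w" using eqw_T0[OF w] e by auto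
  have "eqw w (k2 k s t) (k2 k s' t)"
    using eqw_sub0[of w "case_nat t nil0" nil1 "k2 k (NVar 0) (NVar 1)", OF _ _ e(1)] T w k
    by (simp add: env_cases lang_M_def)
  moreover have "eqw w (k2 k s' t) (k2 k s' t')"
    using eqw_sub0[of w "case_nat s' nil0" nil1 "k2 k (NVar 1) (NVar 0)", OF _ _ e(2)] T w k
    by (simp add: env_cases lang_M_def)
  ultimately show ?thesis by (rule eqw_trans[OF w])
qed

lemma induct:
  assumes A: "wf_fm lang_M A" and e: "env w \<sigma> \<tau>" and z: "forces A w (case_nat \<^bold>0 \<sigma>) \<tau>"
    and s: "\<And>w' t. le w w' \<Longrightarrow> t \<in> T0 w' \<Longrightarrow> forces A w' (case_nat t \<sigma>) \<tau> \<Longrightarrow>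
      forces A w' (case_nat (succ t) \<sigma>) \<tau>"
    and t: "t \<in> T0 w"
  shows "forces A w (case_nat t \<sigma>) \<tau>"
proof (rule induct_gen[OF _ e z s t])
  show "forces (sub0 \<^bold>0 A \<^bold>\<and> All0 (A \<^bold>\<longrightarrow> sub_fm (step0 (succ (NVar 0))) FVar A) \<^bold>\<longrightarrow> All0 A) w \<sigma> \<tau>"
    using A by (intro ax_IA[OF _ e]) (auto simp: IA1_def induction_schema_def)
qed

subsection \<open>Extensional equality\<close>

text \<open>The forcing of \<forall>x u(x) = v(x), which is what equality of functions abbreviates;
  hence the quantifier over larger worlds.\<close>

definition feq :: "world \<Rightarrow> fct \<Rightarrow> fct \<Rightarrow> bool" where
  "feq w u v \<longleftrightarrow> u \<in> T1 w \<and> v \<in> T1 w \<and> (\<forall>w'. le w w' \<longrightarrow> (\<forall>t\<in>T0 w'. eqw w' (App u t) (App v t)))"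

lemma feq_mono: "le w w' \<Longrightarrow> feq w u v \<Longrightarrow> feq w' u v"
  unfolding feq_def using le_trans D1_mono by blast

lemma feqD: "feq w u v \<Longrightarrow> le w w' \<Longrightarrow> t \<in> T0 w' \<Longrightarrow> eqw w' (App u t) (App v t)"
  unfolding feq_def by blast

lemma feq_App: "world w \<Longrightarrow> feq w u v \<Longrightarrow> eqw w s t \<Longrightarrow> eqw w (App u s) (App v t)"
  by (meson feqD eqw_App eqw_T0 eqw_trans le_world(3) feq_def)

lemma feq_Lam:
  assumes e: "env w \<sigma> \<tau>" "env w \<sigma>' \<tau>'" and t: "wf_trm lang_M t"
    and eq: "\<And>w' x. le w w' \<Longrightarrow> x \<in> T0 w' \<Longrightarrow> eqw w' (sub_trm (case_nat x \<sigma>) \<tau> t) (sub_trm (case_nat x \<sigma>') \<tau>' t)"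
  shows "feq w (Lam (sub_trm (up0_trm \<sigma>) (up0_fct \<tau>) t)) (Lam (sub_trm (up0_trm \<sigma>') (up0_fct \<tau>') t))"
  unfolding feq_def
proof (intro conjI allI impI ballI)
  fix w' x assume w': "le w w'" and x: "x \<in> T0 w'"
  show "eqw w' (App (Lam (sub_trm (up0_trm \<sigma>) (up0_fct \<tau>) t)) x) (App (Lam (sub_trm (up0_trm \<sigma>') (up0_fct \<tau>') t)) x)"
    using eqw_cong[OF le_world(2)[OF w'] beta[OF env_le[OF e(1) w'] t x] beta[OF env_le[OF e(2) w'] t x]] eq[OF w' x]
    by blast
qed (use T1_Lam e t in auto)

lemma kleene: "A \<in> kleene_equations \<Longrightarrow> env w \<sigma> \<tau> \<Longrightarrow> forces A w \<sigma> \<tau>"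
  by (rule ax_IA) (simp_all add: IA1_def)

text \<open>Extensionality of a functional defined by recursion, by induction on its number
  argument. \<open>b\<close> is the initial value, \<open>op\<close> the operation of the step, and
  \<open>g\<close> the place where the function is read: \<open>t\<close> for sums and products over
  \<open>y < z\<close>, \<open>succ t\<close> for minima and maxima over
  \<open>y \<le> z\<close>.\<close>

lemma ext_rec:
  assumes k: "arity_klc k = (1, 1)" "arity_klc op = (2, 0)"
    and base: "\<And>u. u \<in> T1 w \<Longrightarrow> eqw w (kf k \<^bold>0 u) (b u)" "eqw w (b u) (b v)"
    and step: "\<And>w' t u. le w w' \<Longrightarrow> t \<in> T0 w' \<Longrightarrow> u \<in> T1 w' \<Longrightarrow>
      eqw w' (kf k (succ t) u) (k2 op (kf k t u) (App u (g t)))"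
    and g: "\<And>w t. t \<in> T0 w \<Longrightarrow> g t \<in> T0 w"
    and w: "world w" and e: "feq w u v" and t: "t \<in> T0 w"
  shows "eqw w (kf k t u) (kf k t v)"
proof -
  have uv: "u \<in> T1 w" "v \<in> T1 w" using e by (auto simp: feq_def)
  let ?A = "kf k (NVar 0) (FVar 0) \<doteq> kf k (NVar 0) (FVar 1)"
  have "forces ?A w (case_nat t nil0) (case_nat u (case_nat v nil1))"
  proof (rule induct[OF _ _ _ _ t])
    show "wf_fm lang_M ?A" using k by (simp add: lang_M_def)
    show "env w nil0 (case_nat u (case_nat v nil1))" using w uv by (simp add: env_cases)
    show "forces ?A w (case_nat \<^bold>0 nil0) (case_nat u (case_nat v nil1))"
      using eqw_cong[OF w base(1)[OF uv(1)] base(1)[OF uv(2)]] base(2) by simp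
  next
    fix w' t assume w': "le w w'" and t: "t \<in> T0 w'"
      and IH: "forces ?A w' (case_nat t nil0) (case_nat u (case_nat v nil1))"
    note ww = le_world(2)[OF w'] and u' = D1_mono[OF w' uv(1)] and v' = D1_mono[OF w' uv(2)]
    have "eqw w' (k2 op (kf k t u) (App u (g t))) (k2 op (kf k t v) (App v (g t)))"
      using IH by (intro eqw_k2[OF ww k(2)] feqD[OF e w'] g t) simp
    then show "forces ?A w' (case_nat (succ t) nil0) (case_nat u (case_nat v nil1))"
      using eqw_cong[OF ww step[OF w' t u'] step[OF w' t v']] by simp
  qed
  then show ?thesis by simp
qed

text \<open>Extensionality of a functional defined explicitly from another one applied to a
  \<lambda>-term: equal functions make the \<lambda>-terms extensionally equal.\<close>

lemma ext_Lam:
  assumes k: "arity_klc k = (1, 1)" "arity_klc k' = (1, 1)" and r: "wf_trm lang_M r"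
    and ax: "(kf k (NVar 0) (FVar 0) \<doteq> kf k' (NVar 0) (Lam r)) \<in> kleene_equations"
    and k': "\<And>t u v. t \<in> T0 w \<Longrightarrow> feq w u v \<Longrightarrow> eqw w (kf k' t u) (kf k' t v)"
    and cong: "\<And>w' x. le w w' \<Longrightarrow> x \<in> T0 w' \<Longrightarrow> eqw w' (sub_trm (case_nat x (case_nat t nil0)) (case_nat u nil1) r)
        (sub_trm (case_nat x (case_nat t nil0)) (case_nat v nil1) r)"
    and w: "world w" and uv: "u \<in> T1 w" "v \<in> T1 w" and t: "t \<in> T0 w"
  shows "eqw w (kf k t u) (kf k t v)"
proof -
  have e: "env w (case_nat t nil0) (case_nat y nil1)" if "y \<in> T1 w" for y
    using w t that by (simp add: env_cases)
  let ?L = "\<lambda>y. Lam (sub_trm (up0_trm (case_nat t nil0)) (up0_fct (case_nat y nil1)) r)"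
  have "eqw w (kf k t y) (kf k' t (?L y))" if "y \<in> T1 w" for y
    using kleene[OF ax e[OF that]] by simp
  moreover have "eqw w (kf k' t (?L u)) (kf k' t (?L v))"
    by (rule k'[OF t feq_Lam[OF e[OF uv(1)] e[OF uv(2)] r cong]])
  ultimately show ?thesis using eqw_cong[OF w] uv by meson
qed

lemma kf_recs:
  assumes "world w" "u \<in> T1 w"
  shows "eqw w (kf KSum \<^bold>0 u) \<^bold>0" "eqw w (kf KProd \<^bold>0 u) \<^bold>1" "eqw w (kf KCcp \<^bold>0 u) \<^bold>1"
    "eqw w (kf KBMin \<^bold>0 u) (App u \<^bold>0)" "eqw w (kf KBMax \<^bold>0 u) (App u \<^bold>0)"
    "t \<in> T0 w \<Longrightarrow> eqw w (kf KSum (succ t) u) (kf KSum t u \<^bold>+ App u t)"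
    "t \<in> T0 w \<Longrightarrow> eqw w (kf KProd (succ t) u) (kf KProd t u \<^bold>\<cdot> App u t)"
    "t \<in> T0 w \<Longrightarrow> eqw w (kf KCcp (succ t) u) (k2 KCirc (kf KCcp t u) (App u t))"
    "t \<in> T0 w \<Longrightarrow> eqw w (kf KBMin (succ t) u) (k2 KMin (kf KBMin t u) (App u (succ t)))"
    "t \<in> T0 w \<Longrightarrow> eqw w (kf KBMax (succ t) u) (k2 KMax (kf KBMax t u) (App u (succ t)))"
proof -
  have e: "env w nil0 (case_nat u nil1)" using assms by (simp add: env_cases)
  have e': "env w (case_nat t nil0) (case_nat u nil1)" if "t \<in> T0 w" using assms that by (simp add: env_cases)
  have k: "eqw w (sub_trm \<sigma> \<tau> l) (sub_trm \<sigma> \<tau> r)" if "env w \<sigma> \<tau>" "(l \<doteq> r) \<in> kleene_equations" for l r \<sigma> \<tau>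
    using kleene[OF that(2,1)] by simp
  show "eqw w (kf KSum \<^bold>0 u) \<^bold>0" using k[OF e, of "kf KSum \<^bold>0 (FVar 0)" "\<^bold>0"] by (simp add: kleene_equations_def Let_def)
  show "eqw w (kf KProd \<^bold>0 u) \<^bold>1" using k[OF e, of "kf KProd \<^bold>0 (FVar 0)" "\<^bold>1"] by (simp add: kleene_equations_def Let_def)
  show "eqw w (kf KCcp \<^bold>0 u) \<^bold>1" using k[OF e, of "kf KCcp \<^bold>0 (FVar 0)" "\<^bold>1"] by (simp add: kleene_equations_def Let_def)
  show "eqw w (kf KBMin \<^bold>0 u) (App u \<^bold>0)" using k[OF e, of "kf KBMin \<^bold>0 (FVar 0)" "App (FVar 0) \<^bold>0"] by (simp add: kleene_equations_def Let_def)
  show "eqw w (kf KBMax \<^bold>0 u) (App u \<^bold>0)" using k[OF e, of "kf KBMax \<^bold>0 (FVar 0)" "App (FVar 0) \<^bold>0"] by (simp add: kleene_equations_def Let_def)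
  assume t: "t \<in> T0 w"
  note k = k[OF e'[OF t]]
  show "eqw w (kf KSum (succ t) u) (kf KSum t u \<^bold>+ App u t)"
    using k[of "kf KSum (succ (NVar 0)) (FVar 0)" "kf KSum (NVar 0) (FVar 0) \<^bold>+ App (FVar 0) (NVar 0)"] by (simp add: kleene_equations_def Let_def)
  show "eqw w (kf KProd (succ t) u) (kf KProd t u \<^bold>\<cdot> App u t)"
    using k[of "kf KProd (succ (NVar 0)) (FVar 0)" "kf KProd (NVar 0) (FVar 0) \<^bold>\<cdot> App (FVar 0) (NVar 0)"] by (simp add: kleene_equations_def Let_def)
  show "eqw w (kf KCcp (succ t) u) (k2 KCirc (kf KCcp t u) (App u t))"
    using k[of "kf KCcp (succ (NVar 0)) (FVar 0)" "k2 KCirc (kf KCcp (NVar 0) (FVar 0)) (App (FVar 0) (NVar 0))"] by (simp add: kleene_equations_def Let_def)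
  show "eqw w (kf KBMin (succ t) u) (k2 KMin (kf KBMin t u) (App u (succ t)))"
    using k[of "kf KBMin (succ (NVar 0)) (FVar 0)" "k2 KMin (kf KBMin (NVar 0) (FVar 0)) (App (FVar 0) (succ (NVar 0)))"] by (simp add: kleene_equations_def Let_def)
  show "eqw w (kf KBMax (succ t) u) (k2 KMax (kf KBMax t u) (App u (succ t)))"
    using k[of "kf KBMax (succ (NVar 0)) (FVar 0)" "k2 KMax (kf KBMax (NVar 0) (FVar 0)) (App (FVar 0) (succ (NVar 0)))"] by (simp add: kleene_equations_def Let_def)
qed

lemma ext_kf:
  assumes k: "arity_klc k = (1, 1)" and w: "world w" and e: "feq w u v" and t: "t \<in> T0 w"
  shows "eqw w (kf k t u) (kf k t v)"
proof -
  have uv: "u \<in> T1 w" "v \<in> T1 w" using e by (auto simp: feq_def)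
  have prod: "eqw w' (kf KProd t u) (kf KProd t v)" if "world w'" "t \<in> T0 w'" "feq w' u v" for w' t u v
    by (rule ext_rec[of KProd KMul w' "\<lambda>u. \<^bold>1" u v "\<lambda>t. t"])
      (use that in \<open>auto intro: kf_recs eqw_refl le_world\<close>)
  have bar: "eqw w (kf k t u) (kf k t v)" if "k = KBar"
    unfolding that
  proof (rule ext_Lam[of KBar KProd "k1 KPrime (NVar 0) \<^bold>\<up> succ (App (FVar 0) (NVar 0))", OF _ _ _ _ _ _ w uv t])
    fix w' x assume w': "le w w'" "x \<in> T0 w'"
    show "eqw w' (sub_trm (case_nat x (case_nat t nil0)) (case_nat u nil1) (k1 KPrime (NVar 0) \<^bold>\<up> succ (App (FVar 0) (NVar 0))))
        (sub_trm (case_nat x (case_nat t nil0)) (case_nat v nil1) (k1 KPrime (NVar 0) \<^bold>\<up> succ (App (FVar 0) (NVar 0))))"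
      using w' le_world(2)[OF w'(1)] by (auto intro!: eqw_k2 eqw_refl eqw_App feqD[OF e])
  qed (auto simp: lang_M_def kleene_equations_def Let_def intro: prod w)
  have tilde: "eqw w (kf k t u) (kf k t v)" if "k = KTilde"
    unfolding that
  proof (rule ext_Lam[of KTilde KProd "k1 KPrime (NVar 0) \<^bold>\<up> App (FVar 0) (NVar 0)", OF _ _ _ _ _ _ w uv t])
    fix w' x assume w': "le w w'" "x \<in> T0 w'"
    show "eqw w' (sub_trm (case_nat x (case_nat t nil0)) (case_nat u nil1) (k1 KPrime (NVar 0) \<^bold>\<up> App (FVar 0) (NVar 0)))
        (sub_trm (case_nat x (case_nat t nil0)) (case_nat v nil1) (k1 KPrime (NVar 0) \<^bold>\<up> App (FVar 0) (NVar 0)))"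
      using w' le_world(2)[OF w'(1)] by (auto intro!: eqw_k2 eqw_refl eqw_App feqD[OF e])
  qed (auto simp: lang_M_def kleene_equations_def Let_def intro: prod w)
  have sum: "eqw w (kf k t u) (kf k t v)" if "k = KSum"
    unfolding that by (rule ext_rec[of KSum KAdd w "\<lambda>u. \<^bold>0" u v "\<lambda>t. t", OF _ _ _ _ _ _ w e t])
      (use w in \<open>auto intro: kf_recs eqw_refl le_world\<close>)
  have ccp: "eqw w (kf k t u) (kf k t v)" if "k = KCcp"
    unfolding that by (rule ext_rec[of KCcp KCirc w "\<lambda>u. \<^bold>1" u v "\<lambda>t. t", OF _ _ _ _ _ _ w e t])
      (use w in \<open>auto intro: kf_recs eqw_refl le_world\<close>)
  have bmin: "eqw w (kf k t u) (kf k t v)" if "k = KBMin"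
    unfolding that by (rule ext_rec[of KBMin KMin w "\<lambda>u. App u \<^bold>0" u v succ, OF _ _ _ _ _ _ w e t])
      (use w in \<open>auto intro: kf_recs eqw_refl le_world feqD[OF e]\<close>)
  have bmax: "eqw w (kf k t u) (kf k t v)" if "k = KBMax"
    unfolding that by (rule ext_rec[of KBMax KMax w "\<lambda>u. App u \<^bold>0" u v succ, OF _ _ _ _ _ _ w e t])
      (use w in \<open>auto intro: kf_recs eqw_refl le_world feqD[OF e]\<close>)
  show ?thesis using k sum prod[OF w t e] bar tilde ccp bmin bmax by (cases k) auto
qed

lemma eqw_kf:
  assumes k: "arity_klc k = (1, 1)" and w: "world w" and e: "feq w u v" and s: "eqw w s t"
  shows "eqw w (kf k s u) (kf k t v)"
proof -
  have v: "v \<in> T1 w" using e by (auto simp: feq_def)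
  have "eqw w (kf k s v) (kf k t v)"
    using eqw_sub0[of w nil0 "case_nat v nil1" "kf k (NVar 0) (FVar 0)", OF _ _ s] v w k
    by (simp add: env_cases lang_M_def)
  then show ?thesis using ext_kf[OF k w e] eqw_T0[OF w s] eqw_trans[OF w] by blast
qed

lemma feq_refl: "u \<in> T1 w \<Longrightarrow> feq w u u"
  unfolding feq_def by (auto intro!: eqw_refl intro: le_world(2) le_T1)

lemma eqw_case: "eqw w x y \<Longrightarrow> \<forall>n. eqw w (\<sigma> n) (\<sigma>' n) \<Longrightarrow> \<forall>n. eqw w (case_nat x \<sigma> n) (case_nat y \<sigma>' n)"
  by (simp split: nat.split)

lemma feq_case: "feq w u v \<Longrightarrow> \<forall>n. feq w (\<tau> n) (\<tau>' n) \<Longrightarrow> \<forall>n. feq w (case_nat u \<tau> n) (case_nat v \<tau>' n)"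
  by (simp split: nat.split)

lemma eqw_all: "le w w' \<Longrightarrow> \<forall>n. eqw w (\<sigma> n) (\<sigma>' n) \<Longrightarrow> \<forall>n. eqw w' (\<sigma> n) (\<sigma>' n)"
  using le_eqw by blast

lemma feq_all: "le w w' \<Longrightarrow> \<forall>n. feq w (\<tau> n) (\<tau>' n) \<Longrightarrow> \<forall>n. feq w' (\<tau> n) (\<tau>' n)"
  using feq_mono by blast

lemma lang_M_Cst:
  assumes wf: "wf_trm lang_M (Cst c ts us)"
  obtains "c = Zero" "ts = []" "us = []"
    | k s t where "c = Kl k" "arity_klc k = (2, 0)" "ts = [s, t]" "us = []"
    | k t u where "c = Kl k" "arity_klc k = (1, 1)" "ts = [t]" "us = [u]"
proof -
  have c: "c \<in> lang_M" "arity c \<noteq> (1, 0)" "arity c = (length ts, length us)" using wf by auto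
  have k: "arity_klc k \<in> {(1, 0), (2, 0), (1, 1)}" for k by (cases k) auto
  show ?thesis
  proof (cases c)
    case Zero then show ?thesis using that(1) c(3) by simp
  next
    case (Kl k)
    with k[of k] c consider "arity_klc k = (2, 0)" | "arity_klc k = (1, 1)" by auto
    then show ?thesis
    proof cases
      case 1
      then have "length ts = Suc (Suc 0)" "us = []" using c(3) Kl by auto
      then show ?thesis using that(2) 1 Kl by (auto simp: length_Suc_conv)
    next
      case 2
      then have "length ts = Suc 0" "length us = Suc 0" using c(3) Kl by auto
      then show ?thesis using that(3) 2 Kl by (auto simp: length_Suc_conv)
    qed
  qed (use c in \<open>auto simp: lang_M_def\<close>)
qed

lemma sub_eqw:
  "wf_trm lang_M t \<Longrightarrow> env w \<sigma> \<tau> \<Longrightarrow> env w \<sigma>' \<tau>' \<Longrightarrow> \<forall>n. eqw w (\<sigma> n) (\<sigma>' n) \<Longrightarrow> \<forall>n. feq w (\<tau> n) (\<tau>' n) \<Longrightarrow>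
    eqw w (sub_trm \<sigma> \<tau> t) (sub_trm \<sigma>' \<tau>' t)"
  "wf_fct lang_M u \<Longrightarrow> env w \<sigma> \<tau> \<Longrightarrow> env w \<sigma>' \<tau>' \<Longrightarrow> \<forall>n. eqw w (\<sigma> n) (\<sigma>' n) \<Longrightarrow> \<forall>n. feq w (\<tau> n) (\<tau>' n) \<Longrightarrow>
    feq w (sub_fct \<sigma> \<tau> u) (sub_fct \<sigma>' \<tau>' u)"
proof (induct t and u arbitrary: w \<sigma> \<tau> \<sigma>' \<tau>' and w \<sigma> \<tau> \<sigma>' \<tau>' rule: trm.induct fct.induct)
  case (Cst c ts us)
  note w = env_world[OF Cst(4)]
  have IH: "eqw w (sub_trm \<sigma> \<tau> t) (sub_trm \<sigma>' \<tau>' t)" if "t \<in> set ts" for t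
    using Cst(1)[OF that _ Cst(4-7)] Cst(3) that by simp
  have IH1: "feq w (sub_fct \<sigma> \<tau> t) (sub_fct \<sigma>' \<tau>' t)" if "t \<in> set us" for t
    using Cst(2)[OF that _ Cst(4-7)] Cst(3) that by simp
  consider "c = Zero" "ts = []" "us = []"
    | k s t where "c = Kl k" "arity_klc k = (2, 0)" "ts = [s, t]" "us = []"
    | k t u where "c = Kl k" "arity_klc k = (1, 1)" "ts = [t]" "us = [u]"
    by (rule lang_M_Cst[OF Cst(3)])
  then show ?case
  proof cases
    case 1 then show ?thesis using eqw_refl[OF w] by simp
  next
    case 2 then show ?thesis using IH by (auto intro: eqw_k2[OF w])
  next
    case 3 then show ?thesis using IH IH1 by (auto intro: eqw_kf[OF _ w])
  qed
next
  case (App u t)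
  then show ?case using feq_App[OF env_world[OF App(4)]] by simp
next
  case (FC c)
  have "FC c \<in> T1 w" using sub_T1[OF FC(2,1)] by simp
  then show ?case using feq_refl by simp
next
  case (Lam t)
  have "feq w (Lam (sub_trm (up0_trm \<sigma>) (up0_fct \<tau>) t)) (Lam (sub_trm (up0_trm \<sigma>') (up0_fct \<tau>') t))"
  proof (rule feq_Lam[OF Lam(3,4)])
    show t: "wf_trm lang_M t" using Lam(2) by simp
    fix w' x assume w': "le w w'" and x: "x \<in> T0 w'"
    show "eqw w' (sub_trm (case_nat x \<sigma>) \<tau> t) (sub_trm (case_nat x \<sigma>') \<tau>' t)"
      by (rule Lam(1)[OF t env_case0[OF env_le[OF Lam(3) w'] x] env_case0[OF env_le[OF Lam(4) w'] x]])
        (use eqw_case[OF eqw_refl[OF le_world(2)[OF w'] x] eqw_all[OF w' Lam(5)]] feq_all[OF w' Lam(6)] in blast)+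
  qed
  then show ?case by simp
qed auto

text \<open>Formulas of \<open>M\<close> are extensional in function variables too. Functions found
  by choice are determined only by their values, so any argument that compares them needs
  this.\<close>

lemma forces_cong:
  "wf_fm lang_M A \<Longrightarrow> env w \<sigma> \<tau> \<Longrightarrow> env w \<sigma>' \<tau>' \<Longrightarrow> \<forall>n. eqw w (\<sigma> n) (\<sigma>' n) \<Longrightarrow> \<forall>n. feq w (\<tau> n) (\<tau>' n) \<Longrightarrow>
    forces A w \<sigma> \<tau> \<longleftrightarrow> forces A w \<sigma>' \<tau>'"
proof (induct A arbitrary: w \<sigma> \<tau> \<sigma>' \<tau>')
  case (Eq s t)
  then show ?case using eqw_cong[OF env_world[OF Eq(2)] sub_eqw(1) sub_eqw(1)] by simp
next
  case (Neg A)
  have "forces A w' \<sigma> \<tau> \<longleftrightarrow> forces A w' \<sigma>' \<tau>'" if "le w w'" for w'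
    using Neg(1)[OF _ env_le[OF Neg(3) that] env_le[OF Neg(4) that] eqw_all[OF that Neg(5)] feq_all[OF that Neg(6)]]
      Neg(2) by simp
  then show ?case by auto
next
  case (And A B)
  show ?case using And(1,2)[OF _ And(4-7)] And(3) by auto
next
  case (Or A B)
  show ?case using Or(1,2)[OF _ Or(4-7)] Or(3) by auto
next
  case (Imp A B)
  have "forces A w' \<sigma> \<tau> \<longleftrightarrow> forces A w' \<sigma>' \<tau>'" "forces B w' \<sigma> \<tau> \<longleftrightarrow> forces B w' \<sigma>' \<tau>'" if "le w w'" for w'
    using Imp(1,2)[OF _ env_le[OF Imp(4) that] env_le[OF Imp(5) that] eqw_all[OF that Imp(6)] feq_all[OF that Imp(7)]]
      Imp(3) by simp_all
  then show ?case by auto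
next
  case (All0 A)
  have "forces A w' (case_nat x \<sigma>) \<tau> \<longleftrightarrow> forces A w' (case_nat x \<sigma>') \<tau>'" if "le w w'" "x \<in> T0 w'" for w' x
    by (rule All0(1)[OF _ env_case0[OF env_le[OF All0(3) that(1)] that(2)] env_case0[OF env_le[OF All0(4) that(1)] that(2)]
        eqw_case[OF eqw_refl[OF le_world(2)[OF that(1)] that(2)] eqw_all[OF that(1) All0(5)]] feq_all[OF that(1) All0(6)]])
      (use All0(2) in simp)
  then show ?case by auto
next
  case (Ex0 A)
  have "forces A w (case_nat x \<sigma>) \<tau> \<longleftrightarrow> forces A w (case_nat x \<sigma>') \<tau>'" if "x \<in> T0 w" for x
    by (rule Ex0(1)[OF _ env_case0[OF Ex0(3) that] env_case0[OF Ex0(4) that]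
        eqw_case[OF eqw_refl[OF env_world[OF Ex0(3)] that] Ex0(5)] Ex0(6)])
      (use Ex0(2) in simp)
  then show ?case by auto
next
  case (All1 A)
  have "forces A w' \<sigma> (case_nat x \<tau>) \<longleftrightarrow> forces A w' \<sigma>' (case_nat x \<tau>')" if "le w w'" "x \<in> T1 w'" for w' x
    by (rule All1(1)[OF _ env_case1[OF env_le[OF All1(3) that(1)] that(2)] env_case1[OF env_le[OF All1(4) that(1)] that(2)]
        eqw_all[OF that(1) All1(5)] feq_case[OF feq_refl[OF that(2)] feq_all[OF that(1) All1(6)]]])
      (use All1(2) in simp)
  then show ?case by auto
next
  case (Ex1 A)
  have "forces A w \<sigma> (case_nat x \<tau>) \<longleftrightarrow> forces A w \<sigma>' (case_nat x \<tau>')" if "x \<in> T1 w" for x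
    by (rule Ex1(1)[OF _ env_case1[OF Ex1(3) that] env_case1[OF Ex1(4) that] Ex1(5)
        feq_case[OF feq_refl[OF that] Ex1(6)]])
      (use Ex1(2) in simp)
  then show ?case by auto
qed

end

locale ext_M = logic +
  assumes extM: "extension S sys_M"
begin

sublocale ext_IA
proof
  have "theorems IA1 \<subseteq> theorems sys_M"
  proof
    fix A assume "A \<in> theorems IA1"
    then have "deriv IA1 {} A" by (simp add: theorems_def)
    then have "deriv sys_M {} A"
      by (rule deriv_extend)
        (auto simp: IA1_def sys_M_def theorems_def formulas_def intro: deriv.Axm)
    then show "A \<in> theorems sys_M" by (simp add: theorems_def)
  qed
  then show "extension S IA1" using extM by (auto simp: extension_def sys_M_def IA1_def)
qed

lemma ax_M:
  assumes "A \<in> axms sys_M" and "env w \<sigma> \<tau>"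
  shows "forces A w \<sigma> \<tau>"
proof (rule forces_theorem[OF _ assms(2)])
  have "wf_fm (lang sys_M) A" using axms_M_wf assms(1) by (auto simp: formulas_def)
  then have "A \<in> theorems sys_M" using assms(1) by (auto simp: theorems_def intro: deriv.Axm)
  then show "deriv S {} A" using extM by (auto simp: extension_def theorems_def)
qed

text \<open>Forcing of the unique existence asks for uniqueness in all larger worlds. The hypothesis
  gives uniqueness within each world, and the witness is carried upwards by monotonicity.\<close>

lemma choice:
  assumes A: "wf_fm lang_M A" and e: "env w \<sigma> \<tau>"
    and ex: "\<And>w' x. le w w' \<Longrightarrow> x \<in> T0 w' \<Longrightarrow> \<exists>y\<in>T0 w'. forces A w' (case_nat y (case_nat x \<sigma>)) \<tau>"
    and un: "\<And>w' x y z. le w w' \<Longrightarrow> x \<in> T0 w' \<Longrightarrow> y \<in> T0 w' \<Longrightarrow> z \<in> T0 w' \<Longrightarrow>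
      forces A w' (case_nat y (case_nat x \<sigma>)) \<tau> \<Longrightarrow> forces A w' (case_nat z (case_nat x \<sigma>)) \<tau> \<Longrightarrow> eqw w' y z"
  shows "\<exists>u\<in>T1 w. \<forall>w'. le w w' \<longrightarrow> (\<forall>x\<in>T0 w'. forces A w' (case_nat (App u x) (case_nat x \<sigma>)) \<tau>)"
proof -
  note w = le_world(3)[OF env_world[OF e]]
  have "forces (All0 (ExU0 A) \<^bold>\<longrightarrow> choice_conclusion A) w \<sigma> \<tau>"
    using A by (intro ax_M[OF _ e]) (auto simp: sys_M_def AC00_unique_def)
  moreover have "forces (All0 (ExU0 A)) w \<sigma> \<tau>"
  proof -
    have 1: "(\<lambda>n. case_nat z (case_nat y (case_nat x \<sigma>)) (up_ren Suc n)) = case_nat z (case_nat x \<sigma>)" for x y z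
      by (rule HOL.ext) (simp add: up_ren_def split: nat.split)
    show ?thesis
      unfolding ExU0_def forces.simps forces_ren 1 id_apply
    proof (intro allI impI ballI)
      fix w' x assume w': "le w w'" and x: "x \<in> T0 w'"
      from ex[OF this] obtain y where y: "y \<in> T0 w'" "forces A w' (case_nat y (case_nat x \<sigma>)) \<tau>" by blast
      have "eqw w2 y z" if "le w' w1" "z \<in> T0 w1" "le w1 w2" "forces A w2 (case_nat z (case_nat x \<sigma>)) \<tau>" for w1 w2 z
      proof -
        have l: "le w' w2" "le w w2" using that w' le_trans by blast+
        have "forces A w2 (case_nat y (case_nat x \<sigma>)) \<tau>"
          by (rule forces_mono[OF wf_fm_M[OF A] _ y(2) l(1)]) (intro env_case0 env_le[OF e w'] x y(1))
        then show ?thesis using un[OF l(2) _ _ _ _ that(4)] l x y(1) that D0_mono by blast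
      qed
      then show "\<exists>y\<in>T0 w'. forces A w' (case_nat y (case_nat x \<sigma>)) \<tau> \<and>
          (\<forall>w1. le w' w1 \<longrightarrow> (\<forall>z\<in>T0 w1. \<forall>w2. le w1 w2 \<longrightarrow> forces A w2 (case_nat z (case_nat x \<sigma>)) \<tau> \<longrightarrow>
            eqw w2 (sub_trm (case_nat z (case_nat y (case_nat x \<sigma>))) \<tau> (NVar 1))
              (sub_trm (case_nat z (case_nat y (case_nat x \<sigma>))) \<tau> (NVar 0))))"
        using y by (intro bexI[of _ y]) auto
    qed
  qed
  moreover have "(\<lambda>n. sub_trm (case_nat x \<sigma>) (case_nat u \<tau>) (inst0 (App (FVar 0) (NVar 0)) n)) =
      case_nat (App u x) (case_nat x \<sigma>)" for x u
    by (rule HOL.ext) (simp add: inst0_def split: nat.split)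
  ultimately show ?thesis using w by (simp add: choice_conclusion_def forces_sub)
qed


end

section \<open>Arithmetic in the worlds\<close>

primrec num :: "nat \<Rightarrow> trm" where
  "num 0 = \<^bold>0"
| "num (Suc n) = succ (num n)"

lemma in_lang_M [simp]: "Zero \<in> lang_M" "Fn SuccD \<in> lang_M" "Kl k \<in> lang_M"
  by (auto simp: lang_M_def)

lemma sub_num [simp]: "sub_trm \<sigma> \<tau> (num n) = num n"
  by (induct n) simp_all

lemma wf_num [simp]: "wf_trm lang_M (num n)"
  by (induct n) (simp_all add: lang_M_def)

context ext_IA
begin

lemma T0_num [simp, intro]: "num n \<in> T0 w"
  by (induct n) auto

section \<open>Decidable equality and the order\<close>

definition lt :: "world \<Rightarrow> trm \<Rightarrow> trm \<Rightarrow> bool" where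
  "lt w s t \<longleftrightarrow> (\<exists>c\<in>T0 w. eqw w (succ c \<^bold>+ s) t)"

lemma forces_Less [simp]: "forces (Less s t) w \<sigma> \<tau> \<longleftrightarrow> lt w (sub_trm \<sigma> \<tau> s) (sub_trm \<sigma> \<tau> t)"
  by (simp add: Less_def lt_def sub_ren)

lemma wf_Less [simp]: "wf_trm lang_M s \<Longrightarrow> wf_trm lang_M t \<Longrightarrow> wf_fm lang_M (Less s t)"
  by (simp add: Less_def wf_ren lang_M_def)

lemma wf_M_simps [simp]:
  "wf_trm lang_M \<^bold>0" "wf_fct lang_M (FC (Fn SuccD))"
  "arity_klc k = (2, 0) \<Longrightarrow> wf_trm lang_M (k2 k s t) \<longleftrightarrow> wf_trm lang_M s \<and> wf_trm lang_M t"
  by (auto simp: lang_M_def)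

lemma lt_mono: "le w w' \<Longrightarrow> lt w s t \<Longrightarrow> lt w' s t"
  unfolding lt_def using le_eqw D0_mono by blast

lemma lt_cong:
  assumes w: "world w" and e: "eqw w s s'" "eqw w t t'"
  shows "lt w s t \<longleftrightarrow> lt w s' t'"
proof -
  have "eqw w (succ c \<^bold>+ s) (succ c \<^bold>+ s')" if "c \<in> T0 w" for c
    using that by (intro eqw_k2[OF w _ eqw_refl[OF w] e(1)]) auto
  then show ?thesis unfolding lt_def using eqw_cong[OF w _ e(2)] by blast
qed

lemma lt_T0: "world w \<Longrightarrow> lt w s t \<Longrightarrow> s \<in> T0 w \<and> t \<in> T0 w"
  unfolding lt_def using eqw_T0 by (fastforce simp: T0_def)

lemma peano:
  assumes w: "world w"
  shows "t \<in> T0 w \<Longrightarrow> \<not> eqw w (succ t) \<^bold>0" "eqw w (succ s) (succ t) \<Longrightarrow> eqw w s t"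
proof -
  assume "t \<in> T0 w"
  then have "forces (\<^bold>\<not> succ (NVar 0) \<doteq> \<^bold>0) w (case_nat t nil0) nil1"
    using w by (intro ax_IA) (auto simp: IA1_def peano_succ_def env_cases)
  then show "\<not> eqw w (succ t) \<^bold>0" using le_world(3)[OF w] by auto
next
  assume e: "eqw w (succ s) (succ t)"
  then have T: "s \<in> T0 w" "t \<in> T0 w" using eqw_T0[OF w e] by (auto simp: T0_def)
  have "forces (succ (NVar 0) \<doteq> succ (NVar 1) \<^bold>\<longrightarrow> NVar 0 \<doteq> NVar 1) w (case_nat s (case_nat t nil0)) nil1"
    using w T by (intro ax_IA) (auto simp: IA1_def peano_succ_def env_cases)
  then show "eqw w s t" using le_world(3)[OF w] e by auto
qed

lemma eqw_succ: "world w \<Longrightarrow> eqw w s t \<Longrightarrow> eqw w (succ s) (succ t)"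
  by (rule eqw_App) auto

lemma add_eqs:
  assumes w: "world w" and s: "s \<in> T0 w"
  shows "eqw w (s \<^bold>+ \<^bold>0) s" "t \<in> T0 w \<Longrightarrow> eqw w (s \<^bold>+ succ t) (succ (s \<^bold>+ t))"
proof -
  show "eqw w (s \<^bold>+ \<^bold>0) s"
    using kleene[of "NVar 0 \<^bold>+ \<^bold>0 \<doteq> NVar 0" w "case_nat s nil0" nil1] w s
    by (simp add: kleene_equations_def Let_def env_cases)
  assume "t \<in> T0 w"
  then show "eqw w (s \<^bold>+ succ t) (succ (s \<^bold>+ t))"
    using kleene[of "NVar 0 \<^bold>+ succ (NVar 1) \<doteq> succ (NVar 0 \<^bold>+ NVar 1)" w "case_nat s (case_nat t nil0)" nil1] w s
    by (simp add: kleene_equations_def Let_def env_cases)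
qed

lemma zero_or_succ:
  assumes w: "world w" and t: "t \<in> T0 w"
  shows "eqw w t \<^bold>0 \<or> (\<exists>s\<in>T0 w. eqw w t (succ s))"
proof -
  let ?A = "NVar 0 \<doteq> \<^bold>0 \<^bold>\<or> Ex0 (NVar 1 \<doteq> succ (NVar 0))"
  have "forces ?A w (case_nat t nil0) nil1"
  proof (rule induct[OF _ env_nil[OF w] _ _ t])
    fix w' t assume "le w w'" "t \<in> T0 w'"
    then show "forces ?A w' (case_nat (succ t) nil0) nil1"
      using eqw_refl[of w' "succ t"] le_world by auto
  qed (use w in \<open>auto intro: eqw_refl\<close>)
  then show ?thesis by simp
qed

text \<open>Decidability is the arithmetical fact behind everything that follows: it permits
  changing a function at one argument and comparing with a unique witness.\<close>

lemma dec_eq: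
  assumes w: "world w" and s: "s \<in> T0 w" and t: "t \<in> T0 w"
  shows "eqw w s t \<or> (\<forall>w'. le w w' \<longrightarrow> \<not> eqw w' s t)"
proof -
  \<comment> \<open>The second number is quantified inside, since the successor step compares
    \<open>s\<close> with the predecessor of \<open>t\<close>.\<close>
  let ?A = "All0 (NVar 1 \<doteq> NVar 0 \<^bold>\<or> \<^bold>\<not> NVar 1 \<doteq> NVar 0)"
  have sz: "\<not> eqw w \<^bold>0 (succ t)" if "t \<in> T0 w" "world w" for w t
    using peano(1)[OF that(2,1)] eqw_sym[OF that(2)] by blast
  have "forces ?A w (case_nat s nil0) nil1"
  proof (rule induct[OF _ env_nil[OF w] _ _ s])
    have "eqw w' \<^bold>0 t \<or> (\<forall>w''. le w' w'' \<longrightarrow> \<not> eqw w'' \<^bold>0 t)" if "le w w'" "t \<in> T0 w'" for w' t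
    proof -
      note ww = le_world(2)[OF that(1)]
      from zero_or_succ[OF ww that(2)] show ?thesis
      proof
        assume "eqw w' t \<^bold>0" then show ?thesis using eqw_sym[OF ww] by blast
      next
        assume "\<exists>s\<in>T0 w'. eqw w' t (succ s)"
        then obtain s where s: "s \<in> T0 w'" "eqw w' t (succ s)" by blast
        have "\<not> eqw w'' \<^bold>0 t" if "le w' w''" for w''
          using sz[OF D0_mono[OF that s(1)] le_world(2)[OF that]] le_eqw[OF that s(2)]
            eqw_trans[OF le_world(2)[OF that]] by blast
        then show ?thesis by blast
      qed
    qed
    then show "forces ?A w (case_nat \<^bold>0 nil0) nil1" by simp
  next
    fix w' s assume w': "le w w'" and s: "s \<in> T0 w'" and IH: "forces ?A w' (case_nat s nil0) nil1"
    have "eqw w1 (succ s) t \<or> (\<forall>w2. le w1 w2 \<longrightarrow> \<not> eqw w2 (succ s) t)" if w1: "le w' w1" and t: "t \<in> T0 w1" for w1 t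
    proof -
      note ww = le_world(2)[OF w1]
      from zero_or_succ[OF ww t] show ?thesis
      proof
        assume z: "eqw w1 t \<^bold>0"
        have "\<not> eqw w2 (succ s) t" if "le w1 w2" for w2
          using peano(1)[OF le_world(2)[OF that] D0_mono[OF le_trans[OF w1 that] s]] le_eqw[OF that z]
            eqw_trans[OF le_world(2)[OF that]] by blast
        then show ?thesis by blast
      next
        assume "\<exists>s\<in>T0 w1. eqw w1 t (succ s)"
        then obtain r where r: "r \<in> T0 w1" "eqw w1 t (succ r)" by blast
        have "eqw w2 (succ s) t \<longleftrightarrow> eqw w2 s r" if "le w1 w2" for w2
          using peano(2)[OF le_world(2)[OF that]] eqw_succ[OF le_world(2)[OF that]] le_eqw[OF that r(2)]
            eqw_trans[OF le_world(2)[OF that]] eqw_sym[OF le_world(2)[OF that]] by blast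
        moreover have "eqw w1 s r \<or> (\<forall>w2. le w1 w2 \<longrightarrow> \<not> eqw w2 s r)"
          using IH w1 r(1) by simp
        ultimately show ?thesis using le_world(3)[OF ww] by blast
      qed
    qed
    then show "forces ?A w' (case_nat (succ s) nil0) nil1" by simp
  qed simp
  then show ?thesis using t le_world(3)[OF w] by simp
qed

text \<open>The order puts the successor on the left summand, while the equations of addition recur
  on the right one.\<close>

lemma succ_add:
  assumes w: "world w" and s: "s \<in> T0 w" and t: "t \<in> T0 w"
  shows "eqw w (succ s \<^bold>+ t) (succ (s \<^bold>+ t))"
proof -
  let ?A = "succ (NVar 1) \<^bold>+ NVar 0 \<doteq> succ (NVar 1 \<^bold>+ NVar 0)"
  have "forces ?A w (case_nat t (case_nat s nil0)) nil1"
  proof (rule induct[OF _ _ _ _ t])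
    show "env w (case_nat s nil0) nil1" using w s by (simp add: env_cases)
    have "eqw w (succ s \<^bold>+ \<^bold>0) (succ s)" "eqw w (succ (s \<^bold>+ \<^bold>0)) (succ s)"
      using add_eqs[OF w] s eqw_succ[OF w] by auto
    then have "eqw w (succ s \<^bold>+ \<^bold>0) (succ (s \<^bold>+ \<^bold>0))" using eqw_trans[OF w] eqw_sym[OF w] by blast
    then show "forces ?A w (case_nat \<^bold>0 (case_nat s nil0)) nil1" by simp
  next
    fix w' t assume w': "le w w'" and t: "t \<in> T0 w'" and IH: "forces ?A w' (case_nat t (case_nat s nil0)) nil1"
    note ww = le_world(2)[OF w'] and s' = D0_mono[OF w' s]
    have "eqw w' (succ s \<^bold>+ succ t) (succ (succ s \<^bold>+ t))" using add_eqs(2)[OF ww _ t] s' by auto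
    moreover have "eqw w' (succ (succ s \<^bold>+ t)) (succ (succ (s \<^bold>+ t)))" using IH by (intro eqw_succ[OF ww]) simp
    moreover have "eqw w' (succ (s \<^bold>+ succ t)) (succ (succ (s \<^bold>+ t)))" using add_eqs(2)[OF ww s' t] by (intro eqw_succ[OF ww])
    ultimately have "eqw w' (succ s \<^bold>+ succ t) (succ (s \<^bold>+ succ t))" using eqw_trans[OF ww] eqw_sym[OF ww] by blast
    then show "forces ?A w' (case_nat (succ t) (case_nat s nil0)) nil1" by simp
  qed simp
  then show ?thesis by simp
qed

lemma zero_add:
  assumes w: "world w" and t: "t \<in> T0 w"
  shows "eqw w (\<^bold>0 \<^bold>+ t) t"
proof -
  let ?A = "\<^bold>0 \<^bold>+ NVar 0 \<doteq> NVar 0"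
  have "forces ?A w (case_nat t nil0) nil1"
  proof (rule induct[OF _ env_nil[OF w] _ _ t])
    show "forces ?A w (case_nat \<^bold>0 nil0) nil1" using add_eqs(1)[OF w] by simp
    fix w' t assume w': "le w w'" and t: "t \<in> T0 w'" and IH: "forces ?A w' (case_nat t nil0) nil1"
    note ww = le_world(2)[OF w']
    show "forces ?A w' (case_nat (succ t) nil0) nil1"
      using eqw_trans[OF ww add_eqs(2)[OF ww _ t] eqw_succ[OF ww]] IH by simp
  qed simp
  then show ?thesis by simp
qed

lemma not_lt_zero: assumes w: "world w" shows "\<not> lt w t \<^bold>0"
proof
  assume l: "lt w t \<^bold>0"
  then have t: "t \<in> T0 w" using lt_T0[OF w] by blast
  from l obtain c where c: "c \<in> T0 w" "eqw w (succ c \<^bold>+ t) \<^bold>0" unfolding lt_def by blast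
  have "eqw w (succ (c \<^bold>+ t)) \<^bold>0" using c succ_add[OF w c(1) t] eqw_trans[OF w] eqw_sym[OF w] by blast
  then show False using peano(1)[OF w, of "c \<^bold>+ t"] c(1) t by auto
qed

lemma lt_succ_cases:
  assumes w: "world w" and l: "lt w s (succ t)"
  shows "lt w s t \<or> eqw w s t"
proof -
  have s: "s \<in> T0 w" using lt_T0[OF w l] by blast
  from l obtain c where c: "c \<in> T0 w" "eqw w (succ c \<^bold>+ s) (succ t)" unfolding lt_def by blast
  have e: "eqw w (c \<^bold>+ s) t"
    using c succ_add[OF w c(1) s] eqw_trans[OF w] eqw_sym[OF w] peano(2)[OF w] by blast
  from zero_or_succ[OF w c(1)] show ?thesis
  proof
    assume "eqw w c \<^bold>0"
    then have "eqw w (c \<^bold>+ s) (\<^bold>0 \<^bold>+ s)" using s by (intro eqw_k2[OF w] eqw_refl[OF w]) auto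
    then show ?thesis using zero_add[OF w s] e eqw_trans[OF w] eqw_sym[OF w] by blast
  next
    assume "\<exists>d\<in>T0 w. eqw w c (succ d)"
    then obtain d where d: "d \<in> T0 w" "eqw w c (succ d)" by blast
    then have "eqw w (c \<^bold>+ s) (succ d \<^bold>+ s)" using s by (intro eqw_k2[OF w] eqw_refl[OF w]) auto
    then have "eqw w (succ d \<^bold>+ s) t" using e eqw_trans[OF w] eqw_sym[OF w] by blast
    then show ?thesis unfolding lt_def using d(1) by blast
  qed
qed

lemma lt_succI:
  assumes w: "world w" and t: "t \<in> T0 w"
  shows "lt w t (succ t)" "lt w s t \<Longrightarrow> lt w s (succ t)" "lt w (succ s) t \<Longrightarrow> lt w s t"
    "lt w (succ s) (succ t) \<Longrightarrow> lt w s t" "lt w s t \<Longrightarrow> s \<in> T0 w \<Longrightarrow> lt w (succ s) (succ t)"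
    "t' \<in> T0 w \<Longrightarrow> lt w \<^bold>0 (succ t')"
proof -
  have "eqw w (succ \<^bold>0 \<^bold>+ t) (succ t)"
    using succ_add[OF w _ t, of "\<^bold>0"] eqw_succ[OF w zero_add[OF w t]] eqw_trans[OF w] by blast
  then show "lt w t (succ t)" unfolding lt_def by blast
  have sw: "eqw w (succ c \<^bold>+ succ s) (succ (succ c) \<^bold>+ s)" if "c \<in> T0 w" "s \<in> T0 w" for c s
    using add_eqs(2)[OF w _ that(2), of "succ c"] succ_add[OF w _ that(2), of "succ c"] that eqw_trans[OF w] eqw_sym[OF w] by blast
  show 2: "lt w s (succ t)" if l: "lt w s t" for s t
  proof -
    from l obtain c where c: "c \<in> T0 w" "eqw w (succ c \<^bold>+ s) t" unfolding lt_def by blast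
    have "s \<in> T0 w" using lt_T0[OF w l] by blast
    then have "eqw w (succ (succ c) \<^bold>+ s) (succ t)"
      using succ_add[OF w, of "succ c" s] eqw_succ[OF w c(2)] c(1) eqw_trans[OF w] by blast
    then show ?thesis unfolding lt_def using c(1) by blast
  qed
  show 3: "lt w s t" if l: "lt w (succ s) t" for s t
  proof -
    from l obtain c where c: "c \<in> T0 w" "eqw w (succ c \<^bold>+ succ s) t" unfolding lt_def by blast
    have "s \<in> T0 w" using lt_T0[OF w l] by (auto simp: T0_def)
    then have "eqw w (succ (succ c) \<^bold>+ s) t" using sw[OF c(1)] c(2) eqw_trans[OF w] eqw_sym[OF w] by blast
    then show ?thesis unfolding lt_def using c(1) by blast
  qed
  show "lt w s t" if l: "lt w (succ s) (succ t)"
  proof -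
    from l obtain c where c: "c \<in> T0 w" "eqw w (succ c \<^bold>+ succ s) (succ t)" unfolding lt_def by blast
    have "s \<in> T0 w" using lt_T0[OF w l] by (auto simp: T0_def)
    then have "eqw w (succ c \<^bold>+ s) t"
      using c add_eqs(2)[OF w, of "succ c" s] eqw_trans[OF w] eqw_sym[OF w] peano(2)[OF w] T0_App T1_succ by meson
    then show ?thesis unfolding lt_def using c(1) by blast
  qed
  show "lt w (succ s) (succ t)" if l: "lt w s t" and s: "s \<in> T0 w"
  proof -
    from l obtain c where c: "c \<in> T0 w" "eqw w (succ c \<^bold>+ s) t" unfolding lt_def by blast
    then have "eqw w (succ c \<^bold>+ succ s) (succ t)"
      using add_eqs(2)[OF w _ s, of "succ c"] eqw_succ[OF w c(2)] eqw_trans[OF w] by blast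
    then show ?thesis unfolding lt_def using c(1) by blast
  qed
  show "lt w \<^bold>0 (succ t')" if "t' \<in> T0 w"
    unfolding lt_def using that add_eqs(1)[OF w, of "succ t'"] by blast
qed

lemma lt_irrefl:
  assumes w: "world w"
  shows "\<not> lt w t t"
proof
  assume l: "lt w t t"
  then have t: "t \<in> T0 w" using lt_T0[OF w] by blast
  let ?A = "\<^bold>\<not> Less (NVar 0) (NVar 0)"
  have "forces ?A w (case_nat t nil0) nil1"
  proof (rule induct[OF _ env_nil[OF w] _ _ t])
    show "forces ?A w (case_nat \<^bold>0 nil0) nil1" using not_lt_zero le_world by auto
    fix w' t assume w': "le w w'" and t: "t \<in> T0 w'" and IH: "forces ?A w' (case_nat t nil0) nil1"
    have "\<not> lt w'' (succ t) (succ t)" if "le w' w''" for w''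
      using IH that lt_succI(4)[OF le_world(2)[OF that] D0_mono[OF that t]] by auto
    then show "forces ?A w' (case_nat (succ t) nil0) nil1" by simp
  qed simp
  then show False using l le_world(3)[OF w] by auto
qed

lemma lt_linear:
  assumes w: "world w" and s: "s \<in> T0 w" and t: "t \<in> T0 w"
  shows "lt w s t \<or> eqw w s t \<or> lt w t s"
proof -
  let ?A = "Less (NVar 0) (NVar 1) \<^bold>\<or> NVar 0 \<doteq> NVar 1 \<^bold>\<or> Less (NVar 1) (NVar 0)"
  have "forces ?A w (case_nat s (case_nat t nil0)) nil1"
  proof (rule induct[OF _ _ _ _ s])
    show "env w (case_nat t nil0) nil1" using w t by (simp add: env_cases)
    have "lt w \<^bold>0 t \<or> eqw w \<^bold>0 t"
      using zero_or_succ[OF w t] lt_succI(6)[OF w t] lt_cong[OF w eqw_refl[OF w], of "\<^bold>0"] eqw_sym[OF w] by blast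
    then show "forces ?A w (case_nat \<^bold>0 (case_nat t nil0)) nil1" by auto
  next
    fix w' s assume w': "le w w'" and s: "s \<in> T0 w'" and IH: "forces ?A w' (case_nat s (case_nat t nil0)) nil1"
    note ww = le_world(2)[OF w'] and t' = D0_mono[OF w' t]
    consider "lt w' s t" | "eqw w' s t" | "lt w' t s" using IH by auto
    then have "lt w' (succ s) t \<or> eqw w' (succ s) t \<or> lt w' t (succ s)"
    proof cases
      case 1
      from lt_succ_cases[OF ww lt_succI(5)[OF ww t' 1 s]] show ?thesis by blast
    next
      case 2
      have "lt w' t (succ s)" using lt_succI(1)[OF ww s] lt_cong[OF ww 2 eqw_refl[OF ww]] s by blast
      then show ?thesis by blast
    next
      case 3 then show ?thesis using lt_succI(2)[OF ww s] by blast
    qed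
    then show "forces ?A w' (case_nat (succ s) (case_nat t nil0)) nil1" by simp
  qed simp
  then show ?thesis by simp
qed

lemma lt_neq:
  assumes w: "world w" and l: "lt w s t"
  shows "\<not> eqw w s t" "\<not> eqw w s (succ t)"
proof -
  have T: "s \<in> T0 w" "t \<in> T0 w" using lt_T0[OF w l] by auto
  show "\<not> eqw w s t" using l lt_irrefl[OF w] lt_cong[OF w _ eqw_refl[OF w T(2)]] by blast
  show "\<not> eqw w s (succ t)"
  proof
    assume "eqw w s (succ t)"
    then have "lt w (succ t) t" using l lt_cong[OF w _ eqw_refl[OF w T(2)]] by blast
    then show False using lt_succI(3)[OF w T(2)] lt_irrefl[OF w] by blast
  qed
qed

lemma neq_succ: "world w \<Longrightarrow> t \<in> T0 w \<Longrightarrow> \<not> eqw w t (succ t)"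
  using lt_neq(1) lt_succI(1) by blast


subsection \<open>Least elements\<close>

text \<open>A least element cannot be had by contradiction in intuitionistic logic; decidability of
  \<open>A\<close> at each number is what replaces it.\<close>

lemma least_element:
  assumes A: "wf_fm lang_M A" and e: "env w \<sigma> \<tau>"
    and dec: "\<And>w' y. le w w' \<Longrightarrow> y \<in> T0 w' \<Longrightarrow>
      forces A w' (case_nat y \<sigma>) \<tau> \<or> (\<forall>w''. le w' w'' \<longrightarrow> \<not> forces A w'' (case_nat y \<sigma>) \<tau>)"
    and y0: "y0 \<in> T0 w" "forces A w (case_nat y0 \<sigma>) \<tau>"
  shows "\<exists>y\<in>T0 w. forces A w (case_nat y \<sigma>) \<tau> \<and>
    (\<forall>w'. le w w' \<longrightarrow> (\<forall>z\<in>T0 w'. forces A w' (case_nat z \<sigma>) \<tau> \<longrightarrow> \<not> lt w' z y))"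
proof -
  note w = env_world[OF e]
  define P where "P w y \<longleftrightarrow> forces A w (case_nat y \<sigma>) \<tau>" for w y
  have P_cong: "P w' y \<longleftrightarrow> P w' z" if "le w w'" "eqw w' y z" for w' y z
  proof -
    note ww = le_world(2)[OF that(1)] and ew = env_le[OF e that(1)]
    show ?thesis unfolding P_def
      by (rule forces_cong[OF A env_case0[OF ew] env_case0[OF ew]])
        (use eqw_T0[OF ww that(2)] that(2) eqw_refl[OF ww] feq_refl env_T[OF ew] in \<open>auto intro: eqw_case[rule_format]\<close>)
  qed
  let ?A = "ren_fm (up_ren Suc) id A" and ?B = "ren_fm (up_ren (\<lambda>n. Suc (Suc n))) id A"
  \<comment> \<open>Induction on a bound \<open>n\<close>: either \<open>A\<close> fails everywhere
    below \<open>n\<close>, or there is a least element. It is used at the successor of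
    \<open>y0\<close>, where the first alternative is excluded because \<open>y0\<close> lies below
    the bound.\<close>
  let ?C = "All0 (Less (NVar 0) (NVar 1) \<^bold>\<longrightarrow> \<^bold>\<not> ?A) \<^bold>\<or> Ex0 (?A \<^bold>\<and> All0 (?B \<^bold>\<longrightarrow> \<^bold>\<not> Less (NVar 0) (NVar 1)))"
  let ?least = "\<lambda>w y. P w y \<and> (\<forall>w1. le w w1 \<longrightarrow> (\<forall>z\<in>T0 w1. \<forall>w2. le w1 w2 \<longrightarrow> P w2 z \<longrightarrow> (\<forall>w3. le w2 w3 \<longrightarrow> \<not> lt w3 z y)))"
  have C: "forces ?C w' (case_nat n \<sigma>) \<tau> \<longleftrightarrow>
      (\<forall>w1. le w' w1 \<longrightarrow> (\<forall>z\<in>T0 w1. \<forall>w2. le w1 w2 \<longrightarrow> lt w2 z n \<longrightarrow> (\<forall>w3. le w2 w3 \<longrightarrow> \<not> P w3 z))) \<or>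
      (\<exists>y\<in>T0 w'. ?least w' y)" for w' n
  proof -
    have "(\<lambda>k. case_nat y (case_nat n \<sigma>) (up_ren Suc k)) = case_nat y \<sigma>"
      "(\<lambda>k. case_nat z (case_nat y (case_nat n \<sigma>)) (up_ren (\<lambda>n. Suc (Suc n)) k)) = case_nat z \<sigma>" for y z
      by (rule HOL.ext, simp add: up_ren_def split: nat.split)+
    then show ?thesis unfolding P_def by (simp add: forces_ren)
  qed
  have Sy: "succ y0 \<in> T0 w" using y0 by blast
  have "forces ?C w (case_nat (succ y0) \<sigma>) \<tau>"
  proof (rule induct[OF _ e _ _ Sy])
    show "wf_fm lang_M ?C" using A by (simp add: wf_ren_fm)
    show "forces ?C w (case_nat \<^bold>0 \<sigma>) \<tau>" unfolding C using not_lt_zero le_world(2) by blast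
  next
    fix w' n assume w': "le w w'" and n: "n \<in> T0 w'" and IH: "forces ?C w' (case_nat n \<sigma>) \<tau>"
    note ww = le_world(2)[OF w']
    show "forces ?C w' (case_nat (succ n) \<sigma>) \<tau>"
    proof (cases "\<exists>y\<in>T0 w'. ?least w' y")
      case True then show ?thesis unfolding C by blast
    next
      case False
      then have none: "\<forall>w1. le w' w1 \<longrightarrow> (\<forall>z\<in>T0 w1. \<forall>w2. le w1 w2 \<longrightarrow> lt w2 z n \<longrightarrow> (\<forall>w3. le w2 w3 \<longrightarrow> \<not> P w3 z))"
        using IH unfolding C by blast
      have none': "\<not> P w3 z" if "le w' w3" "lt w3 z n" for w3 z
        using none that le_world(3)[OF le_world(2)[OF that(1)]] lt_T0[OF le_world(2)[OF that(1)] that(2)] by blast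
      have "\<not> P w' n"
      proof
        assume "P w' n"
        moreover have "\<not> lt w3 z n" if "le w' w1" "z \<in> T0 w1" "le w1 w2" "P w2 z" "le w2 w3" for w1 w2 w3 z
        proof
          assume l: "lt w3 z n"
          have l1: "le w w2" "le w' w3" using that w' le_trans by blast+
          have "P w3 z" unfolding P_def
            by (rule forces_mono[OF wf_fm_M[OF A] env_case0[OF env_le[OF e l1(1)] D0_mono[OF that(3,2)]] that(4)[unfolded P_def] that(5)])
          then show False using none'[OF l1(2) l] by blast
        qed
        ultimately show False using False n by blast
      qed
      then have nP: "\<not> P w3 n" if "le w' w3" for w3 using dec[OF w' n] that unfolding P_def by blast
      have "\<not> P w3 z" if "le w' w1" "z \<in> T0 w1" "le w1 w2" "lt w2 z (succ n)" "le w2 w3" for w1 w2 w3 z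
      proof -
        have l1: "le w' w3" "le w w3" using that w' le_trans by blast+
        from lt_succ_cases[OF le_world(2)[OF l1(1)] lt_mono[OF that(5,4)]] show ?thesis
          using none'[OF l1(1)] nP[OF l1(1)] P_cong[OF l1(2)] by blast
      qed
      then show ?thesis unfolding C by blast
    qed
  qed
  moreover have "lt w y0 (succ y0)" by (rule lt_succI(1)[OF w y0(1)])
  ultimately obtain y where y: "y \<in> T0 w" "?least w y"
    using y0 le_world(3)[OF w] unfolding C P_def by blast
  then show ?thesis unfolding P_def using le_world(2,3) by blast
qed

end

context ext_M
begin

subsection \<open>Primitive recursion\<close>

lemma const_fct:
  assumes w: "world w" and a: "a \<in> T0 w"
  shows "\<exists>u\<in>T1 w. eqw w (App u \<^bold>0) a"
  using beta[of w "case_nat a nil0" nil1 "NVar 1" "\<^bold>0"] T1_Lam[of w "case_nat a nil0" nil1 "NVar 1"] w a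
  by (auto simp: env_cases)

text \<open>The definition by cases is single-valued, and decidable equality makes it total; so
  unique choice applies.\<close>

lemma update_fct:
  assumes w: "world w" and u: "u \<in> T1 w" and n: "n \<in> T0 w" and v: "v \<in> T0 w"
  shows "\<exists>u'\<in>T1 w. \<forall>w'. le w w' \<longrightarrow> (\<forall>x\<in>T0 w'.
    (eqw w' x n \<longrightarrow> eqw w' (App u' x) v) \<and> (\<not> eqw w' x n \<longrightarrow> eqw w' (App u' x) (App u x)))"
proof -
  let ?A = "(NVar 1 \<doteq> NVar 2 \<^bold>\<and> NVar 0 \<doteq> NVar 3) \<^bold>\<or> (\<^bold>\<not> NVar 1 \<doteq> NVar 2 \<^bold>\<and> NVar 0 \<doteq> App (FVar 0) (NVar 1))"
  let ?\<sigma> = "case_nat n (case_nat v nil0)" and ?\<tau> = "case_nat u nil1"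
  have A: "forces ?A w' (case_nat y (case_nat x ?\<sigma>)) ?\<tau> \<longleftrightarrow>
      (eqw w' x n \<and> eqw w' y v) \<or> ((\<forall>w''. le w' w'' \<longrightarrow> \<not> eqw w'' x n) \<and> eqw w' y (App u x))" for w' x y
    by (simp add: numeral_2_eq_2 numeral_3_eq_3)
  have "\<exists>u'\<in>T1 w. \<forall>w'. le w w' \<longrightarrow> (\<forall>x\<in>T0 w'. forces ?A w' (case_nat (App u' x) (case_nat x ?\<sigma>)) ?\<tau>)"
  proof (rule choice)
    show "env w ?\<sigma> ?\<tau>" using w u n v by (simp add: env_cases)
  next
    fix w' x assume w': "le w w'" and x: "x \<in> T0 w'"
    note ww = le_world(2)[OF w'] and u' = D1_mono[OF w' u] and n' = D0_mono[OF w' n] and v' = D0_mono[OF w' v]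
    from dec_eq[OF ww x n'] show "\<exists>y\<in>T0 w'. forces ?A w' (case_nat y (case_nat x ?\<sigma>)) ?\<tau>"
    proof
      assume "eqw w' x n"
      then show ?thesis unfolding A using v' eqw_refl[OF ww v'] by blast
    next
      assume "\<forall>w''. le w' w'' \<longrightarrow> \<not> eqw w'' x n"
      then show ?thesis unfolding A using eqw_refl[OF ww T0_App[OF u' x]] T0_App[OF u' x] by blast
    qed
  next
    fix w' x y z assume w': "le w w'" and h: "forces ?A w' (case_nat y (case_nat x ?\<sigma>)) ?\<tau>"
      "forces ?A w' (case_nat z (case_nat x ?\<sigma>)) ?\<tau>"
    note ww = le_world(2)[OF w']
    show "eqw w' y z" using h le_world(3)[OF ww] eqw_trans[OF ww] eqw_sym[OF ww] unfolding A by blast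
  qed simp
  then obtain u' where u': "u' \<in> T1 w" and h: "\<And>w' x. le w w' \<Longrightarrow> x \<in> T0 w' \<Longrightarrow>
      forces ?A w' (case_nat (App u' x) (case_nat x ?\<sigma>)) ?\<tau>" by blast
  show ?thesis
  proof (rule bexI[OF _ u'], intro allI impI ballI conjI)
    fix w' x assume w': "le w w'" "x \<in> T0 w'"
    note r = h[OF w', unfolded A] and l = le_world(3)[OF le_world(2)[OF w'(1)]]
    show "eqw w' x n \<Longrightarrow> eqw w' (App u' x) v" using r l by blast
    show "\<not> eqw w' x n \<Longrightarrow> eqw w' (App u' x) (App u x)" using r by blast
  qed
qed

text \<open>\<open>A\<close> is the graph of the step, with the number variables 0, 1, 2 for the new
  value, the old value and the argument. Whole functions that satisfy the recursion below
  \<open>n\<close> act as finite approximations, so that no coding of sequences is needed.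
  Approximations exist for each \<open>n\<close> and agree there, and unique choice collects their
  values at \<open>n\<close>.\<close>

lemma prim_rec:
  assumes A: "wf_fm lang_M A" and e: "env w \<sigma> \<tau>" and a: "a \<in> T0 w"
    and ex: "\<And>w' n v. le w w' \<Longrightarrow> n \<in> T0 w' \<Longrightarrow> v \<in> T0 w' \<Longrightarrow>
      \<exists>y\<in>T0 w'. forces A w' (case_nat y (case_nat v (case_nat n \<sigma>))) \<tau>"
    and un: "\<And>w' n v y z. le w w' \<Longrightarrow> n \<in> T0 w' \<Longrightarrow> v \<in> T0 w' \<Longrightarrow> y \<in> T0 w' \<Longrightarrow> z \<in> T0 w' \<Longrightarrow>
      forces A w' (case_nat y (case_nat v (case_nat n \<sigma>))) \<tau> \<Longrightarrow>
      forces A w' (case_nat z (case_nat v (case_nat n \<sigma>))) \<tau> \<Longrightarrow> eqw w' y z"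
  shows "\<exists>u\<in>T1 w. eqw w (App u \<^bold>0) a \<and> (\<forall>w'. le w w' \<longrightarrow> (\<forall>n\<in>T0 w'.
    forces A w' (case_nat (App u (succ n)) (case_nat (App u n) (case_nat n \<sigma>))) \<tau>))"
proof -
  note w = env_world[OF e]
  define R where "R w y v n \<longleftrightarrow> forces A w (case_nat y (case_nat v (case_nat n \<sigma>))) \<tau>" for w y v n
  have R_cong: "R w' y v n \<longleftrightarrow> R w' y' v' n'"
    if w': "le w w'" and eqs: "eqw w' y y'" "eqw w' v v'" "eqw w' n n'" for w' y v n y' v' n'
  proof -
    note ww = le_world(2)[OF w'] and ew = env_le[OF e w']
    have T: "y \<in> T0 w'" "v \<in> T0 w'" "n \<in> T0 w'" "y' \<in> T0 w'" "v' \<in> T0 w'" "n' \<in> T0 w'"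
      using eqw_T0[OF ww] eqs by auto
    show ?thesis unfolding R_def
    proof (rule forces_cong[OF A])
      show "\<forall>k. eqw w' (case_nat y (case_nat v (case_nat n \<sigma>)) k) (case_nat y' (case_nat v' (case_nat n' \<sigma>)) k)"
        using eqs eqw_refl[OF ww] env_T(1)[OF ew] by (intro eqw_case) auto
      show "\<forall>k. feq w' (\<tau> k) (\<tau> k)" using feq_refl env_T(2)[OF ew] by blast
    qed (use T ew in \<open>simp_all add: env_case0\<close>)
  qed
  have R_mono: "R w'' y v n" if "R w' y v n" "le w w'" "le w' w''" "y \<in> T0 w'" "v \<in> T0 w'" "n \<in> T0 w'" for w' w'' y v n
    using that unfolding R_def
    by (intro forces_mono[OF wf_fm_M[OF A] _ _ that(3)]) (auto intro!: env_case0 env_le[OF e])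
  define apx where "apx w b n \<longleftrightarrow> eqw w (App b \<^bold>0) a \<and> (\<forall>w'. le w w' \<longrightarrow> (\<forall>i\<in>T0 w'. \<forall>w''. le w' w'' \<longrightarrow>
    lt w'' i n \<longrightarrow> R w'' (App b (succ i)) (App b i) i))" for w b n
  have apxD: "R w' (App b (succ i)) (App b i) i" if "apx w1 b n" "le w1 w'" "lt w' i n" for w1 w' b n i
    using that le_world(3)[OF le_world(2)[OF that(2)]] lt_T0[OF le_world(2)[OF that(2)] that(3)] unfolding apx_def by blast
  have apxI: "apx w1 b n" if "eqw w1 (App b \<^bold>0) a"
    "\<And>w' i. le w1 w' \<Longrightarrow> lt w' i n \<Longrightarrow> R w' (App b (succ i)) (App b i) i" for w1 b n
    unfolding apx_def using that le_trans by blast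
  have apx_mono: "apx w2 b n" if "apx w1 b n" "le w1 w2" for w1 w2 b n
    using that le_eqw[OF that(2)] le_trans[OF that(2)] unfolding apx_def by blast
  \<comment> \<open>Puts \<open>b(i + 1)\<close>, \<open>b(i)\<close>, \<open>i\<close> for the
    three arguments of \<open>A\<close>. The shift by 4 skips \<open>i\<close>, the value, the bound
    and \<open>a\<close>, which precede the variables of \<sigma>; the function variables are
    shifted past \<open>b\<close>.\<close>
  let ?\<rho> = "case_nat (App (FVar 0) (succ (NVar 0))) (case_nat (App (FVar 0) (NVar 0)) (case_nat (NVar 0) (\<lambda>k. NVar (k + 4))))"
  let ?A = "sub_fm ?\<rho> (\<lambda>k. FVar (Suc k)) A"
  let ?B = "Ex1 ((App (FVar 0) \<^bold>0 \<doteq> NVar 2 \<^bold>\<and> All0 (Less (NVar 0) (NVar 2) \<^bold>\<longrightarrow> ?A)) \<^bold>\<and> App (FVar 0) (NVar 1) \<doteq> NVar 0)"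
  have wB: "wf_fm lang_M ?B" using A by (auto intro!: wf_sub_fm split: nat.split)
  have B: "forces ?B w1 (case_nat y (case_nat n (case_nat a \<sigma>))) \<tau> \<longleftrightarrow>
      (\<exists>b\<in>T1 w1. apx w1 b n \<and> eqw w1 (App b n) y)" for w1 y n
  proof -
    have "(\<lambda>k. sub_trm (case_nat i (case_nat y (case_nat n (case_nat a \<sigma>)))) (case_nat b \<tau>) (?\<rho> k)) =
        case_nat (App b (succ i)) (case_nat (App b i) (case_nat i \<sigma>))" for i b
      by (rule HOL.ext) (simp split: nat.split add: numeral_eq_Suc)
    then show ?thesis unfolding apx_def by (simp add: forces_sub R_def numeral_2_eq_2)
  qed
  have exB: "forces (Ex0 ?B) w1 (case_nat n (case_nat a \<sigma>)) \<tau>" if w1: "le w w1" and n: "n \<in> T0 w1" for w1 n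
  proof (rule induct[OF _ _ _ _ n])
    note ww = le_world(2)[OF w1]
    show "wf_fm lang_M (Ex0 ?B)" using wB by simp
    show "env w1 (case_nat a \<sigma>) \<tau>" using env_case0[OF e a] w1 env_le by blast
    obtain b where b: "b \<in> T1 w1" "eqw w1 (App b \<^bold>0) a" using const_fct[OF ww D0_mono[OF w1 a]] by blast
    have "apx w1 b \<^bold>0" by (rule apxI[OF b(2)]) (use not_lt_zero le_world(2) in blast)
    then show "forces (Ex0 ?B) w1 (case_nat \<^bold>0 (case_nat a \<sigma>)) \<tau>"
      unfolding forces.simps(7) B using b D0_mono[OF w1 a] by blast
  next
    fix w2 n assume w2: "le w1 w2" and n: "n \<in> T0 w2" and IH: "forces (Ex0 ?B) w2 (case_nat n (case_nat a \<sigma>)) \<tau>"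
    note ww = le_world(2)[OF w2] and lw = le_trans[OF w1 w2]
    from IH obtain b where b: "b \<in> T1 w2" "apx w2 b n" unfolding forces.simps(7) B by blast
    obtain v where v: "v \<in> T0 w2" "R w2 v (App b n) n" unfolding R_def using ex[OF lw n T0_App[OF b(1) n]] by blast
    have Sn: "succ n \<in> T0 w2" using n by blast
    \<comment> \<open>Setting \<open>b(n + 1)\<close> to the step value \<open>v\<close> does not
      disturb the equations below \<open>n\<close>, which involve arguments up to \<open>n\<close>
      only.\<close>
    obtain b' where b': "b' \<in> T1 w2" and upd: "\<And>w' x. le w2 w' \<Longrightarrow> x \<in> T0 w' \<Longrightarrow>
      (eqw w' x (succ n) \<longrightarrow> eqw w' (App b' x) v) \<and> (\<not> eqw w' x (succ n) \<longrightarrow> eqw w' (App b' x) (App b x))"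
      using update_fct[OF ww b(1) Sn v(1)] by blast
    have "apx w2 b' (succ n)"
    proof (rule apxI)
      have "\<not> eqw w2 \<^bold>0 (succ n)" using peano(1)[OF ww n] eqw_sym[OF ww] by blast
      then have "eqw w2 (App b' \<^bold>0) (App b \<^bold>0)" using upd le_world(3)[OF ww] by blast
      then show "eqw w2 (App b' \<^bold>0) a" using b(2) eqw_trans[OF ww] unfolding apx_def by blast
    next
      fix w3 i assume w3: "le w2 w3" and l: "lt w3 i (succ n)"
      note ww3 = le_world(2)[OF w3] and lw3 = le_trans[OF lw w3]
      have i: "i \<in> T0 w3" using lt_T0[OF ww3 l] by blast
      have n3: "n \<in> T0 w3" using D0_mono[OF w3 n] .
      from lt_succ_cases[OF ww3 l] show "R w3 (App b' (succ i)) (App b' i) i"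
      proof
        assume lt: "lt w3 i n"
        then have "\<not> eqw w3 i (succ n)" "\<not> eqw w3 (succ i) (succ n)"
          using lt_neq[OF ww3 lt] peano(2)[OF ww3] by blast+
        then have "eqw w3 (App b' i) (App b i)" "eqw w3 (App b' (succ i)) (App b (succ i))"
          using upd[OF w3] i by blast+
        then show ?thesis using R_cong[OF lw3 _ _ eqw_refl[OF ww3 i]] apxD[OF b(2) w3 lt] by blast
      next
        assume eq: "eqw w3 i n"
        have "\<not> eqw w3 i (succ n)" using eq neq_succ[OF ww3 n3] eqw_trans[OF ww3] eqw_sym[OF ww3] by blast
        then have "eqw w3 (App b' i) (App b i)" using upd[OF w3] i by blast
        then have 1: "eqw w3 (App b' i) (App b n)"
          using eqw_App[OF ww3 D1_mono[OF w3 b(1)] eq] eqw_trans[OF ww3] by blast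
        have 2: "eqw w3 (App b' (succ i)) v" using upd[OF w3, of "succ i"] eqw_succ[OF ww3 eq] i by blast
        have "R w3 v (App b n) n" by (rule R_mono[OF v(2) lw w3 v(1) _ n]) (use b(1) n in blast)
        then show ?thesis using R_cong[OF lw3 2 1 eq] by blast
      qed
    qed
    then show "forces (Ex0 ?B) w2 (case_nat (succ n) (case_nat a \<sigma>)) \<tau>"
      unfolding forces.simps(7) B using b' eqw_refl[OF ww T0_App[OF b' Sn]] T0_App[OF b' Sn] by blast
  qed
  have agree: "eqw w1 (App b n) (App c n)"
    if w1: "le w w1" and b: "b \<in> T1 w1" "apx w1 b n" and c: "c \<in> T1 w1" "apx w1 c n" and n: "n \<in> T0 w1" for w1 b c n
  proof -
    note ww = le_world(2)[OF w1]
    \<comment> \<open>The induction is on \<open>i\<close> with the bound \<open>n\<close> fixed: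
      agreement at all \<open>i\<close> up to \<open>n\<close>, used in the end at
      \<open>i = n\<close>.\<close>
    let ?C = "Less (NVar 0) (succ (NVar 1)) \<^bold>\<longrightarrow> App (FVar 0) (NVar 0) \<doteq> App (FVar 1) (NVar 0)"
    have "forces ?C w1 (case_nat n (case_nat n nil0)) (case_nat b (case_nat c nil1))"
    proof (rule induct[OF _ _ _ _ n])
      show "env w1 (case_nat n nil0) (case_nat b (case_nat c nil1))" using ww n b(1) c(1) by (simp add: env_cases)
      have "eqw w2 (App b \<^bold>0) (App c \<^bold>0)" if "le w1 w2" for w2
        using b(2) c(2) le_eqw[OF that] eqw_trans[OF ww] eqw_sym[OF ww] unfolding apx_def by blast
      then show "forces ?C w1 (case_nat \<^bold>0 (case_nat n nil0)) (case_nat b (case_nat c nil1))" by simp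
    next
      fix w2 i assume w2: "le w1 w2" and i: "i \<in> T0 w2"
        and IH: "forces ?C w2 (case_nat i (case_nat n nil0)) (case_nat b (case_nat c nil1))"
      have "eqw w3 (App b (succ i)) (App c (succ i))" if w3: "le w2 w3" and l: "lt w3 (succ i) (succ n)" for w3
      proof -
        note w13 = le_trans[OF w2 w3] and ww3 = le_world(2)[OF w3] 
        note lw3 = le_trans[OF w1 w13] and i3 = D0_mono[OF w3 i] and b3 = D1_mono[OF w13 b(1)] and c3 = D1_mono[OF w13 c(1)]
        have n3: "n \<in> T0 w3" using D0_mono[OF w13 n] .
        have lt: "lt w3 i n" "lt w3 i (succ n)" using lt_succI[OF ww3 n3] l by blast+
        then have 1: "eqw w3 (App b i) (App c i)" using IH w3 by simp
        have "R w3 (App b (succ i)) (App c i) i"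
          using apxD[OF b(2) w13 lt(1)] R_cong[OF lw3 eqw_refl[OF ww3] 1 eqw_refl[OF ww3 i3]] b3 i3 by blast
        moreover have "R w3 (App c (succ i)) (App c i) i" using apxD[OF c(2) w13 lt(1)] .
        ultimately show ?thesis
          by (intro un[OF lw3 i3 T0_App[OF c3 i3]]) (use b3 c3 i3 in \<open>auto simp: R_def\<close>)
      qed
      then show "forces ?C w2 (case_nat (succ i) (case_nat n nil0)) (case_nat b (case_nat c nil1))" by simp
    qed simp
    then show ?thesis using lt_succI(1)[OF ww n] le_world(3)[OF ww] by simp
  qed
  have "\<exists>u\<in>T1 w. \<forall>w'. le w w' \<longrightarrow> (\<forall>x\<in>T0 w'. forces ?B w' (case_nat (App u x) (case_nat x (case_nat a \<sigma>))) \<tau>)"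
  proof (rule choice[OF wB env_case0[OF e a]])
    fix w' x assume "le w w'" "x \<in> T0 w'"
    from exB[OF this] show "\<exists>y\<in>T0 w'. forces ?B w' (case_nat y (case_nat x (case_nat a \<sigma>))) \<tau>"
      unfolding forces.simps(7) .
  next
    fix w' x y z
    assume w': "le w w'" and x: "x \<in> T0 w'" and h: "forces ?B w' (case_nat y (case_nat x (case_nat a \<sigma>))) \<tau>"
      "forces ?B w' (case_nat z (case_nat x (case_nat a \<sigma>))) \<tau>"
    from h obtain b c where b: "b \<in> T1 w'" "apx w' b x" "eqw w' (App b x) y"
      and c: "c \<in> T1 w'" "apx w' c x" "eqw w' (App c x) z" unfolding B by blast
    show "eqw w' y z"
      using agree[OF w' b(1,2) c(1,2) x] b(3) c(3) eqw_trans[OF le_world(2)[OF w']] eqw_sym[OF le_world(2)[OF w']] by blast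
  qed
  then obtain u where u: "u \<in> T1 w" and uB: "\<And>w' x. le w w' \<Longrightarrow> x \<in> T0 w' \<Longrightarrow> \<exists>b\<in>T1 w'. apx w' b x \<and> eqw w' (App b x) (App u x)"
    unfolding B by blast
  show ?thesis
  proof (rule bexI[OF _ u], intro conjI allI impI ballI)
    obtain b where "apx w b \<^bold>0" "eqw w (App b \<^bold>0) (App u \<^bold>0)" using uB[OF le_world(3)[OF w] T0_zero] by blast
    then show "eqw w (App u \<^bold>0) a" using eqw_trans[OF w] eqw_sym[OF w] unfolding apx_def by blast
  next
    fix w' n assume w': "le w w'" and n: "n \<in> T0 w'"
    note ww = le_world(2)[OF w']
    have Sn: "succ n \<in> T0 w'" using n by blast
    obtain b where b: "b \<in> T1 w'" "apx w' b (succ n)" "eqw w' (App b (succ n)) (App u (succ n))" using uB[OF w' Sn] by blast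
    obtain c where c: "c \<in> T1 w'" "apx w' c n" "eqw w' (App c n) (App u n)" using uB[OF w' n] by blast
    \<comment> \<open>The value at \<open>n + 1\<close> comes from one approximation and the value
      at \<open>n\<close> from another. The longer approximation is also one up to \<open>n\<close>,
      so both agree there.\<close>
    have bn: "apx w' b n"
    proof (rule apxI)
      show "eqw w' (App b \<^bold>0) a" using b(2) unfolding apx_def by blast
      fix w'' i assume w'': "le w' w''" and l: "lt w'' i n"
      show "R w'' (App b (succ i)) (App b i) i"
        by (rule apxD[OF b(2) w'' lt_succI(2)[OF le_world(2)[OF w''] D0_mono[OF w'' n] l]])
    qed
    have "eqw w' (App b n) (App u n)" using agree[OF w' b(1) bn c(1,2) n] c(3) eqw_trans[OF ww] by blast
    moreover have "R w' (App b (succ n)) (App b n) n"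
      by (rule apxD[OF b(2) le_world(3)[OF ww] lt_succI(1)[OF ww n]])
    ultimately show "forces A w' (case_nat (App u (succ n)) (case_nat (App u n) (case_nat n \<sigma>))) \<tau>"
      using R_cong[OF w' b(3) _ eqw_refl[OF ww n]] unfolding R_def by blast
  qed
qed

text \<open>A distinction between zero and successor, obtained as a recursion whose step ignores the
  previous value.\<close>

lemma cons_fct:
  assumes w: "world w" and a: "a \<in> T0 w" and u: "u \<in> T1 w"
  shows "\<exists>v\<in>T1 w. eqw w (App v \<^bold>0) a \<and> (\<forall>w'. le w w' \<longrightarrow> (\<forall>n\<in>T0 w'. eqw w' (App v (succ n)) (App u n)))"
proof -
  let ?A = "NVar 0 \<doteq> App (FVar 0) (NVar 2)"
  have "\<exists>v\<in>T1 w. eqw w (App v \<^bold>0) a \<and> (\<forall>w'. le w w' \<longrightarrow> (\<forall>n\<in>T0 w'.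
    forces ?A w' (case_nat (App v (succ n)) (case_nat (App v n) (case_nat n nil0))) (case_nat u nil1)))"
  proof (rule prim_rec[OF _ _ a])
    show "env w nil0 (case_nat u nil1)" using w u by (simp add: env_cases)
  next
    fix w' n v assume w': "le w w'" and n: "n \<in> T0 w'"
    note ww = le_world(2)[OF w']
    have "App u n \<in> T0 w'" using D1_mono[OF w' u] n by blast
    then show "\<exists>y\<in>T0 w'. forces ?A w' (case_nat y (case_nat v (case_nat n nil0))) (case_nat u nil1)"
      using eqw_refl[OF ww] by (auto simp: numeral_2_eq_2)
  next
    fix w' n v y z assume w': "le w w'" and h: "forces ?A w' (case_nat y (case_nat v (case_nat n nil0))) (case_nat u nil1)"
      "forces ?A w' (case_nat z (case_nat v (case_nat n nil0))) (case_nat u nil1)"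
    note ww = le_world(2)[OF w']
    have "eqw w' y (App u n)" "eqw w' z (App u n)" using h by (simp_all add: numeral_2_eq_2)
    then show "eqw w' y z" using eqw_trans[OF ww] eqw_sym[OF ww] by blast
  qed simp
  then show ?thesis by (simp add: numeral_2_eq_2)
qed

text \<open>Only values at numerals are prescribed. In this form a finite list of terms enters
  formulas through a single function variable.\<close>

lemma vec_fct:
  assumes w: "world w"
  shows "set ts \<subseteq> T0 w \<Longrightarrow> \<exists>u\<in>T1 w. \<forall>i<length ts. eqw w (App u (num i)) (ts ! i)"
proof (induct ts)
  case Nil
  show ?case using T1_nil by auto
next
  case (Cons t ts)
  then obtain u where u: "u \<in> T1 w" "\<forall>i<length ts. eqw w (App u (num i)) (ts ! i)" by auto
  obtain v where v: "v \<in> T1 w" "eqw w (App v \<^bold>0) t" "\<forall>n\<in>T0 w. eqw w (App v (succ n)) (App u n)"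
    using cons_fct[OF w _ u(1), of t] Cons(2) le_world(3)[OF w] by auto
  have "eqw w (App v (num i)) ((t # ts) ! i)" if "i < length (t # ts)" for i
  proof (cases i)
    case 0 then show ?thesis using v(2) by simp
  next
    case (Suc j)
    then show ?thesis using v(3) u(2) that eqw_trans[OF w] T0_num[of j w] by auto blast
  qed
  then show ?case using v(1) by blast
qed


end

section \<open>The translation\<close>

text \<open>Graphs of terms. In \<open>pg d\<close> the number variable 0 stands for the value and the function variable
  0 for the vector of arguments. Where another formula of this kind is to be used inside a formula, its
  variables are bound afresh and equated with their intended values, so that no renaming is needed.\<close>

abbreviation fapp :: "nat \<Rightarrow> trm \<Rightarrow> trm" where "fapp n t \<equiv> App (FVar n) t"

text \<open>The index \<open>j\<close> is counted below the quantifier: from outside, the vector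
  read by \<open>A\<close> is function variable \<open>j - 1\<close>, and the vector whose entry
  \<open>i\<close> is described is function variable 0.\<close>

definition argc :: "nat \<Rightarrow> nat \<Rightarrow> fm \<Rightarrow> fm" where
  "argc j i A = Ex1 (All0 (fapp 0 (NVar 0) \<doteq> fapp j (NVar 0)) \<^bold>\<and>
     Ex0 (NVar 0 \<doteq> fapp 1 (num i) \<^bold>\<and> A))"

fun argcs :: "nat \<Rightarrow> nat \<Rightarrow> fm list \<Rightarrow> fm" where
  "argcs j i [] = (\<^bold>0 \<doteq> \<^bold>0)"
| "argcs j i (A # As) = (argc j i A \<^bold>\<and> argcs j (Suc i) As)"

text \<open>The recursion equation at successors for function variable 0. In \<open>A\<close> the
  number variables 0, 1, 2 are the new value, the previous value and the argument.\<close>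

definition recf :: "fm \<Rightarrow> fm" where
  "recf A = All0 (Ex0 (NVar 0 \<doteq> fapp 0 (NVar 1) \<^bold>\<and>
     Ex0 (NVar 0 \<doteq> fapp 0 (succ (NVar 2)) \<^bold>\<and> A)))"

definition tailf :: "nat \<Rightarrow> fm \<Rightarrow> fm" where
  "tailf j A = Ex1 (All0 (fapp 0 (NVar 0) \<doteq> fapp j (succ (NVar 0))) \<^bold>\<and> Ex0 (NVar 0 \<doteq> fapp 1 \<^bold>0 \<^bold>\<and> A))"

text \<open>The step of a recursion takes the argument, the previous value and the parameters. So
  entry 0 of the given vector, the number at which the recursion is evaluated, is replaced by two
  new entries.\<close>

definition stepf :: "nat \<Rightarrow> fm \<Rightarrow> fm" where
  "stepf j A = Ex1 (fapp 0 \<^bold>0 \<doteq> NVar 2 \<^bold>\<and> fapp 0 \<^bold>1 \<doteq> NVar 1 \<^bold>\<and>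
     All0 (fapp 0 (succ (succ (NVar 0))) \<doteq> fapp j (succ (NVar 0))) \<^bold>\<and> A)"

fun pg :: "prd \<Rightarrow> fm" where
  "pg (ZeroD n) = (NVar 0 \<doteq> \<^bold>0)"
| "pg SuccD = (NVar 0 \<doteq> succ (fapp 0 \<^bold>0))"
| "pg (ProjD n i) = (NVar 0 \<doteq> fapp 0 (num i))"
| "pg (CompD n h gs) = Ex1 (argcs 2 0 (map pg gs) \<^bold>\<and> pg h)"
| "pg (RecD g h) = Ex1 (tailf 2 (pg g) \<^bold>\<and> recf (stepf 2 (pg h)) \<^bold>\<and> NVar 0 \<doteq> fapp 0 (fapp 1 \<^bold>0))"

text \<open>The pairing of the recursor axioms rewritten as one binary description, with the
  constants 2 and 3 as binary functions. Its graph is then an instance of \<open>pg\<close>.\<close>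

definition twoD :: prd where "twoD = CompD 2 SuccD [CompD 2 SuccD [ZeroD 2]]"
definition threeD :: prd where "threeD = CompD 2 SuccD [twoD]"
definition pairD :: prd where
  "pairD = CompD 2 mulD [CompD 2 expD [ProjD 2 0, twoD], CompD 2 expD [ProjD 2 1, threeD]]"

text \<open>The previous value is entry 0 and the argument entry 1, in the order in which the
  recursor axiom pairs them.\<close>

definition stepr :: "nat \<Rightarrow> fm" where
  "stepr j = Ex1 (fapp 0 \<^bold>0 \<doteq> NVar 1 \<^bold>\<and> fapp 0 \<^bold>1 \<doteq> NVar 2 \<^bold>\<and> Ex0 (pg pairD \<^bold>\<and> NVar 1 \<doteq> fapp j (NVar 0)))"

text \<open>Here the function variable 0 stands for the vector of number arguments and the function variable
  1 for the function argument, if there is one.\<close>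

fun cg :: "cst \<Rightarrow> fm" where
  "cg Zero = (NVar 0 \<doteq> \<^bold>0)"
| "cg (Fn d) = pg d"
| "cg (Kl k) = (if arity_klc k = (1, 1) then NVar 0 \<doteq> kf k (fapp 0 \<^bold>0) (FVar 1)
     else NVar 0 \<doteq> k2 k (fapp 0 \<^bold>0) (fapp 0 \<^bold>1))"
| "cg Rec = Ex1 (fapp 0 \<^bold>0 \<doteq> fapp 1 \<^bold>0 \<^bold>\<and> recf (stepr 3) \<^bold>\<and> NVar 0 \<doteq> fapp 0 (fapp 1 \<^bold>1))"

text \<open>For the passage under a \<lambda>: the new number variable becomes entry 0 of the
  sequence of values and the others move up, as the de Bruijn indices do.\<close>

definition consf :: "fm \<Rightarrow> fm" where
  "consf A = Ex1 (fapp 0 \<^bold>0 \<doteq> NVar 1 \<^bold>\<and> All0 (fapp 0 (succ (NVar 0)) \<doteq> fapp 1 (NVar 0)) \<^bold>\<and> A)"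

definition fcg :: "cst \<Rightarrow> fm" where
  "fcg c = (case c of Kl k \<Rightarrow> NVar 0 \<doteq> App (FC c) (NVar 1)
     | Fn d \<Rightarrow> Ex1 (fapp 0 \<^bold>0 \<doteq> NVar 1 \<^bold>\<and> pg d) | _ \<Rightarrow> \<^bold>0 \<doteq> \<^bold>0)"

text \<open>The head of the list carries all the information, for a constant takes at most one
  function argument.\<close>

fun gfun :: "fm list \<Rightarrow> fm" where
  "gfun [] = (\<^bold>0 \<doteq> \<^bold>0)"
| "gfun (A # As) = All0 (Ex1 (All0 (fapp 0 (NVar 0) \<doteq> fapp 2 (NVar 0)) \<^bold>\<and>
     Ex0 (NVar 0 \<doteq> fapp 1 (NVar 1) \<^bold>\<and> A)))"

text \<open>In \<open>gr E t\<close> the number variable 0 stands for the value, the function variable 0 for the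
  sequence of the values of the number variables of \<open>t\<close>, and the function variables of \<open>t\<close> are
  shifted by \<open>E\<close>. In \<open>gf E u\<close> the number variable 1 stands for the argument.\<close>

fun gr :: "nat \<Rightarrow> trm \<Rightarrow> fm" and gf :: "nat \<Rightarrow> fct \<Rightarrow> fm" where
  "gr E (NVar n) = (NVar 0 \<doteq> fapp 0 (num n))"
| "gr E (Cst c ts us) =
     Ex1 (gfun (map (gf (E + 2)) us) \<^bold>\<and> Ex1 (argcs 3 0 (map (gr (E + 3)) ts) \<^bold>\<and> cg c))"
| "gr E (App u t) = Ex0 (gr E t \<^bold>\<and> Ex0 (NVar 0 \<doteq> NVar 2 \<^bold>\<and> gf E u))"
| "gf E (FVar n) = (NVar 0 \<doteq> fapp (n + E) (NVar 1))"
| "gf E (FC c) = fcg c"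
| "gf E (Lam t) = consf (gr (E + 1) t)"

text \<open>On terms of the larger language this is membership in the language of \<open>M\<close>.
  Leaving arities aside makes it a plain recursion on codes.\<close>

fun mt :: "trm \<Rightarrow> bool" and mf :: "fct \<Rightarrow> bool" where
  "mt (NVar n) = True"
| "mt (Cst c ts us) = (c \<in> lang_M \<and> (\<forall>t\<in>set ts. mt t) \<and> (\<forall>u\<in>set us. mf u))"
| "mt (App u t) = (mf u \<and> mt t)"
| "mf (FVar n) = True"
| "mf (FC c) = (c \<in> lang_M)"
| "mf (Lam t) = mt t"

fun envc :: "nat \<Rightarrow> fm" where
  "envc 0 = (\<^bold>0 \<doteq> \<^bold>0)"
| "envc (Suc n) = (fapp 0 (num n) \<doteq> NVar n \<^bold>\<and> envc n)"

fun tr :: "fm \<Rightarrow> fm" where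
  "tr (s \<doteq> t) = (if mt s \<and> mt t then s \<doteq> t else
     \<comment> \<open>the Goedel number is a bound for the number variables\<close>
     Ex1 (envc (Suc (gn_fm (s \<doteq> t))) \<^bold>\<and> Ex0 (gr 1 s \<^bold>\<and> gr 1 t)))"
| "tr (\<^bold>\<not> A) = (\<^bold>\<not> tr A)"
| "tr (A \<^bold>\<and> B) = (tr A \<^bold>\<and> tr B)"
| "tr (A \<^bold>\<or> B) = (tr A \<^bold>\<or> tr B)"
| "tr (A \<^bold>\<longrightarrow> B) = (tr A \<^bold>\<longrightarrow> tr B)"
| "tr (All0 A) = All0 (tr A)"
| "tr (Ex0 A) = Ex0 (tr A)"
| "tr (All1 A) = All1 (tr A)"
| "tr (Ex1 A) = Ex1 (tr A)"

section \<open>Language and variables of the translation\<close>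

lemma mt_M: "wf_trm lang_EL_plus t \<Longrightarrow> mt t \<longleftrightarrow> wf_trm lang_M t"
  "wf_fct lang_EL_plus u \<Longrightarrow> mf u \<longleftrightarrow> wf_fct lang_M u"
  by (induct t and u rule: trm.induct fct.induct) auto

lemma lang_M_EL: "lang_M \<subseteq> lang_EL_plus"
  by (auto simp: lang_M_def lang_EL_plus_def lang_HA1_def)

lemma wf_M_EL: "wf_trm lang_M t \<Longrightarrow> wf_trm lang_EL_plus t" "wf_fct lang_M u \<Longrightarrow> wf_fct lang_EL_plus u"
  using lang_M_EL by (induct t and u rule: trm.induct fct.induct) auto

lemma wf_fm_M_EL: "wf_fm lang_M A \<Longrightarrow> wf_fm lang_EL_plus A"
  by (induct A) (auto intro: wf_M_EL)

lemma tr_M: "wf_fm lang_M A \<Longrightarrow> tr A = A"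
  by (induct A) (auto simp: mt_M wf_M_EL)

lemma wf_argcs: "(\<And>A. A \<in> set As \<Longrightarrow> wf_fm lang_M A) \<Longrightarrow> wf_fm lang_M (argcs j i As)"
  by (induct As arbitrary: i) (auto simp: argc_def)

lemma wf_pg [simp]: "wf_fm lang_M (pg d)"
  by (induct d) (auto simp: recf_def tailf_def stepf_def intro!: wf_argcs)

lemma wf_cg: "arity c \<noteq> (1, 0) \<Longrightarrow> wf_fm lang_M (cg c)"
proof (cases c)
  case (Kl k) then show "arity c \<noteq> (1, 0) \<Longrightarrow> ?thesis" by (cases k) auto
qed (auto simp: recf_def stepr_def)

lemma wf_fcg: "arity c = (1, 0) \<Longrightarrow> wf_fm lang_M (fcg c)"
  by (auto simp: fcg_def split: cst.split)

lemma wf_gfun: "(\<And>A. A \<in> set As \<Longrightarrow> wf_fm lang_M A) \<Longrightarrow> wf_fm lang_M (gfun As)"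
  by (cases As) auto

lemma wf_gr: "wf_trm L t \<Longrightarrow> wf_fm lang_M (gr E t)" "wf_fct L u \<Longrightarrow> wf_fm lang_M (gf E u)"
  by (induct t and u arbitrary: E and E rule: trm.induct fct.induct)
    (auto simp: consf_def wf_fcg wf_cg intro!: wf_argcs wf_gfun)

lemma wf_envc: "wf_fm lang_M (envc n)"
  by (induct n) auto

lemma wf_tr: "wf_fm lang_EL_plus A \<Longrightarrow> wf_fm lang_M (tr A)"
  by (induct A) (auto simp: mt_M wf_gr wf_envc)

text \<open>Pairing dominates its components, so a variable index never exceeds a code in which it
  occurs. Under a \<lambda> the free indices decrease by one and stay below the bound.\<close>

lemma vt_gn: "gn_trm t < N \<Longrightarrow> vt (below N) (\<lambda>_. True) t" "gn_fct u < N \<Longrightarrow> vu (below N) (\<lambda>_. True) u"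
proof (induct t and u arbitrary: N and N rule: trm.induct fct.induct)
  case (NVar n)
  then show ?case using le_prod_encode_2[of n 0] by (simp add: tag_def)
next
  case (Cst c ts us)
  have le: "x \<le> list_encode xs" if "x \<in> set xs" for x xs
    using that
  proof (induct xs)
    case (Cons y ys)
    then show ?case using le_prod_encode_1[of y "list_encode ys"] le_prod_encode_2[of "list_encode ys" y] by fastforce
  qed simp
  let ?p = "prod_encode (list_encode (map gn_trm ts), list_encode (map gn_fct us))"
  have "?p \<le> gn_trm (Cst c ts us)"
    using le_prod_encode_2[of ?p "gn_cst c"] le_prod_encode_2[of "prod_encode (gn_cst c, ?p)" 1] by (simp add: tag_def)
  then have p: "list_encode (map gn_trm ts) < N" "list_encode (map gn_fct us) < N"
    using Cst(3) le_prod_encode_1 le_prod_encode_2 by (meson le_less_trans)+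
  have "gn_trm t < N" if "t \<in> set ts" for t using le[of "gn_trm t" "map gn_trm ts"] p that by fastforce
  moreover have "gn_fct u < N" if "u \<in> set us" for u using le[of "gn_fct u" "map gn_fct us"] p that by fastforce
  ultimately show ?case using Cst(1,2) by simp
next
  case (App u t)
  have "prod_encode (gn_fct u, gn_trm t) < N"
    using App(3) le_prod_encode_2[of "prod_encode (gn_fct u, gn_trm t)" 2] by (simp add: tag_def)
  then show ?case using App(1,2) le_prod_encode_1 le_prod_encode_2 by (metis le_less_trans vt.simps(3))
next
  case (Lam t)
  have "gn_trm t < N" using Lam(2) le_prod_encode_2[of "gn_trm t" 2] by (simp add: tag_def)
  from Lam(1)[OF this] have "vt (case_nat True (below N)) (\<lambda>_. True) t"
    by (rule vt_mono(1)[rotated 2]) (auto split: nat.split)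
  then show ?case by simp
qed auto


section \<open>The expanded model\<close>

type_synonym elt = "world \<Rightarrow> trm set"

context ext_M
begin

text \<open>An element over a world \<open>w\<close> is the family of the equality classes of one term in the worlds
  above \<open>w\<close>. Elements with values chosen world by world exist by uniqueness of the values.\<close>

definition rep :: "world \<Rightarrow> trm \<Rightarrow> elt \<Rightarrow> bool" where
  "rep w t x \<longleftrightarrow> t \<in> T0 w \<and> (\<forall>w'. le w w' \<longrightarrow> x w' = {s. eqw w' t s})"

text \<open>The functions of the expansion act on elements rather than on terms; a representing
  functor constrains them only at elements that have representatives.\<close>

definition frep :: "world \<Rightarrow> fct \<Rightarrow> (elt \<Rightarrow> elt) \<Rightarrow> bool" where
  "frep w u f \<longleftrightarrow> u \<in> T1 w \<and> (\<forall>w' t x. le w w' \<longrightarrow> rep w' t x \<longrightarrow> rep w' (App u t) (f x))"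

definition cls :: "trm \<Rightarrow> elt" where "cls t = (\<lambda>w. {s. eqw w t s})"

lemma rep_T0: "rep w t x \<Longrightarrow> t \<in> T0 w" by (simp add: rep_def)
lemma frep_T1: "frep w u f \<Longrightarrow> u \<in> T1 w" by (simp add: frep_def)

lemma rep_mono: "rep w t x \<Longrightarrow> le w w' \<Longrightarrow> rep w' t x"
  unfolding rep_def using le_trans D0_mono by blast

lemma frep_mono: "frep w u f \<Longrightarrow> le w w' \<Longrightarrow> frep w' u f"
  unfolding frep_def using le_trans D1_mono by blast

lemma frepD: "world w \<Longrightarrow> frep w u f \<Longrightarrow> rep w t x \<Longrightarrow> rep w (App u t) (f x)"
  unfolding frep_def using le_world(3) by blast

lemma rep_cls: "t \<in> T0 w \<Longrightarrow> rep w t (cls t)"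
  by (simp add: rep_def cls_def)

lemma class_eq:
  assumes w: "world w" and s: "s \<in> T0 w"
  shows "{r. eqw w s r} = {r. eqw w t r} \<longleftrightarrow> eqw w s t"
proof
  assume "{r. eqw w s r} = {r. eqw w t r}"
  then have "eqw w t s" using eqw_refl[OF w s] by blast
  then show "eqw w s t" by (rule eqw_sym[OF w])
next
  assume "eqw w s t"
  then show "{r. eqw w s r} = {r. eqw w t r}" using eqw_trans[OF w] eqw_sym[OF w] by blast
qed

lemma rep_eq: "world w \<Longrightarrow> rep w s x \<Longrightarrow> rep w t y \<Longrightarrow> x w = y w \<longleftrightarrow> eqw w s t"
  using class_eq le_world(3) unfolding rep_def by metis

lemma rep_iff:
  assumes w: "world w" and x: "rep w s x"
  shows "rep w t x \<longleftrightarrow> eqw w s t"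
proof
  assume "rep w t x" then show "eqw w s t" using rep_eq[OF w x] by blast
next
  assume e: "eqw w s t"
  have "{r. eqw w' s r} = {r. eqw w' t r}" if "le w w'" for w'
    using class_eq[OF le_world(2)[OF that]] le_eqw[OF that e] le_T0[OF that] rep_T0[OF x] by blast
  then show "rep w t x" using x eqw_T0[OF w e] unfolding rep_def by blast
qed

lemma eqw_left: "world w \<Longrightarrow> eqw w s t \<Longrightarrow> eqw w s y \<longleftrightarrow> eqw w t y"
  using eqw_trans eqw_sym by blast

lemma rep_unique: "world w \<Longrightarrow> rep w s x \<Longrightarrow> eqw w y s \<longleftrightarrow> rep w y x"
  using rep_iff eqw_sym by blast

lemma rep_eqw: "world w \<Longrightarrow> rep w s x \<Longrightarrow> eqw w s t \<Longrightarrow> rep w t x"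
  using rep_iff by blast

lemma rep_eqw': "world w \<Longrightarrow> rep w s x \<Longrightarrow> eqw w t s \<Longrightarrow> rep w t x"
  using rep_iff eqw_sym by blast

lemma repI:
  assumes t: "t \<in> T0 w" and P: "\<And>w'. le w w' \<Longrightarrow> x w' = {s. eqw w' t s}"
  shows "rep w t x"
  using assms by (simp add: rep_def)

section \<open>Recursion on elements\<close>

definition pru :: "world \<Rightarrow> fct \<Rightarrow> elt \<Rightarrow> (elt \<Rightarrow> elt \<Rightarrow> elt) \<Rightarrow> bool" where
  "pru w u a h \<longleftrightarrow> u \<in> T1 w \<and> rep w (App u \<^bold>0) a \<and> (\<forall>w' n xn xv. le w w' \<longrightarrow> rep w' n xn \<longrightarrow>
     rep w' (App u n) xv \<longrightarrow> rep w' (App u (succ n)) (h xn xv))"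

text \<open>Defined in each world from all solutions of the recursion present there. Since solutions
  agree pointwise, the set is a single class as soon as one solution exists, and no choice of a
  solution enters.\<close>

definition PR :: "elt \<Rightarrow> (elt \<Rightarrow> elt \<Rightarrow> elt) \<Rightarrow> elt \<Rightarrow> elt" where
  "PR a h s = (\<lambda>w. {y. \<exists>u t. pru w u a h \<and> rep w t s \<and> eqw w (App u t) y})"

lemma pru_mono: "pru w u a h \<Longrightarrow> le w w' \<Longrightarrow> pru w' u a h"
  unfolding pru_def using le_trans D1_mono rep_mono by blast

lemma pru_unique:
  assumes w: "world w" and u: "pru w u a h" and v: "pru w v a h" and n: "n \<in> T0 w"
  shows "eqw w (App u n) (App v n)"
proof -
  have uv: "u \<in> T1 w" "v \<in> T1 w" using u v by (auto simp: pru_def)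
  let ?A = "fapp 0 (NVar 0) \<doteq> fapp 1 (NVar 0)"
  have "forces ?A w (case_nat n nil0) (case_nat u (case_nat v nil1))"
  proof (rule induct[OF _ _ _ _ n])
    show "env w nil0 (case_nat u (case_nat v nil1))" using w uv by (simp add: env_cases)
    have "rep w (App u \<^bold>0) a" "rep w (App v \<^bold>0) a" using u v by (auto simp: pru_def)
    then have "eqw w (App u \<^bold>0) (App v \<^bold>0)" using rep_iff[OF w] by blast
    then show "forces ?A w (case_nat \<^bold>0 nil0) (case_nat u (case_nat v nil1))" by simp
  next
    fix w' n assume w': "le w w'" and n: "n \<in> T0 w'" and IH: "forces ?A w' (case_nat n nil0) (case_nat u (case_nat v nil1))"
    note ww = le_world(2)[OF w']
    have e: "eqw w' (App u n) (App v n)" using IH by simp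
    have r: "rep w' (App u n) (cls (App u n))" using rep_cls D1_mono[OF w' uv(1)] n by blast
    have "rep w' (App u (succ n)) (h (cls n) (cls (App u n)))" "rep w' (App v (succ n)) (h (cls n) (cls (App u n)))"
      using u v r rep_eqw[OF ww r e] rep_cls[OF n] w' unfolding pru_def by blast+
    then have "eqw w' (App u (succ n)) (App v (succ n))" using rep_iff[OF ww] by blast
    then show "forces ?A w' (case_nat (succ n) nil0) (case_nat u (case_nat v nil1))" by simp
  qed simp
  then show ?thesis by simp
qed

lemma PR_rep:
  assumes w: "world w" and u: "pru w u a h" and t: "rep w t s"
  shows "rep w (App u t) (PR a h s)"
proof (rule repI)
  have uT: "u \<in> T1 w" using u by (simp add: pru_def)
  show "App u t \<in> T0 w" using uT rep_T0[OF t] by blast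
  fix w' assume w': "le w w'"
  note ww = le_world(2)[OF w']
  have "eqw w' (App v r) y \<longleftrightarrow> eqw w' (App u t) y" if "pru w' v a h" "rep w' r s" for v r y
  proof -
    have "eqw w' r t" using rep_iff[OF ww that(2)] rep_mono[OF t w'] by blast
    then have "eqw w' (App v r) (App v t)" using eqw_App[OF ww] that(1) by (auto simp: pru_def)
    moreover have "eqw w' (App v t) (App u t)"
      using pru_unique[OF ww that(1) pru_mono[OF u w']] rep_T0[OF t] le_T0[OF w'] by blast
    ultimately show ?thesis using eqw_trans[OF ww] eqw_sym[OF ww] by blast
  qed
  then show "PR a h s w' = {s. eqw w' (App u t) s}"
    unfolding PR_def using pru_mono[OF u w'] rep_mono[OF t w'] by blast
qed

text \<open>The recursion principle of the worlds needs a formula for the step, whereas the step on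
  elements is a function. The last hypothesis links them: \<open>A\<close> defines the graph of
  \<open>h\<close>.\<close>

lemma pru_exists:
  assumes A: "wf_fm lang_M A" and e: "env w \<sigma> \<tau>" and a: "rep w ta a"
    and ex: "\<And>w' n v xn xv. le w w' \<Longrightarrow> rep w' n xn \<Longrightarrow> rep w' v xv \<Longrightarrow> \<exists>y. rep w' y (h xn xv)"
    and A_h: "\<And>w' n v y xn xv. le w w' \<Longrightarrow> rep w' n xn \<Longrightarrow> rep w' v xv \<Longrightarrow> y \<in> T0 w' \<Longrightarrow>
      forces A w' (case_nat y (case_nat v (case_nat n \<sigma>))) \<tau> \<longleftrightarrow> rep w' y (h xn xv)"
  shows "\<exists>u. pru w u a h"
proof -
  note w = env_world[OF e]
  have "\<exists>u\<in>T1 w. eqw w (App u \<^bold>0) ta \<and> (\<forall>w'. le w w' \<longrightarrow> (\<forall>n\<in>T0 w'.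
    forces A w' (case_nat (App u (succ n)) (case_nat (App u n) (case_nat n \<sigma>))) \<tau>))"
  proof (rule prim_rec[OF A e rep_T0[OF a]])
    fix w' n v assume h: "le w w'" "n \<in> T0 w'" "v \<in> T0 w'"
    obtain y where y: "rep w' y (h (cls n) (cls v))" using ex[OF h(1) rep_cls[OF h(2)] rep_cls[OF h(3)]] by blast
    then show "\<exists>y\<in>T0 w'. forces A w' (case_nat y (case_nat v (case_nat n \<sigma>))) \<tau>"
      using A_h[OF h(1) rep_cls[OF h(2)] rep_cls[OF h(3)] rep_T0[OF y]] rep_T0[OF y] by blast
  next
    fix w' n v y z assume h: "le w w'" "n \<in> T0 w'" "v \<in> T0 w'" "y \<in> T0 w'" "z \<in> T0 w'"
      and f: "forces A w' (case_nat y (case_nat v (case_nat n \<sigma>))) \<tau>" "forces A w' (case_nat z (case_nat v (case_nat n \<sigma>))) \<tau>"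
    show "eqw w' y z"
      using f A_h[OF h(1) rep_cls[OF h(2)] rep_cls[OF h(3)] h(4)] A_h[OF h(1) rep_cls[OF h(2)] rep_cls[OF h(3)] h(5)]
        rep_iff[OF le_world(2)[OF h(1)]] by blast
  qed
  then obtain u where u: "u \<in> T1 w" "eqw w (App u \<^bold>0) ta" and st: "\<And>w' n. le w w' \<Longrightarrow> n \<in> T0 w' \<Longrightarrow>
    forces A w' (case_nat (App u (succ n)) (case_nat (App u n) (case_nat n \<sigma>))) \<tau>" by blast
  have "rep w' (App u (succ n)) (h xn xv)" if h: "le w w'" "rep w' n xn" "rep w' (App u n) xv" for w' n xn xv
    using st[OF h(1) rep_T0[OF h(2)]] A_h[OF h] D1_mono[OF h(1) u(1)] rep_T0[OF h(2)] by blast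
  then show ?thesis using u rep_eqw'[OF w a] unfolding pru_def by blast
qed

section \<open>Values of constants and terms\<close>

definition sucv :: "elt \<Rightarrow> elt" where
  "sucv x = (\<lambda>w. {y. \<exists>t. rep w t x \<and> eqw w (succ t) y})"

fun pv :: "prd \<Rightarrow> elt list \<Rightarrow> elt" where
  "pv (ZeroD n) xs = cls \<^bold>0"
| "pv SuccD xs = sucv (xs ! 0)"
| "pv (ProjD n i) xs = xs ! i"
| "pv (CompD n h gs) xs = pv h (map (\<lambda>g. pv g xs) gs)"
| "pv (RecD g h) xs = PR (pv g (tl xs)) (\<lambda>n v. pv h (n # v # tl xs)) (hd xs)"

fun ic :: "cst \<Rightarrow> elt list \<Rightarrow> (elt \<Rightarrow> elt) list \<Rightarrow> elt" where
  "ic Zero xs fs = cls \<^bold>0"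
| "ic (Fn d) xs fs = pv d xs"
| "ic (Kl k) xs fs = (\<lambda>w. {y.
     if arity_klc k = (1, 0) then \<exists>t. rep w t (xs ! 0) \<and> eqw w (k1 k t) y
     else if arity_klc k = (1, 1) then \<exists>t u. rep w t (xs ! 0) \<and> frep w u (fs ! 0) \<and> eqw w (kf k t u) y
     else \<exists>s t. rep w s (xs ! 0) \<and> rep w t (xs ! 1) \<and> eqw w (k2 k s t) y})"
| "ic Rec xs fs = PR (xs ! 0) (\<lambda>n v. (fs ! 0) (pv pairD [v, n])) (xs ! 1)"

text \<open>Values are defined without regard to existence, which keeps them independent of the
  world. That they are represented over a given world is a separate matter, settled together with
  the correctness of the graphs.\<close>

fun val0 :: "(nat \<Rightarrow> elt) \<Rightarrow> (nat \<Rightarrow> elt \<Rightarrow> elt) \<Rightarrow> trm \<Rightarrow> elt"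
  and val1 :: "(nat \<Rightarrow> elt) \<Rightarrow> (nat \<Rightarrow> elt \<Rightarrow> elt) \<Rightarrow> fct \<Rightarrow> elt \<Rightarrow> elt" where
  "val0 e f (NVar n) = e n"
| "val0 e f (Cst c ts us) = ic c (map (val0 e f) ts) (map (val1 e f) us)"
| "val0 e f (App u t) = val1 e f u (val0 e f t)"
| "val1 e f (FVar n) = f n"
| "val1 e f (FC c) = (\<lambda>x. ic c [x] [])"
| "val1 e f (Lam t) = (\<lambda>x. val0 (case_nat x e) f t)"

lemma val_ren:
  "val0 e f (ren_trm r q t) = val0 (\<lambda>n. e (r n)) (\<lambda>n. f (q n)) t"
  "val1 e f (ren_fct r q u) = val1 (\<lambda>n. e (r n)) (\<lambda>n. f (q n)) u"
proof (induct t and u arbitrary: e f r q and e f r q rule: trm.induct fct.induct)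
  case (Lam t)
  have "(\<lambda>n. case_nat x e (up_ren r n)) = case_nat x (\<lambda>n. e (r n))" for x
    by (rule HOL.ext) (simp add: up_ren_def split: nat.split)
  then show ?case by (simp add: Lam)
qed (auto simp: comp_def cong: map_cong)

lemma val_sub:
  "val0 e f (sub_trm \<sigma> \<tau> t) = val0 (\<lambda>n. val0 e f (\<sigma> n)) (\<lambda>n. val1 e f (\<tau> n)) t"
  "val1 e f (sub_fct \<sigma> \<tau> u) = val1 (\<lambda>n. val0 e f (\<sigma> n)) (\<lambda>n. val1 e f (\<tau> n)) u"
proof (induct t and u arbitrary: e f \<sigma> \<tau> and e f \<sigma> \<tau> rule: trm.induct fct.induct)
  case (Lam t)
  have "(\<lambda>n. val0 (case_nat x e) f (up0_trm \<sigma> n)) = case_nat x (\<lambda>n. val0 e f (\<sigma> n))"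
    "(\<lambda>n. val1 (case_nat x e) f (up0_fct \<tau> n)) = (\<lambda>n. val1 e f (\<tau> n))" for x
    by (rule HOL.ext, simp add: up0_trm_def up0_fct_def val_ren split: nat.split)+
  then show ?case by (simp add: Lam)
qed (auto simp: comp_def cong: map_cong)

lemma rep_succ:
  assumes w: "world w" and t: "rep w t x"
  shows "rep w (succ t) (sucv x)"
proof (rule repI)
  show "succ t \<in> T0 w" using rep_T0[OF t] by blast
  fix w' assume w': "le w w'"
  note ww = le_world(2)[OF w']
  have "eqw w' (succ r) y \<longleftrightarrow> eqw w' (succ t) y" if "rep w' r x" for r y
    by (rule eqw_left[OF ww eqw_succ[OF ww]]) (use rep_iff[OF ww that] rep_mono[OF t w'] in blast)
  then show "sucv x w' = {s. eqw w' (succ t) s}" unfolding sucv_def using rep_mono[OF t w'] by blast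
qed

lemma frep_feq: "world w \<Longrightarrow> frep w u f \<Longrightarrow> frep w v f \<Longrightarrow> feq w u v"
  unfolding feq_def
  using frep_T1 frepD[OF le_world(2) frep_mono rep_cls] rep_iff[OF le_world(2)] by meson

lemma rep_k1:
  assumes w: "world w" and k: "arity_klc k = (1, 0)" and t: "rep w t x"
  shows "rep w (k1 k t) (ic (Kl k) [x] fs)"
proof (rule repI)
  show "k1 k t \<in> T0 w" using rep_T0[OF t] k by blast
  fix w' assume w': "le w w'"
  note ww = le_world(2)[OF w']
  have "eqw w' (k1 k r) y \<longleftrightarrow> eqw w' (k1 k t) y" if "rep w' r x" for r y
    by (rule eqw_left[OF ww eqw_App[OF ww T1_Kl[OF k]]]) (use rep_iff[OF ww that] rep_mono[OF t w'] in blast)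
  moreover have "ic (Kl k) [x] fs w' = {y. \<exists>t. rep w' t x \<and> eqw w' (k1 k t) y}" by (simp add: k)
  ultimately show "ic (Kl k) [x] fs w' = {s. eqw w' (k1 k t) s}" using rep_mono[OF t w'] by blast
qed

lemma rep_k2:
  assumes w: "world w" and k: "arity_klc k = (2, 0)" and s: "rep w s x" and t: "rep w t y"
  shows "rep w (k2 k s t) (ic (Kl k) [x, y] fs)"
proof (rule repI)
  show "k2 k s t \<in> T0 w" using rep_T0[OF s] rep_T0[OF t] k by blast
  fix w' assume w': "le w w'"
  note ww = le_world(2)[OF w']
  have "eqw w' (k2 k s' t') z \<longleftrightarrow> eqw w' (k2 k s t) z" if "rep w' s' x" "rep w' t' y" for s' t' z
    by (rule eqw_left[OF ww eqw_k2[OF ww k]])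
      (use rep_iff[OF ww that(1)] rep_iff[OF ww that(2)] rep_mono[OF s w'] rep_mono[OF t w'] in blast)+
  moreover have "ic (Kl k) [x, y] fs w' = {z. \<exists>s t. rep w' s x \<and> rep w' t y \<and> eqw w' (k2 k s t) z}" by (simp add: k)
  ultimately show "ic (Kl k) [x, y] fs w' = {r. eqw w' (k2 k s t) r}"
    using rep_mono[OF s w'] rep_mono[OF t w'] by blast
qed

text \<open>Functors representing the same function are extensionally equal; here the extensionality
  of the functionals is what makes the value a single class.\<close>

lemma rep_kf:
  assumes w: "world w" and k: "arity_klc k = (1, 1)" and t: "rep w t x" and u: "frep w u f"
  shows "rep w (kf k t u) (ic (Kl k) [x] [f])"
proof (rule repI)
  show "kf k t u \<in> T0 w" using rep_T0[OF t] frep_T1[OF u] k by blast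
  fix w' assume w': "le w w'"
  note ww = le_world(2)[OF w']
  have "eqw w' (kf k t' u') z \<longleftrightarrow> eqw w' (kf k t u) z" if "rep w' t' x" "frep w' u' f" for t' u' z
    by (rule eqw_left[OF ww eqw_kf[OF k ww frep_feq[OF ww that(2) frep_mono[OF u w']]]])
      (use rep_iff[OF ww that(1)] rep_mono[OF t w'] in blast)
  moreover have "ic (Kl k) [x] [f] w' = {z. \<exists>t u. rep w' t x \<and> frep w' u f \<and> eqw w' (kf k t u) z}" by (simp add: k)
  ultimately show "ic (Kl k) [x] [f] w' = {r. eqw w' (kf k t u) r}"
    using rep_mono[OF t w'] frep_mono[OF u w'] by blast
qed

section \<open>Correctness of the graph formulas of constants\<close>

definition vrep :: "world \<Rightarrow> fct \<Rightarrow> elt list \<Rightarrow> bool" where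
  "vrep w u xs \<longleftrightarrow> u \<in> T1 w \<and> (\<forall>i<length xs. rep w (App u (num i)) (xs ! i))"

lemma vrep_mono: "vrep w u xs \<Longrightarrow> le w w' \<Longrightarrow> vrep w' u xs"
  unfolding vrep_def using rep_mono D1_mono by blast

lemma vrep_eq:
  "world w \<Longrightarrow> vrep w u xs \<Longrightarrow> v \<in> T1 w \<Longrightarrow> \<forall>i<length xs. eqw w (App v (num i)) (App u (num i)) \<Longrightarrow> vrep w v xs"
  unfolding vrep_def using rep_eqw' by blast

lemma vrep_exists:
  assumes w: "world w" and xs: "\<And>i. i < length xs \<Longrightarrow> \<exists>t. rep w t (xs ! i)"
  shows "\<exists>u. vrep w u xs"
proof -
  obtain t where t: "\<And>i. i < length xs \<Longrightarrow> rep w (t i) (xs ! i)" using xs by metis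
  let ?ts = "map t [0..<length xs]"
  have "set ?ts \<subseteq> T0 w" using rep_T0[OF t] by auto
  from vec_fct[OF w this] obtain u where "u \<in> T1 w" "\<forall>i<length xs. eqw w (App u (num i)) (t i)" by auto
  then show ?thesis unfolding vrep_def using t rep_eqw'[OF w] by blast
qed

lemma vrep_Cons:
  assumes w: "world w" and u: "u \<in> T1 w"
  shows "vrep w u (x # xs) \<longleftrightarrow> rep w (App u \<^bold>0) x \<and> (\<forall>i<length xs. rep w (App u (num (Suc i))) (xs ! i))"
  unfolding vrep_def using u by (auto simp: less_Suc_eq_0_disj)

text \<open>\<open>A\<close> has to be understood at every copy \<open>e\<close> of the source,
  because the formula determines the copy only up to extensional equality.\<close>

lemma forces_argc:
  assumes w: "world w" and src: "case_nat b \<tau> j = src" "src \<in> T1 w" and b: "b \<in> T1 w"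
    and K: "\<And>e y \<sigma>. e \<in> T1 w \<Longrightarrow> feq w e src \<Longrightarrow> y \<in> T0 w \<Longrightarrow>
      forces A w (case_nat y \<sigma>) (case_nat e (case_nat b \<tau>)) \<longleftrightarrow> rep w y v"
  shows "forces (argc (Suc j) i A) w \<sigma> (case_nat b \<tau>) \<longleftrightarrow> rep w (App b (num i)) v"
proof -
  have "forces (argc (Suc j) i A) w \<sigma> (case_nat b \<tau>) \<longleftrightarrow> (\<exists>e\<in>T1 w. feq w e src \<and>
     (\<exists>y\<in>T0 w. eqw w y (App b (num i)) \<and> forces A w (case_nat y \<sigma>) (case_nat e (case_nat b \<tau>))))"
    using src b unfolding argc_def feq_def by auto
  also have "\<dots> \<longleftrightarrow> (\<exists>y\<in>T0 w. eqw w y (App b (num i)) \<and> rep w y v)"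
    using K feq_refl[OF src(2)] src(2) by blast
  also have "\<dots> \<longleftrightarrow> rep w (App b (num i)) v"
    using rep_eqw[OF w] eqw_refl[OF w] T0_App[OF b T0_num] by blast
  finally show ?thesis .
qed

lemma forces_argcs:
  assumes w: "world w" and src: "case_nat b \<tau> j = src" "src \<in> T1 w" and b: "b \<in> T1 w"
  shows "length As = length vs \<Longrightarrow> (\<And>k e y \<sigma>. k < length As \<Longrightarrow> e \<in> T1 w \<Longrightarrow> feq w e src \<Longrightarrow> y \<in> T0 w \<Longrightarrow>
      forces (As ! k) w (case_nat y \<sigma>) (case_nat e (case_nat b \<tau>)) \<longleftrightarrow> rep w y (vs ! k)) \<Longrightarrow>
    forces (argcs (Suc j) i As) w \<sigma> (case_nat b \<tau>) \<longleftrightarrow> (\<forall>k<length vs. rep w (App b (num (i + k))) (vs ! k))"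
proof (induct As arbitrary: vs i)
  case Nil then show ?case using eqw_refl[OF w] by simp
next
  case (Cons A As)
  then obtain v vs' where vs: "vs = v # vs'" by (cases vs) auto
  have "forces (argc (Suc j) i A) w \<sigma> (case_nat b \<tau>) \<longleftrightarrow> rep w (App b (num i)) v"
    using Cons(3)[of 0] vs by (intro forces_argc[OF w src b]) simp
  moreover have "forces (argcs (Suc j) (Suc i) As) w \<sigma> (case_nat b \<tau>) \<longleftrightarrow> (\<forall>k<length vs'. rep w (App b (num (Suc i + k))) (vs' ! k))"
    using Cons(2) vs Cons(3)[of "Suc _"] by (intro Cons(1)) auto
  ultimately show ?case using vs by (auto simp: less_Suc_eq_0_disj)
qed

lemma forces_recf:
  assumes w: "world w" and b: "b \<in> T1 w"
    and K: "\<And>w' n v y xn xv. le w w' \<Longrightarrow> rep w' n xn \<Longrightarrow> rep w' v xv \<Longrightarrow> y \<in> T0 w' \<Longrightarrow>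
      forces A w' (case_nat y (case_nat v (case_nat n \<sigma>))) (case_nat b \<tau>) \<longleftrightarrow> rep w' y (h xn xv)"
  shows "forces (recf A) w \<sigma> (case_nat b \<tau>) \<longleftrightarrow> (\<forall>w' n xn xv. le w w' \<longrightarrow> rep w' n xn \<longrightarrow>
     rep w' (App b n) xv \<longrightarrow> rep w' (App b (succ n)) (h xn xv))"
proof -
  have "forces (recf A) w \<sigma> (case_nat b \<tau>) \<longleftrightarrow> (\<forall>w'. le w w' \<longrightarrow> (\<forall>n\<in>T0 w'. \<exists>v\<in>T0 w'. eqw w' v (App b n) \<and>
      (\<exists>y\<in>T0 w'. eqw w' y (App b (succ n)) \<and> forces A w' (case_nat y (case_nat v (case_nat n \<sigma>))) (case_nat b \<tau>))))"
    by (simp add: recf_def numeral_2_eq_2)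
  also have "\<dots> \<longleftrightarrow> (\<forall>w' n xn xv. le w w' \<longrightarrow> rep w' n xn \<longrightarrow>
     rep w' (App b n) xv \<longrightarrow> rep w' (App b (succ n)) (h xn xv))" (is "?L \<longleftrightarrow> ?R")
  proof
    assume L: ?L
    show ?R
    proof (intro allI impI)
      fix w' n xn xv assume w': "le w w'" and n: "rep w' n xn" and v: "rep w' (App b n) xv"
      note ww = le_world(2)[OF w']
      from L w' rep_T0[OF n] obtain v' y where "eqw w' v' (App b n)" "y \<in> T0 w'" "eqw w' y (App b (succ n))"
        "forces A w' (case_nat y (case_nat v' (case_nat n \<sigma>))) (case_nat b \<tau>)" by blast
      then show "rep w' (App b (succ n)) (h xn xv)"
        using K[OF w' n rep_eqw'[OF ww v]] rep_eqw[OF ww] by blast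
    qed
  next
    assume R: ?R
    show ?L
    proof (intro allI impI ballI)
      fix w' n assume w': "le w w'" and n: "n \<in> T0 w'"
      note ww = le_world(2)[OF w']
      have b': "b \<in> T1 w'" using D1_mono[OF w' b] .
      have T: "App b n \<in> T0 w'" "App b (succ n) \<in> T0 w'" using b' n by blast+
      have "rep w' (App b (succ n)) (h (cls n) (cls (App b n)))"
        using R w' rep_cls[OF n] rep_cls[OF T(1)] by blast
      then have "forces A w' (case_nat (App b (succ n)) (case_nat (App b n) (case_nat n \<sigma>))) (case_nat b \<tau>)"
        using K[OF w' rep_cls[OF n] rep_cls[OF T(1)] T(2)] by blast
      then show "\<exists>v\<in>T0 w'. eqw w' v (App b n) \<and> (\<exists>y\<in>T0 w'. eqw w' y (App b (succ n)) \<and>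
        forces A w' (case_nat y (case_nat v (case_nat n \<sigma>))) (case_nat b \<tau>))"
        using T eqw_refl[OF ww] by blast
    qed
  qed
  finally show ?thesis .
qed

lemma tail_fct:
  assumes w: "world w" and u: "u \<in> T1 w"
  shows "\<exists>v\<in>T1 w. \<forall>w'. le w w' \<longrightarrow> (\<forall>n\<in>T0 w'. eqw w' (App v n) (App u (succ n)))"
proof -
  let ?t = "fapp 0 (succ (NVar 0))"
  have e: "env w nil0 (case_nat u nil1)" using w u by (simp add: env_cases)
  show ?thesis
    using beta[OF env_le[OF e], of _ ?t] T1_Lam[OF e, of ?t] by (intro bexI[OF _ T1_Lam[OF e, of ?t]]) auto
qed

lemma forces_tailf:
  assumes w: "world w" and src: "case_nat b \<tau> j = src" "vrep w src (x # xs)" and b: "b \<in> T1 w"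
    and K: "\<And>e y \<sigma>. vrep w e xs \<Longrightarrow> y \<in> T0 w \<Longrightarrow>
      forces A w (case_nat y \<sigma>) (case_nat e (case_nat b \<tau>)) \<longleftrightarrow> rep w y v"
  shows "forces (tailf (Suc j) A) w \<sigma> (case_nat b \<tau>) \<longleftrightarrow> rep w (App b \<^bold>0) v"
proof -
  have s: "src \<in> T1 w" using src(2) by (simp add: vrep_def)
  let ?P = "\<lambda>e. \<forall>w'. le w w' \<longrightarrow> (\<forall>n\<in>T0 w'. eqw w' (App e n) (App src (succ n)))"
  have P: "vrep w e xs" if "e \<in> T1 w" "?P e" for e
    using src(2) that le_world(3)[OF w] rep_eqw'[OF w] unfolding vrep_Cons[OF w s] vrep_def by auto
  obtain e0 where e0: "e0 \<in> T1 w" "?P e0" using tail_fct[OF w s] by blast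
  have "forces (tailf (Suc j) A) w \<sigma> (case_nat b \<tau>) \<longleftrightarrow> (\<exists>e\<in>T1 w. ?P e \<and>
     (\<exists>y\<in>T0 w. eqw w y (App b \<^bold>0) \<and> forces A w (case_nat y \<sigma>) (case_nat e (case_nat b \<tau>))))"
    using src(1) unfolding tailf_def by auto
  also have "\<dots> \<longleftrightarrow> (\<exists>y\<in>T0 w. eqw w y (App b \<^bold>0) \<and> rep w y v)"
    using K P e0 by blast
  also have "\<dots> \<longleftrightarrow> rep w (App b \<^bold>0) v"
    using rep_eqw[OF w] eqw_refl[OF w] T0_App[OF b T0_zero] by blast
  finally show ?thesis .
qed

lemma forces_stepf:
  assumes w: "world w" and src: "\<tau> j = src" "vrep w src (x # xs)"
    and n: "rep w n xn" and v: "rep w v xv"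
    and K: "\<And>e \<sigma>. vrep w e (xn # xv # xs) \<Longrightarrow> forces A w (case_nat y \<sigma>) (case_nat e \<tau>) \<longleftrightarrow> rep w y r"
  shows "forces (stepf (Suc j) A) w (case_nat y (case_nat v (case_nat n \<sigma>))) \<tau> \<longleftrightarrow> rep w y r"
proof -
  have s: "src \<in> T1 w" using src(2) by (simp add: vrep_def)
  note ln = le_world(3)[OF w]
  let ?P = "\<lambda>e. eqw w (App e \<^bold>0) n \<and> eqw w (App e \<^bold>1) v \<and>
    (\<forall>w'. le w w' \<longrightarrow> (\<forall>k\<in>T0 w'. eqw w' (App e (succ (succ k))) (App src (succ k))))"
  have P: "vrep w e (xn # xv # xs)" if e: "e \<in> T1 w" "?P e" for e
  proof -
    have "rep w (App e (num i)) ((xn # xv # xs) ! i)" if i: "i < length (xn # xv # xs)" for i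
    proof -
      consider "i = 0" | "i = 1" | k where "i = Suc (Suc k)" "k < length xs"
        using i by (cases i; cases "i - 1") auto
      then show ?thesis
      proof cases
        case 1 then show ?thesis using e n rep_eqw'[OF w] by auto
      next
        case 2 then show ?thesis using e v rep_eqw'[OF w] by auto
      next
        case 3
        then have "rep w (App src (num (Suc k))) (xs ! k)" using src(2) unfolding vrep_Cons[OF w s] by blast
        then show ?thesis using e 3 ln rep_eqw'[OF w] by auto
      qed
    qed
    then show ?thesis using e(1) unfolding vrep_def by blast
  qed
  obtain t where t: "t \<in> T1 w" "\<forall>w'. le w w' \<longrightarrow> (\<forall>n\<in>T0 w'. eqw w' (App t n) (App src (succ n)))"
    using tail_fct[OF w s] by blast
  obtain c where c: "c \<in> T1 w" "eqw w (App c \<^bold>0) v" "\<forall>w'. le w w' \<longrightarrow> (\<forall>n\<in>T0 w'. eqw w' (App c (succ n)) (App t n))"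
    using cons_fct[OF w rep_T0[OF v] t(1)] by blast
  obtain d where d: "d \<in> T1 w" "eqw w (App d \<^bold>0) n" "\<forall>w'. le w w' \<longrightarrow> (\<forall>n\<in>T0 w'. eqw w' (App d (succ n)) (App c n))"
    using cons_fct[OF w rep_T0[OF n] c(1)] by blast
  have Pd: "?P d"
  proof (intro conjI allI impI ballI)
    show "eqw w (App d \<^bold>0) n" by (rule d(2))
    show "eqw w (App d \<^bold>1) v" using d(3) ln c(2) eqw_trans[OF w] T0_zero by blast
    fix w' k assume w': "le w w'" and k: "k \<in> T0 w'"
    have "eqw w' (App d (succ (succ k))) (App c (succ k))" using d(3) w' k by blast
    moreover have "eqw w' (App c (succ k)) (App t k)" "eqw w' (App t k) (App src (succ k))" using c(3) t(2) w' k by blast+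
    ultimately show "eqw w' (App d (succ (succ k))) (App src (succ k))" using eqw_trans[OF le_world(2)[OF w']] by blast
  qed
  have "forces (stepf (Suc j) A) w (case_nat y (case_nat v (case_nat n \<sigma>))) \<tau> \<longleftrightarrow> (\<exists>e\<in>T1 w. ?P e \<and>
      forces A w (case_nat y (case_nat v (case_nat n \<sigma>))) (case_nat e \<tau>))"
    using src(1) by (simp add: stepf_def numeral_2_eq_2)
  also have "\<dots> \<longleftrightarrow> rep w y r" using K P Pd d(1) by blast
  finally show ?thesis .
qed

text \<open>Existence and definability of the values need a common induction: a recursion can be
  solved in a world only if its step is defined by a formula, and the formula of a composition or
  recursion is correct only if the inner values exist.\<close>

lemma pg_correct:
  "wf_prd d \<Longrightarrow> length xs = arity_prd d \<Longrightarrow> world w \<Longrightarrow> vrep w a xs \<Longrightarrow>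
    (\<exists>y. rep w y (pv d xs)) \<and> (\<forall>y\<in>T0 w. \<forall>\<sigma> \<tau>. forces (pg d) w (case_nat y \<sigma>) (case_nat a \<tau>) \<longleftrightarrow> rep w y (pv d xs))"
proof (induct d arbitrary: xs w a)
  case (ZeroD n)
  note w = ZeroD(3)
  show ?case using rep_unique[OF w rep_cls[OF T0_zero]] rep_cls[OF T0_zero] by auto
next
  case SuccD
  note w = SuccD(3)
  have r: "rep w (App a \<^bold>0) (xs ! 0)" using SuccD(2,4) by (auto simp: vrep_def)
  show ?case using rep_unique[OF w rep_succ[OF w r]] rep_succ[OF w r] by auto
next
  case (ProjD n i)
  note w = ProjD(3)
  have r: "rep w (App a (num i)) (xs ! i)" using ProjD(1,2,4) by (auto simp: vrep_def)
  show ?case using rep_unique[OF w r] r by auto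
next
  case (CompD n h gs)
  note w = CompD(5)
  let ?vs = "map (\<lambda>g. pv g xs) gs"
  have aT: "a \<in> T1 w" using CompD(6) by (simp add: vrep_def)
  have IH: "(\<exists>y. rep w y (pv g xs)) \<and> (\<forall>y\<in>T0 w. \<forall>\<sigma> \<tau>. forces (pg g) w (case_nat y \<sigma>) (case_nat e \<tau>) \<longleftrightarrow> rep w y (pv g xs))"
    if "g \<in> set gs" "vrep w e xs" for g e
    using CompD(2)[OF that(1) _ _ w that(2)] CompD(3,4) that(1) by simp
  obtain b0 where b0: "vrep w b0 ?vs" using vrep_exists[OF w, of ?vs] IH[OF _ CompD(6)] by auto
  have args: "forces (argcs 2 0 (map pg gs)) w \<sigma> (case_nat b (case_nat a \<tau>)) \<longleftrightarrow> vrep w b ?vs" if b: "b \<in> T1 w" for b \<sigma> \<tau>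
  proof -
    have "forces (argcs (Suc 1) 0 (map pg gs)) w \<sigma> (case_nat b (case_nat a \<tau>)) \<longleftrightarrow> (\<forall>k<length ?vs. rep w (App b (num (0 + k))) (?vs ! k))"
    proof (rule forces_argcs[OF w _ aT b])
      fix k e y \<sigma>' assume h: "k < length (map pg gs)" "e \<in> T1 w" "feq w e a" "y \<in> T0 w"
      have "vrep w e xs"
        by (rule vrep_eq[OF w CompD(6) h(2)]) (use h(3) le_world(3)[OF w] in \<open>auto simp: feq_def\<close>)
      then show "forces (map pg gs ! k) w (case_nat y \<sigma>') (case_nat e (case_nat b (case_nat a \<tau>))) \<longleftrightarrow> rep w y (?vs ! k)"
        using IH[of "gs ! k" e] h by auto
    qed simp_all
    then show ?thesis using b by (simp add: vrep_def numeral_2_eq_2)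
  qed
  have H: "(\<exists>y. rep w y (pv h ?vs)) \<and> (\<forall>y\<in>T0 w. \<forall>\<sigma> \<tau>. forces (pg h) w (case_nat y \<sigma>) (case_nat b \<tau>) \<longleftrightarrow> rep w y (pv h ?vs))"
    if "vrep w b ?vs" for b
    using CompD(1)[OF _ _ w that] CompD(3) by simp
  have "forces (pg (CompD n h gs)) w (case_nat y \<sigma>) (case_nat a \<tau>) \<longleftrightarrow> rep w y (pv (CompD n h gs) xs)" if "y \<in> T0 w" for y \<sigma> \<tau>
  proof -
    have "forces (pg (CompD n h gs)) w (case_nat y \<sigma>) (case_nat a \<tau>) \<longleftrightarrow>
      (\<exists>b\<in>T1 w. vrep w b ?vs \<and> forces (pg h) w (case_nat y \<sigma>) (case_nat b (case_nat a \<tau>)))" using args by auto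
    also have "\<dots> \<longleftrightarrow> rep w y (pv h ?vs)" using H that b0 unfolding vrep_def by blast
    finally show ?thesis by simp
  qed
  then show ?case using H[OF b0] by simp
next
  case (RecD g h)
  note w = RecD(5)
  obtain x xs' where xs: "xs = x # xs'" "length xs' = arity_prd g" using RecD(4) by (cases xs) auto
  let ?h = "\<lambda>n v. pv h (n # v # xs')"
  have a: "vrep w a (x # xs')" using RecD(6) xs by simp
  have aT: "a \<in> T1 w" using a by (simp add: vrep_def)
  have G: "(\<exists>y. rep w y (pv g xs')) \<and> (\<forall>y\<in>T0 w. \<forall>\<sigma> \<tau>. forces (pg g) w (case_nat y \<sigma>) (case_nat e \<tau>) \<longleftrightarrow> rep w y (pv g xs'))"
    if "vrep w e xs'" for e using RecD(1)[OF _ _ w that] RecD(3) xs(2) by simp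
  have H: "(\<exists>y. rep w' y (?h xn xv)) \<and> (\<forall>y\<in>T0 w'. \<forall>\<sigma> \<tau>. forces (pg h) w' (case_nat y \<sigma>) (case_nat e \<tau>) \<longleftrightarrow> rep w' y (?h xn xv))"
    if "le w w'" "vrep w' e (xn # xv # xs')" for e w' xn xv
    using RecD(2)[OF _ _ le_world(2)[OF that(1)] that(2)] RecD(3) xs(2) by simp
  \<comment> \<open>The index stays open because the vector \<open>a\<close> is function variable 0
    where the recursion is solved, but variable 1 inside the graph formula, where the solution is
    bound in front of it.\<close>
  have St: "forces (stepf (Suc j) (pg h)) w' (case_nat y (case_nat v (case_nat n \<sigma>))) \<tau> \<longleftrightarrow> rep w' y (?h xn xv)"
    if "le w w'" "rep w' n xn" "rep w' v xv" "y \<in> T0 w'" "\<tau> j = a" for w' n v y xn xv \<tau> j \<sigma>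
    by (rule forces_stepf[where \<tau> = \<tau> and j = j, OF le_world(2)[OF that(1)] that(5) vrep_mono[OF a that(1)] that(2,3)])
      (use H[OF that(1)] that(4) in blast)
  have ex_h: "\<exists>y. rep w' y (?h xn xv)" if l: "le w w'" and n: "rep w' n xn" and v: "rep w' v xv" for w' n v xn xv
  proof -
    have "\<exists>t. rep w' t ((xn # xv # xs') ! i)" if i: "i < length (xn # xv # xs')" for i
    proof -
      consider "i = 0" | "i = 1" | k where "i = Suc (Suc k)" "k < length xs'"
        using i by (cases i; cases "i - 1") auto
      then show ?thesis
        using n v vrep_mono[OF a l] unfolding vrep_Cons[OF le_world(2)[OF l] D1_mono[OF l aT]] by cases auto
    qed
    then obtain e where "vrep w' e (xn # xv # xs')" using vrep_exists[OF le_world(2)[OF l], of "xn # xv # xs'"] by blast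
    then show ?thesis using H[OF l] by blast
  qed
  have "\<exists>t\<in>T1 w. vrep w t xs'"
  proof -
    obtain t where t: "t \<in> T1 w" "\<forall>w'. le w w' \<longrightarrow> (\<forall>n\<in>T0 w'. eqw w' (App t n) (App a (succ n)))"
      using tail_fct[OF w aT] by blast
    have "vrep w t xs'"
      using a t le_world(3)[OF w] rep_eqw'[OF w] unfolding vrep_Cons[OF w aT] by (auto simp: vrep_def)
    then show ?thesis using t(1) by blast
  qed
  then obtain ta where ta: "rep w ta (pv g xs')" using G by blast
  have e: "env w nil0 (case_nat a nil1)" using w aT by (simp add: env_cases)
  have "\<exists>u. pru w u (pv g xs') ?h"
  proof (rule pru_exists[OF _ e ta])
    show "wf_fm lang_M (stepf (Suc 0) (pg h))" by (simp add: stepf_def)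
    show "\<exists>y. rep w' y (?h xn xv)" if "le w w'" "rep w' n xn" "rep w' v xv" for w' n v xn xv
      by (rule ex_h[OF that])
    show "forces (stepf (Suc 0) (pg h)) w' (case_nat y (case_nat v (case_nat n nil0))) (case_nat a nil1) \<longleftrightarrow> rep w' y (?h xn xv)"
      if "le w w'" "rep w' n xn" "rep w' v xv" "y \<in> T0 w'" for w' n v y xn xv
      by (rule St[OF that]) simp
  qed
  then obtain u where u: "pru w u (pv g xs') ?h" by blast
  have ra: "rep w (App a \<^bold>0) x" using a vrep_Cons[OF w aT] by blast
  have uT: "u \<in> T1 w" using u by (simp add: pru_def)
  have F: "forces (pg (RecD g h)) w (case_nat y \<sigma>) (case_nat a \<tau>) \<longleftrightarrow>
      (\<exists>b. pru w b (pv g xs') ?h \<and> eqw w y (App b (App a \<^bold>0)))" for y \<sigma> \<tau>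
  proof -
    have 1: "forces (tailf 2 (pg g)) w (case_nat y \<sigma>) (case_nat b (case_nat a \<tau>)) \<longleftrightarrow> rep w (App b \<^bold>0) (pv g xs')" if "b \<in> T1 w" for b
      using forces_tailf[OF w _ a that, of "case_nat a \<tau>" 1 "pg g" "pv g xs'"] G by (simp add: numeral_2_eq_2)
    have 2: "forces (recf (stepf 2 (pg h))) w (case_nat y \<sigma>) (case_nat b (case_nat a \<tau>)) \<longleftrightarrow>
       (\<forall>w' n xn xv. le w w' \<longrightarrow> rep w' n xn \<longrightarrow> rep w' (App b n) xv \<longrightarrow> rep w' (App b (succ n)) (?h xn xv))" if "b \<in> T1 w" for b
      using St[where j = 1 and \<tau> = "case_nat b (case_nat a \<tau>)"]
      by (intro forces_recf[OF w that]) (simp add: numeral_2_eq_2)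
    show ?thesis unfolding pg.simps forces.simps pru_def using 1 2 by auto
  qed
  have R: "rep w (App b (App a \<^bold>0)) (pv (RecD g h) xs)" if "pru w b (pv g xs') ?h" for b
    using PR_rep[OF w that ra] xs by simp
  have "forces (pg (RecD g h)) w (case_nat y \<sigma>) (case_nat a \<tau>) \<longleftrightarrow> rep w y (pv (RecD g h) xs)" for y \<sigma> \<tau>
    unfolding F using R u rep_iff[OF w R] eqw_sym[OF w] by blast
  then show ?case using R[OF u] by blast
qed

end

lemma wf_pairD: "wf_prd pairD" "arity_prd pairD = 2"
  by (auto simp: pairD_def twoD_def threeD_def mulD_def addD_def expD_def numeral_eq_Suc less_Suc_eq)

context ext_M
begin

lemma forces_stepr:
  assumes w: "world w" and g: "\<tau> j = g" "frep w g F" and n: "rep w n xn" and v: "rep w v xv" and y: "y \<in> T0 w"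
  shows "forces (stepr (Suc j)) w (case_nat y (case_nat v (case_nat n \<sigma>))) \<tau> \<longleftrightarrow> rep w y (F (pv pairD [xv, xn]))"
    and "\<exists>y. rep w y (F (pv pairD [xv, xn]))"
proof -
  have V: "vrep w e [xv, xn]" if "e \<in> T1 w" "eqw w (App e \<^bold>0) v" "eqw w (App e \<^bold>1) n" for e
    using that rep_eqw'[OF w v] rep_eqw'[OF w n] unfolding vrep_Cons[OF w that(1)] by simp
  have P: "(\<exists>p. rep w p (pv pairD [xv, xn])) \<and> (\<forall>p\<in>T0 w. \<forall>\<sigma> \<tau>. forces (pg pairD) w (case_nat p \<sigma>) (case_nat e \<tau>) \<longleftrightarrow> rep w p (pv pairD [xv, xn]))"
    if "vrep w e [xv, xn]" for e
    using pg_correct[OF wf_pairD(1) _ w that] wf_pairD(2) by simp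
  have "\<exists>t. rep w t ([xv, xn] ! i)" if "i < length [xv, xn]" for i
    using that n v by (cases i) auto
  then obtain e where e: "vrep w e [xv, xn]" using vrep_exists[OF w, of "[xv, xn]"] by blast
  have eT: "e \<in> T1 w" using e by (simp add: vrep_def)
  have e': "eqw w (App e \<^bold>0) v" "eqw w (App e \<^bold>1) n"
    using e rep_unique[OF w v] rep_unique[OF w n] unfolding vrep_Cons[OF w eT] by auto
  obtain p where p: "rep w p (pv pairD [xv, xn])" using P[OF e] by blast
  have R: "rep w (App g p) (F (pv pairD [xv, xn]))" if "rep w p (pv pairD [xv, xn])" for p
    by (rule frepD[OF w g(2) that])
  have "forces (stepr (Suc j)) w (case_nat y (case_nat v (case_nat n \<sigma>))) \<tau> \<longleftrightarrow>
     (\<exists>e\<in>T1 w. eqw w (App e \<^bold>0) v \<and> eqw w (App e \<^bold>1) n \<and> (\<exists>p\<in>T0 w.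
       forces (pg pairD) w (case_nat p (case_nat y (case_nat v (case_nat n \<sigma>)))) (case_nat e \<tau>) \<and> eqw w y (App g p)))"
    using g(1) by (simp add: stepr_def numeral_2_eq_2)
  also have "\<dots> \<longleftrightarrow> (\<exists>p\<in>T0 w. rep w p (pv pairD [xv, xn]) \<and> eqw w y (App g p))"
    using P V eT e' by blast
  also have "\<dots> \<longleftrightarrow> rep w y (F (pv pairD [xv, xn]))"
    using R p rep_T0[OF p] rep_unique[OF w R] by blast
  finally show "forces (stepr (Suc j)) w (case_nat y (case_nat v (case_nat n \<sigma>))) \<tau> \<longleftrightarrow> rep w y (F (pv pairD [xv, xn]))" .
  show "\<exists>y. rep w y (F (pv pairD [xv, xn]))" using R[OF p] by blast
qed

lemma cg_Rec:
  assumes w: "world w" and b: "vrep w b [xa, xs]" and g: "frep w g F"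
  shows "(\<exists>y. rep w y (ic Rec [xa, xs] [F])) \<and> (\<forall>y\<in>T0 w. \<forall>\<sigma> \<tau>.
    forces (cg Rec) w (case_nat y \<sigma>) (case_nat b (case_nat g \<tau>)) \<longleftrightarrow> rep w y (ic Rec [xa, xs] [F]))"
proof -
  let ?h = "\<lambda>n v. F (pv pairD [v, n])"
  have bT: "b \<in> T1 w" using b by (simp add: vrep_def)
  have b': "rep w (App b \<^bold>0) xa" "rep w (App b \<^bold>1) xs" using b unfolding vrep_Cons[OF w bT] by auto
  note gT = frep_T1[OF g]
  have e: "env w nil0 (case_nat g nil1)" using w gT by (simp add: env_cases)
  have St: "forces (stepr (Suc j)) w' (case_nat y (case_nat v (case_nat n \<sigma>))) \<tau> \<longleftrightarrow> rep w' y (?h xn xv)"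
    "\<exists>y. rep w' y (?h xn xv)"
    if "le w w'" "rep w' n xn" "rep w' v xv" "y \<in> T0 w'" "\<tau> j = g" for w' n v y xn xv \<tau> j \<sigma>
    using forces_stepr[where \<tau> = \<tau> and j = j, OF le_world(2)[OF that(1)] that(5) frep_mono[OF g that(1)] that(2,3,4)] by blast+
  have "\<exists>u. pru w u xa ?h"
  proof (rule pru_exists[OF _ e b'(1)])
    show "wf_fm lang_M (stepr (Suc 0))" by (simp add: stepr_def)
    show "\<exists>y. rep w' y (?h xn xv)" if "le w w'" "rep w' n xn" "rep w' v xv" for w' n v xn xv
      by (rule St(2)[OF that T0_zero, of "\<lambda>_. g"]) simp
    show "forces (stepr (Suc 0)) w' (case_nat y (case_nat v (case_nat n nil0))) (case_nat g nil1) \<longleftrightarrow> rep w' y (?h xn xv)"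
      if "le w w'" "rep w' n xn" "rep w' v xv" "y \<in> T0 w'" for w' n v y xn xv
      by (rule St(1)[OF that]) simp
  qed
  then obtain u where u: "pru w u xa ?h" by blast
  have F: "forces (cg Rec) w (case_nat y \<sigma>) (case_nat b (case_nat g \<tau>)) \<longleftrightarrow>
      (\<exists>a. pru w a xa ?h \<and> eqw w y (App a (App b \<^bold>1)))" for y \<sigma> \<tau>
  proof -
    have 2: "forces (recf (stepr 3)) w (case_nat y \<sigma>) (case_nat a (case_nat b (case_nat g \<tau>))) \<longleftrightarrow>
       (\<forall>w' n xn xv. le w w' \<longrightarrow> rep w' n xn \<longrightarrow> rep w' (App a n) xv \<longrightarrow> rep w' (App a (succ n)) (?h xn xv))" if "a \<in> T1 w" for a
      using St(1)[where j = 2 and \<tau> = "case_nat a (case_nat b (case_nat g \<tau>))"]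
      by (intro forces_recf[OF w that]) (simp add: numeral_3_eq_3 numeral_2_eq_2)
    show ?thesis unfolding cg.simps forces.simps pru_def using 2 rep_unique[OF w b'(1)] by auto
  qed
  have R: "rep w (App a (App b \<^bold>1)) (ic Rec [xa, xs] [F])" if "pru w a xa ?h" for a
    using PR_rep[OF w that b'(2)] by simp
  have "forces (cg Rec) w (case_nat y \<sigma>) (case_nat b (case_nat g \<tau>)) \<longleftrightarrow> rep w y (ic Rec [xa, xs] [F])" for y \<sigma> \<tau>
    unfolding F using R u rep_unique[OF w R] by blast
  then show ?thesis using R[OF u] by blast
qed

lemma cg_correct:
  assumes c: "c \<in> lang_EL_plus" "arity c = (length xs, length fs)" "arity c \<noteq> (1, 0)"
    and w: "world w" and b: "vrep w b xs" and g: "fs \<noteq> [] \<Longrightarrow> frep w g (hd fs)"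
  shows "(\<exists>y. rep w y (ic c xs fs)) \<and> (\<forall>y\<in>T0 w. \<forall>\<sigma> \<tau>.
    forces (cg c) w (case_nat y \<sigma>) (case_nat b (case_nat g \<tau>)) \<longleftrightarrow> rep w y (ic c xs fs))"
proof (cases c)
  case Zero
  then show ?thesis using rep_unique[OF w rep_cls[OF T0_zero]] rep_cls[OF T0_zero] by auto
next
  case (Fn d)
  then have "wf_prd d" using c(1) by (auto simp: lang_EL_plus_def lang_HA1_def)
  then show ?thesis using pg_correct[OF _ _ w b] Fn c(2) by auto
next
  case (Kl k)
  have bT: "b \<in> T1 w" using b by (simp add: vrep_def)
  have "arity_klc k \<in> {(1, 0), (2, 0), (1, 1)}" by (cases k) auto
  with Kl c(3) consider "arity_klc k = (2, 0)" | "arity_klc k = (1, 1)" by auto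
  then show ?thesis
  proof cases
    case 1
    then have "length xs = Suc (Suc 0)" using c(2) Kl by simp
    then obtain x y where xs: "xs = [x, y]" by (auto simp: length_Suc_conv)
    have r: "rep w (App b \<^bold>0) x" "rep w (App b \<^bold>1) y" using b unfolding xs vrep_Cons[OF w bT] by auto
    note R = rep_k2[OF w 1 r, of fs]
    show ?thesis using rep_unique[OF w R] R Kl 1 xs by auto
  next
    case 2
    then have "length xs = Suc 0" "length fs = Suc 0" using c(2) Kl by simp_all
    then obtain x f where xs: "xs = [x]" "fs = [f]" by (auto simp: length_Suc_conv)
    have r: "rep w (App b \<^bold>0) x" using b unfolding xs vrep_Cons[OF w bT] by auto
    note R = rep_kf[OF w 2 r, of g f]
    show ?thesis using rep_unique[OF w R] R g Kl 2 xs by auto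
  qed
next
  case Rec
  then have "length xs = Suc (Suc 0)" "length fs = Suc 0" using c(2) by simp_all
  then obtain xa x f where xs: "xs = [xa, x]" "fs = [f]" by (auto simp: length_Suc_conv)
  show ?thesis using cg_Rec[OF w b[unfolded xs(1)]] g xs Rec by simp
qed

lemma fcg_correct:
  assumes c: "c \<in> lang_EL_plus" "arity c = (1, 0)" and w: "world w" and x: "rep w x xn"
  shows "(\<exists>y. rep w y (ic c [xn] [])) \<and> (\<forall>y\<in>T0 w. \<forall>\<sigma> \<tau>.
    forces (fcg c) w (case_nat y (case_nat x \<sigma>)) \<tau> \<longleftrightarrow> rep w y (ic c [xn] []))"
proof (cases c)
  case (Kl k)
  then have k: "arity_klc k = (1, 0)" using c by simp
  show ?thesis using rep_unique[OF w rep_k1[OF w k x]] rep_k1[OF w k x, of "[]"] Kl by (auto simp: fcg_def)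
next
  case (Fn d)
  then have d: "wf_prd d" "length [xn] = arity_prd d" using c by (auto simp: lang_EL_plus_def lang_HA1_def)
  have "\<exists>t. rep w t ([xn] ! i)" if "i < length [xn]" for i using that x by auto
  then obtain e where e: "vrep w e [xn]" using vrep_exists[OF w] by blast
  have eT: "e \<in> T1 w" using e by (simp add: vrep_def)
  have e0: "eqw w (App e \<^bold>0) x" using e rep_unique[OF w x] unfolding vrep_Cons[OF w eT] by auto
  have V: "vrep w e [xn]" if "e \<in> T1 w" "eqw w (App e \<^bold>0) x" for e
    using rep_eqw'[OF w x that(2)] unfolding vrep_Cons[OF w that(1)] by simp
  have "forces (fcg c) w (case_nat y (case_nat x \<sigma>)) \<tau> \<longleftrightarrow> (\<exists>e\<in>T1 w. eqw w (App e \<^bold>0) x \<and>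
     forces (pg d) w (case_nat y (case_nat x \<sigma>)) (case_nat e \<tau>))" for y \<sigma> \<tau>
    using Fn by (simp add: fcg_def)
  moreover note P = pg_correct[OF d w]
  ultimately have "forces (fcg c) w (case_nat y (case_nat x \<sigma>)) \<tau> \<longleftrightarrow> rep w y (pv d [xn])" if "y \<in> T0 w" for y \<sigma> \<tau>
    using V that eT e0 by blast
  then show ?thesis using P[OF e] Fn by auto
qed (use c in auto)

text \<open>By unique choice: a formula of \<open>M\<close> that defines the values of a function on
  elements turns the function into a functor of the world.\<close>

lemma frep_exists:
  assumes A: "wf_fm lang_M A" and e: "env w \<sigma> \<tau>"
    and c: "\<And>w' x xn. le w w' \<Longrightarrow> rep w' x xn \<Longrightarrow> (\<exists>y. rep w' y (F xn)) \<and>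
      (\<forall>y\<in>T0 w'. forces A w' (case_nat y (case_nat x \<sigma>)) \<tau> \<longleftrightarrow> rep w' y (F xn))"
  shows "\<exists>v. frep w v F"
proof -
  have "\<exists>u\<in>T1 w. \<forall>w'. le w w' \<longrightarrow> (\<forall>x\<in>T0 w'. forces A w' (case_nat (App u x) (case_nat x \<sigma>)) \<tau>)"
  proof (rule choice[OF A e])
    show "\<exists>y\<in>T0 w'. forces A w' (case_nat y (case_nat x \<sigma>)) \<tau>" if "le w w'" "x \<in> T0 w'" for w' x
      using c[OF that(1) rep_cls[OF that(2)]] rep_T0 by blast
    show "eqw w' y z" if h: "le w w'" "x \<in> T0 w'" "y \<in> T0 w'" "z \<in> T0 w'"
      and f: "forces A w' (case_nat y (case_nat x \<sigma>)) \<tau>" "forces A w' (case_nat z (case_nat x \<sigma>)) \<tau>" for w' x y z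
    proof -
      have "rep w' y (F (cls x))" "rep w' z (F (cls x))" using c[OF h(1) rep_cls[OF h(2)]] h(3,4) f by blast+
      then show ?thesis using rep_iff[OF le_world(2)[OF h(1)]] by blast
    qed
  qed
  then obtain u where u: "u \<in> T1 w" "\<And>w' x. le w w' \<Longrightarrow> x \<in> T0 w' \<Longrightarrow> forces A w' (case_nat (App u x) (case_nat x \<sigma>)) \<tau>" by blast
  have "rep w' (App u x) (F xn)" if "le w w'" "rep w' x xn" for w' x xn
    using c[OF that] u(2)[OF that(1) rep_T0[OF that(2)]] D1_mono[OF that(1) u(1)] rep_T0[OF that(2)] by blast
  then have "frep w u F" using u(1) unfolding frep_def by blast
  then show ?thesis by blast
qed

section \<open>Correctness of the graph formulas of terms\<close>

definition genv :: "world \<Rightarrow> (nat \<Rightarrow> fct) \<Rightarrow> nat \<Rightarrow> nat \<Rightarrow> (nat \<Rightarrow> elt) \<Rightarrow> (nat \<Rightarrow> elt \<Rightarrow> elt) \<Rightarrow> bool" where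
  "genv w \<tau> E N e f \<longleftrightarrow> world w \<and> (\<forall>n. \<tau> n \<in> T1 w) \<and> (\<forall>n<N. rep w (App (\<tau> 0) (num n)) (e n)) \<and>
     (\<forall>n. frep w (\<tau> (n + E)) (f n))"

lemma genv_mono: "genv w \<tau> E N e f \<Longrightarrow> le w w' \<Longrightarrow> genv w' \<tau> E N e f"
  unfolding genv_def using le_world D1_mono rep_mono frep_mono by blast

text \<open>For entering function quantifiers: a copy of the sequence of values becomes function
  variable 0, and the offset of the proper function variables grows by the number of new
  ones.\<close>

lemma genv_push:
  assumes g: "genv w \<tau> E N e f" and v: "v \<in> T1 w" "feq w v (\<tau> 0)"
    and \<tau>': "\<And>n. \<tau>' n \<in> T1 w" "\<tau>' 0 = v" "\<And>n. \<tau>' (n + E') = \<tau> (n + E)"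
  shows "genv w \<tau>' E' N e f"
proof -
  have w: "world w" using g by (simp add: genv_def)
  have "rep w (App v (num n)) (e n)" if "n < N" for n
    using g that rep_eqw'[OF w] feqD[OF v(2) le_world(3)[OF w] T0_num] unfolding genv_def by blast
  then show ?thesis using assms unfolding genv_def by simp
qed

lemma case_True_below: "case_nat True (below N) = below (Suc N)"
  by (rule HOL.ext) (simp split: nat.split)

lemma forces_gfun:
  assumes g: "genv w \<tau> E N e f" and \<gamma>: "\<gamma> \<in> T1 w"
    and IH: "\<And>w' \<tau> y x xn \<sigma>. genv w' \<tau> (E + 2) N e f \<Longrightarrow> y \<in> T0 w' \<Longrightarrow> rep w' x xn \<Longrightarrow>
      forces A w' (case_nat y (case_nat x \<sigma>)) \<tau> \<longleftrightarrow> rep w' y (F xn)"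
  shows "forces (gfun [A]) w \<sigma> (case_nat \<gamma> \<tau>) \<longleftrightarrow> frep w \<gamma> F"
proof -
  have w: "world w" and T: "\<And>n. \<tau> n \<in> T1 w" using g by (auto simp: genv_def)
  have "forces (gfun [A]) w \<sigma> (case_nat \<gamma> \<tau>) \<longleftrightarrow> (\<forall>w'. le w w' \<longrightarrow> (\<forall>x\<in>T0 w'. \<exists>v\<in>T1 w'. feq w' v (\<tau> 0) \<and>
      (\<exists>y\<in>T0 w'. eqw w' y (App \<gamma> x) \<and> forces A w' (case_nat y (case_nat x \<sigma>)) (case_nat v (case_nat \<gamma> \<tau>)))))"
    using D1_mono[OF _ T] by (auto simp: feq_def numeral_2_eq_2)
  also have "\<dots> \<longleftrightarrow> (\<forall>w' x xn. le w w' \<longrightarrow> rep w' x xn \<longrightarrow> rep w' (App \<gamma> x) (F xn))" (is "?L \<longleftrightarrow> ?R")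
  proof -
    have I: "forces A w' (case_nat y (case_nat x \<sigma>)) (case_nat v (case_nat \<gamma> \<tau>)) \<longleftrightarrow> rep w' y (F xn)"
      if h: "le w w'" "v \<in> T1 w'" "feq w' v (\<tau> 0)" "y \<in> T0 w'" "rep w' x xn" for w' v y x xn
    proof (rule IH[OF _ h(4,5)])
      show "genv w' (case_nat v (case_nat \<gamma> \<tau>)) (E + 2) N e f"
        by (rule genv_push[OF genv_mono[OF g h(1)] h(2,3)])
          (use h(2) D1_mono[OF h(1) \<gamma>] D1_mono[OF h(1) T] in \<open>auto split: nat.split\<close>)
    qed
    show ?thesis
    proof
      assume L: ?L
      show ?R
      proof (intro allI impI)
        fix w' x xn assume w': "le w w'" and x: "rep w' x xn"
        note ww = le_world(2)[OF w']
        from L w' rep_T0[OF x] obtain v y where v: "v \<in> T1 w'" "feq w' v (\<tau> 0)" and y: "y \<in> T0 w'" "eqw w' y (App \<gamma> x)"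
          and A: "forces A w' (case_nat y (case_nat x \<sigma>)) (case_nat v (case_nat \<gamma> \<tau>))" by blast
        show "rep w' (App \<gamma> x) (F xn)" using I[OF w' v y(1) x] A rep_eqw[OF ww _ y(2)] by blast
      qed
    next
      assume R: ?R
      show ?L
      proof (intro allI impI ballI)
        fix w' x assume w': "le w w'" and x: "x \<in> T0 w'"
        note ww = le_world(2)[OF w']
        have t: "\<tau> 0 \<in> T1 w'" "App \<gamma> x \<in> T0 w'" using D1_mono[OF w' T] D1_mono[OF w' \<gamma>] x by blast+
        have "rep w' (App \<gamma> x) (F (cls x))" using R w' rep_cls[OF x] by blast
        then have "forces A w' (case_nat (App \<gamma> x) (case_nat x \<sigma>)) (case_nat (\<tau> 0) (case_nat \<gamma> \<tau>))"
          using I[OF w' t(1) feq_refl[OF t(1)] t(2) rep_cls[OF x]] by blast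
        then show "\<exists>v\<in>T1 w'. feq w' v (\<tau> 0) \<and> (\<exists>y\<in>T0 w'. eqw w' y (App \<gamma> x) \<and>
            forces A w' (case_nat y (case_nat x \<sigma>)) (case_nat v (case_nat \<gamma> \<tau>)))"
          using t feq_refl[OF t(1)] eqw_refl[OF ww t(2)] by blast
      qed
    qed
  qed
  also have "\<dots> \<longleftrightarrow> frep w \<gamma> F" using \<gamma> unfolding frep_def by blast
  finally show ?thesis .
qed

text \<open>As for descriptions, existence and definability go together: the functor for a
  \<lambda>-term is obtained by choice from the graph formula of its body. Only the first
  \<open>N\<close> entries of the sequence of values are under control, hence the bound on the
  variables.\<close>

lemma gr_correct:
  "wf_trm lang_EL_plus t \<Longrightarrow> vt (below N) (\<lambda>_. True) t \<Longrightarrow> genv w \<tau> E N e f \<Longrightarrow>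
    (\<exists>y. rep w y (val0 e f t)) \<and> (\<forall>y\<in>T0 w. \<forall>\<sigma>. forces (gr E t) w (case_nat y \<sigma>) \<tau> \<longleftrightarrow> rep w y (val0 e f t))"
  "wf_fct lang_EL_plus u \<Longrightarrow> vu (below N) (\<lambda>_. True) u \<Longrightarrow> genv w \<tau> E N e f \<Longrightarrow>
    (\<exists>v. frep w v (val1 e f u)) \<and> (\<forall>y\<in>T0 w. \<forall>x xn \<sigma>. rep w x xn \<longrightarrow>
      (forces (gf E u) w (case_nat y (case_nat x \<sigma>)) \<tau> \<longleftrightarrow> rep w y (val1 e f u xn)))"
proof (induct t and u arbitrary: N w \<tau> E e and N w \<tau> E e rule: trm.induct fct.induct)
  case (NVar n)
  have w: "world w" using NVar(3) by (simp add: genv_def)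
  have r: "rep w (App (\<tau> 0) (num n)) (e n)" using NVar(2,3) by (simp add: genv_def)
  show ?case using rep_unique[OF w r] r by auto
next
  case (Cst c ts us)
  note g = Cst(5)
  have w: "world w" and T: "\<And>n. \<tau> n \<in> T1 w" using g by (auto simp: genv_def)
  let ?xs = "map (val0 e f) ts" and ?fs = "map (val1 e f) us"
  have c: "c \<in> lang_EL_plus" "arity c = (length ?xs, length ?fs)" "arity c \<noteq> (1, 0)" using Cst(3) by auto
  have us: "us = [] \<or> (\<exists>u. us = [u])"
  proof -
    have "snd (arity c) \<le> 1" by (cases c rule: arity.cases; cases "SOME k. c = Kl k") (auto, (metis One_nat_def arity_klc.elims le_refl snd_conv zero_le)?)
    then show ?thesis using c(2) by (cases us; cases "tl us") auto
  qed
  have t: "(\<exists>y. rep w' y (val0 e f t)) \<and> (\<forall>y\<in>T0 w'. \<forall>\<sigma>. forces (gr E' t) w' (case_nat y \<sigma>) \<tau>' \<longleftrightarrow> rep w' y (val0 e f t))"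
    if "t \<in> set ts" "genv w' \<tau>' E' N e f" for t w' \<tau>' E'
    using Cst(1)[OF that(1) _ _ that(2)] Cst(3,4) that(1) by simp
  have u: "(\<exists>v. frep w' v (val1 e f u)) \<and> (\<forall>y\<in>T0 w'. \<forall>x xn \<sigma>. rep w' x xn \<longrightarrow>
      (forces (gf E' u) w' (case_nat y (case_nat x \<sigma>)) \<tau>' \<longleftrightarrow> rep w' y (val1 e f u xn)))"
    if "u \<in> set us" "genv w' \<tau>' E' N e f" for u w' \<tau>' E'
    using Cst(2)[OF that(1) _ _ that(2)] Cst(3,4) that(1) by simp
  let ?G = "\<lambda>\<gamma>. ?fs \<noteq> [] \<longrightarrow> frep w \<gamma> (hd ?fs)"
  have G: "forces (gfun (map (gf (E + 2)) us)) w \<sigma> (case_nat \<gamma> \<tau>) \<longleftrightarrow> ?G \<gamma>" if \<gamma>: "\<gamma> \<in> T1 w" for \<gamma> \<sigma>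
    using us
  proof (elim disjE exE)
    fix v assume v: "us = [v]"
    show ?thesis using forces_gfun[OF g \<gamma>, of "gf (E + 2) v" "val1 e f v"] u[of v] v by simp
  qed (use eqw_refl[OF w] in simp)
  obtain \<gamma>0 where \<gamma>0: "\<gamma>0 \<in> T1 w" "?G \<gamma>0"
    using us
  proof (elim disjE exE)
    fix v assume v: "us = [v]"
    with u[of v, OF _ g] show ?thesis using that frep_T1 by auto
  qed (use that[of "\<tau> 0"] T in auto)
  have args: "forces (argcs 3 0 (map (gr (E + 3)) ts)) w \<sigma> (case_nat b (case_nat \<gamma> \<tau>)) \<longleftrightarrow> vrep w b ?xs"
    if b: "b \<in> T1 w" and \<gamma>: "\<gamma> \<in> T1 w" for b \<gamma> \<sigma>
  proof -
    have "forces (argcs (Suc 2) 0 (map (gr (E + 3)) ts)) w \<sigma> (case_nat b (case_nat \<gamma> \<tau>)) \<longleftrightarrow>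
        (\<forall>k<length ?xs. rep w (App b (num (0 + k))) (?xs ! k))"
    proof (rule forces_argcs[OF w _ T b])
      show "case_nat b (case_nat \<gamma> \<tau>) 2 = \<tau> 0" by (simp add: numeral_2_eq_2)
      fix k v y \<sigma>' assume h: "k < length (map (gr (E + 3)) ts)" "v \<in> T1 w" "feq w v (\<tau> 0)" "y \<in> T0 w"
      \<comment> \<open>Three function variables have been added: the functor argument, the vector
        of number arguments, and the copy of the sequence.\<close>
      have "genv w (case_nat v (case_nat b (case_nat \<gamma> \<tau>))) (E + 3) N e f"
        by (rule genv_push[OF g h(2,3)]) (use h(2) b \<gamma> T in \<open>auto split: nat.split simp: numeral_3_eq_3\<close>)
      then show "forces (map (gr (E + 3)) ts ! k) w (case_nat y \<sigma>') (case_nat v (case_nat b (case_nat \<gamma> \<tau>))) \<longleftrightarrow> rep w y (?xs ! k)"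
        using t[of "ts ! k"] h(1,4) by auto
    qed simp
    then show ?thesis using b by (simp add: vrep_def numeral_3_eq_3)
  qed
  obtain b0 where b0: "vrep w b0 ?xs" using vrep_exists[OF w, of ?xs] t[OF _ g] by auto
  have b0T: "b0 \<in> T1 w" using b0 by (simp add: vrep_def)
  have C: "(\<exists>y. rep w y (ic c ?xs ?fs)) \<and> (\<forall>y\<in>T0 w. \<forall>\<sigma> \<tau>.
    forces (cg c) w (case_nat y \<sigma>) (case_nat b (case_nat \<gamma> \<tau>)) \<longleftrightarrow> rep w y (ic c ?xs ?fs))"
    if "vrep w b ?xs" "?G \<gamma>" for b \<gamma>
    by (rule cg_correct[OF c w that(1)]) (use that(2) in simp)
  have "forces (gr E (Cst c ts us)) w (case_nat y \<sigma>) \<tau> \<longleftrightarrow> (\<exists>\<gamma>\<in>T1 w. ?G \<gamma> \<and> (\<exists>b\<in>T1 w. vrep w b ?xs \<and>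
      forces (cg c) w (case_nat y \<sigma>) (case_nat b (case_nat \<gamma> \<tau>))))" for y \<sigma>
    using G args by auto
  then have "forces (gr E (Cst c ts us)) w (case_nat y \<sigma>) \<tau> \<longleftrightarrow> rep w y (ic c ?xs ?fs)" if "y \<in> T0 w" for y \<sigma>
    using C that b0 b0T \<gamma>0 by blast
  then show ?case using C[OF b0 \<gamma>0(2)] by simp
next
  case (App u t)
  note g = App(5)
  have w: "world w" using g by (simp add: genv_def)
  from App(1)[OF _ _ g] App(3,4) have u: "\<exists>v. frep w v (val1 e f u)"
    "\<And>y x xn \<sigma>. y \<in> T0 w \<Longrightarrow> rep w x xn \<Longrightarrow> forces (gf E u) w (case_nat y (case_nat x \<sigma>)) \<tau> \<longleftrightarrow> rep w y (val1 e f u xn)"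
    by auto
  from App(2)[OF _ _ g] App(3,4) have t: "\<exists>z. rep w z (val0 e f t)"
    "\<And>y \<sigma>. y \<in> T0 w \<Longrightarrow> forces (gr E t) w (case_nat y \<sigma>) \<tau> \<longleftrightarrow> rep w y (val0 e f t)" by auto
  obtain v z where v: "frep w v (val1 e f u)" and z: "rep w z (val0 e f t)" using u(1) t(1) by blast
  note R = frepD[OF w v z]
  have "forces (gr E (App u t)) w (case_nat y \<sigma>) \<tau> \<longleftrightarrow> rep w y (val1 e f u (val0 e f t))" if y: "y \<in> T0 w" for y \<sigma>
  proof -
    have "forces (gr E (App u t)) w (case_nat y \<sigma>) \<tau> \<longleftrightarrow> (\<exists>z\<in>T0 w. forces (gr E t) w (case_nat z (case_nat y \<sigma>)) \<tau> \<and>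
      (\<exists>y'\<in>T0 w. eqw w y' y \<and> forces (gf E u) w (case_nat y' (case_nat z (case_nat y \<sigma>))) \<tau>))"
      by (simp add: numeral_2_eq_2)
    also have "\<dots> \<longleftrightarrow> (\<exists>z\<in>T0 w. rep w z (val0 e f t) \<and> (\<exists>y'\<in>T0 w. eqw w y' y \<and> rep w y' (val1 e f u (val0 e f t))))"
      using t(2) u(2) by blast
    also have "\<dots> \<longleftrightarrow> rep w y (val1 e f u (val0 e f t))"
      using z rep_T0[OF z] y eqw_refl[OF w y] rep_eqw[OF w] by blast
    finally show ?thesis .
  qed
  then show ?case using R by auto
next
  case (FVar n)
  have w: "world w" and v: "frep w (\<tau> (n + E)) (f n)" using FVar(3) by (auto simp: genv_def)
  show ?case using v rep_unique[OF w frepD[OF w v]] by auto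
next
  case (FC c)
  have w: "world w" using FC(3) by (simp add: genv_def)
  have c: "c \<in> lang_EL_plus" "arity c = (1, 0)" using FC(1) by auto
  have "\<exists>v. frep w v (\<lambda>x. ic c [x] [])"
    by (rule frep_exists[OF wf_fcg[OF c(2)] env_nil[OF w]]) (use fcg_correct[OF c le_world(2)] in blast)
  then show ?case using fcg_correct[OF c w] by auto
next
  case (Lam t)
  note g = Lam(4)
  have w: "world w" and T: "\<And>n. \<tau> n \<in> T1 w" using g by (auto simp: genv_def)
  \<comment> \<open>Below the binder one more entry of the sequence is needed.\<close>
  have t: "wf_trm lang_EL_plus t" "vt (below (Suc N)) (\<lambda>_. True) t" using Lam(2,3) by (auto simp: case_True_below)
  have key: "(\<exists>y. rep w' y (val1 e f (Lam t) xn)) \<and> (\<forall>y\<in>T0 w'. \<forall>\<sigma>.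
      forces (gf E (Lam t)) w' (case_nat y (case_nat x \<sigma>)) \<tau> \<longleftrightarrow> rep w' y (val1 e f (Lam t) xn))"
    if w': "le w w'" and x: "rep w' x xn" for w' x xn
  proof -
    note ww = le_world(2)[OF w'] and g' = genv_mono[OF g w'] and T' = D1_mono[OF w' T]
    let ?P = "\<lambda>v. eqw w' (App v \<^bold>0) x \<and> (\<forall>w''. le w' w'' \<longrightarrow> (\<forall>k\<in>T0 w''. eqw w'' (App v (succ k)) (App (\<tau> 0) k)))"
    have IH: "(\<exists>y. rep w' y (val0 (case_nat xn e) f t)) \<and> (\<forall>y\<in>T0 w'. \<forall>\<sigma>.
      forces (gr (E + 1) t) w' (case_nat y \<sigma>) (case_nat v \<tau>) \<longleftrightarrow> rep w' y (val0 (case_nat xn e) f t))"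
      if v: "v \<in> T1 w'" "?P v" for v
    proof (rule Lam(1)[OF t])
      have "rep w' (App v (num n)) (case_nat xn e n)" if "n < Suc N" for n
      proof (cases n)
        case 0 then show ?thesis using v(2) rep_eqw'[OF ww x] by simp
      next
        case (Suc m)
        have "rep w' (App (\<tau> 0) (num m)) (e m)" using g' that Suc by (simp add: genv_def)
        moreover have "eqw w' (App v (num n)) (App (\<tau> 0) (num m))" using v(2) le_world(3)[OF ww] T0_num Suc by auto
        ultimately show ?thesis using rep_eqw'[OF ww] Suc by simp
      qed
      then show "genv w' (case_nat v \<tau>) (E + 1) (Suc N) (case_nat xn e) f"
        using g' v(1) T' unfolding genv_def by (auto split: nat.split)
    qed
    obtain v0 where v0: "v0 \<in> T1 w'" "?P v0" using cons_fct[OF ww rep_T0[OF x] T'] by blast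
    have "forces (gf E (Lam t)) w' (case_nat y (case_nat x \<sigma>)) \<tau> \<longleftrightarrow> (\<exists>v\<in>T1 w'. ?P v \<and>
        forces (gr (E + 1) t) w' (case_nat y (case_nat x \<sigma>)) (case_nat v \<tau>))" for y \<sigma>
      by (auto simp: consf_def)
    then have "forces (gf E (Lam t)) w' (case_nat y (case_nat x \<sigma>)) \<tau> \<longleftrightarrow> rep w' y (val0 (case_nat xn e) f t)" if "y \<in> T0 w'" for y \<sigma>
      using IH v0 that by blast
    then show ?thesis using IH[OF v0] by simp
  qed
  have "\<exists>v. frep w v (val1 e f (Lam t))"
  proof (rule frep_exists[where \<sigma> = nil0 and \<tau> = \<tau>])
    show "wf_fm lang_M (gf E (Lam t))" using wf_gr(2)[OF Lam(2)] .
    show "env w nil0 \<tau>" using w T by (intro envI) (auto simp: nil0_def)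
  qed (use key in blast)
  then show ?case using key[OF le_world(3)[OF w]] by blast
qed

lemma rep_envc:
  "forces (envc N) w \<sigma> \<tau> \<longleftrightarrow> eqw w \<^bold>0 \<^bold>0 \<and> (\<forall>n<N. eqw w (App (\<tau> 0) (num n)) (\<sigma> n))"
  by (induct N) (auto simp: less_Suc_eq)

text \<open>Infinitely many variables receive values, but the code of the term bounds those that
  occur, so a finite vector is enough.\<close>

lemma val_exists:
  assumes w: "world w" and e: "\<And>n. \<exists>t. rep w t (e n)" and f: "\<And>n. \<exists>u. frep w u (f n)"
  shows "wf_trm lang_EL_plus t \<Longrightarrow> \<exists>y. rep w y (val0 e f t)" "wf_fct lang_EL_plus u \<Longrightarrow> \<exists>v. frep w v (val1 e f u)"
proof -
  obtain \<tau> where \<tau>: "\<And>n. frep w (\<tau> n) (f n)" using f by metis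
  have "\<exists>v. genv w (case_nat v \<tau>) 1 N e f" for N
  proof -
    obtain v where v: "vrep w v (map e [0..<N])" using vrep_exists[OF w, of "map e [0..<N]"] e by auto
    then show ?thesis using w \<tau> frep_T1 by (intro exI[of _ v]) (auto simp: genv_def vrep_def split: nat.split)
  qed
  moreover have "vt (below (Suc (gn_trm t))) (\<lambda>_. True) t" "vu (below (Suc (gn_fct u))) (\<lambda>_. True) u"
    using vt_gn by auto
  ultimately show "wf_trm lang_EL_plus t \<Longrightarrow> \<exists>y. rep w y (val0 e f t)" "wf_fct lang_EL_plus u \<Longrightarrow> \<exists>v. frep w v (val1 e f u)"
    using gr_correct by blast+
qed

section \<open>The expansion as a Kripke model and the translation\<close>

definition X0 :: "world \<Rightarrow> elt set" where "X0 w = {x. \<exists>t. rep w t x}"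
definition X1 :: "world \<Rightarrow> (elt \<Rightarrow> elt) set" where "X1 w = {f. \<exists>u. frep w u f}"
definition eqx :: "world \<Rightarrow> elt \<Rightarrow> elt \<Rightarrow> bool" where "eqx w x y \<longleftrightarrow> x w = y w"

sublocale X: kmodel lang_EL_plus val0 val1 le X0 X1 eqx
proof
  fix w w' :: world assume "le w w'"
  then show "x \<in> X0 w \<Longrightarrow> x \<in> X0 w'" "f \<in> X1 w \<Longrightarrow> f \<in> X1 w'" for x f
    unfolding X0_def X1_def using rep_mono frep_mono by blast+
  show "eqx w' x y" if h: "x \<in> X0 w" "y \<in> X0 w" "eqx w x y" for x y
  proof -
    obtain s t where "rep w s x" "rep w t y" using h unfolding X0_def by blast
    with h(3) have "rep w s x" "rep w s y" using rep_eq[OF le_world(1)[OF \<open>le w w'\<close>]] rep_eqw'[OF le_world(1)[OF \<open>le w w'\<close>]]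
      unfolding eqx_def by blast+
    then show ?thesis using \<open>le w w'\<close> unfolding eqx_def rep_def by simp
  qed
next
  fix w :: world and e :: "nat \<Rightarrow> elt" and f :: "nat \<Rightarrow> elt \<Rightarrow> elt" assume h: "le w w" "\<forall>n. e n \<in> X0 w" "\<forall>n. f n \<in> X1 w"
  then have E: "\<And>n. \<exists>t. rep w t (e n)" "\<And>n. \<exists>u. frep w u (f n)" by (auto simp: X0_def X1_def)
  show "wf_trm lang_EL_plus t \<Longrightarrow> val0 e f t \<in> X0 w" "wf_fct lang_EL_plus u \<Longrightarrow> val1 e f u \<in> X1 w" for t u
    unfolding X0_def X1_def using val_exists[of w e f, OF le_world(2)[OF h(1)] E] by simp_all
qed (auto simp: val_sub intro: le_trans le_refl)

lemma X_forces_Eq: "X.forces (s \<doteq> t) w e f \<longleftrightarrow> val0 e f s w = val0 e f t w"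
  by (rule trans[OF X.forces.simps(1) eqx_def])

definition fcls :: "fct \<Rightarrow> elt \<Rightarrow> elt" where
  "fcls u x = (\<lambda>w. {y. \<exists>t. rep w t x \<and> eqw w (App u t) y})"

lemma frep_fcls:
  assumes u: "u \<in> T1 w"
  shows "frep w u (fcls u)"
  unfolding frep_def
proof (intro conjI u allI impI)
  fix w' t x assume w': "le w w'" and t: "rep w' t x"
  show "rep w' (App u t) (fcls u x)"
  proof (rule repI)
    show "App u t \<in> T0 w'" using rep_T0[OF t] D1_mono[OF w' u] by blast
    fix w'' assume w'': "le w' w''"
    note ww = le_world(2)[OF w'']
    have "eqw w'' (App u r) y \<longleftrightarrow> eqw w'' (App u t) y" if "rep w'' r x" for r y
      by (rule eqw_left[OF ww eqw_App[OF ww D1_mono[OF le_trans[OF w' w''] u]]])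
        (use rep_iff[OF ww that] rep_mono[OF t w''] in blast)
    then show "fcls u x w'' = {s. eqw w'' (App u t) s}" unfolding fcls_def using rep_mono[OF t w''] by blast
  qed
qed

lemma rep_all: "le w w' \<Longrightarrow> \<forall>n. rep w (\<sigma> n) (e n) \<Longrightarrow> \<forall>n. rep w' (\<sigma> n) (e n)"
  using rep_mono by blast

lemma frep_all: "le w w' \<Longrightarrow> \<forall>n. frep w (\<tau> n) (f n) \<Longrightarrow> \<forall>n. frep w' (\<tau> n) (f n)"
  using frep_mono by blast

lemma rep_case: "rep w t x \<Longrightarrow> \<forall>n. rep w (\<sigma> n) (e n) \<Longrightarrow> \<forall>n. rep w (case_nat t \<sigma> n) (case_nat x e n)"
  by (simp split: nat.split)

lemma frep_case: "frep w u g \<Longrightarrow> \<forall>n. frep w (\<tau> n) (f n) \<Longrightarrow> \<forall>n. frep w (case_nat u \<tau> n) (case_nat g f n)"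
  by (simp split: nat.split)

text \<open>The expansion leaves the language of \<open>M\<close> as it was; this is why equations
  of \<open>M\<close> may be left untranslated.\<close>

lemma val_M:
  "wf_trm lang_M t \<Longrightarrow> env w \<sigma> \<tau> \<Longrightarrow> \<forall>n. rep w (\<sigma> n) (e n) \<Longrightarrow> \<forall>n. frep w (\<tau> n) (f n) \<Longrightarrow>
    rep w (sub_trm \<sigma> \<tau> t) (val0 e f t)"
  "wf_fct lang_M u \<Longrightarrow> env w \<sigma> \<tau> \<Longrightarrow> \<forall>n. rep w (\<sigma> n) (e n) \<Longrightarrow> \<forall>n. frep w (\<tau> n) (f n) \<Longrightarrow>
    frep w (sub_fct \<sigma> \<tau> u) (val1 e f u)"
proof (induct t and u arbitrary: w \<sigma> e and w \<sigma> e rule: trm.induct fct.induct)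
  case (Cst c ts us)
  note w = env_world[OF Cst(4)]
  have IH: "rep w (sub_trm \<sigma> \<tau> t) (val0 e f t)" if "t \<in> set ts" for t
    using Cst(1)[OF that _ Cst(4-6)] Cst(3) that by simp
  have IH1: "frep w (sub_fct \<sigma> \<tau> t) (val1 e f t)" if "t \<in> set us" for t
    using Cst(2)[OF that _ Cst(4-6)] Cst(3) that by simp
  consider "c = Zero" "ts = []" "us = []"
    | k s t where "c = Kl k" "arity_klc k = (2, 0)" "ts = [s, t]" "us = []"
    | k t u where "c = Kl k" "arity_klc k = (1, 1)" "ts = [t]" "us = [u]"
    by (rule lang_M_Cst[OF Cst(3)])
  then show ?case
  proof cases
    case 1 then show ?thesis using rep_cls by simp
  next
    case 2 then show ?thesis using IH rep_k2[OF w, of k _ _ _ _ "[]"] by auto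
  next
    case 3 then show ?thesis using IH IH1 rep_kf[OF w, of k] by auto
  qed
next
  case (App u t)
  then show ?case using frepD[OF env_world[OF App(4)]] by simp
next
  case (FC c)
  have T: "FC c \<in> T1 w" using sub_T1[OF FC(2,1)] by simp
  have "c = Fn SuccD \<or> (\<exists>k. c = Kl k \<and> arity_klc k = (1, 0))" using FC(1) by (auto simp: lang_M_def)
  then show ?case using T rep_succ[OF le_world(2)] rep_k1[OF le_world(2)] by (auto simp: frep_def)
next
  case (Lam t)
  have t: "wf_trm lang_M t" using Lam(2) by simp
  have L: "sub_fct \<sigma> \<tau> (Lam t) \<in> T1 w" using sub_T1[OF Lam(3,2)] .
  have "rep w' (App (sub_fct \<sigma> \<tau> (Lam t)) x) (val1 e f (Lam t) xn)" if w': "le w w'" and x: "rep w' x xn" for w' x xn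
  proof -
    have "rep w' (sub_trm (case_nat x \<sigma>) \<tau> t) (val0 (case_nat xn e) f t)"
      by (rule Lam(1)[OF t env_case0[OF env_le[OF Lam(3) w'] rep_T0[OF x]]])
        (use rep_case[OF x rep_all[OF w' Lam(4)]] frep_all[OF w' Lam(5)] in blast)+
    then show ?thesis
      using rep_eqw'[OF le_world(2)[OF w'] _ beta[OF env_le[OF Lam(3) w'] t rep_T0[OF x]]] by simp
  qed
  then show ?case using L unfolding frep_def by blast
qed auto

text \<open>The work is in the equations. Quantifiers of the expansion range over the elements that
  have a representative, so one passes from an element to its representative and from a term to its
  class.\<close>

theorem forces_tr:
  "wf_fm lang_EL_plus A \<Longrightarrow> env w \<sigma> \<tau> \<Longrightarrow> \<forall>n. rep w (\<sigma> n) (e n) \<Longrightarrow> \<forall>n. frep w (\<tau> n) (f n) \<Longrightarrow>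
    X.forces A w e f \<longleftrightarrow> forces (tr A) w \<sigma> \<tau>"
proof (induct A arbitrary: w \<sigma> \<tau> e f)
  case (Eq s t)
  note w = env_world[OF Eq(2)]
  show ?case
  proof (cases "mt s \<and> mt t")
    case True
    then have "wf_trm lang_M s" "wf_trm lang_M t" using Eq(1) mt_M by auto
    then have "rep w (sub_trm \<sigma> \<tau> s) (val0 e f s)" "rep w (sub_trm \<sigma> \<tau> t) (val0 e f t)"
      using val_M(1)[OF _ Eq(2-4)] by blast+
    then show ?thesis using rep_eq[OF w] True by (simp only: X_forces_Eq tr.simps forces.simps simp_thms if_True)
  next
    case False
    let ?N = "Suc (gn_fm (s \<doteq> t))"
    have le: "gn_trm s < ?N" "gn_trm t < ?N"
      using le_prod_encode_1[of "gn_trm s" "gn_trm t"] le_prod_encode_2[of "gn_trm t" "gn_trm s"]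
        le_prod_encode_2[of "prod_encode (gn_trm s, gn_trm t)" 0] by (auto simp: tag_def)
    \<comment> \<open>A vector that agrees with the environment on the variables below the code
      meets the requirements of both graph formulas.\<close>
    have G: "genv w (case_nat v \<tau>) 1 ?N e f" if "v \<in> T1 w" "\<forall>n<?N. eqw w (App v (num n)) (\<sigma> n)" for v
    proof -
      have "rep w (App v (num n)) (e n)" if "n < ?N" for n
        using rep_eqw'[OF w Eq(3)[rule_format]] \<open>\<forall>n<?N. _ n\<close> that by blast
      then show ?thesis
        using that(1) w Eq(4) env_T[OF Eq(2)] unfolding genv_def by (auto split: nat.split simp del: gn_fm.simps)
    qed
    obtain v0 where v0: "v0 \<in> T1 w" "\<forall>n<?N. eqw w (App v0 (num n)) (\<sigma> n)"
      using vec_fct[OF w, of "map \<sigma> [0..<?N]"] env_T(1)[OF Eq(2)] by (auto simp del: upt_Suc)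
    have "forces (tr (s \<doteq> t)) w \<sigma> \<tau> \<longleftrightarrow> (\<exists>v\<in>T1 w. (\<forall>n<?N. eqw w (App v (num n)) (\<sigma> n)) \<and>
      (\<exists>y\<in>T0 w. forces (gr 1 s) w (case_nat y \<sigma>) (case_nat v \<tau>) \<and> forces (gr 1 t) w (case_nat y \<sigma>) (case_nat v \<tau>)))"
    proof -
      have "tr (s \<doteq> t) = Ex1 (envc ?N \<^bold>\<and> Ex0 (gr 1 s \<^bold>\<and> gr 1 t))" using False by (simp del: envc.simps gn_fm.simps)
      then show ?thesis using eqw_refl[OF w T0_zero] by (simp add: rep_envc del: envc.simps gn_fm.simps tr.simps)
    qed
    also have "\<dots> \<longleftrightarrow> (\<exists>y\<in>T0 w. rep w y (val0 e f s) \<and> rep w y (val0 e f t))"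
    proof -
      have "wf_trm lang_EL_plus s" "wf_trm lang_EL_plus t" using Eq(1) by simp_all
      then have "\<forall>y\<in>T0 w. (forces (gr 1 s) w (case_nat y \<sigma>) (case_nat v \<tau>) \<longleftrightarrow> rep w y (val0 e f s)) \<and>
          (forces (gr 1 t) w (case_nat y \<sigma>) (case_nat v \<tau>) \<longleftrightarrow> rep w y (val0 e f t))"
        if "v \<in> T1 w" "\<forall>n<?N. eqw w (App v (num n)) (\<sigma> n)" for v
        using gr_correct(1)[OF _ vt_gn(1)[OF le(1)] G[OF that]] gr_correct(1)[OF _ vt_gn(1)[OF le(2)] G[OF that]] by blast
      then show ?thesis using v0 by blast
    qed
    also have "\<dots> \<longleftrightarrow> eqx w (val0 e f s) (val0 e f t)"
    proof -
      obtain x y where "rep w x (val0 e f s)" "rep w y (val0 e f t)"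
        using val_exists(1)[OF w] Eq(1,3,4) by (metis wf_fm.simps(1))
      then show ?thesis using rep_eq[OF w] rep_iff[OF w] rep_T0 unfolding eqx_def by blast
    qed
    finally show ?thesis by simp
  qed
next
  case (Neg A)
  have "X.forces A w' e f \<longleftrightarrow> forces (tr A) w' \<sigma> \<tau>" if "le w w'" for w'
    by (rule Neg(1)[OF _ env_le[OF Neg(3) that]]) (use Neg(2) rep_all[OF that Neg(4)] frep_all[OF that Neg(5)] in auto)
  then show ?case by auto
next
  case (And A B)
  show ?case using And(1,2)[OF _ And(4-6)] And(3) by auto
next
  case (Or A B)
  show ?case using Or(1,2)[OF _ Or(4-6)] Or(3) by auto
next
  case (Imp A B)
  have "(X.forces A w' e f \<longleftrightarrow> forces (tr A) w' \<sigma> \<tau>) \<and> (X.forces B w' e f \<longleftrightarrow> forces (tr B) w' \<sigma> \<tau>)" if "le w w'" for w'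
    by (rule conjI[OF Imp(1)[OF _ env_le[OF Imp(4) that]] Imp(2)[OF _ env_le[OF Imp(4) that]]])
      (use Imp(3) rep_all[OF that Imp(5)] frep_all[OF that Imp(6)] in auto)
  then show ?case by auto
next
  case (All0 A)
  have K: "X.forces A w' (case_nat x e) f \<longleftrightarrow> forces (tr A) w' (case_nat t \<sigma>) \<tau>" if "le w w'" "rep w' t x" for w' t x
    by (rule All0(1)[OF _ env_case0[OF env_le[OF All0(3) that(1)] rep_T0[OF that(2)]]])
      (use All0(2) rep_case[OF that(2) rep_all[OF that(1) All0(4)]] frep_all[OF that(1) All0(5)] in simp_all)
  show ?case
    unfolding tr.simps forces.simps X.forces.simps
    using K rep_cls rep_T0 unfolding X0_def by blast
next
  case (Ex0 A)
  have K: "X.forces A w (case_nat x e) f \<longleftrightarrow> forces (tr A) w (case_nat t \<sigma>) \<tau>" if "rep w t x" for t x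
    by (rule Ex0(1)[OF _ env_case0[OF Ex0(3) rep_T0[OF that]]])
      (use Ex0(2) rep_case[OF that Ex0(4)] Ex0(5) in simp_all)
  show ?case
    unfolding tr.simps forces.simps X.forces.simps
    using K rep_cls rep_T0 unfolding X0_def by blast
next
  case (All1 A)
  have K: "X.forces A w' e (case_nat x f) \<longleftrightarrow> forces (tr A) w' \<sigma> (case_nat t \<tau>)" if "le w w'" "frep w' t x" for w' t x
    by (rule All1(1)[OF _ env_case1[OF env_le[OF All1(3) that(1)] frep_T1[OF that(2)]]])
      (use All1(2) rep_all[OF that(1) All1(4)] frep_case[OF that(2) frep_all[OF that(1) All1(5)]] in simp_all)
  show ?case
    unfolding tr.simps forces.simps X.forces.simps
    using K frep_fcls frep_T1 unfolding X1_def by blast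
next
  case (Ex1 A)
  have K: "X.forces A w e (case_nat x f) \<longleftrightarrow> forces (tr A) w \<sigma> (case_nat t \<tau>)" if "frep w t x" for t x
    by (rule Ex1(1)[OF _ env_case1[OF Ex1(3) frep_T1[OF that]]])
      (use Ex1(2) Ex1(4) frep_case[OF that Ex1(5)] in simp_all)
  show ?case
    unfolding tr.simps forces.simps X.forces.simps
    using K frep_fcls frep_T1 unfolding X1_def by blast
qed

end

section \<open>The axioms of \<open>EL\<^sup>+ + CF\<^sub>d\<close> in the expanded model\<close>

context ext_M
begin

lemma X_env:
  assumes "X.env w e f"
  obtains \<sigma> \<tau> where "env w \<sigma> \<tau>" "\<forall>n. rep w (\<sigma> n) (e n)" "\<forall>n. frep w (\<tau> n) (f n)"
proof -
  have "\<forall>n. \<exists>t. rep w t (e n)" "\<forall>n. \<exists>u. frep w u (f n)" and w: "world w"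
    using assms le_world(2) by (auto simp: X.env_def X0_def X1_def)
  then obtain \<sigma> \<tau> where h: "\<forall>n. rep w (\<sigma> n) (e n)" "\<forall>n. frep w (\<tau> n) (f n)" by metis
  have "env w \<sigma> \<tau>" using h rep_T0 frep_T1 w by (blast intro: envI)
  with h that show ?thesis by blast
qed

lemma X_world: "X.env w e f \<Longrightarrow> world w"
  using le_world(2) by (auto simp: X.env_def)

lemma X_val: "X.env w e f \<Longrightarrow> wf_trm lang_EL_plus t \<Longrightarrow> \<exists>y. rep w y (val0 e f t)"
  using X.v0_env unfolding X0_def by blast

lemma X_ax_M:
  assumes "A \<in> axms sys_M" and e: "X.env w e f"
  shows "X.forces A w e f"
proof -
  obtain \<sigma> \<tau> where h: "env w \<sigma> \<tau>" "\<forall>n. rep w (\<sigma> n) (e n)" "\<forall>n. frep w (\<tau> n) (f n)" using X_env[OF e] by blast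
  have wf: "wf_fm lang_M A" using axms_M_wf assms(1) by (auto simp: formulas_def sys_M_def)
  show ?thesis using forces_tr[OF wf_fm_M_EL[OF wf] h] ax_M[OF assms(1) h(1)] tr_M[OF wf] by simp
qed

lemma val_app_cst:
  "val0 e f (app_cst (Fn d) ts) = pv d (map (val0 e f) ts)"
  by (cases ts) (auto simp: app_cst_def)

lemma val_vars: "map (val0 e f) (vars m n) = map e [m..<m + n]"
  by (simp add: vars_def)

text \<open>A represented value contains its representative, so the set is nonempty and a solution
  exists. Hence the recursion equations follow from the mere existence of values of terms.\<close>

lemma PR_pru: "world w \<Longrightarrow> rep w y (PR a h x) \<Longrightarrow> \<exists>u. pru w u a h"
  using eqw_refl rep_T0 le_world(3) unfolding rep_def PR_def by blast

lemma PR_zero: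
  assumes w: "world w" and y: "rep w y (PR a h (cls \<^bold>0))"
  shows "PR a h (cls \<^bold>0) w = a w"
proof -
  obtain u where u: "pru w u a h" using PR_pru[OF w y] by blast
  have "rep w (App u \<^bold>0) (PR a h (cls \<^bold>0))" by (rule PR_rep[OF w u rep_cls]) simp
  moreover have "rep w (App u \<^bold>0) a" using u by (simp add: pru_def)
  ultimately show ?thesis using rep_eq[OF w] eqw_refl[OF w rep_T0] by blast
qed

lemma PR_succ:
  assumes w: "world w" and y: "rep w y (PR a h x)" and x: "rep w t x"
  shows "PR a h (sucv x) w = h x (PR a h x) w"
proof -
  obtain u where u: "pru w u a h" using PR_pru[OF w y] by blast
  have "rep w (App u (succ t)) (PR a h (sucv x))" by (rule PR_rep[OF w u rep_succ[OF w x]])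
  moreover have "rep w (App u (succ t)) (h x (PR a h x))"
    using u x PR_rep[OF w u x] le_world(3)[OF w] unfolding pru_def by blast
  ultimately show ?thesis using rep_eq[OF w] eqw_refl[OF w rep_T0] by blast
qed

lemma val1_FVar_all: "(\<lambda>n. val1 e f (FVar n)) = f"
  by simp

lemma X_replacement:
  assumes A: "wf_fm lang_EL_plus A" and e: "X.env w e f"
  shows "X.forces (sub0 (NVar i) A \<^bold>\<and> NVar i \<doteq> NVar j \<^bold>\<longrightarrow> sub0 (NVar j) A) w e f"
proof -
  obtain \<sigma> \<tau> where h: "env w \<sigma> \<tau>" "\<forall>n. rep w (\<sigma> n) (e n)" "\<forall>n. frep w (\<tau> n) (f n)" using X_env[OF e] by blast
  have R: "X.forces A w' (case_nat (e j) e) f" if w': "le w w'" and a: "X.forces A w' (case_nat (e i) e) f" and eq: "e i w' = e j w'" for w'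
  proof -
    note ww = le_world(2)[OF w'] and h' = env_le[OF h(1) w'] rep_all[OF w' h(2)] frep_all[OF w' h(3)]
    \<comment> \<open>Elements that are equal in a world share a representative; both instances of
      \<open>A\<close> then have the truth value of \<open>tr A\<close> at that
      representative.\<close>
    have r: "rep w' (\<sigma> i) (e i)" "rep w' (\<sigma> i) (e j)"
      using h'(2) rep_eq[OF ww] eq rep_eqw'[OF ww] by blast+
    have "X.forces A w' (case_nat (e i) e) f \<longleftrightarrow> forces (tr A) w' (case_nat (\<sigma> i) \<sigma>) \<tau>"
      "X.forces A w' (case_nat (e j) e) f \<longleftrightarrow> forces (tr A) w' (case_nat (\<sigma> i) \<sigma>) \<tau>"
      by (rule forces_tr[OF A env_case0[OF h'(1) rep_T0[OF r(1)]] rep_case h'(3)]; use r h'(2) in blast)+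
    then show ?thesis using a by blast
  qed
  show ?thesis
    unfolding X.forces.simps(3,5) X.forces_sub0 val0.simps X_forces_Eq
    by (intro allI impI, elim conjE) (rule R)
qed

text \<open>Induction for \<open>A\<close> in the expansion is induction for \<open>tr A\<close>, a
  formula of \<open>M\<close>, in the model below.\<close>

lemma X_induction:
  assumes A: "wf_fm lang_EL_plus A" and e: "X.env w e f"
  shows "X.forces (sub0 \<^bold>0 A \<^bold>\<and> All0 (A \<^bold>\<longrightarrow> sub_fm (step0 (succ (NVar 0))) FVar A) \<^bold>\<longrightarrow> All0 A) w e f"
proof -
  obtain \<sigma> \<tau> where h: "env w \<sigma> \<tau>" "\<forall>n. rep w (\<sigma> n) (e n)" "\<forall>n. frep w (\<tau> n) (f n)" using X_env[OF e] by blast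
  have L: "X.forces A w' (case_nat x e) f \<longleftrightarrow> forces (tr A) w' (case_nat t \<sigma>) \<tau>" if "le w w'" "rep w' t x" for w' t x
    by (rule forces_tr[OF A env_case0[OF env_le[OF h(1) that(1)] rep_T0[OF that(2)]]
        rep_case[OF that(2) rep_all[OF that(1) h(2)]] frep_all[OF that(1) h(3)]])
  have eq: "(\<lambda>n. val0 (case_nat x e) f (step0 (succ (NVar 0)) n)) = case_nat (sucv x) e" for x
    by (rule HOL.ext) (simp add: step0_def split: nat.split)
  have "X.forces A w2 (case_nat x e) f"
    if w1: "le w w1" and z: "X.forces A w1 (case_nat (cls \<^bold>0) e) f"
      and s: "\<And>w' x w''. le w1 w' \<Longrightarrow> x \<in> X0 w' \<Longrightarrow> le w' w'' \<Longrightarrow> X.forces A w'' (case_nat x e) f \<Longrightarrow> X.forces A w'' (case_nat (sucv x) e) f"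
      and w2: "le w1 w2" and x: "x \<in> X0 w2" for w1 w2 x
  proof -
    note l2 = le_trans[OF w1 w2]
    obtain t where t: "rep w2 t x" using x by (auto simp: X0_def)
    have "forces (tr A) w2 (case_nat t \<sigma>) \<tau>"
    proof (rule induct[OF wf_tr[OF A] env_le[OF h(1) l2] _ _ rep_T0[OF t]])
      have "forces (tr A) w1 (case_nat \<^bold>0 \<sigma>) \<tau>" using L[OF w1 rep_cls] z by blast
      then show "forces (tr A) w2 (case_nat \<^bold>0 \<sigma>) \<tau>"
        by (intro forces_mono[OF wf_fm_M[OF wf_tr[OF A]] env_case0[OF env_le[OF h(1) w1]] _ w2]) auto
    next
      fix w' t assume w': "le w2 w'" and t: "t \<in> T0 w'" and IH: "forces (tr A) w' (case_nat t \<sigma>) \<tau>"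
      note ww = le_world(2)[OF w'] and l' = le_trans[OF l2 w']
      have "X.forces A w' (case_nat (cls t) e) f" using L[OF l' rep_cls[OF t]] IH by blast
      then have "X.forces A w' (case_nat (sucv (cls t)) e) f"
        using s[OF le_trans[OF w2 w'] _ le_world(3)[OF ww]] rep_cls[OF t] unfolding X0_def by blast
      then show "forces (tr A) w' (case_nat (succ t) \<sigma>) \<tau>" using L[OF l' rep_succ[OF ww rep_cls[OF t]]] by blast
    qed
    then show ?thesis using L[OF l2 t] by blast
  qed
  then have "(\<forall>w1. le w w1 \<longrightarrow> X.forces (sub0 \<^bold>0 A) w1 e f \<and>
      X.forces (All0 (A \<^bold>\<longrightarrow> sub_fm (step0 (succ (NVar 0))) FVar A)) w1 e f \<longrightarrow> X.forces (All0 A) w1 e f)"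
    unfolding X.forces.simps(5,6) X.forces_sub0 unfolding X.forces_sub eq val0.simps ic.simps val1_FVar_all by blast
  then show ?thesis by (simp only: X.forces.simps(3,5))
qed

lemma X_prd_equations:
  assumes d: "wf_prd d" and A: "A \<in> prd_equations d" and e: "X.env w e f"
  shows "X.forces A w e f"
proof (cases d)
  case (ZeroD n)
  then show ?thesis using A by (simp del: X.forces.simps add: X_forces_Eq val_app_cst)
next
  case SuccD then show ?thesis using A by simp
next
  case (ProjD n i)
  then show ?thesis using A d by (simp del: X.forces.simps add: X_forces_Eq val_app_cst val_vars)
next
  case (CompD n h gs)
  then show ?thesis using A by (simp del: X.forces.simps add: X_forces_Eq val_app_cst comp_def)
next
  case (RecD g h)
  note w = X_world[OF e]
  let ?n = "arity_prd g"
  let ?xs = "map e [1..<1 + ?n]"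
  let ?h = "\<lambda>n v. pv h (n # v # ?xs)"
  have wf: "wf_trm lang_EL_plus (app_cst (Fn d) (t # vars 1 ?n))" if "wf_trm lang_EL_plus t" for t
    using that d RecD by (intro wf_app_cst) (auto simp: lang_EL_plus_def lang_HA1_def vars_def)
  have v: "val0 e f (app_cst (Fn d) (t # vars 1 ?n)) = PR (pv g ?xs) ?h (val0 e f t)" for t
    using RecD by (simp add: val_app_cst val_vars del: upt_Suc)
  have z: "\<exists>y. rep w y (PR (pv g ?xs) ?h (cls \<^bold>0))"
    using X_val[OF e wf[of "\<^bold>0"]] unfolding v by (simp add: lang_EL_plus_def lang_HA1_def)
  have s: "\<exists>y. rep w y (PR (pv g ?xs) ?h (e 0))"
    using X_val[OF e wf[of "NVar 0"]] unfolding v by simp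
  obtain t where t: "rep w t (e 0)" using X_val[OF e, of "NVar 0"] by auto
  have "A = (app_cst (Fn d) (\<^bold>0 # vars 1 ?n) \<doteq> app_cst (Fn g) (vars 1 ?n)) \<or>
     A = (app_cst (Fn d) (succ (NVar 0) # vars 1 ?n) \<doteq> app_cst (Fn h) (NVar 0 # app_cst (Fn d) (NVar 0 # vars 1 ?n) # vars 1 ?n))"
    using A RecD by (simp add: Let_def)
  then show ?thesis
  proof
    assume "A = (app_cst (Fn d) (\<^bold>0 # vars 1 ?n) \<doteq> app_cst (Fn g) (vars 1 ?n))"
    then show ?thesis using PR_zero[OF w] z
      by (simp only: X_forces_Eq v) (auto simp: val_app_cst val_vars simp del: upt_Suc)
  next
    assume "A = (app_cst (Fn d) (succ (NVar 0) # vars 1 ?n) \<doteq> app_cst (Fn h) (NVar 0 # app_cst (Fn d) (NVar 0 # vars 1 ?n) # vars 1 ?n))"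
    moreover have "PR (pv g ?xs) ?h (sucv (e 0)) w = ?h (e 0) (PR (pv g ?xs) ?h (e 0)) w"
      using PR_succ[OF w _ t] s by blast
    moreover have "val0 e f (app_cst (Fn h) (NVar 0 # app_cst (Fn d) (NVar 0 # vars 1 ?n) # vars 1 ?n)) =
        ?h (e 0) (PR (pv g ?xs) ?h (e 0))"
      unfolding val_app_cst[of e f h] list.map v val_vars by simp
    ultimately show ?thesis by (simp only: X_forces_Eq v) simp
  qed
qed

lemma val_pair: "val0 e f (pair s t) = pv pairD [val0 e f s, val0 e f t]"
  by (simp add: pair_def pairD_def twoD_def threeD_def)

lemma X_recursor:
  assumes A: "A \<in> recursor_axioms lang_EL_plus" and e: "X.env w e f"
  shows "X.forces A w e f"
proof -
  note w = X_world[OF e]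
  have R: "Rec \<in> lang_EL_plus" by (simp add: lang_EL_plus_def lang_HA1_def)
  let ?h = "\<lambda>u n v. val1 e f u (pv pairD [v, n])"
  have v: "val0 e f (rec t u s) = PR (val0 e f t) (?h u) (val0 e f s)" for t u s
    by simp
  from A consider t u where "A = (rec t u \<^bold>0 \<doteq> t)" "wf_trm lang_EL_plus t" "wf_fct lang_EL_plus u"
    | t u s where "A = (rec t u (succ s) \<doteq> App u (pair (rec t u s) s))" "wf_trm lang_EL_plus t"
      "wf_fct lang_EL_plus u" "wf_trm lang_EL_plus s"
    unfolding recursor_axioms_def by blast
  then show ?thesis
  proof cases
    case 1
    have "wf_trm lang_EL_plus (rec t u \<^bold>0)" using 1 R by (simp add: lang_EL_plus_def lang_HA1_def)
    from X_val[OF e this] obtain y where y: "rep w y (PR (val0 e f t) (?h u) (cls \<^bold>0))" by auto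
    show ?thesis unfolding 1(1) X_forces_Eq v using PR_zero[OF w y] by simp
  next
    case 2
    have "wf_trm lang_EL_plus (rec t u s)" using 2 R by simp
    from X_val[OF e this] obtain y where y: "rep w y (PR (val0 e f t) (?h u) (val0 e f s))" by auto
    obtain r where r: "rep w r (val0 e f s)" using X_val[OF e 2(4)] by blast
    show ?thesis unfolding 2(1) X_forces_Eq v using PR_succ[OF w y r] val_pair by simp
  qed
qed

text \<open>Equality of elements is equality of their representatives, which is decidable by
  arithmetic, even for terms outside the language of \<open>M\<close>.\<close>

lemma qf_dec:
  "quantifier_free A \<Longrightarrow> wf_fm lang_EL_plus A \<Longrightarrow> X.env w e f \<Longrightarrow>
     X.forces A w e f \<or> (\<forall>w'. le w w' \<longrightarrow> \<not> X.forces A w' e f)"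
proof (induct A arbitrary: w)
  case (Eq s t)
  note w = X_world[OF Eq(3)]
  obtain x y where x: "rep w x (val0 e f s)" and y: "rep w y (val0 e f t)"
    using X_val[OF Eq(3)] Eq(2) by (metis wf_fm.simps(1))
  have "X.forces (s \<doteq> t) w' e f \<longleftrightarrow> eqw w' x y" if "le w w'" for w'
    unfolding X_forces_Eq by (rule rep_eq[OF le_world(2)[OF that] rep_mono[OF x that] rep_mono[OF y that]])
  then show ?case using dec_eq[OF w rep_T0[OF x] rep_T0[OF y]] le_world(3)[OF w] by blast
next
  case (Neg A)
  note w = le_world(3)[OF X_world[OF Neg(4)]]
  have "X.forces A w e f \<or> (\<forall>w'. le w w' \<longrightarrow> \<not> X.forces A w' e f)" using Neg by simp
  then show ?case
  proof
    assume a: "X.forces A w e f"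
    have "X.forces A w' e f" if "le w w'" for w'
      by (rule X.forces_mono[OF _ Neg(4) a that]) (use Neg(3) in simp)
    then show ?thesis using le_refl by auto
  next
    assume "\<forall>w'. le w w' \<longrightarrow> \<not> X.forces A w' e f"
    then show ?thesis by simp
  qed
next
  case (And A B)
  then show ?case by auto
next
  case (Or A B)
  then show ?case by auto
next
  case (Imp A B)
  note w = le_world(3)[OF X_world[OF Imp(5)]]
  have A: "X.forces A w e f \<or> (\<forall>w'. le w w' \<longrightarrow> \<not> X.forces A w' e f)"
    and B: "X.forces B w e f \<or> (\<forall>w'. le w w' \<longrightarrow> \<not> X.forces B w' e f)" using Imp by auto
  have mA: "X.forces A w' e f" if "X.forces A w e f" "le w w'" for w'
    by (rule X.forces_mono[OF _ Imp(5) that]) (use Imp(4) in simp)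
  have mB: "X.forces B w' e f" if "X.forces B w e f" "le w w'" for w'
    by (rule X.forces_mono[OF _ Imp(5) that]) (use Imp(4) in simp)
  show ?case using A B mA mB le_refl unfolding X.forces.simps(5) by blast
qed auto

text \<open>\<open>tr A\<close> may contain quantifiers although \<open>A\<close> does not, but it
  inherits the decidability of \<open>A\<close>. This suffices to pass to the least witness, which
  is unique because the order is linear.\<close>

lemma X_QF_AC00:
  assumes A: "wf_fm lang_EL_plus A" "quantifier_free A" and e: "X.env w e f"
  shows "X.forces (All0 (Ex0 A) \<^bold>\<longrightarrow> choice_conclusion A) w e f"
proof -
  obtain \<sigma> \<tau> where h: "env w \<sigma> \<tau>" "\<forall>n. rep w (\<sigma> n) (e n)" "\<forall>n. frep w (\<tau> n) (f n)" using X_env[OF e] by blast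
  have eq: "(\<lambda>n. val0 (case_nat x e) (case_nat g f) (inst0 (App (FVar 0) (NVar 0)) n)) = case_nat (g x) (case_nat x e)"
    "(\<lambda>n. val1 (case_nat x e) (case_nat g f) (FVar (Suc n))) = f" for x g
    by (rule HOL.ext, simp add: inst0_def split: nat.split)+
  have L: "X.forces A w' (case_nat yn (case_nat xn e)) f \<longleftrightarrow> forces (tr A) w' (case_nat y (case_nat x \<sigma>)) \<tau>"
    if "le w w'" "rep w' x xn" "rep w' y yn" for w' x y xn yn
    by (rule forces_tr[OF A(1) env_case0[OF env_case0[OF env_le[OF h(1) that(1)] rep_T0[OF that(2)]] rep_T0[OF that(3)]]
          rep_case[OF that(3) rep_case[OF that(2) rep_all[OF that(1) h(2)]]] frep_all[OF that(1) h(3)]])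
  have "\<exists>g\<in>X1 w1. \<forall>w'. le w1 w' \<longrightarrow> (\<forall>x\<in>X0 w'. X.forces A w' (case_nat (g x) (case_nat x e)) f)"
    if w1: "le w w1" and ex: "\<forall>w'. le w1 w' \<longrightarrow> (\<forall>x\<in>X0 w'. \<exists>y\<in>X0 w'. X.forces A w' (case_nat y (case_nat x e)) f)" for w1
  proof -
    note e1 = env_le[OF h(1) w1]
    let ?B = "tr A \<^bold>\<and> All0 (ren_fm (up_ren Suc) id (tr A) \<^bold>\<longrightarrow> \<^bold>\<not> Less (NVar 0) (NVar 1))"
    have wB: "wf_fm lang_M ?B" using wf_tr[OF A(1)] by (simp add: wf_ren_fm)
    have "(\<lambda>n. case_nat z (case_nat y (case_nat x \<sigma>)) (up_ren Suc n)) = case_nat z (case_nat x \<sigma>)" for x y z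
      by (rule HOL.ext) (simp add: up_ren_def split: nat.split)
    then have B: "forces ?B w' (case_nat y (case_nat x \<sigma>)) \<tau> \<longleftrightarrow> forces (tr A) w' (case_nat y (case_nat x \<sigma>)) \<tau> \<and>
        (\<forall>w2. le w' w2 \<longrightarrow> (\<forall>z\<in>T0 w2. \<forall>w3. le w2 w3 \<longrightarrow> forces (tr A) w3 (case_nat z (case_nat x \<sigma>)) \<tau> \<longrightarrow>
          (\<forall>w4. le w3 w4 \<longrightarrow> \<not> lt w4 z y)))" for w' x y
      by (simp add: forces_ren)
    have "\<exists>u\<in>T1 w1. \<forall>w'. le w1 w' \<longrightarrow> (\<forall>x\<in>T0 w'. forces ?B w' (case_nat (App u x) (case_nat x \<sigma>)) \<tau>)"
    proof (rule choice[OF wB e1])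
      fix w' x assume w': "le w1 w'" and x: "x \<in> T0 w'"
      note ww = le_world(2)[OF w'] and lw = le_trans[OF w1 w'] and x' = rep_cls[OF x]
      have ex': "env w' (case_nat x \<sigma>) \<tau>" by (rule env_case0[OF env_le[OF h(1) lw] x])
      obtain yn where "yn \<in> X0 w'" and yf: "X.forces A w' (case_nat yn (case_nat (cls x) e)) f"
        using ex w' x' unfolding X0_def by blast
      then obtain y where y: "rep w' y yn" by (auto simp: X0_def)
      have yf': "forces (tr A) w' (case_nat y (case_nat x \<sigma>)) \<tau>" using L[OF lw x' y] yf by blast
      have "\<exists>y\<in>T0 w'. forces (tr A) w' (case_nat y (case_nat x \<sigma>)) \<tau> \<and>
          (\<forall>w2. le w' w2 \<longrightarrow> (\<forall>z\<in>T0 w2. forces (tr A) w2 (case_nat z (case_nat x \<sigma>)) \<tau> \<longrightarrow> \<not> lt w2 z y))"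
      proof (rule least_element[OF wf_tr[OF A(1)] ex' _ rep_T0[OF y] yf'])
        fix w2 z assume w2: "le w' w2" and z: "z \<in> T0 w2"
        note l2 = le_trans[OF lw w2] and x2 = rep_mono[OF x' w2] and z2 = rep_cls[OF z]
        have "X.env w2 (case_nat (cls z) (case_nat (cls x) e)) f"
          using X.env_le[OF e l2] x2 z2 by (intro X.env_case0) (auto simp: X0_def)
        from qf_dec[OF A(2,1) this]
        show "forces (tr A) w2 (case_nat z (case_nat x \<sigma>)) \<tau> \<or> (\<forall>w''. le w2 w'' \<longrightarrow> \<not> forces (tr A) w'' (case_nat z (case_nat x \<sigma>)) \<tau>)"
          using L[OF l2 x2 z2] L[OF le_trans[OF l2] rep_mono[OF x2] rep_mono[OF z2]] by blast
      qed
      then obtain y where y: "y \<in> T0 w'" "forces (tr A) w' (case_nat y (case_nat x \<sigma>)) \<tau>"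
        and mn: "\<And>w2 z. le w' w2 \<Longrightarrow> z \<in> T0 w2 \<Longrightarrow> forces (tr A) w2 (case_nat z (case_nat x \<sigma>)) \<tau> \<Longrightarrow> \<not> lt w2 z y" by blast
      have "\<not> lt w4 z y" if "le w' w2" "z \<in> T0 w2" "le w2 w3" "forces (tr A) w3 (case_nat z (case_nat x \<sigma>)) \<tau>" "le w3 w4" for w2 z w3 w4
      proof (rule mn)
        have l3: "le w' w3" using that le_trans by blast
        then show "le w' w4" using that le_trans by blast
        have z3: "z \<in> T0 w3" using that D0_mono by blast
        then show "z \<in> T0 w4" using that D0_mono by blast
        show "forces (tr A) w4 (case_nat z (case_nat x \<sigma>)) \<tau>"
          by (rule forces_mono[OF wf_fm_M[OF wf_tr[OF A(1)]] env_case0[OF env_le[OF ex' l3] z3] that(4,5)])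
      qed
      then show "\<exists>y\<in>T0 w'. forces ?B w' (case_nat y (case_nat x \<sigma>)) \<tau>" unfolding B using y by blast
    next
      fix w' x y z assume w': "le w1 w'" and T: "y \<in> T0 w'" "z \<in> T0 w'"
        and b: "forces ?B w' (case_nat y (case_nat x \<sigma>)) \<tau>" "forces ?B w' (case_nat z (case_nat x \<sigma>)) \<tau>"
      note ww = le_world(2)[OF w']
      show "eqw w' y z" using b T le_world(3)[OF ww] lt_linear[OF ww T] unfolding B by blast
    qed
    then obtain u where u: "u \<in> T1 w1" and uB: "\<And>w' x. le w1 w' \<Longrightarrow> x \<in> T0 w' \<Longrightarrow> forces (tr A) w' (case_nat (App u x) (case_nat x \<sigma>)) \<tau>"
      unfolding B by blast
    have "X.forces A w' (case_nat (fcls u xn) (case_nat xn e)) f" if w': "le w1 w'" and xn: "xn \<in> X0 w'" for w' xn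
    proof -
      obtain x where x: "rep w' x xn" using xn by (auto simp: X0_def)
      have "rep w' (App u x) (fcls u xn)" by (rule frepD[OF le_world(2)[OF w'] frep_mono[OF frep_fcls[OF u] w'] x])
      from L[OF le_trans[OF w1 w'] x this] uB[OF w' rep_T0[OF x]] show ?thesis by blast
    qed
    then show ?thesis using frep_fcls[OF u] unfolding X1_def by blast
  qed
  then show ?thesis unfolding choice_conclusion_def X.forces.simps(5-9) X.forces_sub eq by blast
qed

lemma X_CFd:
  assumes B: "wf_fm lang_EL_plus B" and e: "X.env w e f"
  shows "X.forces (All0 (B \<^bold>\<or> \<^bold>\<not> B) \<^bold>\<longrightarrow> Ex1 (All0 (LessEq (App (FVar 0) (NVar 0)) \<^bold>1 \<^bold>\<and>
    (App (FVar 0) (NVar 0) \<doteq> \<^bold>0 \<^bold>\<longleftrightarrow> lift1 B)))) w e f"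
proof -
  obtain \<sigma> \<tau> where h: "env w \<sigma> \<tau>" "\<forall>n. rep w (\<sigma> n) (e n)" "\<forall>n. frep w (\<tau> n) (f n)" using X_env[OF e] by blast
  have L: "X.forces B w' (case_nat xn e) f \<longleftrightarrow> forces (tr B) w' (case_nat x \<sigma>) \<tau>"
    if "le w w'" "rep w' x xn" for w' x xn
    by (rule forces_tr[OF B env_case0[OF env_le[OF h(1) that(1)] rep_T0[OF that(2)]]
          rep_case[OF that(2) rep_all[OF that(1) h(2)]] frep_all[OF that(1) h(3)]])
  \<comment> \<open>The graph of the characteristic function: single-valued in any case, and total
    where \<open>B\<close> is decided.\<close>
  let ?C = "NVar 0 \<doteq> \<^bold>0 \<^bold>\<and> lift0 (tr B) \<^bold>\<or> NVar 0 \<doteq> \<^bold>1 \<^bold>\<and> \<^bold>\<not> lift0 (tr B)"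
  have wC: "wf_fm lang_M ?C" using wf_tr[OF B] by (simp add: wf_ren_fm)
  have C: "forces ?C w' (case_nat y (case_nat x \<sigma>)) \<tau> \<longleftrightarrow> eqw w' y \<^bold>0 \<and> forces (tr B) w' (case_nat x \<sigma>) \<tau> \<or>
      eqw w' y \<^bold>1 \<and> (\<forall>w2. le w' w2 \<longrightarrow> \<not> forces (tr B) w2 (case_nat x \<sigma>) \<tau>)" for w' x y
    by (simp add: forces_lift0)
  let ?D = "LessEq (App (FVar 0) (NVar 0)) \<^bold>1 \<^bold>\<and> (App (FVar 0) (NVar 0) \<doteq> \<^bold>0 \<^bold>\<longleftrightarrow> lift1 B)"
  have "\<exists>g\<in>X1 w1. \<forall>w'. le w1 w' \<longrightarrow> (\<forall>x\<in>X0 w'. X.forces ?D w' (case_nat x e) (case_nat g f))"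
    if w1: "le w w1" and dec: "\<forall>w'. le w1 w' \<longrightarrow> (\<forall>x\<in>X0 w'. X.forces B w' (case_nat x e) f \<or>
      (\<forall>w''. le w' w'' \<longrightarrow> \<not> X.forces B w'' (case_nat x e) f))" for w1
  proof -
    note e1 = env_le[OF h(1) w1]
    have "\<exists>u\<in>T1 w1. \<forall>w'. le w1 w' \<longrightarrow> (\<forall>x\<in>T0 w'. forces ?C w' (case_nat (App u x) (case_nat x \<sigma>)) \<tau>)"
    proof (rule choice[OF wC e1])
      fix w' x assume w': "le w1 w'" and x: "x \<in> T0 w'"
      note ww = le_world(2)[OF w'] and lw = le_trans[OF w1 w'] and x' = rep_cls[OF x]
      have "forces (tr B) w' (case_nat x \<sigma>) \<tau> \<or> (\<forall>w2. le w' w2 \<longrightarrow> \<not> forces (tr B) w2 (case_nat x \<sigma>) \<tau>)"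
        using dec w' x' L[OF lw x'] L[OF le_trans[OF lw] rep_mono[OF x']] unfolding X0_def by blast
      moreover have "eqw w' \<^bold>0 \<^bold>0" "eqw w' \<^bold>1 \<^bold>1" "\<^bold>0 \<in> T0 w'" "\<^bold>1 \<in> T0 w'" using eqw_refl[OF ww] by blast+
      ultimately show "\<exists>y\<in>T0 w'. forces ?C w' (case_nat y (case_nat x \<sigma>)) \<tau>" unfolding C by blast
    next
      fix w' x y z assume w': "le w1 w'"
        and c: "forces ?C w' (case_nat y (case_nat x \<sigma>)) \<tau>" "forces ?C w' (case_nat z (case_nat x \<sigma>)) \<tau>"
      note ww = le_world(2)[OF w']
      show "eqw w' y z" using c le_world(3)[OF ww] eqw_trans[OF ww] eqw_sym[OF ww] unfolding C by blast
    qed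
    then obtain u where u: "u \<in> T1 w1" and uC: "\<And>w' x. le w1 w' \<Longrightarrow> x \<in> T0 w' \<Longrightarrow> forces ?C w' (case_nat (App u x) (case_nat x \<sigma>)) \<tau>"
      by blast
    note fu = frep_fcls[OF u]
    have "X.forces ?D w' (case_nat xn e) (case_nat (fcls u) f)" if w': "le w1 w'" and xn: "xn \<in> X0 w'" for w' xn
    proof -
      note ww = le_world(2)[OF w'] and lw = le_trans[OF w1 w']
      obtain x where x: "rep w' x xn" using xn by (auto simp: X0_def)
      have xT: "x \<in> T0 w'" by (rule rep_T0[OF x])
      have r: "rep w' (App u x) (fcls u xn)" by (rule frepD[OF ww frep_mono[OF fu w'] x])
      note c = uC[OF w' xT, unfolded C]
      have 01: "lt w' \<^bold>0 \<^bold>1" using lt_succI(6)[OF ww, of "\<^bold>0" "\<^bold>0"] by blast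
      have "lt w' (App u x) \<^bold>1 \<or> eqw w' (App u x) \<^bold>1"
        using c 01 lt_cong[OF ww _ eqw_refl[OF ww, of "\<^bold>1"], of "App u x" "\<^bold>0"] by blast
      then have "forces (LessEq (App (FVar 0) (NVar 0)) \<^bold>1) w' (case_nat x \<sigma>) (case_nat u \<tau>)"
        by (simp add: LessEq_def)
      moreover have wl: "wf_fm lang_M (LessEq (App (FVar 0) (NVar 0)) \<^bold>1)" by (simp add: LessEq_def)
      ultimately have 1: "X.forces (LessEq (App (FVar 0) (NVar 0)) \<^bold>1) w' (case_nat xn e) (case_nat (fcls u) f)"
        using forces_tr[OF wf_fm_M_EL[OF wl] env_case1[OF env_case0[OF env_le[OF h(1) lw] xT] D1_mono[OF w' u]]
            rep_case[OF x rep_all[OF lw h(2)]] frep_case[OF frep_mono[OF fu w'] frep_all[OF lw h(3)]]] tr_M[OF wl] by simp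
      have 2: "fcls u xn w2 = cls \<^bold>0 w2 \<longleftrightarrow> X.forces B w2 (case_nat xn e) f" if w2: "le w' w2" for w2
      proof -
        note ww2 = le_world(2)[OF w2]
        have "fcls u xn w2 = cls \<^bold>0 w2 \<longleftrightarrow> eqw w2 (App u x) \<^bold>0"
          by (rule rep_eq[OF ww2 rep_mono[OF r w2] rep_cls[OF T0_zero]])
        also have "\<dots> \<longleftrightarrow> forces (tr B) w2 (case_nat x \<sigma>) \<tau>"
        proof -
          have "forces (tr B) w2 (case_nat x \<sigma>) \<tau>" if "forces (tr B) w' (case_nat x \<sigma>) \<tau>"
            by (rule forces_mono[OF wf_fm_M[OF wf_tr[OF B]] env_case0[OF env_le[OF h(1) lw] xT] that w2])
          moreover have "\<not> eqw w2 (App u x) \<^bold>0" if "eqw w' (App u x) \<^bold>1"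
          proof
            assume "eqw w2 (App u x) \<^bold>0"
            then have "eqw w2 \<^bold>1 \<^bold>0" using le_eqw[OF w2 that] eqw_trans'[OF ww2] by blast
            then show False using peano(1)[OF ww2 T0_zero] by blast
          qed
          ultimately show ?thesis using c le_eqw[OF w2] w2 by blast
        qed
        also have "\<dots> \<longleftrightarrow> X.forces B w2 (case_nat xn e) f" using L[OF le_trans[OF lw w2] rep_mono[OF x w2]] by blast
        finally show ?thesis .
      qed
      show ?thesis
        unfolding Iff_def X.forces.simps(3,5) X_forces_Eq X.forces_lift1 using 1 2 le_trans by simp
    qed
    then show ?thesis using fu unfolding X1_def by blast
  qed
  then show ?thesis unfolding X.forces.simps(2,4,5-9) by blast
qed

lemma X_axioms:
  assumes A: "A \<in> axms sys_EL_plus_CFd" and e: "X.env w e f"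
  shows "X.forces A w e f"
proof -
  have one: "X.forces (\<^bold>\<not> \<^bold>1 \<doteq> \<^bold>0) w e f"
  proof -
    have wf: "wf_fm lang_M (\<^bold>\<not> \<^bold>1 \<doteq> \<^bold>0)" by simp
    obtain \<sigma> \<tau> where h: "env w \<sigma> \<tau>" "\<forall>n. rep w (\<sigma> n) (e n)" "\<forall>n. frep w (\<tau> n) (f n)" using X_env[OF e] by blast
    have "forces (\<^bold>\<not> \<^bold>1 \<doteq> \<^bold>0) w \<sigma> \<tau>" using peano(1)[OF le_world(2) T0_zero] by simp
    then show ?thesis using forces_tr[OF wf_fm_M_EL[OF wf] h] tr_M[OF wf] by simp
  qed
  from A consider "A = (NVar 0 \<doteq> NVar 0)" | "A = (\<^bold>\<not> \<^bold>1 \<doteq> \<^bold>0)" | "A \<in> replacement_schema lang_EL_plus"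
    | "A \<in> induction_schema lang_EL_plus" | d where "wf_prd d" "A \<in> prd_equations d"
    | "A \<in> lambda_conversion lang_EL_plus" | "A \<in> recursor_axioms lang_EL_plus" | "A \<in> QF_AC00 lang_EL_plus"
    | "A \<in> kleene_equations" | "A \<in> CFd lang_EL_plus"
    unfolding sys_EL_plus_CFd_def sys_EL_plus_def axms_EL_def axms_HA1_def by auto
  then show ?thesis
  proof cases
    case 1 then show ?thesis by (simp only: X_forces_Eq)
  next
    case 2 then show ?thesis using one by simp
  next
    case 3 then show ?thesis using X_replacement[OF _ e] unfolding replacement_schema_def by blast
  next
    case 4 then show ?thesis using X_induction[OF _ e] unfolding induction_schema_def by blast
  next
    case 5 then show ?thesis by (rule X_prd_equations[OF _ _ e])
  next
    case 6
    have "(\<lambda>n. val0 e f (inst0 s n)) = case_nat (val0 e f s) e" for s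
      by (rule HOL.ext) (simp add: inst0_def split: nat.split)
    then show ?thesis using 6 unfolding lambda_conversion_def
      by (auto simp: X_forces_Eq val_sub simp del: X.forces.simps)
  next
    case 7 then show ?thesis by (rule X_recursor[OF _ e])
  next
    case 8 then show ?thesis using X_QF_AC00[OF _ _ e] unfolding QF_AC00_def by blast
  next
    case 9 then show ?thesis by (intro X_ax_M[OF _ e]) (simp add: sys_M_def IA1_def)
  next
    case 10 then show ?thesis using X_CFd[OF _ e] unfolding CFd_def by blast
  qed
qed

end

interpretation M: ext_M sys_M
  by standard (simp add: extension_def)

lemma lang_simps [simp]: "lang sys_M = lang_M" "lang sys_EL_plus_CFd = lang_EL_plus"
  by (simp_all add: sys_M_def sys_EL_plus_CFd_def)

theorem deriv_tr:
  assumes "\<Gamma> \<subseteq> formulas sys_EL_plus_CFd" and "deriv sys_EL_plus_CFd \<Gamma> E"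
  shows "deriv sys_M (tr ` \<Gamma>) (tr E)"
proof -
  \<comment> \<open>Completeness is available for finitely many assumptions.\<close>
  obtain F where F: "finite F" "F \<subseteq> \<Gamma>" and d: "deriv sys_EL_plus_CFd F E"
    using deriv_compact[OF assms(2)] by (elim exE conjE) (rule that)
  have wfF: "\<forall>B\<in>F. wf_fm lang_EL_plus B" using F(2) assms(1) by (auto simp: formulas_def)
  have wfE: "wf_fm lang_EL_plus E" using deriv_wf[OF d] by simp
  have "deriv sys_M (tr ` F) (tr E)"
  proof (rule M.completeness)
    show "wf_fm (lang sys_M) (tr E)" using wf_tr[OF wfE] by simp
    show "\<forall>B\<in>tr ` F. wf_fm (lang sys_M) B" using wfF wf_tr by simp
    show "finite (tr ` F)" using F(1) by simp
    fix w \<sigma> \<tau> assume env: "M.env w \<sigma> \<tau>" and prem: "\<forall>B\<in>tr ` F. M.forces B w \<sigma> \<tau>"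
    let ?e = "\<lambda>n. M.cls (\<sigma> n)" and ?f = "\<lambda>n. M.fcls (\<tau> n)"
    have r: "\<forall>n. M.rep w (\<sigma> n) (?e n)" "\<forall>n. M.frep w (\<tau> n) (?f n)"
      using M.rep_cls M.frep_fcls M.env_T[OF env] by blast+
    have X: "M.X.env w ?e ?f"
      using r M.le_world(3)[OF M.env_world[OF env]] unfolding M.X.env_def M.X0_def M.X1_def by blast
    have "M.X.forces E w ?e ?f"
    proof (rule M.X.soundness[OF d])
      show "\<forall>B\<in>F. wf_fm lang_EL_plus B" by (rule wfF)
      show "\<forall>B\<in>F. M.X.forces B w ?e ?f" using prem M.forces_tr[OF _ env r] wfF by blast
      show "M.X.forces A w e f" if "A \<in> axms sys_EL_plus_CFd" "M.X.env w e f" for A w e f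
        by (rule M.X_axioms[OF that])
    qed (simp_all add: X)
    then show "M.forces (tr E) w \<sigma> \<tau>" using M.forces_tr[OF wfE env r] by blast
  qed
  then show ?thesis by (rule deriv_weaken) (use F(2) in blast)
qed

section \<open>\<open>EL\<^sup>+ + CF\<^sub>d\<close> extends \<open>M\<close>\<close>

interpretation E: logic sys_EL_plus_CFd .

lemma ax_E: "A \<in> axms sys_EL_plus_CFd \<Longrightarrow> E.env w \<sigma> \<tau> \<Longrightarrow> E.forces A w \<sigma> \<tau>"
  using axms_EL_plus_CFd_wf by (intro E.forces_theorem deriv.Axm) (auto simp: formulas_def)

lemma axms_E: "axms sys_EL_plus_CFd = {NVar 0 \<doteq> NVar 0, \<^bold>\<not> \<^bold>1 \<doteq> \<^bold>0} \<union> replacement_schema lang_EL_plus \<union>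
    induction_schema lang_EL_plus \<union> (\<Union>d\<in>{d. wf_prd d}. prd_equations d) \<union> lambda_conversion lang_EL_plus \<union>
    recursor_axioms lang_EL_plus \<union> QF_AC00 lang_EL_plus \<union> kleene_equations \<union> CFd lang_EL_plus"
  by (simp add: sys_EL_plus_CFd_def sys_EL_plus_def axms_EL_def axms_HA1_def Un_assoc)

lemma in_lang_EL [simp]: "Zero \<in> lang_EL_plus" "Rec \<in> lang_EL_plus" "Kl k \<in> lang_EL_plus" "Fn d \<in> lang_EL_plus \<longleftrightarrow> wf_prd d"
  by (auto simp: lang_EL_plus_def lang_HA1_def)

lemma E_T0 [simp, intro]:
  "\<^bold>0 \<in> E.T0 w" "u \<in> E.T1 w \<Longrightarrow> t \<in> E.T0 w \<Longrightarrow> App u t \<in> E.T0 w" "FC (Fn SuccD) \<in> E.T1 w" "Lam \<^bold>0 \<in> E.T1 w"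
  by (auto simp: E.T0_def E.T1_def)

lemma E_env_nil: "E.world w \<Longrightarrow> E.env w nil0 nil1"
  by (rule E.envI) (auto simp: nil0_def nil1_def)

lemmas E_env = E.env_case0 E.env_case1 E_env_nil

lemma E_le: "E.world w \<Longrightarrow> E.le w w" "E.le w w' \<Longrightarrow> E.world w'" "E.le w w' \<Longrightarrow> E.world w"
  by (auto simp: E.le_def)

lemma E_eqw_T0: "E.world w \<Longrightarrow> E.eqw w s t \<Longrightarrow> s \<in> E.T0 w \<and> t \<in> E.T0 w"
  by (auto simp: E.world_def E.eqw_def E.Fm_def E.T0_def)

text \<open>The schema speaks of variables only, so \<open>s\<close> and \<open>t\<close> become the
  values of two variables and \<open>A\<close> is shifted past both.\<close>

lemma E_replace:
  assumes A: "wf_fm lang_EL_plus A" and e: "E.env w \<sigma> \<tau>" and eq: "E.eqw w s t"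
    and f: "E.forces A w (case_nat s \<sigma>) \<tau>"
  shows "E.forces A w (case_nat t \<sigma>) \<tau>"
proof -
  note w = E.env_world[OF e]
  let ?A = "ren_fm (up_ren (\<lambda>n. Suc (Suc n))) id A"
  have T: "s \<in> E.T0 w" "t \<in> E.T0 w" using E_eqw_T0[OF w eq] by auto
  have "wf_fm lang_EL_plus ?A" using A by (simp add: wf_ren_fm)
  then have "E.forces (sub0 (NVar 0) ?A \<^bold>\<and> NVar 0 \<doteq> NVar 1 \<^bold>\<longrightarrow> sub0 (NVar 1) ?A) w (case_nat s (case_nat t \<sigma>)) \<tau>"
    using e T by (intro ax_E) (auto simp: axms_E replacement_schema_def E_env)
  moreover have "(\<lambda>k. case_nat r (case_nat s (case_nat t \<sigma>)) (up_ren (\<lambda>n. Suc (Suc n)) k)) = case_nat r \<sigma>" for r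
    by (rule HOL.ext) (simp add: up_ren_def split: nat.split)
  ultimately show ?thesis using f eq E_le(1)[OF w] by (simp add: E.forces_sub0 E.forces_ren)
qed

lemma E_refl: "E.world w \<Longrightarrow> t \<in> E.T0 w \<Longrightarrow> E.eqw w t t"
  using ax_E[of "NVar 0 \<doteq> NVar 0" w "case_nat t nil0" nil1]
  by (simp add: axms_E E_env)

text \<open>Congruence for all ways of forming terms at once: replacement in an equation whose left
  side is kept at \<open>s\<close> while the right side varies.\<close>

lemma E_sub_eq:
  assumes r: "wf_trm lang_EL_plus r" and e: "E.env w \<sigma> \<tau>" and eq: "E.eqw w s t"
  shows "E.eqw w (sub_trm (case_nat s \<sigma>) \<tau> r) (sub_trm (case_nat t \<sigma>) \<tau> r)"
proof -
  note w = E.env_world[OF e]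
  have T: "s \<in> E.T0 w" using E_eqw_T0[OF w eq] by auto
  let ?A = "ren_trm Suc id r \<doteq> ren_trm (up_ren Suc) id r"
  have n: "(\<lambda>n. case_nat a (case_nat s \<sigma>) (up_ren Suc n)) = case_nat a \<sigma>" for a
    by (rule HOL.ext) (simp add: up_ren_def split: nat.split)
  have sT: "sub_trm (case_nat s \<sigma>) \<tau> r \<in> E.T0 w" using E.v0_env[of w "case_nat s \<sigma>" \<tau> r] e T r by (simp add: E_env)
  have "E.forces ?A w (case_nat t (case_nat s \<sigma>)) \<tau>"
    by (rule E_replace[OF _ E.env_case0[OF e T] eq]) (use r E_refl[OF w sT] in \<open>simp_all add: wf_ren sub_ren n\<close>)
  then show ?thesis by (simp add: sub_ren n)
qed

lemma E_sym:
  assumes w: "E.world w" and e: "E.eqw w s t"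
  shows "E.eqw w t s"
proof -
  have T: "s \<in> E.T0 w" using E_eqw_T0[OF w e] by blast
  have "E.forces (NVar 0 \<doteq> NVar 1) w (case_nat t (case_nat s nil0)) nil1"
    by (rule E_replace[OF _ _ e]) (use w T E_refl[OF w T] in \<open>simp_all add: E_env\<close>)
  then show ?thesis by simp
qed

lemma E_trans:
  assumes w: "E.world w" and e: "E.eqw w r s" "E.eqw w s t"
  shows "E.eqw w r t"
proof -
  have T: "r \<in> E.T0 w" using E_eqw_T0[OF w e(1)] by blast
  have "E.forces (NVar 1 \<doteq> NVar 0) w (case_nat t (case_nat r nil0)) nil1"
    by (rule E_replace[OF _ _ e(2)]) (use w T e(1) in \<open>simp_all add: E_env\<close>)
  then show ?thesis by simp
qed

lemma E_theoremI:
  assumes "wf_fm lang_EL_plus A" and "\<And>w \<sigma> \<tau>. E.env w \<sigma> \<tau> \<Longrightarrow> E.forces A w \<sigma> \<tau>"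
  shows "A \<in> theorems sys_EL_plus_CFd"
  using E.completeness[of A "{}"] assms by (simp add: theorems_def)

lemma E_eqw_mono: "E.le w w' \<Longrightarrow> E.eqw w s t \<Longrightarrow> E.eqw w' s t"
  by (auto simp: E.le_def E.eqw_def)

text \<open>\<open>HA1\<close> states merely that 1 is not 0. Injectivity of the successor follows
  by applying the predecessor, and no successor is 0 because \<open>sg\<close> would send both sides
  to 1 and 0; the equations of both functions are among the added axioms.\<close>

lemma E_IA1: "extension sys_EL_plus_CFd IA1"
proof -
  have kl: "E.eqw w (sub_trm \<sigma> \<tau> l) (sub_trm \<sigma> \<tau> r)" if "(l \<doteq> r) \<in> kleene_equations" "E.env w \<sigma> \<tau>" for l r w \<sigma> \<tau>
    using ax_E[of "l \<doteq> r" w \<sigma> \<tau>] that by (simp add: axms_E)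
  have cg: "E.eqw w (App u s) (App u t)" if "E.world w" "u \<in> E.T1 w" "E.eqw w s t" for w u s t
    using E_sub_eq[of "fapp 0 (NVar 0)" w nil0 "case_nat u nil1" s t] that by (simp add: E_env)
  have KT: "FC (Kl k) \<in> E.T1 w" if "arity_klc k = (1, 0)" for k w using that by (simp add: E.T1_def)
  have pd: "E.eqw w (k1 KPd (succ t)) t" if "E.world w" "t \<in> E.T0 w" for w t
    using kl[of "k1 KPd (succ (NVar 0))" "NVar 0" w "case_nat t nil0" nil1] that
    by (simp add: kleene_equations_def Let_def E_env)
  have sg: "E.eqw w (k1 KSg (succ t)) \<^bold>1" "E.eqw w (k1 KSg \<^bold>0) \<^bold>0" if "E.world w" "t \<in> E.T0 w" for w t
    using kl[of "k1 KSg (succ (NVar 0))" "\<^bold>1" w "case_nat t nil0" nil1] kl[of "k1 KSg \<^bold>0" "\<^bold>0" w nil0 nil1] that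
    by (simp_all add: kleene_equations_def Let_def E_env)
  have one: "\<not> E.eqw w \<^bold>1 \<^bold>0" if "E.world w" for w
    using ax_E[of "\<^bold>\<not> \<^bold>1 \<doteq> \<^bold>0" w nil0 nil1] that E_le(1)[OF that]
    by (simp add: axms_E E_env)
  have "axms IA1 \<inter> formulas IA1 \<subseteq> theorems sys_EL_plus_CFd"
  proof
    fix A assume "A \<in> axms IA1 \<inter> formulas IA1"
    then have A: "A \<in> axms IA1" "wf_fm lang_M A" by (auto simp: formulas_def IA1_def)
    show "A \<in> theorems sys_EL_plus_CFd"
    proof (rule E_theoremI[OF wf_fm_M_EL[OF A(2)]])
      fix w \<sigma> \<tau> assume e: "E.env w \<sigma> \<tau>"
      note w = E.env_world[OF e]
      have T: "\<sigma> n \<in> E.T0 w'" if "E.le w w'" for n w' using E.env_T(1)[OF e] E.D0_mono[OF that] by blast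
      note T1 = E.env_T(2)[OF e, rule_format]
      from A(1) consider "A = (succ (NVar 0) \<doteq> succ (NVar 1) \<^bold>\<longrightarrow> NVar 0 \<doteq> NVar 1)" | "A = (\<^bold>\<not> succ (NVar 0) \<doteq> \<^bold>0)"
        | "A = (NVar 0 \<doteq> NVar 0)" | "A = (NVar 0 \<doteq> NVar 1 \<^bold>\<longrightarrow> (NVar 0 \<doteq> NVar 2 \<^bold>\<longrightarrow> NVar 1 \<doteq> NVar 2))"
        | "A = (NVar 0 \<doteq> NVar 1 \<^bold>\<longrightarrow> succ (NVar 0) \<doteq> succ (NVar 1))" | "A \<in> kleene_equations" | "A = function_ext"
        | "A \<in> lambda_conversion lang_M" | "A \<in> induction_schema lang_M"
        unfolding IA1_def peano_succ_def equality_axioms_def system.sel Un_iff insert_iff empty_iff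
        by (elim disjE) iprover+
      then show "E.forces A w \<sigma> \<tau>"
      proof cases
        case 1
        have "E.eqw w' (\<sigma> 0) (\<sigma> 1)" if l: "E.le w w'" and q: "E.eqw w' (succ (\<sigma> 0)) (succ (\<sigma> 1))" for w'
        proof -
          note w' = E_le(2)[OF l]
          have "E.eqw w' (k1 KPd (succ (\<sigma> 0))) (k1 KPd (succ (\<sigma> 1)))" by (rule cg[OF w' KT q]) simp
          from E_trans[OF w' E_trans[OF w' E_sym[OF w' pd[OF w' T[OF l]]] this] pd[OF w' T[OF l]]] show ?thesis .
        qed
        then show ?thesis using 1 by simp
      next
        case 2
        have False if l: "E.le w w'" and q: "E.eqw w' (succ (\<sigma> 0)) \<^bold>0" for w'
        proof -
          note w' = E_le(2)[OF l]
          have "E.eqw w' (k1 KSg (succ (\<sigma> 0))) (k1 KSg \<^bold>0)" by (rule cg[OF w' KT q]) simp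
          from E_trans[OF w' E_trans[OF w' E_sym[OF w' sg(1)[OF w' T[OF l]]] this] sg(2)[OF w' T[OF l, of 0]]]
          have "E.eqw w' \<^bold>1 \<^bold>0" .
          then show False using one[OF w'] by blast
        qed
        then show ?thesis using 2 by auto
      next
        case 3 then show ?thesis using E_refl[OF w T[OF E_le(1)[OF w]]] by simp
      next
        case 4
        have "E.eqw w2 (\<sigma> 1) (\<sigma> 2)" if "E.le w w1" "E.eqw w1 (\<sigma> 0) (\<sigma> 1)" "E.le w1 w2" "E.eqw w2 (\<sigma> 0) (\<sigma> 2)" for w1 w2
          using E_trans[OF E_le(2)[OF that(3)]] E_sym[OF E_le(2)[OF that(3)]] E_eqw_mono[OF that(3,2)] that(4) by blast
        then show ?thesis using 4 by simp
      next
        case 5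
        have "E.eqw w' (succ (\<sigma> 0)) (succ (\<sigma> 1))" if l: "E.le w w'" and q: "E.eqw w' (\<sigma> 0) (\<sigma> 1)" for w'
          by (rule cg[OF E_le(2)[OF l] _ q]) simp
        then show ?thesis using 5 by simp
      next
        case 6 then show ?thesis by (intro ax_E[OF _ e]) (simp add: axms_E)
      next
        case 7
        have "E.eqw w' (App (\<tau> 0) (\<sigma> 0)) (App (\<tau> 0) (\<sigma> 1))" if l: "E.le w w'" and q: "E.eqw w' (\<sigma> 0) (\<sigma> 1)" for w'
          by (rule cg[OF E_le(2)[OF l] E.D1_mono[OF l T1] q])
        then show ?thesis using 7 by (simp add: function_ext_def)
      next
        case 8
        then have "A \<in> lambda_conversion lang_EL_plus" using wf_M_EL unfolding lambda_conversion_def by blast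
        then show ?thesis
          by (intro ax_E[OF _ e]) (simp add: axms_E)
      next
        case 9
        then have "A \<in> induction_schema lang_EL_plus" using wf_fm_M_EL unfolding induction_schema_def by blast
        then show ?thesis
          by (intro ax_E[OF _ e]) (simp add: axms_E)
      qed
    qed
  qed
  moreover have "lang IA1 \<subseteq> lang sys_EL_plus_CFd" using lang_M_EL by (simp add: IA1_def)
  ultimately show ?thesis unfolding extension_def theorems_def using deriv_extend by (auto simp: theorems_def)
qed

interpretation E: ext_IA sys_EL_plus_CFd
  by standard (rule E_IA1)


subsection \<open>A pairing function\<close>

text \<open>The pairs are enumerated along the diagonals: \<open>k = y + x\<close> is the diagonal of \<open>(x, y)\<close>, its first
  position is the triangular number \<open>T k\<close>, and the number of the pair is \<open>x + T k\<close>. The function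
  \<open>K\<close> assigns the diagonal to a position.\<close>

definition pdD :: prd where "pdD = RecD (ZeroD 0) (ProjD 2 0)"
text \<open>The recursion is on the number subtracted: \<open>f2 monD s t\<close> is cut-off
  \<open>t - s\<close>.\<close>

definition monD :: prd where "monD = RecD (ProjD 1 0) (CompD 3 pdD [ProjD 3 1])"
text \<open>This is the signum with a bar, 1 at 0 and 0 elsewhere.\<close>

definition sgD :: prd where "sgD = RecD (CompD 0 SuccD [ZeroD 0]) (ZeroD 2)"
definition TD :: prd where "TD = RecD (ZeroD 0) (CompD 2 addD [CompD 2 SuccD [ProjD 2 0], ProjD 2 1])"
text \<open>\<open>K\<close> moves to the next diagonal exactly when the position
  \<open>z + 1\<close> has reached its start, that is, when \<open>T(K(z) + 1) - (z + 1)\<close> is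
  0.\<close>

definition KD :: prd where
  "KD = RecD (ZeroD 0) (CompD 2 addD [CompD 2 sgD [CompD 2 monD [CompD 2 SuccD [ProjD 2 0],
     CompD 2 TD [CompD 2 SuccD [ProjD 2 1]]]], ProjD 2 1])"

abbreviation f1 :: "prd \<Rightarrow> trm \<Rightarrow> trm" where "f1 d t \<equiv> App (FC (Fn d)) t"
abbreviation f2 :: "prd \<Rightarrow> trm \<Rightarrow> trm \<Rightarrow> trm" where "f2 d s t \<equiv> Cst (Fn d) [s, t] []"

lemma arity_simps [simp]:
  "wf_prd addD" "arity_prd addD = 2" "wf_prd pdD" "arity_prd pdD = 1" "wf_prd monD" "arity_prd monD = 2"
  "wf_prd sgD" "arity_prd sgD = 1" "wf_prd TD" "arity_prd TD = 1" "wf_prd KD" "arity_prd KD = 1"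
  by (auto simp: addD_def pdD_def monD_def sgD_def TD_def KD_def numeral_2_eq_2 numeral_3_eq_3)

lemma E_f [simp, intro]:
  "wf_prd d \<Longrightarrow> arity_prd d = 1 \<Longrightarrow> t \<in> E.T0 w \<Longrightarrow> f1 d t \<in> E.T0 w"
  "wf_prd d \<Longrightarrow> arity_prd d = 2 \<Longrightarrow> s \<in> E.T0 w \<Longrightarrow> t \<in> E.T0 w \<Longrightarrow> f2 d s t \<in> E.T0 w"
  by (auto simp: E.T0_def E.T1_def)

lemma sub_app_cst: "sub_trm \<sigma> \<tau> (app_cst c ts) = app_cst c (map (sub_trm \<sigma> \<tau>) ts)"
  by (cases ts) (auto simp: app_cst_def)

lemma sub_vars: "map (sub_trm \<sigma> \<tau>) (vars m n) = map \<sigma> [m..<m + n]"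
  by (simp add: vars_def)

section \<open>Defining equations of descriptions in the worlds\<close>

lemma E_prd:
  assumes "wf_prd d" "(l \<doteq> r) \<in> prd_equations d" and e: "E.env w \<sigma> \<tau>"
  shows "E.eqw w (sub_trm \<sigma> \<tau> l) (sub_trm \<sigma> \<tau> r)"
  using ax_E[of "l \<doteq> r" w \<sigma> \<tau>] assms
  by (auto simp: axms_E)

lemma env_list:
  assumes w: "E.world w" and ts: "set ts \<subseteq> E.T0 w"
  shows "E.env w (\<lambda>i. if i < length ts then ts ! i else \<^bold>0) nil1"
  using w ts by (intro E.envI) (auto simp: nil1_def)

lemma map_list: "map (\<lambda>i. if i < length ts then ts ! i else \<^bold>0) [0..<0 + length ts] = ts"
  by (rule nth_equalityI) auto

lemma E_ZeroD: "E.world w \<Longrightarrow> set ts \<subseteq> E.T0 w \<Longrightarrow> E.eqw w (app_cst (Fn (ZeroD (length ts))) ts) \<^bold>0"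
  using E_prd[OF _ _ env_list, of "ZeroD (length ts)" "app_cst (Fn (ZeroD (length ts))) (vars 0 (length ts))" "\<^bold>0" w ts]
  by (simp add: sub_app_cst sub_vars map_list[simplified])

lemma E_ProjD: "E.world w \<Longrightarrow> set ts \<subseteq> E.T0 w \<Longrightarrow> i < length ts \<Longrightarrow> E.eqw w (app_cst (Fn (ProjD (length ts) i)) ts) (ts ! i)"
  using E_prd[OF _ _ env_list, of "ProjD (length ts) i" "app_cst (Fn (ProjD (length ts) i)) (vars 0 (length ts))" "NVar i" w ts]
  by (simp add: sub_app_cst sub_vars map_list[simplified])

lemma E_CompD:
  assumes w: "E.world w" and ts: "set ts \<subseteq> E.T0 w" and d: "wf_prd (CompD (length ts) h gs)"
  shows "E.eqw w (app_cst (Fn (CompD (length ts) h gs)) ts) (app_cst (Fn h) (map (\<lambda>g. app_cst (Fn g) ts) gs))"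
  using E_prd[OF d _ env_list[OF w ts], of "app_cst (Fn (CompD (length ts) h gs)) (vars 0 (length ts))"
      "app_cst (Fn h) (map (\<lambda>g. app_cst (Fn g) (vars 0 (length ts))) gs)"]
  by (simp add: sub_app_cst sub_vars map_list[simplified] comp_def)

lemma E_RecD:
  assumes w: "E.world w" and ts: "set ts \<subseteq> E.T0 w" and d: "wf_prd (RecD g h)" "arity_prd g = length ts"
  shows "E.eqw w (app_cst (Fn (RecD g h)) (\<^bold>0 # ts)) (app_cst (Fn g) ts)"
    "t \<in> E.T0 w \<Longrightarrow> E.eqw w (app_cst (Fn (RecD g h)) (succ t # ts))
       (app_cst (Fn h) (t # app_cst (Fn (RecD g h)) (t # ts) # ts))"
proof -
  have m: "map (case_nat t (\<lambda>i. if i < length ts then ts ! i else \<^bold>0)) [1..<1 + length ts] = ts" for t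
    by (rule nth_equalityI) (auto simp del: upt_Suc)
  note e = E.env_case0[OF env_list[OF w ts]]
  show "E.eqw w (app_cst (Fn (RecD g h)) (\<^bold>0 # ts)) (app_cst (Fn g) ts)"
    using E_prd[OF d(1) _ e[of "\<^bold>0"], of "app_cst (Fn (RecD g h)) (\<^bold>0 # vars 1 (length ts))" "app_cst (Fn g) (vars 1 (length ts))"] d(2)
    unfolding sub_app_cst list.map sub_vars m by (simp add: Let_def)
  show "E.eqw w (app_cst (Fn (RecD g h)) (succ t # ts)) (app_cst (Fn h) (t # app_cst (Fn (RecD g h)) (t # ts) # ts))"
    if "t \<in> E.T0 w"
    using E_prd[OF d(1) _ e[OF that], of "app_cst (Fn (RecD g h)) (succ (NVar 0) # vars 1 (length ts))"
        "app_cst (Fn h) (NVar 0 # app_cst (Fn (RecD g h)) (NVar 0 # vars 1 (length ts)) # vars 1 (length ts))"] d(2)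
    unfolding sub_app_cst list.map sub_vars m by (simp add: Let_def)
qed

lemma E_cong1: "E.world w \<Longrightarrow> wf_prd d \<Longrightarrow> arity_prd d = 1 \<Longrightarrow> E.eqw w s t \<Longrightarrow> E.eqw w (f1 d s) (f1 d t)"
  by (rule E.eqw_App) (simp_all add: E.T1_def)

lemma E_cong2:
  assumes w: "E.world w" and d: "wf_prd d" "arity_prd d = 2" and e: "E.eqw w s s'" "E.eqw w t t'"
  shows "E.eqw w (f2 d s t) (f2 d s' t')"
proof -
  have T: "s' \<in> E.T0 w" "t \<in> E.T0 w" using E_eqw_T0[OF w] e by auto
  have "E.eqw w (f2 d s t) (f2 d s' t)"
    using E_sub_eq[of "f2 d (NVar 0) (NVar 1)" w "case_nat t nil0" nil1 s s'] w d e T by (simp add: E_env)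
  moreover have "E.eqw w (f2 d s' t) (f2 d s' t')"
    using E_sub_eq[of "f2 d (NVar 1) (NVar 0)" w "case_nat s' nil0" nil1 t t'] w d e T by (simp add: E_env)
  ultimately show ?thesis by (rule E_trans[OF w])
qed

lemma E_comp_eval:
  assumes w: "E.world w" and ts: "set ts \<subseteq> E.T0 w"
  shows "wf_prd (CompD (length ts) d [g]) \<Longrightarrow> E.eqw w (app_cst (Fn g) ts) a \<Longrightarrow>
      E.eqw w (app_cst (Fn (CompD (length ts) d [g])) ts) (f1 d a)"
    "wf_prd (CompD (length ts) d [g, g']) \<Longrightarrow> E.eqw w (app_cst (Fn g) ts) a \<Longrightarrow> E.eqw w (app_cst (Fn g') ts) b \<Longrightarrow>
      E.eqw w (app_cst (Fn (CompD (length ts) d [g, g'])) ts) (f2 d a b)"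
proof -
  show "E.eqw w (app_cst (Fn (CompD (length ts) d [g])) ts) (f1 d a)"
    if d: "wf_prd (CompD (length ts) d [g])" and a: "E.eqw w (app_cst (Fn g) ts) a"
  proof -
    have "E.eqw w (f1 d (app_cst (Fn g) ts)) (f1 d a)" by (rule E_cong1[OF w _ _ a]) (use d in auto)
    moreover have "E.eqw w (app_cst (Fn (CompD (length ts) d [g])) ts) (f1 d (app_cst (Fn g) ts))"
      using E_CompD[OF w ts d] by (simp add: app_cst_def)
    ultimately show ?thesis using E_trans[OF w] by blast
  qed
  show "E.eqw w (app_cst (Fn (CompD (length ts) d [g, g'])) ts) (f2 d a b)"
    if d: "wf_prd (CompD (length ts) d [g, g'])" and a: "E.eqw w (app_cst (Fn g) ts) a" "E.eqw w (app_cst (Fn g') ts) b"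
  proof -
    have "E.eqw w (f2 d (app_cst (Fn g) ts) (app_cst (Fn g') ts)) (f2 d a b)" by (rule E_cong2[OF w _ _ a]) (use d in auto)
    moreover have "E.eqw w (app_cst (Fn (CompD (length ts) d [g, g'])) ts) (f2 d (app_cst (Fn g) ts) (app_cst (Fn g') ts))"
      using E_CompD[OF w ts d] by (simp add: app_cst_def)
    ultimately show ?thesis using E_trans[OF w] by blast
  qed
qed

lemma E_proj2:
  assumes w: "E.world w" and ts: "s \<in> E.T0 w" "t \<in> E.T0 w"
  shows "E.eqw w (app_cst (Fn (ProjD 2 0)) [s, t]) s" "E.eqw w (app_cst (Fn (ProjD 2 (Suc 0))) [s, t]) t"
  using E_ProjD[OF w, of "[s, t]" 0] E_ProjD[OF w, of "[s, t]" 1] ts by (simp_all add: numeral_2_eq_2)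

lemma E_proj3:
  assumes w: "E.world w" and ts: "r \<in> E.T0 w" "s \<in> E.T0 w" "t \<in> E.T0 w"
  shows "E.eqw w (app_cst (Fn (ProjD 3 (Suc 0))) [r, s, t]) s"
  using E_ProjD[OF w, of "[r, s, t]" 1] ts by (simp add: numeral_3_eq_3)

lemma E_funs:
  assumes w: "E.world w" and s: "s \<in> E.T0 w"
  shows "E.eqw w (f2 addD \<^bold>0 s) s"
    and "t \<in> E.T0 w \<Longrightarrow> E.eqw w (f2 addD (succ t) s) (succ (f2 addD t s))"
    and "E.eqw w (f1 pdD (succ s)) s"
    and "E.eqw w (f2 monD \<^bold>0 s) s"
    and "t \<in> E.T0 w \<Longrightarrow> E.eqw w (f2 monD (succ t) s) (f1 pdD (f2 monD t s))"
    and "E.eqw w (f1 sgD \<^bold>0) \<^bold>1"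
    and "E.eqw w (f1 sgD (succ s)) \<^bold>0"
    and "E.eqw w (f1 TD (succ s)) (f2 addD (succ s) (f1 TD s))"
    and "E.eqw w (f1 KD (succ s)) (f2 addD (f1 sgD (f2 monD (succ s) (f1 TD (succ (f1 KD s))))) (f1 KD s))"
    and "E.eqw w (f1 TD \<^bold>0) \<^bold>0" and "E.eqw w (f1 KD \<^bold>0) \<^bold>0"
proof -
  have z0: "E.eqw w (app_cst (Fn (ZeroD 0)) []) \<^bold>0" using E_ZeroD[OF w, of "[]"] by simp
  show "E.eqw w (f2 addD \<^bold>0 s) s"
    using E_RecD(1)[OF w, of "[s]" "ProjD 1 0" "CompD 3 SuccD [ProjD 3 1]"] E_ProjD[OF w, of "[s]" 0] s E_trans[OF w]
    by (auto simp: addD_def app_cst_def numeral_3_eq_3)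
  show "E.eqw w (f2 addD (succ t) s) (succ (f2 addD t s))" if t: "t \<in> E.T0 w"
  proof -
    let ?ts = "[t, f2 addD t s, s]"
    have T: "set ?ts \<subseteq> E.T0 w" using s t by auto
    have "E.eqw w (f2 addD (succ t) s) (app_cst (Fn (CompD 3 SuccD [ProjD 3 1])) ?ts)"
      using E_RecD(2)[OF w, of "[s]" "ProjD 1 0" "CompD 3 SuccD [ProjD 3 1]" t] s t
      by (auto simp: addD_def app_cst_def numeral_3_eq_3)
    moreover have "E.eqw w (app_cst (Fn (CompD 3 SuccD [ProjD 3 1])) ?ts) (succ (f2 addD t s))"
      using E_comp_eval(1)[OF w T, of SuccD "ProjD 3 1" "f2 addD t s"] E_proj3[OF w, of t "f2 addD t s" s] s t
      by (simp add: numeral_3_eq_3)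
    ultimately show ?thesis by (rule E_trans[OF w])
  qed
  have pds: "E.eqw w (f1 pdD (succ t)) t" if t: "t \<in> E.T0 w" for t
  proof -
    have "E.eqw w (f1 pdD (succ t)) (app_cst (Fn (ProjD 2 0)) [t, f1 pdD t])"
      using E_RecD(2)[OF w, of "[]" "ZeroD 0" "ProjD 2 0" t] t by (simp add: pdD_def app_cst_def numeral_2_eq_2)
    then show ?thesis using E_proj2(1)[OF w t, of "f1 pdD t"] t E_trans[OF w] by auto
  qed
  then show "E.eqw w (f1 pdD (succ s)) s" using s by blast
  show "E.eqw w (f2 monD \<^bold>0 s) s"
    using E_RecD(1)[OF w, of "[s]" "ProjD 1 0" "CompD 3 pdD [ProjD 3 1]"] E_ProjD[OF w, of "[s]" 0] s E_trans[OF w]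
    by (auto simp: monD_def app_cst_def numeral_3_eq_3)
  show "E.eqw w (f2 monD (succ t) s) (f1 pdD (f2 monD t s))" if t: "t \<in> E.T0 w"
  proof -
    let ?ts = "[t, f2 monD t s, s]"
    have T: "set ?ts \<subseteq> E.T0 w" using s t by auto
    have "E.eqw w (f2 monD (succ t) s) (app_cst (Fn (CompD 3 pdD [ProjD 3 1])) ?ts)"
      using E_RecD(2)[OF w, of "[s]" "ProjD 1 0" "CompD 3 pdD [ProjD 3 1]" t] s t
      by (auto simp: monD_def app_cst_def numeral_3_eq_3)
    moreover have "E.eqw w (app_cst (Fn (CompD 3 pdD [ProjD 3 1])) ?ts) (f1 pdD (f2 monD t s))"
      using E_comp_eval(1)[OF w T, of pdD "ProjD 3 1" "f2 monD t s"] E_proj3[OF w, of t "f2 monD t s" s] s t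
      by (simp add: numeral_3_eq_3)
    ultimately show ?thesis by (rule E_trans[OF w])
  qed
  show "E.eqw w (f1 sgD \<^bold>0) \<^bold>1"
  proof -
    have "E.eqw w (f1 sgD \<^bold>0) (app_cst (Fn (CompD 0 SuccD [ZeroD 0])) [])"
      using E_RecD(1)[OF w, of "[]" "CompD 0 SuccD [ZeroD 0]" "ZeroD 2"] by (simp add: sgD_def app_cst_def)
    moreover have "E.eqw w (app_cst (Fn (CompD 0 SuccD [ZeroD 0])) []) \<^bold>1"
      using E_comp_eval(1)[OF w, of "[]" SuccD "ZeroD 0" "\<^bold>0"] z0 by simp
    ultimately show ?thesis by (rule E_trans[OF w])
  qed
  show "E.eqw w (f1 sgD (succ s)) \<^bold>0"
  proof -
    have "E.eqw w (f1 sgD (succ s)) (app_cst (Fn (ZeroD 2)) [s, f1 sgD s])"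
      using E_RecD(2)[OF w, of "[]" "CompD 0 SuccD [ZeroD 0]" "ZeroD 2" s] s by (simp add: sgD_def app_cst_def)
    moreover have "E.eqw w (app_cst (Fn (ZeroD 2)) [s, f1 sgD s]) \<^bold>0"
      using E_ZeroD[OF w, of "[s, f1 sgD s]"] s by (simp add: numeral_2_eq_2)
    ultimately show ?thesis by (rule E_trans[OF w])
  qed
  have suc0: "E.eqw w (app_cst (Fn (CompD 2 SuccD [ProjD 2 0])) [a, b]) (succ a)"
    and suc1: "E.eqw w (app_cst (Fn (CompD 2 SuccD [ProjD 2 1])) [a, b]) (succ b)"
    if "a \<in> E.T0 w" "b \<in> E.T0 w" for a b
    using E_comp_eval(1)[OF w, of "[a, b]" SuccD "ProjD 2 0" a] E_comp_eval(1)[OF w, of "[a, b]" SuccD "ProjD 2 1" b]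
      E_proj2[OF w that] that by (simp_all add: numeral_2_eq_2)
  show "E.eqw w (f1 TD (succ s)) (f2 addD (succ s) (f1 TD s))"
  proof -
    have "E.eqw w (f1 TD (succ s)) (app_cst (Fn (CompD 2 addD [CompD 2 SuccD [ProjD 2 0], ProjD 2 1])) [s, f1 TD s])"
      using E_RecD(2)[OF w, of "[]" "ZeroD 0" "CompD 2 addD [CompD 2 SuccD [ProjD 2 0], ProjD 2 1]" s] s arity_simps(9)
      unfolding TD_def by (simp add: app_cst_def numeral_2_eq_2)
    moreover have "E.eqw w (app_cst (Fn (CompD 2 addD [CompD 2 SuccD [ProjD 2 0], ProjD 2 1])) [s, f1 TD s]) (f2 addD (succ s) (f1 TD s))"
      using E_comp_eval(2)[OF w, of "[s, f1 TD s]" addD "CompD 2 SuccD [ProjD 2 0]" "ProjD 2 1" "succ s" "f1 TD s"]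
        suc0[of s "f1 TD s"] E_proj2(2)[OF w, of s "f1 TD s"] s by (simp add: numeral_2_eq_2)
    ultimately show ?thesis by (rule E_trans[OF w])
  qed
  show "E.eqw w (f1 KD (succ s)) (f2 addD (f1 sgD (f2 monD (succ s) (f1 TD (succ (f1 KD s))))) (f1 KD s))"
  proof -
    let ?a = "f1 KD s"
    let ?ts = "[s, ?a]"
    have T: "set ?ts \<subseteq> E.T0 w" and a: "?a \<in> E.T0 w" using s by auto
    let ?t = "CompD 2 TD [CompD 2 SuccD [ProjD 2 1]]"
    let ?m = "CompD 2 monD [CompD 2 SuccD [ProjD 2 0], ?t]"
    let ?g = "CompD 2 sgD [?m]"
    have "E.eqw w (app_cst (Fn ?t) ?ts) (f1 TD (succ ?a))"
      using E_comp_eval(1)[OF w T, of TD "CompD 2 SuccD [ProjD 2 1]" "succ ?a"] suc1[OF s a] by (simp add: numeral_2_eq_2)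
    then have "E.eqw w (app_cst (Fn ?m) ?ts) (f2 monD (succ s) (f1 TD (succ ?a)))"
      using E_comp_eval(2)[OF w T, of monD "CompD 2 SuccD [ProjD 2 0]" ?t "succ s"] suc0[OF s a] by (simp add: numeral_2_eq_2)
    then have "E.eqw w (app_cst (Fn ?g) ?ts) (f1 sgD (f2 monD (succ s) (f1 TD (succ ?a))))"
      using E_comp_eval(1)[OF w T, of sgD ?m] by (simp add: numeral_2_eq_2)
    then have "E.eqw w (app_cst (Fn (CompD 2 addD [?g, ProjD 2 1])) ?ts) (f2 addD (f1 sgD (f2 monD (succ s) (f1 TD (succ ?a)))) ?a)"
      using E_comp_eval(2)[OF w T, of addD ?g "ProjD 2 1" _ ?a] E_proj2(2)[OF w s a] by (simp add: numeral_2_eq_2)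
    moreover have "E.eqw w (f1 KD (succ s)) (app_cst (Fn (CompD 2 addD [?g, ProjD 2 1])) ?ts)"
      using E_RecD(2)[OF w, of "[]" "ZeroD 0" "CompD 2 addD [?g, ProjD 2 1]" s] s arity_simps(11)
      unfolding KD_def by (simp add: app_cst_def numeral_2_eq_2)
    ultimately show ?thesis using E_trans[OF w] by blast
  qed
  show "E.eqw w (f1 TD \<^bold>0) \<^bold>0"
    using E_RecD(1)[OF w, of "[]" "ZeroD 0" "CompD 2 addD [CompD 2 SuccD [ProjD 2 0], ProjD 2 1]"] z0 E_trans[OF w] arity_simps(9)
    unfolding TD_def by (auto simp: app_cst_def)
  show "E.eqw w (f1 KD \<^bold>0) \<^bold>0"
    using E_RecD(1)[OF w, of "[]" "ZeroD 0" "CompD 2 addD [CompD 2 sgD [CompD 2 monD [CompD 2 SuccD [ProjD 2 0],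
     CompD 2 TD [CompD 2 SuccD [ProjD 2 1]]]], ProjD 2 1]"] z0 E_trans[OF w] arity_simps(11)
    unfolding KD_def by (auto simp: app_cst_def)
qed

section \<open>Addition, subtraction and the diagonals\<close>

lemma E_induct:
  assumes A: "wf_fm lang_EL_plus A" and e: "E.env w \<sigma> \<tau>" and z: "E.forces A w (case_nat \<^bold>0 \<sigma>) \<tau>"
    and s: "\<And>w' t. E.le w w' \<Longrightarrow> t \<in> E.T0 w' \<Longrightarrow> E.forces A w' (case_nat t \<sigma>) \<tau> \<Longrightarrow>
      E.forces A w' (case_nat (succ t) \<sigma>) \<tau>"
    and t: "t \<in> E.T0 w"
  shows "E.forces A w (case_nat t \<sigma>) \<tau>"
proof (rule E.induct_gen[OF _ e z s t])
  show "E.forces (sub0 \<^bold>0 A \<^bold>\<and> All0 (A \<^bold>\<longrightarrow> sub_fm (step0 (succ (NVar 0))) FVar A) \<^bold>\<longrightarrow> All0 A) w \<sigma> \<tau>"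
    using A by (intro ax_E[OF _ e]) (auto simp: axms_E induction_schema_def)
qed

lemma E_succ: "E.world w \<Longrightarrow> E.eqw w s t \<Longrightarrow> E.eqw w (succ s) (succ t)"
  using E_cong1[of w SuccD s t] by simp

lemma E_add_zero:
  assumes w: "E.world w" and t: "t \<in> E.T0 w"
  shows "E.eqw w (f2 addD t \<^bold>0) t"
proof -
  have "E.forces (f2 addD (NVar 0) \<^bold>0 \<doteq> NVar 0) w (case_nat t nil0) nil1"
  proof (rule E_induct[OF _ E_env_nil[OF w] _ _ t])
    fix w' t assume l: "E.le w w'" and t: "t \<in> E.T0 w'" and IH: "E.forces (f2 addD (NVar 0) \<^bold>0 \<doteq> NVar 0) w' (case_nat t nil0) nil1"
    note w' = E_le(2)[OF l]
    note [trans] = E_trans[OF w']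
    have "E.eqw w' (f2 addD (succ t) \<^bold>0) (succ (f2 addD t \<^bold>0))" using E_funs(2)[OF w' _ t] by simp
    also have "E.eqw w' (succ (f2 addD t \<^bold>0)) (succ t)" by (rule E_succ[OF w']) (use IH in simp)
    finally show "E.forces (f2 addD (NVar 0) \<^bold>0 \<doteq> NVar 0) w' (case_nat (succ t) nil0) nil1" by simp
  qed (use E_funs(1)[OF w] in auto)
  then show ?thesis by simp
qed

lemma E_add_succ:
  assumes w: "E.world w" and s: "s \<in> E.T0 w" and t: "t \<in> E.T0 w"
  shows "E.eqw w (f2 addD s (succ t)) (succ (f2 addD s t))"
proof -
  let ?A = "f2 addD (NVar 0) (succ (NVar 1)) \<doteq> succ (f2 addD (NVar 0) (NVar 1))"
  have "E.forces ?A w (case_nat s (case_nat t nil0)) nil1"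
  proof (rule E_induct[OF _ _ _ _ s])
    show "E.env w (case_nat t nil0) nil1" using w t by (simp add: E_env)
    have "E.eqw w (f2 addD \<^bold>0 (succ t)) (succ t)" by (rule E_funs(1)[OF w]) (use t in auto)
    from E_trans[OF w this E_sym[OF w E_succ[OF w E_funs(1)[OF w t]]]]
    show "E.forces ?A w (case_nat \<^bold>0 (case_nat t nil0)) nil1" by simp
    fix w' s assume l: "E.le w w'" and s: "s \<in> E.T0 w'" and IH: "E.forces ?A w' (case_nat s (case_nat t nil0)) nil1"
    note w' = E_le(2)[OF l]
    note [trans] = E_trans[OF w']
    have t': "t \<in> E.T0 w'" using t E.D0_mono[OF l] by blast
    have "E.eqw w' (f2 addD (succ s) (succ t)) (succ (f2 addD s (succ t)))" using E_funs(2)[OF w' _ s] t' by simp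
    also have "E.eqw w' (succ (f2 addD s (succ t))) (succ (succ (f2 addD s t)))" by (rule E_succ[OF w']) (use IH in simp)
    also have "E.eqw w' (succ (succ (f2 addD s t))) (succ (f2 addD (succ s) t))"
      by (rule E_succ[OF w' E_sym[OF w' E_funs(2)[OF w' t' s]]])
    finally show "E.forces ?A w' (case_nat (succ s) (case_nat t nil0)) nil1" by simp
  qed simp
  then show ?thesis by simp
qed

lemma E_add_assoc:
  assumes w: "E.world w" and r: "r \<in> E.T0 w" and s: "s \<in> E.T0 w" and t: "t \<in> E.T0 w"
  shows "E.eqw w (f2 addD (f2 addD r s) t) (f2 addD r (f2 addD s t))"
proof -
  let ?A = "f2 addD (f2 addD (NVar 0) (NVar 1)) (NVar 2) \<doteq> f2 addD (NVar 0) (f2 addD (NVar 1) (NVar 2))"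
  let ?\<sigma> = "case_nat s (case_nat t nil0)"
  have "E.forces ?A w (case_nat r ?\<sigma>) nil1"
  proof (rule E_induct[OF _ _ _ _ r])
    show "E.env w ?\<sigma> nil1" using w s t by (simp add: E_env)
    note [trans] = E_trans[OF w]
    have "E.eqw w (f2 addD (f2 addD \<^bold>0 s) t) (f2 addD s t)"
      by (rule E_cong2[OF w _ _ E_funs(1)[OF w s] E_refl[OF w t]]) auto
    also have "E.eqw w (f2 addD s t) (f2 addD \<^bold>0 (f2 addD s t))"
      by (rule E_sym[OF w E_funs(1)[OF w]]) (use s t in auto)
    finally show "E.forces ?A w (case_nat \<^bold>0 ?\<sigma>) nil1" by simp
    fix w' r assume l: "E.le w w'" and r: "r \<in> E.T0 w'" and IH: "E.forces ?A w' (case_nat r ?\<sigma>) nil1"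
    note w' = E_le(2)[OF l]
    note [trans] = E_trans[OF w']
    have st: "s \<in> E.T0 w'" "t \<in> E.T0 w'" using s t E.D0_mono[OF l] by blast+
    have "E.eqw w' (f2 addD (f2 addD (succ r) s) t) (f2 addD (succ (f2 addD r s)) t)"
      by (rule E_cong2[OF w' _ _ E_funs(2)[OF w' st(1) r] E_refl[OF w' st(2)]]) auto
    also have "E.eqw w' (f2 addD (succ (f2 addD r s)) t) (succ (f2 addD (f2 addD r s) t))"
      using E_funs(2)[OF w' st(2)] r st by auto
    also have "E.eqw w' (succ (f2 addD (f2 addD r s) t)) (succ (f2 addD r (f2 addD s t)))"
      by (rule E_succ[OF w']) (use IH in simp)
    also have "E.eqw w' (succ (f2 addD r (f2 addD s t))) (f2 addD (succ r) (f2 addD s t))"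
      by (rule E_sym[OF w' E_funs(2)[OF w' _ r]]) (use st in auto)
    finally show "E.forces ?A w' (case_nat (succ r) ?\<sigma>) nil1" by simp
  qed simp
  then show ?thesis by simp
qed

lemma E_monus_succ:
  assumes w: "E.world w" and s: "s \<in> E.T0 w" and t: "t \<in> E.T0 w"
  shows "E.eqw w (f2 monD (succ s) (succ t)) (f2 monD s t)"
proof -
  let ?A = "f2 monD (succ (NVar 0)) (succ (NVar 1)) \<doteq> f2 monD (NVar 0) (NVar 1)"
  have "E.forces ?A w (case_nat s (case_nat t nil0)) nil1"
  proof (rule E_induct[OF _ _ _ _ s])
    show "E.env w (case_nat t nil0) nil1" using w t by (simp add: E_env)
    note [trans] = E_trans[OF w]
    have "E.eqw w (f2 monD \<^bold>1 (succ t)) (f1 pdD (f2 monD \<^bold>0 (succ t)))" using E_funs(5)[OF w] t by auto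
    also have "E.eqw w (f1 pdD (f2 monD \<^bold>0 (succ t))) (f1 pdD (succ t))"
      by (rule E_cong1[OF w _ _ E_funs(4)[OF w]]) (use t in auto)
    also have "E.eqw w (f1 pdD (succ t)) t" using E_funs(3)[OF w t] .
    also have "E.eqw w t (f2 monD \<^bold>0 t)" using E_sym[OF w E_funs(4)[OF w t]] .
    finally show "E.forces ?A w (case_nat \<^bold>0 (case_nat t nil0)) nil1" by simp
    fix w' s assume l: "E.le w w'" and s: "s \<in> E.T0 w'" and IH: "E.forces ?A w' (case_nat s (case_nat t nil0)) nil1"
    note w' = E_le(2)[OF l]
    note [trans] = E_trans[OF w']
    have t': "t \<in> E.T0 w'" using t E.D0_mono[OF l] by blast
    have "E.eqw w' (f2 monD (succ (succ s)) (succ t)) (f1 pdD (f2 monD (succ s) (succ t)))" using E_funs(5)[OF w'] s t' by auto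
    also have "E.eqw w' (f1 pdD (f2 monD (succ s) (succ t))) (f1 pdD (f2 monD s t))"
      by (rule E_cong1[OF w']) (use IH in auto)
    also have "E.eqw w' (f1 pdD (f2 monD s t)) (f2 monD (succ s) t)" by (rule E_sym[OF w' E_funs(5)[OF w' t' s]])
    finally show "E.forces ?A w' (case_nat (succ s) (case_nat t nil0)) nil1" by simp
  qed simp
  then show ?thesis by simp
qed

lemma E_monus_add:
  assumes w: "E.world w" and s: "s \<in> E.T0 w" and t: "t \<in> E.T0 w"
  shows "E.eqw w (f2 monD s (f2 addD t s)) t"
proof -
  let ?A = "f2 monD (NVar 0) (f2 addD (NVar 1) (NVar 0)) \<doteq> NVar 1"
  have "E.forces ?A w (case_nat s (case_nat t nil0)) nil1"
  proof (rule E_induct[OF _ _ _ _ s])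
    show "E.env w (case_nat t nil0) nil1" using w t by (simp add: E_env)
    note [trans] = E_trans[OF w]
    have "E.eqw w (f2 monD \<^bold>0 (f2 addD t \<^bold>0)) (f2 addD t \<^bold>0)" by (rule E_funs(4)[OF w]) (use t in auto)
    also have "E.eqw w (f2 addD t \<^bold>0) t" by (rule E_add_zero[OF w t])
    finally show "E.forces ?A w (case_nat \<^bold>0 (case_nat t nil0)) nil1" by simp
    fix w' s assume l: "E.le w w'" and s: "s \<in> E.T0 w'" and IH: "E.forces ?A w' (case_nat s (case_nat t nil0)) nil1"
    note w' = E_le(2)[OF l]
    note [trans] = E_trans[OF w']
    have t': "t \<in> E.T0 w'" using t E.D0_mono[OF l] by blast
    have "E.eqw w' (f2 monD (succ s) (f2 addD t (succ s))) (f2 monD (succ s) (succ (f2 addD t s)))"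
      by (rule E_cong2[OF w' _ _ E_refl[OF w'] E_add_succ[OF w' t' s]]) (use s in auto)
    also have "E.eqw w' (f2 monD (succ s) (succ (f2 addD t s))) (f2 monD s (f2 addD t s))"
      by (rule E_monus_succ[OF w' s]) (use s t' in auto)
    also have "E.eqw w' (f2 monD s (f2 addD t s)) t" using IH by simp
    finally show "E.forces ?A w' (case_nat (succ s) (case_nat t nil0)) nil1" by simp
  qed simp
  then show ?thesis by simp
qed

text \<open>Induction along the diagonal. \<open>c\<close> is the distance of the position
  \<open>i\<close> from its end. Before the end is reached, the next diagonal starts beyond the next
  position, so the increment of \<open>K\<close> is 0.\<close>

lemma KD_diagonal:
  assumes w: "E.world w" and k: "k \<in> E.T0 w" and K: "E.eqw w (f1 KD (f1 TD k)) k" and i: "i \<in> E.T0 w"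
    and c: "c \<in> E.T0 w" and eq: "E.eqw w (f2 addD c i) k"
  shows "E.eqw w (f1 KD (f2 addD i (f1 TD k))) k"
proof -
  \<comment> \<open>The distance is quantified inside: it decreases while \<open>i\<close> grows,
    and the step for \<open>c\<close> uses the hypothesis at \<open>c + 1\<close>.\<close>
  let ?A = "All0 (f2 addD (NVar 0) (NVar 1) \<doteq> NVar 2 \<^bold>\<longrightarrow> f1 KD (f2 addD (NVar 1) (f1 TD (NVar 2))) \<doteq> NVar 2)"
  have "E.forces ?A w (case_nat i (case_nat k nil0)) nil1"
  proof (rule E_induct[OF _ _ _ _ i])
    show "E.env w (case_nat k nil0) nil1" using w k by (simp add: E_env)
    have base: "E.eqw w (f1 KD (f2 addD \<^bold>0 (f1 TD k))) k"
      by (rule E_trans[OF w E_cong1[OF w _ _ E_funs(1)[OF w]] K]) (use k in auto)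
    show "E.forces ?A w (case_nat \<^bold>0 (case_nat k nil0)) nil1"
      using base by (auto intro: E_eqw_mono)
    fix w' i assume l': "E.le w w'" and i': "i \<in> E.T0 w'" and IH': "E.forces ?A w' (case_nat i (case_nat k nil0)) nil1"
    have "E.eqw w2 (f1 KD (f2 addD (succ i) (f1 TD k))) k"
      if l1: "E.le w' w1" and c1: "c \<in> E.T0 w1" and l2: "E.le w1 w2" and eq: "E.eqw w2 (f2 addD c (succ i)) k" for w1 w2 c
    proof -
      note w2 = E_le(2)[OF l2]
      note [trans] = E_trans[OF w2]
      have l: "E.le w' w2" "E.le w w2" using l1 l2 l' E.le_trans by blast+
      have c: "c \<in> E.T0 w2" and i: "i \<in> E.T0 w2" and k: "k \<in> E.T0 w2"
        using E.D0_mono[OF l2 c1] E.D0_mono[OF l(1) i'] E.D0_mono[OF l(2) k] by auto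
      let ?t = "f1 TD k"
      let ?z = "f2 addD i ?t"
      have t: "?t \<in> E.T0 w2" and z: "?z \<in> E.T0 w2" using i k by auto
      have "E.eqw w2 (f2 addD (succ c) i) (succ (f2 addD c i))" by (rule E_funs(2)[OF w2 i c])
      also have "E.eqw w2 (succ (f2 addD c i)) (f2 addD c (succ i))" by (rule E_sym[OF w2 E_add_succ[OF w2 c i]])
      also note eq
      finally have eq': "E.eqw w2 (f2 addD (succ c) i) k" .
      have sc: "succ c \<in> E.T0 w2" using c by auto
      have Kz: "E.eqw w2 (f1 KD ?z) k" using IH' l(1) sc eq' E_le(1)[OF w2] by simp
      have "E.eqw w2 (f1 TD (succ (f1 KD ?z))) (f1 TD (succ k))"
        by (rule E_cong1[OF w2 _ _ E_succ[OF w2 Kz]]) auto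
      also have "E.eqw w2 (f1 TD (succ k)) (f2 addD (succ k) ?t)" by (rule E_funs(8)[OF w2 k])
      also have "E.eqw w2 (f2 addD (succ k) ?t) (succ (f2 addD k ?t))" by (rule E_funs(2)[OF w2 t k])
      also have "E.eqw w2 (succ (f2 addD k ?t)) (succ (f2 addD (f2 addD (succ c) i) ?t))"
        by (rule E_succ[OF w2 E_cong2[OF w2 _ _ E_sym[OF w2 eq'] E_refl[OF w2 t]]]) auto
      also have "E.eqw w2 (succ (f2 addD (f2 addD (succ c) i) ?t)) (succ (f2 addD (succ c) ?z))"
        by (rule E_succ[OF w2 E_add_assoc[OF w2 sc i t]])
      finally have T: "E.eqw w2 (f1 TD (succ (f1 KD ?z))) (succ (f2 addD (succ c) ?z))" .
      have "E.eqw w2 (f2 monD (succ ?z) (f1 TD (succ (f1 KD ?z)))) (f2 monD (succ ?z) (succ (f2 addD (succ c) ?z)))"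
        by (rule E_cong2[OF w2 _ _ E_refl[OF w2] T]) (use z in auto)
      also have "E.eqw w2 (f2 monD (succ ?z) (succ (f2 addD (succ c) ?z))) (f2 monD ?z (f2 addD (succ c) ?z))"
        by (rule E_monus_succ[OF w2 z]) (use sc z in auto)
      also have "E.eqw w2 (f2 monD ?z (f2 addD (succ c) ?z)) (succ c)" by (rule E_monus_add[OF w2 z sc])
      finally have M: "E.eqw w2 (f2 monD (succ ?z) (f1 TD (succ (f1 KD ?z)))) (succ c)" .
      have "E.eqw w2 (f1 sgD (f2 monD (succ ?z) (f1 TD (succ (f1 KD ?z))))) (f1 sgD (succ c))"
        by (rule E_cong1[OF w2 _ _ M]) auto
      also have "E.eqw w2 (f1 sgD (succ c)) \<^bold>0" by (rule E_funs(7)[OF w2 c])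
      finally have G: "E.eqw w2 (f1 sgD (f2 monD (succ ?z) (f1 TD (succ (f1 KD ?z))))) \<^bold>0" .
      have "E.eqw w2 (f1 KD (f2 addD (succ i) ?t)) (f1 KD (succ ?z))"
        by (rule E_cong1[OF w2 _ _ E_funs(2)[OF w2 t i]]) auto
      also have "E.eqw w2 (f1 KD (succ ?z)) (f2 addD (f1 sgD (f2 monD (succ ?z) (f1 TD (succ (f1 KD ?z))))) (f1 KD ?z))"
        by (rule E_funs(9)[OF w2 z])
      also have "E.eqw w2 (f2 addD (f1 sgD (f2 monD (succ ?z) (f1 TD (succ (f1 KD ?z))))) (f1 KD ?z)) (f2 addD \<^bold>0 k)"
        by (rule E_cong2[OF w2 _ _ G Kz]) auto
      also have "E.eqw w2 (f2 addD \<^bold>0 k) k" by (rule E_funs(1)[OF w2 k])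
      finally show ?thesis .
    qed
    then show "E.forces ?A w' (case_nat (succ i) (case_nat k nil0)) nil1" by simp
  qed simp
  then show ?thesis using c eq E_le(1)[OF w] by simp
qed

text \<open>The last position \<open>k + T(k)\<close> of diagonal \<open>k\<close> is followed by
  \<open>T(k + 1)\<close>. There the difference vanishes and \<open>K\<close> increases by
  one.\<close>

lemma KD_TD:
  assumes w: "E.world w" and k: "k \<in> E.T0 w"
  shows "E.eqw w (f1 KD (f1 TD k)) k"
proof -
  let ?A = "f1 KD (f1 TD (NVar 0)) \<doteq> NVar 0"
  have "E.forces ?A w (case_nat k nil0) nil1"
  proof (rule E_induct[OF _ E_env_nil[OF w] _ _ k])
    have "E.eqw w (f1 KD (f1 TD \<^bold>0)) \<^bold>0"
      by (rule E_trans[OF w E_cong1[OF w _ _ E_funs(10)[OF w]] E_funs(11)[OF w]]) (rule arity_simps E_T0)+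
    then show "E.forces ?A w (case_nat \<^bold>0 nil0) nil1" by simp
    fix w' k assume l: "E.le w w'" and k: "k \<in> E.T0 w'" and "E.forces ?A w' (case_nat k nil0) nil1"
    then have IH: "E.eqw w' (f1 KD (f1 TD k)) k" by simp
    note w' = E_le(2)[OF l]
    note [trans] = E_trans[OF w']
    let ?z = "f2 addD k (f1 TD k)"
    have z: "?z \<in> E.T0 w'" using k by auto
    have Kz: "E.eqw w' (f1 KD ?z) k"
      by (rule KD_diagonal[OF w' k IH k _ E_funs(1)[OF w' k]]) auto
    have "E.eqw w' (f1 TD (succ k)) (f2 addD (succ k) (f1 TD k))" by (rule E_funs(8)[OF w' k])
    also have "E.eqw w' (f2 addD (succ k) (f1 TD k)) (succ ?z)" by (rule E_funs(2)[OF w' _ k]) (use k in auto)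
    finally have T: "E.eqw w' (f1 TD (succ k)) (succ ?z)" .
    have "E.eqw w' (f1 TD (succ (f1 KD ?z))) (f1 TD (succ k))" by (rule E_cong1[OF w' _ _ E_succ[OF w' Kz]]) auto
    also note T
    also have "E.eqw w' (succ ?z) (f2 addD \<^bold>0 (succ ?z))" by (rule E_sym[OF w' E_funs(1)[OF w']]) (use z in auto)
    finally have "E.eqw w' (f2 monD (succ ?z) (f1 TD (succ (f1 KD ?z)))) (f2 monD (succ ?z) (f2 addD \<^bold>0 (succ ?z)))"
      by (intro E_cong2[OF w' _ _ E_refl[OF w']]) (use z in auto)
    also have "E.eqw w' (f2 monD (succ ?z) (f2 addD \<^bold>0 (succ ?z))) \<^bold>0" by (rule E_monus_add[OF w']) (use z in auto)
    finally have "E.eqw w' (f1 sgD (f2 monD (succ ?z) (f1 TD (succ (f1 KD ?z))))) (f1 sgD \<^bold>0)"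
      by (intro E_cong1[OF w']) auto
    also have "E.eqw w' (f1 sgD \<^bold>0) \<^bold>1" by (rule E_funs(6)[OF w' k])
    finally have G: "E.eqw w' (f1 sgD (f2 monD (succ ?z) (f1 TD (succ (f1 KD ?z))))) \<^bold>1" .
    have "E.eqw w' (f1 KD (f1 TD (succ k))) (f1 KD (succ ?z))" by (rule E_cong1[OF w' _ _ T]) auto
    also have "E.eqw w' (f1 KD (succ ?z)) (f2 addD (f1 sgD (f2 monD (succ ?z) (f1 TD (succ (f1 KD ?z))))) (f1 KD ?z))"
      by (rule E_funs(9)[OF w' z])
    also have "E.eqw w' (f2 addD (f1 sgD (f2 monD (succ ?z) (f1 TD (succ (f1 KD ?z))))) (f1 KD ?z)) (f2 addD \<^bold>1 k)"
      by (rule E_cong2[OF w' _ _ G Kz]) auto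
    also have "E.eqw w' (f2 addD \<^bold>1 k) (succ (f2 addD \<^bold>0 k))" by (rule E_funs(2)[OF w' k]) auto
    also have "E.eqw w' (succ (f2 addD \<^bold>0 k)) (succ k)" by (rule E_succ[OF w' E_funs(1)[OF w' k]])
    finally show "E.forces ?A w' (case_nat (succ k) nil0) nil1" by simp
  qed simp
  then show ?thesis by simp
qed

text \<open>The first component is the offset within the diagonal, the second is what remains of the
  diagonal \<open>y + x\<close>.\<close>

abbreviation lft :: "trm \<Rightarrow> trm" where "lft t \<equiv> f2 monD (f1 TD (f1 KD t)) t"
abbreviation rgt :: "trm \<Rightarrow> trm" where "rgt t \<equiv> f2 monD (lft t) (f1 KD t)"

lemma E_pairing:
  assumes w: "E.world w" and x: "x \<in> E.T0 w" and y: "y \<in> E.T0 w"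
  shows "\<exists>z\<in>E.T0 w. E.eqw w (lft z) x \<and> E.eqw w (rgt z) y"
proof -
  note [trans] = E_trans[OF w]
  let ?k = "f2 addD y x"
  let ?z = "f2 addD x (f1 TD ?k)"
  have k: "?k \<in> E.T0 w" and z: "?z \<in> E.T0 w" using x y by auto
  have K: "E.eqw w (f1 KD ?z) ?k" by (rule KD_diagonal[OF w k KD_TD[OF w k] x y E_refl[OF w k]])
  have "E.eqw w (lft ?z) (f2 monD (f1 TD ?k) ?z)"
    by (rule E_cong2[OF w _ _ E_cong1[OF w _ _ K] E_refl[OF w z]]) auto
  also have "E.eqw w (f2 monD (f1 TD ?k) ?z) x" by (rule E_monus_add[OF w _ x]) (use k in auto)
  finally have L: "E.eqw w (lft ?z) x" .
  have "E.eqw w (rgt ?z) (f2 monD x ?k)" by (rule E_cong2[OF w _ _ L K]) auto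
  also have "E.eqw w (f2 monD x ?k) y" by (rule E_monus_add[OF w x y])
  finally show ?thesis using L z by blast
qed

section \<open>Unique choice from characteristic functions\<close>

lemma E_beta:
  assumes e: "E.env w \<sigma> \<tau>" and t: "wf_trm lang_EL_plus t" and s: "s \<in> E.T0 w"
  shows "E.eqw w (App (Lam (sub_trm (up0_trm \<sigma>) (up0_fct \<tau>) t)) s) (sub_trm (case_nat s \<sigma>) \<tau> t)"
proof -
  have "E.forces (App (Lam (ren_trm (up_ren Suc) id t)) (NVar 0) \<doteq> t) w (case_nat s \<sigma>) \<tau>"
  proof (rule ax_E[OF _ E.env_case0[OF e s]])
    have "sub_trm (inst0 (NVar 0)) FVar (ren_trm (up_ren Suc) id t) = sub_trm NVar FVar t"
      unfolding sub_ren by (rule arg_cong2[of _ _ _ _ "\<lambda>a b. sub_trm a b t"])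
        (auto simp: inst0_def up_ren_def split: nat.split)
    moreover have "wf_trm lang_EL_plus (ren_trm (up_ren Suc) id t)" "wf_trm lang_EL_plus (NVar 0)"
      using t by (simp_all add: wf_ren)
    ultimately have "(App (Lam (ren_trm (up_ren Suc) id t)) (NVar 0) \<doteq> t) \<in> lambda_conversion lang_EL_plus"
      unfolding lambda_conversion_def sub_id by force
    then show "(App (Lam (ren_trm (up_ren Suc) id t)) (NVar 0) \<doteq> t) \<in> axms sys_EL_plus_CFd"
      by (simp add: axms_E)
  qed
  moreover have "(\<lambda>n. up0_trm (case_nat s \<sigma>) (up_ren Suc n)) = up0_trm \<sigma>"
    by (rule HOL.ext) (simp add: up0_trm_def up_ren_def split: nat.split)
  ultimately show ?thesis by (simp add: sub_ren)
qed

lemma E_T1_Lam: "E.env w \<sigma> \<tau> \<Longrightarrow> wf_trm lang_EL_plus t \<Longrightarrow> Lam (sub_trm (up0_trm \<sigma>) (up0_fct \<tau>) t) \<in> E.T1 w"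
  using E.v1_env[of w \<sigma> \<tau> "Lam t"] by simp

text \<open>\<open>CFd\<close> yields functions of one argument, hence \<open>A\<close> is first
  contracted to a predicate of pair codes. Quantifier-free choice then selects a code with first
  component \<open>x\<close>; the chosen code contains the witness as its second component.\<close>

lemma E_choice:
  assumes A: "wf_fm lang_M A" and e: "E.env w \<sigma> \<tau>"
    and ex: "\<And>w' x. E.le w w' \<Longrightarrow> x \<in> E.T0 w' \<Longrightarrow> \<exists>y\<in>E.T0 w'. E.forces A w' (case_nat y (case_nat x \<sigma>)) \<tau> \<and>
      (\<forall>w2. E.le w' w2 \<longrightarrow> (\<forall>z\<in>E.T0 w2. E.forces A w2 (case_nat z (case_nat x \<sigma>)) \<tau> \<longrightarrow> E.eqw w2 y z))"
  shows "\<exists>u\<in>E.T1 w. \<forall>w'. E.le w w' \<longrightarrow> (\<forall>x\<in>E.T0 w'. E.forces A w' (case_nat (App u x) (case_nat x \<sigma>)) \<tau>)"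
proof -
  note w = E.env_world[OF e]
  note AE = wf_fm_M_EL[OF A]
  \<comment> \<open>\<open>z\<close> stands for the code of a pair: its components replace
    \<open>y\<close> and \<open>x\<close> in \<open>A\<close>, while the other variables move past
    \<open>z\<close>.\<close>
  let ?s = "case_nat (rgt (NVar 0)) (case_nat (lft (NVar 0)) (\<lambda>n. NVar (Suc n)))"
  let ?B = "sub_fm ?s FVar A"
  have wB: "wf_fm lang_EL_plus ?B"
    by (rule wf_sub_fm) (use AE in \<open>auto split: nat.split\<close>)
  have "(\<lambda>n. sub_trm (case_nat z \<sigma>) \<tau> (?s n)) = case_nat (rgt z) (case_nat (lft z) \<sigma>)" for z
    by (rule HOL.ext) (simp split: nat.split)
  then have B: "E.forces ?B w' (case_nat z \<sigma>) \<tau> \<longleftrightarrow> E.forces A w' (case_nat (rgt z) (case_nat (lft z) \<sigma>)) \<tau>" for w' z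
    by (simp add: E.forces_sub)
  have LR: "lft z \<in> E.T0 w'" "rgt z \<in> E.T0 w'" if "z \<in> E.T0 w'" for z w' using that by auto
  have cong: "E.forces A w' (case_nat y (case_nat x \<sigma>)) \<tau> \<longleftrightarrow> E.forces A w' (case_nat y' (case_nat x' \<sigma>)) \<tau>"
    if l: "E.le w w'" and xy: "E.eqw w' x x'" "E.eqw w' y y'" for w' x y x' y'
  proof -
    note w' = E_le(2)[OF l] and e' = E.env_le[OF e l]
    show ?thesis
      using E_eqw_T0[OF w' xy(1)] E_eqw_T0[OF w' xy(2)] E.env_T[OF e']
      by (intro E.forces_cong[OF A E.env_case0[OF E.env_case0[OF e']] E.env_case0[OF E.env_case0[OF e']]]
          E.eqw_case xy) (auto intro: E.eqw_refl[OF w'] E.feq_refl)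
  qed
  have "E.forces (All0 (?B \<^bold>\<or> \<^bold>\<not> ?B)) w \<sigma> \<tau>"
  proof -
    have "E.forces ?B w' (case_nat z \<sigma>) \<tau> \<or> (\<forall>w''. E.le w' w'' \<longrightarrow> \<not> E.forces ?B w'' (case_nat z \<sigma>) \<tau>)"
      if l: "E.le w w'" and z: "z \<in> E.T0 w'" for w' z
    proof -
      note w' = E_le(2)[OF l]
      obtain y where y: "y \<in> E.T0 w'" "E.forces A w' (case_nat y (case_nat (lft z) \<sigma>)) \<tau>"
        and un: "\<And>w2 v. E.le w' w2 \<Longrightarrow> v \<in> E.T0 w2 \<Longrightarrow> E.forces A w2 (case_nat v (case_nat (lft z) \<sigma>)) \<tau> \<Longrightarrow> E.eqw w2 y v"
        using ex[OF l LR(1)[OF z]] by blast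
      \<comment> \<open>\<open>A\<close> holds at the coded pair exactly if the second component
        equals the unique witness for the first, and equality is decidable.\<close>
      from E.dec_eq[OF w' y(1) LR(2)[OF z]] show ?thesis
      proof
        assume "E.eqw w' y (rgt z)"
        then show ?thesis using cong[OF l E.eqw_refl[OF w' LR(1)[OF z]]] y(2) B by blast
      next
        assume "\<forall>w2. E.le w' w2 \<longrightarrow> \<not> E.eqw w2 y (rgt z)"
        then show ?thesis using un[OF _ E.D0_mono[OF _ LR(2)[OF z]]] B by blast
      qed
    qed
    then show ?thesis by simp
  qed
  moreover have "E.forces (All0 (?B \<^bold>\<or> \<^bold>\<not> ?B) \<^bold>\<longrightarrow>
        Ex1 (All0 (LessEq (App (FVar 0) (NVar 0)) \<^bold>1 \<^bold>\<and>
                   (App (FVar 0) (NVar 0) \<doteq> \<^bold>0 \<^bold>\<longleftrightarrow> lift1 ?B)))) w \<sigma> \<tau>"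
    by (rule ax_E[OF _ e]) (use wB in \<open>auto simp: axms_E CFd_def\<close>)
  ultimately have "E.forces (Ex1 (All0 (LessEq (App (FVar 0) (NVar 0)) \<^bold>1 \<^bold>\<and>
      (App (FVar 0) (NVar 0) \<doteq> \<^bold>0 \<^bold>\<longleftrightarrow> lift1 ?B)))) w \<sigma> \<tau>"
    using E_le(1)[OF w] E.forces.simps(5) by blast
  then obtain b where b: "b \<in> E.T1 w" and bB': "E.forces (All0 (LessEq (App (FVar 0) (NVar 0)) \<^bold>1 \<^bold>\<and>
      (App (FVar 0) (NVar 0) \<doteq> \<^bold>0 \<^bold>\<longleftrightarrow> lift1 ?B))) w \<sigma> (case_nat b \<tau>)"
    unfolding E.forces.simps(9) by blast
  have bB: "E.eqw w' (App b z) \<^bold>0 \<longleftrightarrow> E.forces ?B w' (case_nat z \<sigma>) \<tau>" if l: "E.le w w'" and z: "z \<in> E.T0 w'" for w' z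
  proof -
    have "E.forces (App (FVar 0) (NVar 0) \<doteq> \<^bold>0 \<^bold>\<longleftrightarrow> lift1 ?B) w' (case_nat z \<sigma>) (case_nat b \<tau>)"
      using bB' l z unfolding E.forces.simps(3,6) by blast
    then have "E.forces (App (FVar 0) (NVar 0) \<doteq> \<^bold>0) w' (case_nat z \<sigma>) (case_nat b \<tau>) \<longleftrightarrow> E.forces ?B w' (case_nat z \<sigma>) \<tau>"
      using E_le(1)[OF E_le(2)[OF l]] unfolding Iff_def E.forces.simps(3,5) E.forces_lift1 by blast
    then show ?thesis by simp
  qed
  \<comment> \<open>Quantifier-free since \<open>b\<close> has absorbed \<open>A\<close>.\<close>
  let ?C = "App (FVar 0) (NVar 0) \<doteq> \<^bold>0 \<^bold>\<and> lft (NVar 0) \<doteq> NVar 1"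
  let ?\<tau> = "case_nat b \<tau>"
  note e1 = E.env_case1[OF e b]
  have "E.forces (All0 (Ex0 ?C)) w \<sigma> ?\<tau>"
  proof -
    have "\<exists>z\<in>E.T0 w'. E.eqw w' (App b z) \<^bold>0 \<and> E.eqw w' (lft z) x" if l: "E.le w w'" and x: "x \<in> E.T0 w'" for w' x
    proof -
      note w' = E_le(2)[OF l]
      obtain y where y: "y \<in> E.T0 w'" "E.forces A w' (case_nat y (case_nat x \<sigma>)) \<tau>" using ex[OF l x] by blast
      obtain z where z: "z \<in> E.T0 w'" "E.eqw w' (lft z) x" "E.eqw w' (rgt z) y" using E_pairing[OF w' x y(1)] by blast
      then show ?thesis using bB[OF l z(1)] B cong[OF l z(2,3)] y(2) by blast
    qed
    then show ?thesis by simp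
  qed
  moreover have "E.forces (All0 (Ex0 ?C) \<^bold>\<longrightarrow> choice_conclusion ?C) w \<sigma> ?\<tau>"
    by (rule ax_E[OF _ e1]) (auto simp: axms_E QF_AC00_def)
  ultimately have "E.forces (choice_conclusion ?C) w \<sigma> ?\<tau>"
    using E_le(1)[OF w] E.forces.simps(5) by blast
  then obtain c where c: "c \<in> E.T1 w"
    and cC: "\<And>w' x. E.le w w' \<Longrightarrow> x \<in> E.T0 w' \<Longrightarrow> E.eqw w' (App b (App c x)) \<^bold>0 \<and> E.eqw w' (lft (App c x)) x"
    by (auto simp: choice_conclusion_def inst0_def)
  let ?r = "rgt (App (FVar 0) (NVar 0))"
  have e2: "E.env w nil0 (case_nat c nil1)" using w c by (simp add: E_env)
  \<comment> \<open>The choice function proper extracts the second component from the selected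
    code.\<close>
  let ?u = "Lam (sub_trm (up0_trm nil0) (up0_fct (case_nat c nil1)) ?r)"
  have u: "?u \<in> E.T1 w" by (rule E_T1_Lam[OF e2]) simp
  have "E.forces A w' (case_nat (App ?u x) (case_nat x \<sigma>)) \<tau>" if l: "E.le w w'" and x: "x \<in> E.T0 w'" for w' x
  proof -
    note w' = E_le(2)[OF l]
    have cx: "App c x \<in> E.T0 w'" using x E.D1_mono[OF l c] by auto
    have bt: "E.eqw w' (App ?u x) (rgt (App c x))"
      using E_beta[OF E.env_le[OF e2 l] _ x, of ?r] by simp
    have "E.forces A w' (case_nat (rgt (App c x)) (case_nat (lft (App c x)) \<sigma>)) \<tau>"
      using cC[OF l x] bB[OF l cx] B by blast
    then show ?thesis using cong[OF l _ bt] cC[OF l x] E_sym[OF w'] by blast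
  qed
  then show ?thesis using u by blast
qed

lemma E_M: "extension sys_EL_plus_CFd sys_M"
proof -
  have "axms sys_M \<inter> formulas sys_M \<subseteq> theorems sys_EL_plus_CFd"
  proof
    fix A assume "A \<in> axms sys_M \<inter> formulas sys_M"
    then consider "A \<in> axms IA1" "wf_fm lang_M A" | B where "A = (All0 (ExU0 B) \<^bold>\<longrightarrow> choice_conclusion B)" "wf_fm lang_M B" "wf_fm lang_M A"
      by (auto simp: formulas_def sys_M_def AC00_unique_def)
    then show "A \<in> theorems sys_EL_plus_CFd"
    proof cases
      case 1
      then have "A \<in> theorems IA1" by (auto simp: theorems_def IA1_def intro: deriv.Axm)
      then show ?thesis using E_IA1 by (auto simp: extension_def)
    next
      case 2
      show ?thesis
      proof (rule E_theoremI[OF wf_fm_M_EL[OF 2(3)]])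
        fix w \<sigma> \<tau> assume e: "E.env w \<sigma> \<tau>"
        have eq: "(\<lambda>n. sub_trm (case_nat x \<sigma>) (case_nat u \<tau>) (inst0 (App (FVar 0) (NVar 0)) n)) =
            case_nat (App u x) (case_nat x \<sigma>)" for x u
          by (rule HOL.ext) (simp add: inst0_def split: nat.split)
        have eq': "(\<lambda>n. case_nat z (case_nat y (case_nat x \<sigma>)) (up_ren Suc n)) = case_nat z (case_nat x \<sigma>)" for x y z
          by (rule HOL.ext) (simp add: up_ren_def split: nat.split)
        have "E.forces (choice_conclusion B) w' \<sigma> \<tau>" if l: "E.le w w'" and h: "E.forces (All0 (ExU0 B)) w' \<sigma> \<tau>" for w'
        proof -
          have "\<exists>u\<in>E.T1 w'. \<forall>w2. E.le w' w2 \<longrightarrow> (\<forall>x\<in>E.T0 w2. E.forces B w2 (case_nat (App u x) (case_nat x \<sigma>)) \<tau>)"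
          proof (rule E_choice[OF 2(2) E.env_le[OF e l]])
            fix w2 x assume l2: "E.le w' w2" and x: "x \<in> E.T0 w2"
            from h[unfolded E.forces.simps ExU0_def, rule_format, OF this]
            obtain y where y: "y \<in> E.T0 w2" "E.forces B w2 (case_nat y (case_nat x \<sigma>)) \<tau>"
              and un: "\<And>w3 w4 z. E.le w2 w3 \<Longrightarrow> z \<in> E.T0 w3 \<Longrightarrow> E.le w3 w4 \<Longrightarrow> E.forces B w4 (case_nat z (case_nat x \<sigma>)) \<tau> \<Longrightarrow> E.eqw w4 y z"
              by (auto simp: E.forces_ren eq')
            show "\<exists>y\<in>E.T0 w2. E.forces B w2 (case_nat y (case_nat x \<sigma>)) \<tau> \<and>
                (\<forall>w3. E.le w2 w3 \<longrightarrow> (\<forall>z\<in>E.T0 w3. E.forces B w3 (case_nat z (case_nat x \<sigma>)) \<tau> \<longrightarrow> E.eqw w3 y z))"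
              using y un[OF _ _ E_le(1)] E_le(2) by blast
          qed
          then show ?thesis by (simp add: choice_conclusion_def E.forces_sub eq)
        qed
        then show "E.forces A w \<sigma> \<tau>" using 2(1) E.forces.simps(5) by blast
      qed
    qed
  qed
  moreover have "lang sys_M \<subseteq> lang sys_EL_plus_CFd" using lang_M_EL by simp
  ultimately show ?thesis unfolding extension_def using deriv_extend by (auto simp: theorems_def)
qed

interpretation E: ext_M sys_EL_plus_CFd
  by standard (rule E_M)


subsection \<open>The translation is equivalent to the identity\<close>

lemma E_rep_Zero: "E.rep w \<^bold>0 (E.cls \<^bold>0)"
  by (rule E.rep_cls) simp

lemma rep_list_T0: "list_all2 (E.rep w) ts xs \<Longrightarrow> set ts \<subseteq> E.T0 w"
  by (induct rule: list_all2_induct) (auto dest: E.rep_T0)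

text \<open>In a world of the larger system the constants already have values. As a function of its
  recursion argument such a constant solves its own recursion, so its value is the common value of
  all solutions used in the expansion.\<close>

lemma rep_prd:
  "wf_prd d \<Longrightarrow> length ts = arity_prd d \<Longrightarrow> E.world w \<Longrightarrow> list_all2 (E.rep w) ts xs \<Longrightarrow>
    E.rep w (app_cst (Fn d) ts) (E.pv d xs)"
proof (induct d arbitrary: ts xs w)
  case (ZeroD n)
  have "set ts \<subseteq> E.T0 w" by (rule rep_list_T0[OF ZeroD(4)])
  then show ?case using E.rep_eqw'[OF ZeroD(3) E_rep_Zero E_ZeroD[OF ZeroD(3)]] ZeroD(2) by auto
next
  case SuccD
  then obtain t x where "ts = [t]" "xs = [x]" "E.rep w t x" by (auto simp: length_Suc_conv list_all2_Cons1)
  then show ?case using E.rep_succ[OF SuccD(3)] by (simp add: app_cst_def)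
next
  case (ProjD n i)
  have T: "set ts \<subseteq> E.T0 w" by (rule rep_list_T0[OF ProjD(4)])
  have r: "E.rep w (ts ! i) (xs ! i)" using ProjD(1,2,4) by (simp add: list_all2_conv_all_nth)
  from E.rep_eqw'[OF ProjD(3) r E_ProjD[OF ProjD(3) T]] show ?case using ProjD(1,2) by simp
next
  case (CompD n h gs)
  note w = CompD(5)
  have T: "set ts \<subseteq> E.T0 w" by (rule rep_list_T0[OF CompD(6)])
  have n: "n = length ts" using CompD(4) by simp
  have "list_all2 (E.rep w) (map (\<lambda>g. app_cst (Fn g) ts) gs) (map (\<lambda>g. E.pv g xs) gs)"
    using CompD(2)[OF _ _ _ w CompD(6)] CompD(3,4) by (auto simp: list_all2_conv_all_nth)
  then have "E.rep w (app_cst (Fn h) (map (\<lambda>g. app_cst (Fn g) ts) gs)) (E.pv h (map (\<lambda>g. E.pv g xs) gs))"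
    by (intro CompD(1)[OF _ _ w]) (use CompD(3) in auto)
  from E.rep_eqw'[OF w this E_CompD[OF w T]] show ?case using CompD(3) n by simp
next
  case (RecD g h)
  note w = RecD(5)
  obtain t0 ts' where ts: "ts = t0 # ts'" "length ts' = arity_prd g" using RecD(4) by (cases ts) auto
  obtain x xs' where xs: "xs = x # xs'" "E.rep w t0 x" "list_all2 (E.rep w) ts' xs'"
    using RecD(6) ts(1) by (auto simp: list_all2_Cons1)
  have T: "set ts' \<subseteq> E.T0 w" by (rule rep_list_T0[OF xs(3)])
  let ?f = "\<lambda>t. app_cst (Fn (RecD g h)) (t # ts')"
  let ?\<sigma> = "\<lambda>i. if i < length ts' then ts' ! i else \<^bold>0"
  let ?r = "app_cst (Fn (RecD g h)) (NVar 0 # vars 1 (length ts'))"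
  have m: "map (case_nat t ?\<sigma>) [1..<1 + length ts'] = ts'" for t
    by (rule nth_equalityI) (auto simp del: upt_Suc)
  note e = env_list[OF w T]
  have wf: "wf_trm lang_EL_plus ?r" using RecD(3) ts(2) by (intro wf_app_cst) (auto simp: vars_def)
  \<comment> \<open>The constant with its parameters fixed, abstracted over the argument of the
    recursion.\<close>
  let ?u = "Lam (sub_trm (up0_trm ?\<sigma>) (up0_fct nil1) ?r)"
  have u: "?u \<in> E.T1 w" by (rule E_T1_Lam[OF e wf])
  have be: "E.eqw w' (App ?u t) (?f t)" if l: "E.le w w'" and t: "t \<in> E.T0 w'" for w' t
    using E_beta[OF E.env_le[OF e l] wf t] unfolding sub_app_cst list.map sub_vars m by simp
  let ?h = "\<lambda>n v. E.pv h (n # v # xs')"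
  have "E.pru w ?u (E.pv g xs') ?h"
    unfolding E.pru_def
  proof (intro conjI allI impI)
    show "?u \<in> E.T1 w" by (rule u)
    have "E.rep w (app_cst (Fn g) ts') (E.pv g xs')" by (rule RecD(1)[OF _ _ w xs(3)]) (use RecD(3) ts(2) in auto)
    from E.rep_eqw'[OF w this E_RecD(1)[OF w T RecD(3)]] have "E.rep w (?f \<^bold>0) (E.pv g xs')" using ts(2) by simp
    from E.rep_eqw'[OF w this be[OF E_le(1)[OF w]]] show "E.rep w (App ?u \<^bold>0) (E.pv g xs')" by simp
    fix w' n xn xv assume l: "E.le w w'" and n: "E.rep w' n xn" and v: "E.rep w' (App ?u n) xv"
    note w' = E_le(2)[OF l] and nT = E.rep_T0[OF n]
    have T': "set ts' \<subseteq> E.T0 w'" using T E.D0_mono[OF l] by blast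
    have "E.rep w' (?f n) xv" by (rule E.rep_eqw[OF w' v be[OF l nT]])
    moreover have "list_all2 (E.rep w') ts' xs'" using xs(3) E.rep_mono[OF _ l] by (auto simp: list_all2_conv_all_nth)
    ultimately have "E.rep w' (app_cst (Fn h) (n # ?f n # ts')) (?h xn xv)"
      by (intro RecD(2)[OF _ _ w']) (use RecD(3) ts(2) n in auto)
    from E.rep_eqw'[OF w' this E_RecD(2)[OF w' T' RecD(3) _ nT]] have "E.rep w' (?f (succ n)) (?h xn xv)" using ts(2) by simp
    then show "E.rep w' (App ?u (succ n)) (?h xn xv)" by (rule E.rep_eqw'[OF w' _ be[OF l]]) (use nT in auto)
  qed
  from E.PR_rep[OF w this xs(2)] have "E.rep w (App ?u t0) (E.pv (RecD g h) xs)" using xs(1) by simp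
  from E.rep_eqw[OF w this be[OF E_le(1)[OF w] E.rep_T0[OF xs(2)]]] show ?case using ts(1) by simp
qed

lemma rep_pair:
  assumes w: "E.world w" and s: "E.rep w s x" and t: "E.rep w t y"
  shows "E.rep w (pair s t) (E.pv pairD [x, y])"
proof -
  have p: "E.pv pairD [x, y] = E.pv mulD [E.pv expD [x, E.sucv (E.sucv (E.cls \<^bold>0))], E.pv expD [y, E.sucv (E.sucv (E.sucv (E.cls \<^bold>0)))]]"
    by (simp add: pairD_def twoD_def threeD_def)
  have wf: "wf_prd mulD" "arity_prd mulD = 2" "wf_prd expD" "arity_prd expD = 2"
    by (auto simp: mulD_def expD_def addD_def numeral_eq_Suc less_Suc_eq)
  have 2: "E.rep w (app_cst (Fn d) [a, b]) (E.pv d [p, q])" if "wf_prd d" "arity_prd d = 2" "E.rep w a p" "E.rep w b q" for d a b p q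
    using rep_prd[OF that(1) _ w, of "[a, b]" "[p, q]"] that by simp
  have "pair s t = app_cst (Fn mulD) [app_cst (Fn expD) [s, \<^bold>2], app_cst (Fn expD) [t, succ \<^bold>2]]"
    by (simp add: pair_def app_cst_def)
  then show ?thesis unfolding p using s t by (auto intro!: 2 wf E.rep_succ[OF w] E_rep_Zero)
qed

text \<open>The same argument as for recursive descriptions: the recursor term, abstracted over its
  last argument, solves the recursion by its own axioms.\<close>

lemma rep_recursor:
  assumes w: "E.world w" and t: "E.rep w t a" and s: "E.rep w s x" and v: "E.frep w v f"
  shows "E.rep w (rec t v s) (E.ic Rec [a, x] [f])"
proof -
  let ?r = "rec (NVar 1) (FVar 0) (NVar 0)"
  let ?\<sigma> = "case_nat t nil0" and ?\<tau> = "case_nat v nil1"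
  have e: "E.env w ?\<sigma> ?\<tau>" using w E.rep_T0[OF t] E.frep_T1[OF v] by (simp add: E_env)
  have wf: "wf_trm lang_EL_plus ?r" by simp
  let ?u = "Lam (sub_trm (up0_trm ?\<sigma>) (up0_fct ?\<tau>) ?r)"
  have u: "?u \<in> E.T1 w" by (rule E_T1_Lam[OF e wf])
  have be: "E.eqw w' (App ?u n) (rec t v n)" if l: "E.le w w'" and n: "n \<in> E.T0 w'" for w' n
    using E_beta[OF E.env_le[OF e l] wf n] by simp
  let ?h = "\<lambda>n y. f (E.pv pairD [y, n])"
  have "E.pru w ?u a ?h"
    unfolding E.pru_def
  proof (intro conjI allI impI)
    show "?u \<in> E.T1 w" by (rule u)
    have "E.forces (rec (NVar 0) (FVar 0) \<^bold>0 \<doteq> NVar 0) w ?\<sigma> ?\<tau>"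
      by (rule ax_E[OF _ e]) (auto simp: axms_E recursor_axioms_def)
    then have "E.eqw w (rec t v \<^bold>0) t" by simp
    from E.rep_eqw'[OF w E.rep_eqw'[OF w t this] be[OF E_le(1)[OF w]]] show "E.rep w (App ?u \<^bold>0) a" by simp
    fix w' n xn xv assume l: "E.le w w'" and n: "E.rep w' n xn" and y: "E.rep w' (App ?u n) xv"
    note w' = E_le(2)[OF l] and nT = E.rep_T0[OF n]
    have r: "E.rep w' (rec t v n) xv" by (rule E.rep_eqw[OF w' y be[OF l nT]])
    have "E.forces (rec (NVar 1) (FVar 0) (succ (NVar 0)) \<doteq> App (FVar 0) (pair (rec (NVar 1) (FVar 0) (NVar 0)) (NVar 0))) w' (case_nat n ?\<sigma>) ?\<tau>"
      by (rule ax_E[OF _ E.env_case0[OF E.env_le[OF e l] nT]]) (auto simp: axms_E recursor_axioms_def)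
    then have "E.eqw w' (rec t v (succ n)) (App v (pair (rec t v n) n))" by (simp add: pair_def)
    moreover have "E.rep w' (App v (pair (rec t v n) n)) (?h xn xv)"
      by (rule E.frepD[OF w' E.frep_mono[OF v l] rep_pair[OF w' r n]])
    ultimately have "E.rep w' (rec t v (succ n)) (?h xn xv)" using E.rep_eqw'[OF w'] by blast
    then show "E.rep w' (App ?u (succ n)) (?h xn xv)" by (rule E.rep_eqw'[OF w' _ be[OF l]]) (use nT in auto)
  qed
  from E.PR_rep[OF w this s] have "E.rep w (App ?u s) (E.ic Rec [a, x] [f])" by simp
  then show ?thesis by (rule E.rep_eqw[OF w _ be[OF E_le(1)[OF w] E.rep_T0[OF s]]])
qed

lemma rep_val:
  "wf_trm lang_EL_plus t \<Longrightarrow> E.env w \<sigma> \<tau> \<Longrightarrow> \<forall>n. E.rep w (\<sigma> n) (e n) \<Longrightarrow> \<forall>n. E.frep w (\<tau> n) (f n) \<Longrightarrow>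
    E.rep w (sub_trm \<sigma> \<tau> t) (E.val0 e f t)"
  "wf_fct lang_EL_plus u \<Longrightarrow> E.env w \<sigma> \<tau> \<Longrightarrow> \<forall>n. E.rep w (\<sigma> n) (e n) \<Longrightarrow> \<forall>n. E.frep w (\<tau> n) (f n) \<Longrightarrow>
    E.frep w (sub_fct \<sigma> \<tau> u) (E.val1 e f u)"
proof (induct t and u arbitrary: w \<sigma> e and w \<sigma> e rule: trm.induct fct.induct)
  case (Cst c ts us)
  note w = E.env_world[OF Cst(4)]
  have IH: "E.rep w (sub_trm \<sigma> \<tau> t) (E.val0 e f t)" if "t \<in> set ts" for t
    using Cst(1)[OF that _ Cst(4-6)] Cst(3) that by simp
  have IH1: "E.frep w (sub_fct \<sigma> \<tau> t) (E.val1 e f t)" if "t \<in> set us" for t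
    using Cst(2)[OF that _ Cst(4-6)] Cst(3) that by simp
  have c: "arity c = (length ts, length us)" "arity c \<noteq> (1, 0)" "c \<in> lang_EL_plus" using Cst(3) by auto
  show ?case
  proof (cases c)
    case Zero
    then show ?thesis using c(1) E_rep_Zero by simp
  next
    case (Fn d)
    have "us = []" "length ts = arity_prd d" "length ts \<noteq> 1" using c Fn by auto
    moreover have "list_all2 (E.rep w) (map (sub_trm \<sigma> \<tau>) ts) (map (E.val0 e f) ts)"
      using IH by (auto simp: list_all2_conv_all_nth)
    ultimately show ?thesis using rep_prd[OF _ _ w, of d "map (sub_trm \<sigma> \<tau>) ts"] c(3) Fn by (simp add: app_cst_def)
  next
    case (Kl k)
    have "arity_klc k \<in> {(1, 0), (2, 0), (1, 1)}" by (cases k) auto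
    with c Kl consider "arity_klc k = (2, 0)" | "arity_klc k = (1, 1)" by auto
    then show ?thesis
    proof cases
      case 1
      then have "length ts = Suc (Suc 0)" "us = []" using c Kl by auto
      then obtain s t where "ts = [s, t]" "us = []" by (auto simp: length_Suc_conv)
      then show ?thesis using E.rep_k2[OF w 1, of _ _ _ _ "[]"] IH Kl by simp
    next
      case 2
      then have "length ts = Suc 0" "length us = Suc 0" using c Kl by auto
      then obtain t u where "ts = [t]" "us = [u]" by (auto simp: length_Suc_conv)
      then show ?thesis using E.rep_kf[OF w 2] IH IH1 Kl by simp
    qed
  next
    case Rec
    then have "length ts = Suc (Suc 0)" "length us = Suc 0" using c by auto
    then obtain s t u where "ts = [s, t]" "us = [u]" by (auto simp: length_Suc_conv)
    then show ?thesis using rep_recursor[OF w IH IH IH1] Rec by simp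
  qed
next
  case (App u t)
  then show ?case using E.frepD[OF E.env_world[OF App(4)]] by simp
next
  case (FC c)
  have T: "FC c \<in> E.T1 w" using FC(1) by (simp add: E.T1_def)
  have "E.rep w' (App (FC c) t) (E.ic c [x] [])" if l: "E.le w w'" and t: "E.rep w' t x" for w' t x
  proof (cases c)
    case (Fn d)
    then show ?thesis using rep_prd[OF _ _ E_le(2)[OF l], of d "[t]" "[x]"] FC(1) t by (simp add: app_cst_def)
  next
    case (Kl k)
    then show ?thesis using E.rep_k1[OF E_le(2)[OF l] _ t] FC(1) by simp
  qed (use FC(1) in auto)
  then show ?case using T by (simp add: E.frep_def)
next
  case (Lam t)
  have t: "wf_trm lang_EL_plus t" using Lam(2) by simp
  have L: "sub_fct \<sigma> \<tau> (Lam t) \<in> E.T1 w" using E_T1_Lam[OF Lam(3) t] by simp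
  have "E.rep w' (App (sub_fct \<sigma> \<tau> (Lam t)) x) (E.val1 e f (Lam t) xn)" if w': "E.le w w'" and x: "E.rep w' x xn" for w' x xn
  proof -
    have "E.rep w' (sub_trm (case_nat x \<sigma>) \<tau> t) (E.val0 (case_nat xn e) f t)"
      by (rule Lam(1)[OF t E.env_case0[OF E.env_le[OF Lam(3) w'] E.rep_T0[OF x]]])
        (use E.rep_case[OF x E.rep_all[OF w' Lam(4)]] E.frep_all[OF w' Lam(5)] in blast)+
    then show ?thesis
      using E.rep_eqw'[OF E_le(2)[OF w'] _ E_beta[OF E.env_le[OF Lam(3) w'] t E.rep_T0[OF x]]] by simp
  qed
  then show ?case using L unfolding E.frep_def by blast
qed auto

text \<open>Equations pass through the expansion, where both sides denote the classes of the
  original terms. The remaining cases follow since the translation commutes with the logical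
  operations.\<close>

lemma forces_tr_iff:
  "wf_fm lang_EL_plus A \<Longrightarrow> E.env w \<sigma> \<tau> \<Longrightarrow> E.forces (tr A) w \<sigma> \<tau> \<longleftrightarrow> E.forces A w \<sigma> \<tau>"
proof (induct A arbitrary: w \<sigma> \<tau>)
  case (Eq s t)
  note w = E.env_world[OF Eq(2)]
  let ?e = "\<lambda>n. E.cls (\<sigma> n)" and ?f = "\<lambda>n. E.fcls (\<tau> n)"
  have r: "\<forall>n. E.rep w (\<sigma> n) (?e n)" "\<forall>n. E.frep w (\<tau> n) (?f n)"
    using E.rep_cls E.frep_fcls E.env_T[OF Eq(2)] by blast+
  have "E.forces (tr (s \<doteq> t)) w \<sigma> \<tau> \<longleftrightarrow> E.X.forces (s \<doteq> t) w ?e ?f" using E.forces_tr[OF Eq(1,2) r] by blast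
  also have "\<dots> \<longleftrightarrow> E.eqw w (sub_trm \<sigma> \<tau> s) (sub_trm \<sigma> \<tau> t)"
    unfolding E.X_forces_Eq by (rule E.rep_eq[OF w rep_val(1)[OF _ Eq(2) r] rep_val(1)[OF _ Eq(2) r]]) (use Eq(1) in simp_all)
  finally show ?case by simp
next
  case (Neg A) then show ?case using E.env_le[OF Neg(3)] by simp
next
  case (Imp A B) then show ?case using E.env_le[OF Imp(4)] by simp
next
  case (All0 A) then show ?case using E.env_case0[OF E.env_le[OF All0(3)]] by simp
next
  case (Ex0 A) then show ?case using E.env_case0[OF Ex0(3)] by simp
next
  case (All1 A) then show ?case using E.env_case1[OF E.env_le[OF All1(3)]] by simp
next
  case (Ex1 A) then show ?case using E.env_case1[OF Ex1(3)] by simp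
qed simp_all

theorem tr_equiv: "wf_fm lang_EL_plus A \<Longrightarrow> (tr A \<^bold>\<longleftrightarrow> A) \<in> theorems sys_EL_plus_CFd"
  by (rule E_theoremI) (auto simp: Iff_def forces_tr_iff E.env_le wf_fm_M_EL wf_tr simp del: tr.simps)

section \<open>Recursive functions\<close>

text \<open>Nothing is claimed about the values at lists of other lengths.\<close>

definition recn :: "nat \<Rightarrow> (nat list \<Rightarrow> nat) \<Rightarrow> bool" where
  "recn n f \<longleftrightarrow> (\<exists>F. recursive n F \<and> (\<forall>xs. length xs = n \<longrightarrow> F xs = f xs))"

lemma recn_cong: "recn n f \<Longrightarrow> (\<And>xs. length xs = n \<Longrightarrow> f xs = g xs) \<Longrightarrow> recn n g"
  unfolding recn_def by metis

lemma recn_comp: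
  assumes f: "recn (length gs) f" and g: "\<And>g. g \<in> set gs \<Longrightarrow> recn n g"
  shows "recn n (\<lambda>xs. f (map (\<lambda>g. g xs) gs))"
proof -
  obtain F where F: "recursive (length gs) F" "\<And>xs. length xs = length gs \<Longrightarrow> F xs = f xs"
    using f unfolding recn_def by blast
  from g obtain H where H: "\<And>g. g \<in> set gs \<Longrightarrow> recursive n (H g) \<and> (\<forall>xs. length xs = n \<longrightarrow> H g xs = g xs)"
    unfolding recn_def by metis
  have "recursive n (\<lambda>xs. F (map (\<lambda>g. g xs) (map H gs)))"
    using F(1) H by (intro recursive.Comp) auto
  moreover have "F (map (\<lambda>g. g xs) (map H gs)) = f (map (\<lambda>g. g xs) gs)" if "length xs = n" for xs
    using F(2) H that by (simp add: comp_def cong: map_cong)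
  ultimately show ?thesis unfolding recn_def by blast
qed

lemma recn_proj: "i < n \<Longrightarrow> recn n (\<lambda>xs. xs ! i)"
  unfolding recn_def using recursive.Proj by blast

lemma recn_Suc: "recn n f \<Longrightarrow> recn n (\<lambda>xs. Suc (f xs))"
  using recn_comp[of "[f]" "\<lambda>xs. Suc (xs ! 0)" n] recursive.Succ unfolding recn_def by auto

lemma recn_const: "recn n (\<lambda>xs. c)"
proof (induct c)
  case 0 then show ?case unfolding recn_def using recursive.Zero by blast
qed (rule recn_Suc)

lemma recn_drop: "recn n f \<Longrightarrow> recn (m + n) (\<lambda>ys. f (drop m ys))"
proof -
  assume f: "recn n f"
  have "recn (m + n) (\<lambda>ys. f (map (\<lambda>g. g ys) (map (\<lambda>i ys. ys ! (m + i)) [0..<n])))"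
    using f by (intro recn_comp) (auto intro: recn_proj)
  then show ?thesis
  proof (rule recn_cong)
    fix ys :: "nat list" assume "length ys = m + n"
    then have "map (\<lambda>g. g ys) (map (\<lambda>i ys. ys ! (m + i)) [0..<n]) = drop m ys"
      by (intro nth_equalityI) auto
    then show "f (map (\<lambda>g. g ys) (map (\<lambda>i ys. ys ! (m + i)) [0..<n])) = f (drop m ys)" by simp
  qed
qed

lemma recn_rec:
  assumes a: "recn n a" and m: "recn n m" and h: "recn (n + 2) (\<lambda>ys. h (ys ! 0) (ys ! 1) (drop 2 ys))"
  shows "recn n (\<lambda>xs. rec_nat (a xs) (\<lambda>k r. h k r xs) (m xs))"
proof -
  let ?h = "\<lambda>ys. h (ys ! 0) (ys ! 1) (drop 2 ys)"
  obtain A where A: "recursive n A" "\<And>xs. length xs = n \<Longrightarrow> A xs = a xs" using a unfolding recn_def by blast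
  obtain H where H: "recursive (n + 2) H" "\<And>xs. length xs = n + 2 \<Longrightarrow> H xs = ?h xs" using h unfolding recn_def by blast
  let ?P = "\<lambda>xs. rec_nat (A (tl xs)) (\<lambda>k r. H (k # r # tl xs)) (hd xs)"
  \<comment> \<open>\<open>Prim\<close> recurs on the head of its argument list, so the number of
    steps is placed in front of the parameters.\<close>
  let ?gs = "m # map (\<lambda>i xs. xs ! i) [0..<n]"
  have "recn (length ?gs) ?P"
    using recursive.Prim[OF A(1) H(1)] unfolding recn_def by auto
  then have "recn n (\<lambda>xs. ?P (map (\<lambda>g. g xs) ?gs))"
    by (rule recn_comp[where f = ?P]) (use m in \<open>auto intro: recn_proj\<close>)
  then show ?thesis
  proof (rule recn_cong)
    fix xs :: "nat list" assume l: "length xs = n"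
    then have "map (\<lambda>g. g xs) ?gs = m xs # xs" by (auto simp: comp_def intro: nth_equalityI)
    moreover have "rec_nat (A xs) (\<lambda>k r. H (k # r # xs)) j = rec_nat (a xs) (\<lambda>k r. h k r xs) j" for j
      using A(2) H(2) l by (induct j) auto
    ultimately show "?P (map (\<lambda>g. g xs) ?gs) = rec_nat (a xs) (\<lambda>k r. h k r xs) (m xs)" by simp
  qed
qed

lemma recn_drop2: "recn n f \<Longrightarrow> recn (n + 2) (\<lambda>ys. f (drop 2 ys))"
  using recn_drop[of n f 2] by (simp add: add.commute)

lemma recn_add: "recn n f \<Longrightarrow> recn n g \<Longrightarrow> recn n (\<lambda>xs. f xs + g xs)"
proof -
  have "rec_nat a (\<lambda>k r. Suc r) b = a + b" for a b by (induct b) auto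
  moreover assume "recn n f" "recn n g"
  then have "recn n (\<lambda>xs. rec_nat (f xs) (\<lambda>k r. Suc r) (g xs))"
    by (rule recn_rec) (intro recn_Suc recn_proj, simp)
  ultimately show ?thesis by simp
qed

lemma recn_pred: "recn n f \<Longrightarrow> recn n (\<lambda>xs. f xs - 1)"
proof -
  have "rec_nat 0 (\<lambda>k r. k) b = b - 1" for b by (induct b) auto
  moreover assume "recn n f"
  then have "recn n (\<lambda>xs. rec_nat 0 (\<lambda>k r. k) (f xs))"
    by (rule recn_rec[OF recn_const]) (intro recn_proj, simp)
  ultimately show ?thesis by simp
qed

lemma recn_diff: "recn n f \<Longrightarrow> recn n g \<Longrightarrow> recn n (\<lambda>xs. f xs - g xs)"
proof -
  have "rec_nat a (\<lambda>k r. r - 1) b = a - b" for a b :: nat by (induct b) auto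
  moreover assume "recn n f" "recn n g"
  then have "recn n (\<lambda>xs. rec_nat (f xs) (\<lambda>k r. r - 1) (g xs))"
    by (rule recn_rec) (intro recn_pred recn_proj, simp)
  ultimately show ?thesis by simp
qed

lemma recn_if:
  assumes "recn n f" "recn n g" "recn n a" "recn n b"
  shows "recn n (\<lambda>xs. if f xs = g xs then a xs else b xs)"
proof -
  \<comment> \<open>The distance of the two values counts the steps: no step leaves the first
    result, any positive number of steps gives the second.\<close>
  have "recn n (\<lambda>xs. rec_nat (a xs) (\<lambda>k r. b xs) ((f xs - g xs) + (g xs - f xs)))"
    by (rule recn_rec[OF assms(3) recn_add[OF recn_diff[OF assms(1,2)] recn_diff[OF assms(2,1)]] recn_drop2[OF assms(4)]])
  moreover have "rec_nat p (\<lambda>k r. q) (i - j + (j - i)) = (if i = j then p else q)" for p q :: nat and i j :: nat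
    by (cases "i - j + (j - i)") auto
  ultimately show ?thesis by simp
qed

section \<open>Projections of the pairing\<close>

lemma recn_triangle: "recn n f \<Longrightarrow> recn n (\<lambda>xs. triangle (f xs))"
proof -
  have "rec_nat 0 (\<lambda>k r. r + Suc k) b = triangle b" for b by (induct b) auto
  moreover assume "recn n f"
  then have "recn n (\<lambda>xs. rec_nat 0 (\<lambda>k r. r + Suc k) (f xs))"
    by (rule recn_rec[OF recn_const]) (intro recn_add recn_Suc recn_proj; simp)
  ultimately show ?thesis by simp
qed

text \<open>Recovers the sum of the components from the code of a pair, in the manner of
  \<open>K\<close> above. The test is an inequality between a triangular number and the next
  position, written with cut-off subtraction because the case distinction compares for
  equality.\<close>

definition diag :: "nat \<Rightarrow> nat" where
  "diag m = rec_nat 0 (\<lambda>k r. if triangle (Suc r) - Suc k = 0 then Suc r else r) m"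

lemma recn_diag: "recn n f \<Longrightarrow> recn n (\<lambda>xs. diag (f xs))"
  unfolding diag_def
  by (rule recn_rec[OF recn_const], assumption)
    (rule recn_if recn_diff recn_triangle recn_Suc recn_proj recn_const | simp)+

lemma diag_bounds: "triangle (diag m) \<le> m \<and> m < triangle (Suc (diag m))"
  by (induct m) (auto simp: diag_def)

lemma triangle_mono: "a \<le> b \<Longrightarrow> triangle a \<le> triangle b"
  by (induct b rule: dec_induct) auto

lemma diag_prod_encode: "diag (prod_encode (a, b)) = a + b"
proof -
  let ?m = "prod_encode (a, b)"
  have m: "triangle (a + b) \<le> ?m" "?m < triangle (Suc (a + b))" by (auto simp: prod_encode_def)
  have "\<not> Suc (a + b) \<le> diag ?m" using diag_bounds[of ?m] m triangle_mono by fastforce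
  moreover have "\<not> Suc (diag ?m) \<le> a + b" using diag_bounds[of ?m] m triangle_mono by fastforce
  ultimately show ?thesis by linarith
qed

abbreviation pe :: "nat \<Rightarrow> nat \<Rightarrow> nat" where "pe a b \<equiv> prod_encode (a, b)"
definition p0 :: "nat \<Rightarrow> nat" where "p0 z = fst (prod_decode z)"
definition p1 :: "nat \<Rightarrow> nat" where "p1 z = snd (prod_decode z)"

lemma p_simps [simp]: "p0 (pe a b) = a" "p1 (pe a b) = b" "pe (p0 z) (p1 z) = z"
  by (simp_all add: p0_def p1_def)

lemma p_diag: "p0 z = z - triangle (diag z)" "p1 z = diag z - p0 z"
proof -
  have "diag z = p0 z + p1 z" using diag_prod_encode[of "p0 z" "p1 z"] by simp
  moreover have "z = triangle (p0 z + p1 z) + p0 z" using p_simps(3)[of z] by (simp add: prod_encode_def)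
  ultimately show "p0 z = z - triangle (diag z)" "p1 z = diag z - p0 z" by simp_all
qed

lemma recn_p:
  assumes "recn n f"
  shows "recn n (\<lambda>xs. p0 (f xs))" "recn n (\<lambda>xs. p1 (f xs))"
  unfolding p_diag by (rule recn_diff recn_triangle recn_diag assms)+

text \<open>Several arguments are packed into one code, so that recursiveness of long compositions
  follows by a uniform set of rules for unary functions.\<close>

definition rec1 :: "(nat \<Rightarrow> nat) \<Rightarrow> bool" where
  "rec1 f \<longleftrightarrow> recn 1 (\<lambda>xs. f (xs ! 0))"

lemma rec1_comp: "rec1 f \<Longrightarrow> recn n g \<Longrightarrow> recn n (\<lambda>xs. f (g xs))"
  unfolding rec1_def using recn_comp[of "[g]" "\<lambda>xs. f (xs ! 0)" n] by auto

lemma rec1_basic: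
  "rec1 (\<lambda>x. c)" "rec1 (\<lambda>x. x)"
  "rec1 f \<Longrightarrow> rec1 (\<lambda>x. Suc (f x))"
  "rec1 f \<Longrightarrow> rec1 g \<Longrightarrow> rec1 (\<lambda>x. f x + g x)"
  "rec1 f \<Longrightarrow> rec1 g \<Longrightarrow> rec1 (\<lambda>x. f x - g x)"
  "rec1 f \<Longrightarrow> rec1 g \<Longrightarrow> rec1 a \<Longrightarrow> rec1 b \<Longrightarrow> rec1 (\<lambda>x. if f x = g x then a x else b x)"
  "rec1 f \<Longrightarrow> rec1 g \<Longrightarrow> rec1 (\<lambda>x. pe (f x) (g x))"
  "rec1 f \<Longrightarrow> rec1 (\<lambda>x. p0 (f x))"
  "rec1 f \<Longrightarrow> rec1 (\<lambda>x. p1 (f x))"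
  unfolding rec1_def
  by (auto simp: prod_encode_def intro!: recn_const recn_proj recn_Suc recn_add recn_diff recn_if recn_triangle recn_p)

lemma rec1_tag: "rec1 f \<Longrightarrow> rec1 g \<Longrightarrow> rec1 (\<lambda>x. tag (f x) (g x))"
  unfolding tag_def by (rule rec1_basic(7))

lemma p_tag [simp]: "p0 (tag k n) = k" "p1 (tag k n) = n"
  by (simp_all add: tag_def)

lemma rec1_rec:
  assumes "rec1 a" "rec1 m" and h: "rec1 (\<lambda>z. h (p0 z) (p0 (p1 z)) (p1 (p1 z)))"
  shows "rec1 (\<lambda>x. rec_nat (a x) (h x) (m x))"
proof -
  have e: "recn (1 + 2) (\<lambda>ys. pe (drop 2 ys ! 0) (pe (ys ! 0) (ys ! 1)))"
    unfolding prod_encode_def by (auto intro!: recn_triangle recn_add recn_proj recn_drop2[of 1 "\<lambda>xs. xs ! 0", simplified])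
  show ?thesis
    using assms(1,2) unfolding rec1_def
    by (rule recn_rec) (use rec1_comp[OF h e] in simp)
qed

lemma rec1_trans: "rec1 f \<Longrightarrow> rec1 g \<Longrightarrow> rec1 (\<lambda>x. f (g x))"
  using rec1_comp[of f 1 "\<lambda>xs. g (xs ! 0)"] by (simp add: rec1_def)


subsection \<open>Lists\<close>

text \<open>Subtracting 1 removes the successor in front of a nonempty list code. The empty list has
  code 0, which is mapped to itself, so that dropping too many entries is harmless.\<close>

definition tlc :: "nat \<Rightarrow> nat" where "tlc l = p1 (l - 1)"
definition hdc :: "nat \<Rightarrow> nat" where "hdc l = p0 (l - 1)"
definition dropc :: "nat \<Rightarrow> nat \<Rightarrow> nat" where "dropc l i = rec_nat l (\<lambda>k r. tlc r) i"
text \<open>Counts the positions at which a nonempty rest remains. The code itself bounds their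
  number.\<close>

definition lenc :: "nat \<Rightarrow> nat" where
  "lenc l = rec_nat 0 (\<lambda>k r. if dropc l k = 0 then r else Suc r) l"

lemma rec1_list:
  "rec1 f \<Longrightarrow> rec1 (\<lambda>x. tlc (f x))" "rec1 f \<Longrightarrow> rec1 (\<lambda>x. hdc (f x))"
  by (auto simp: tlc_def hdc_def intro!: rec1_basic)

lemma rec1_dropc: "rec1 f \<Longrightarrow> rec1 g \<Longrightarrow> rec1 (\<lambda>x. dropc (f x) (g x))"
  unfolding dropc_def by (intro rec1_rec rec1_list rec1_basic)

lemma rec1_lenc: "rec1 f \<Longrightarrow> rec1 (\<lambda>x. lenc (f x))"
proof -
  have "rec1 (\<lambda>l. lenc l)" unfolding lenc_def by (intro rec1_rec rec1_dropc rec1_basic)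
  then show "rec1 f \<Longrightarrow> rec1 (\<lambda>x. lenc (f x))" by (rule rec1_trans)
qed

lemma tlc_encode [simp]: "tlc (list_encode xs) = list_encode (tl xs)"
proof -
  have "p1 0 = 0" using p_simps(2)[of 0 0] by (simp add: prod_encode_def)
  then show ?thesis by (cases xs) (auto simp: tlc_def)
qed

lemma hdc_encode: "xs \<noteq> [] \<Longrightarrow> hdc (list_encode xs) = hd xs"
  by (cases xs) (auto simp: hdc_def)

lemma dropc_encode [simp]: "dropc (list_encode xs) i = list_encode (drop i xs)"
  by (induct i) (auto simp: dropc_def drop_Suc tl_drop)

lemma nthc_encode: "i < length xs \<Longrightarrow> hdc (dropc (list_encode xs) i) = xs ! i"
  by (simp add: hdc_encode hd_drop_conv_nth)

lemma length_le_list_encode: "length xs \<le> list_encode xs"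
proof (induct xs)
  case (Cons x xs) then show ?case using le_prod_encode_2[of "list_encode xs" x] by simp
qed simp

lemma list_encode_0: "list_encode xs = 0 \<longleftrightarrow> xs = []"
  by (cases xs) auto

lemma lenc_encode [simp]: "lenc (list_encode xs) = length xs"
proof -
  have "rec_nat 0 (\<lambda>k r. if dropc (list_encode xs) k = 0 then r else Suc r) m = min m (length xs)" for m
    by (induct m) (auto simp: list_encode_0)
  then show ?thesis unfolding lenc_def using length_le_list_encode[of xs] by simp
qed

primrec foldri :: "(nat \<Rightarrow> 'a \<Rightarrow> nat \<Rightarrow> nat) \<Rightarrow> nat \<Rightarrow> nat \<Rightarrow> 'a list \<Rightarrow> nat" where
  "foldri f a i [] = a"
| "foldri f a i (x # xs) = f i x (foldri f a (Suc i) xs)"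

text \<open>The fold works from the last entry backwards, so step \<open>k\<close> of the recursion
  treats position \<open>length xs - Suc k\<close>.\<close>

lemma foldri_rec:
  "foldri f a 0 xs = rec_nat a (\<lambda>k r. f (length xs - Suc k) (xs ! (length xs - Suc k)) r) (length xs)"
proof -
  have "foldri f a (length xs - m) (drop (length xs - m) xs) =
      rec_nat a (\<lambda>k r. f (length xs - Suc k) (xs ! (length xs - Suc k)) r) m" if "m \<le> length xs" for m
    using that
  proof (induct m)
    case (Suc m)
    then have "drop (length xs - Suc m) xs = xs ! (length xs - Suc m) # drop (length xs - m) xs"
      using Cons_nth_drop_Suc[of "length xs - Suc m" xs] by (simp add: Suc_diff_Suc)
    then show ?case using Suc by (simp add: Suc_diff_Suc)
  qed simp
  from this[of "length xs"] show ?thesis by simp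
qed

lemma rec1_foldri:
  assumes l: "rec1 l" and a: "rec1 a" and f: "rec1 (\<lambda>z. f (p0 z) (p0 (p1 z)) (p0 (p1 (p1 z))) (p1 (p1 (p1 z))))"
  shows "rec1 (\<lambda>x. foldri (f x) (a x) 0 (list_decode (l x)))"
proof -
  let ?i = "\<lambda>x k. lenc (l x) - Suc k"
  let ?e = "\<lambda>z. pe (p0 z) (pe (?i (p0 z) (p0 (p1 z))) (pe (hdc (dropc (l (p0 z)) (?i (p0 z) (p0 (p1 z))))) (p1 (p1 z))))"
  have "rec1 ?e" by (intro rec1_basic rec1_list rec1_dropc rec1_lenc rec1_trans[OF l])
  from rec1_trans[OF f this]
  have "rec1 (\<lambda>x. rec_nat (a x) (\<lambda>k r. f x (?i x k) (hdc (dropc (l x) (?i x k))) r) (lenc (l x)))"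
    by (intro rec1_rec a rec1_lenc l) simp
  moreover have "foldri (f x) (a x) 0 xs =
      rec_nat (a x) (\<lambda>k r. f x (lenc (list_encode xs) - Suc k) (hdc (dropc (list_encode xs) (lenc (list_encode xs) - Suc k))) r) (lenc (list_encode xs))"
    for x xs
  proof -
    have "rec_nat (a x) (\<lambda>k r. f x (length xs - Suc k) (xs ! (length xs - Suc k)) r) m =
      rec_nat (a x) (\<lambda>k r. f x (length xs - Suc k) (hdc (dropc (list_encode xs) (length xs - Suc k))) r) m" if "m \<le> length xs" for m
      using that nthc_encode[of _ xs] by (induct m) (auto simp del: dropc_encode)
    then show ?thesis unfolding foldri_rec lenc_encode by blast
  qed
  from this[of _ "list_decode (l _)"] have "(\<lambda>x. foldri (f x) (a x) 0 (list_decode (l x))) =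
      (\<lambda>x. rec_nat (a x) (\<lambda>k r. f x (?i x k) (hdc (dropc (l x) (?i x k))) r) (lenc (l x)))" by (auto simp del: lenc_encode dropc_encode)
  ultimately show ?thesis by simp
qed


subsection \<open>Course-of-values recursion\<close>

text \<open>The table lists the values at \<open>x - 1, ..., 0\<close>, the most recent first; hence
  the position \<open>x - Suc y\<close>. Outside the table the value is 0.\<close>

definition look :: "nat \<Rightarrow> nat \<Rightarrow> nat \<Rightarrow> nat" where
  "look t x y = (if Suc y - x = 0 then hdc (dropc t (x - Suc y)) else 0)"

lemma rec1_look: "rec1 t \<Longrightarrow> rec1 x \<Longrightarrow> rec1 y \<Longrightarrow> rec1 (\<lambda>z. look (t z) (x z) (y z))"
  unfolding look_def by (intro rec1_basic rec1_list rec1_dropc)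

text \<open>The step receives the earlier values as a function. Thus a translation can be given by
  its recursion equations, and it remains to check that their combination with the table lookup is
  recursive.\<close>

lemma rec1_cov:
  assumes H: "rec1 (\<lambda>z. H (look (p1 z) (p0 z)) (p0 z))"
  shows "\<exists>F. rec1 F \<and> (\<forall>x. F x = H (\<lambda>y. if y < x then F y else 0) x)"
proof -
  let ?G = "\<lambda>n t. H (look t n) n"
  define T where "T n = rec_nat 0 (\<lambda>n t. Suc (pe (?G n t) t)) n" for n
  define F where "F n = ?G n (T n)" for n
  have G: "rec1 f \<Longrightarrow> rec1 g \<Longrightarrow> rec1 (\<lambda>x. ?G (f x) (g x))" for f g
    using rec1_trans[OF H rec1_basic(7)[of f g]] by simp
  have T: "rec1 T" unfolding T_def by (intro rec1_rec rec1_basic G)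
  then have "rec1 F" unfolding F_def by (intro G rec1_basic)
  moreover have TF: "T n = list_encode (rev (map F [0..<n]))" for n
    by (induct n) (auto simp: T_def F_def)
  have "look (T x) x y = (if y < x then F y else 0)" for x y
  proof (cases "y < x")
    case True
    then have "look (T x) x y = rev (map F [0..<x]) ! (x - Suc y)"
      unfolding look_def TF by (simp add: nthc_encode del: dropc_encode)
    then show ?thesis using True by (simp add: rev_nth)
  qed (simp add: look_def)
  then have "F x = H (\<lambda>y. if y < x then F y else 0) x" for x
    unfolding F_def[of x] by presburger
  ultimately show ?thesis by blast
qed


text \<open>Fails for tag 0, as \<open>tag 0 0 = 0\<close>; but in each of the numberings involved
  recursive arguments occur under positive tags only.\<close>

lemma tag_less: "0 < k \<Longrightarrow> y \<le> n \<Longrightarrow> y < tag k n"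
proof -
  have "m \<le> triangle m" for m by (induct m) auto
  from this[of "k + n"] show "0 < k \<Longrightarrow> y \<le> n \<Longrightarrow> y < tag k n" by (simp add: tag_def prod_encode_def)
qed

lemma le_pe: "y \<le> a \<Longrightarrow> y \<le> pe a b" "y \<le> b \<Longrightarrow> y \<le> pe a b"
  using le_prod_encode_1[of a b] le_prod_encode_2[of b a] by linarith+

lemma le_list_encode: "x \<in> set xs \<Longrightarrow> x \<le> list_encode xs"
  by (induct xs) (auto intro: le_SucI le_pe)

lemma foldri_map: "foldri f a i (map g xs) = foldri (\<lambda>i x r. f i (g x) r) a i xs"
  by (induct xs arbitrary: i) auto

lemma foldri_cong: "(\<And>i x r. x \<in> set xs \<Longrightarrow> f i x r = g i x r) \<Longrightarrow> foldri f a i xs = foldri g a i xs"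
  by (induct xs arbitrary: i) auto


section \<open>The translation is effective\<close>

definition cnum :: "nat \<Rightarrow> nat" where
  "cnum i = rec_nat (gn_trm \<^bold>0) (\<lambda>_ r. tag 2 (pe (gn_fct (FC (Fn SuccD))) r)) i"

lemma gn_num [simp]: "gn_trm (num i) = cnum i"
  by (induct i) (auto simp: cnum_def)

lemma rec1_cnum: "rec1 f \<Longrightarrow> rec1 (\<lambda>x. cnum (f x))"
  unfolding cnum_def by (intro rec1_rec rec1_tag rec1_basic)

text \<open>The operation \<open>argc\<close> on codes, constructor by constructor; subformulas that
  do not depend on the arguments are left as numerical constants. The later operations on codes
  follow the same pattern.\<close>

definition cargc :: "nat \<Rightarrow> nat \<Rightarrow> nat \<Rightarrow> nat" where
  "cargc j i a = tag 8 (tag 2 (pe (gn_fm (All0 (fapp 0 (NVar 0) \<doteq> fapp j (NVar 0))))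
     (tag 6 (tag 2 (pe (tag 0 (pe (gn_trm (NVar 0)) (tag 2 (pe (gn_fct (FVar 1)) (cnum i))))) a)))))"

lemma rec1_cargc: "rec1 f \<Longrightarrow> rec1 g \<Longrightarrow> rec1 (\<lambda>x. cargc j (f x) (g x))"
  unfolding cargc_def by (intro rec1_tag rec1_cnum rec1_basic)

abbreviation ceq0 :: nat where "ceq0 \<equiv> gn_fm (\<^bold>0 \<doteq> \<^bold>0)"

lemma gn_argcs: "gn_fm (argcs j i As) = foldri (\<lambda>i a r. tag 2 (pe (cargc j i a) r)) ceq0 i (map gn_fm As)"
  by (induct As arbitrary: i) (simp_all add: argc_def cargc_def)

text \<open>In the case of a composition the coded list starts with the arity and the outer
  description: the outer one is the head of the tail, the inner ones form the tail of the
  tail.\<close>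

definition stepPG :: "(nat \<Rightarrow> nat) \<Rightarrow> nat \<Rightarrow> nat" where
  "stepPG \<Phi> x = (if p0 x = 0 then gn_fm (NVar 0 \<doteq> \<^bold>0)
     else if p0 x = 1 then gn_fm (pg SuccD)
     else if p0 x = 2 then tag 0 (pe (gn_trm (NVar 0)) (tag 2 (pe (gn_fct (FVar 0)) (cnum (p1 (p1 x))))))
     else if p0 x = 3 then tag 8 (tag 2 (pe (foldri (\<lambda>i g r. tag 2 (pe (cargc 2 i (\<Phi> g)) r)) ceq0 0 (list_decode (tlc (tlc (p1 x)))))
       (\<Phi> (hdc (tlc (p1 x))))))
     else tag 8 (tag 2 (pe
       (tag 8 (tag 2 (pe (gn_fm (All0 (fapp 0 (NVar 0) \<doteq> fapp 2 (succ (NVar 0)))))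
         (tag 6 (tag 2 (pe (gn_fm (NVar 0 \<doteq> fapp 1 \<^bold>0)) (\<Phi> (p0 (p1 x)))))))))
       (tag 2 (pe
         (tag 5 (tag 6 (tag 2 (pe (gn_fm (NVar 0 \<doteq> fapp 0 (NVar 1))) (tag 6 (tag 2 (pe (gn_fm (NVar 0 \<doteq> fapp 0 (succ (NVar 2))))
           (tag 8 (tag 2 (pe (gn_fm (fapp 0 \<^bold>0 \<doteq> NVar 2)) (tag 2 (pe (gn_fm (fapp 0 \<^bold>1 \<doteq> NVar 1)) (tag 2 (pe
             (gn_fm (All0 (fapp 0 (succ (succ (NVar 0))) \<doteq> fapp 2 (succ (NVar 0))))) (\<Phi> (p1 (p1 x)))))))))))))))))
         (gn_fm (NVar 0 \<doteq> fapp 0 (fapp 1 \<^bold>0))))))))"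

lemma pg_recursive: "\<exists>F. rec1 F \<and> (\<forall>d. F (gn_prd d) = gn_fm (pg d))"
proof -
  have "rec1 (\<lambda>z. stepPG (look (p1 z) (p0 z)) (p0 z))"
    unfolding stepPG_def
    by (intro rec1_tag rec1_cnum rec1_cargc rec1_foldri rec1_list rec1_look rec1_basic)
  from rec1_cov[of stepPG, OF this] obtain F where F: "rec1 F" and
    eq: "\<And>x. F x = stepPG (\<lambda>y. if y < x then F y else 0) x" by blast
  have "F (gn_prd d) = gn_fm (pg d)" for d
  proof (induct d)
    case (CompD n h gs)
    let ?x = "gn_prd (CompD n h gs)"
    let ?\<Phi> = "\<lambda>y. if y < ?x then F y else 0"
    have gs: "?\<Phi> (gn_prd g) = gn_fm (pg g)" if "g \<in> set gs" for g
    proof -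
      have "gn_prd g \<le> list_encode (n # gn_prd h # map gn_prd gs)" by (rule le_list_encode) (use that in auto)
      then show ?thesis using CompD(2)[OF that] tag_less[of 3] by (simp del: list_encode.simps)
    qed
    have "gn_prd h \<le> list_encode (n # gn_prd h # map gn_prd gs)" by (rule le_list_encode) simp
    then have h: "?\<Phi> (gn_prd h) = gn_fm (pg h)" using CompD(1) tag_less[of 3] by (simp del: list_encode.simps)
    have "foldri (\<lambda>i g r. tag 2 (pe (cargc 2 i (?\<Phi> g)) r)) ceq0 0 (map gn_prd gs) =
      foldri (\<lambda>i a r. tag 2 (pe (cargc 2 i a) r)) ceq0 0 (map gn_fm (map pg gs))"
      unfolding foldri_map by (rule foldri_cong) (simp add: gs del: gn_prd.simps gn_fm.simps)
    then have "F ?x = tag 8 (tag 2 (pe (gn_fm (argcs 2 0 (map pg gs))) (gn_fm (pg h))))"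
      unfolding eq[of ?x] gn_argcs h[symmetric] by (simp add: stepPG_def hdc_encode del: list_encode.simps gn_fm.simps)
    then show ?case by simp
  next
    case (RecD g h)
    have "gn_prd g < gn_prd (RecD g h)" "gn_prd h < gn_prd (RecD g h)" by (auto simp: tag_less le_pe)
    then show ?case using RecD unfolding eq[of "gn_prd (RecD g h)"]
      by (simp add: stepPG_def tailf_def recf_def stepf_def)
  qed (simp_all add: eq[of "gn_prd _"] eq[of "tag _ _"] stepPG_def)
  with F show ?thesis by blast
qed

text \<open>The number \<open>tag 1 (tag 1 0)\<close> is the code of the successor, the only
  description in the language of \<open>M\<close>.\<close>

definition cM :: "nat \<Rightarrow> nat" where
  "cM c = (if p0 c = 0 then 1 else if p0 c = 2 then 1 else if c = tag 1 (tag 1 0) then 1 else 0)"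

lemma cM_gn: "cM (gn_cst c) = (if c \<in> lang_M then 1 else 0)"
proof (cases c)
  case (Fn d)
  then show ?thesis using gn_prd_inj[of d SuccD] by (auto simp: cM_def lang_M_def)
qed (auto simp: cM_def lang_M_def)

text \<open>A number may code a term and a functor at the same time, since the two numberings
  overlap. The recursion therefore computes a pair, one component for each reading.\<close>

definition stepM :: "(nat \<Rightarrow> nat) \<Rightarrow> nat \<Rightarrow> nat" where
  "stepM \<Phi> c = pe
     (if p0 c = 0 then 1
      else if p0 c = 1 then
        foldri (\<lambda>i t r. if p0 (\<Phi> t) = 1 then r else 0)
          (foldri (\<lambda>i u r. if p1 (\<Phi> u) = 1 then r else 0) (cM (p0 (p1 c))) 0 (list_decode (p1 (p1 (p1 c)))))
          0 (list_decode (p0 (p1 (p1 c))))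
      else if p1 (\<Phi> (p0 (p1 c))) = 1 then p0 (\<Phi> (p1 (p1 c))) else 0)
     (if p0 c = 0 then 1 else if p0 c = 1 then cM (p1 c) else p0 (\<Phi> (p1 c)))"

lemma foldri_all: "foldri (\<lambda>i t r. if P t then r else 0) a i xs = (if \<forall>x\<in>set xs. P x then a else 0)"
  by (induct xs arbitrary: i) auto

lemma mt_recursive:
  "\<exists>F. rec1 F \<and> (\<forall>t. p0 (F (gn_trm t)) = (if mt t then 1 else 0)) \<and> (\<forall>u. p1 (F (gn_fct u)) = (if mf u then 1 else 0))"
proof -
  have "rec1 (\<lambda>z. stepM (look (p1 z) (p0 z)) (p0 z))"
    unfolding stepM_def cM_def
    by (intro rec1_tag rec1_foldri rec1_look rec1_basic)
  from rec1_cov[of stepM, OF this] obtain F where F: "rec1 F" and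
    eq: "\<And>x. F x = stepM (\<lambda>y. if y < x then F y else 0) x" by blast
  have "p0 (F (gn_trm t)) = (if mt t then 1 else 0)" "p1 (F (gn_fct u)) = (if mf u then 1 else 0)" for t u
  proof (induct t and u rule: trm.induct fct.induct)
    case (Cst c ts us)
    let ?x = "gn_trm (Cst c ts us)"
    let ?\<Phi> = "\<lambda>y. if y < ?x then F y else 0"
    have t: "gn_trm t < ?x" if "t \<in> set ts" for t
      unfolding gn_trm.simps by (intro tag_less le_pe(2) le_pe(1) le_list_encode) (use that in auto)
    have u: "gn_fct t < ?x" if "t \<in> set us" for t
      unfolding gn_trm.simps by (intro tag_less le_pe(2) le_list_encode) (use that in auto)
    have "(\<forall>x\<in>set (map gn_trm ts). p0 (?\<Phi> x) = 1) \<longleftrightarrow> (\<forall>t\<in>set ts. mt t)"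
      using t Cst(1) by (auto simp del: gn_trm.simps)
    moreover have "(\<forall>x\<in>set (map gn_fct us). p1 (?\<Phi> x) = 1) \<longleftrightarrow> (\<forall>t\<in>set us. mf t)"
      using u Cst(2) by (auto simp del: gn_trm.simps)
    ultimately have "p0 (stepM ?\<Phi> ?x) = (if mt (Cst c ts us) then 1 else 0)"
      unfolding stepM_def foldri_all by (simp add: cM_gn)
    then show ?case unfolding eq[of ?x] .
  next
    case (App u t)
    have "gn_trm t < gn_trm (App u t)" "gn_fct u < gn_trm (App u t)" by (auto simp: tag_less le_pe)
    then show ?case using App unfolding eq[of "gn_trm (App u t)"] by (simp add: stepM_def)
  next
    case (Lam t)
    have "gn_trm t < gn_fct (Lam t)" by (auto intro!: tag_less)
    then show ?case using Lam unfolding eq[of "gn_fct (Lam t)"] by (simp add: stepM_def)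
  qed (simp_all add: eq[of "tag _ _"] stepM_def cM_gn)
  with F show ?thesis by blast
qed

definition c4 :: "nat \<Rightarrow> nat" where "c4 c = c + c + c + c"
definition key :: "nat \<Rightarrow> nat \<Rightarrow> nat" where "key c E = pe c (E + c4 c)"

text \<open>A recursive call lowers the code by at least 1 and raises the offset by at most 3, which
  the weight 4 of the code outbalances. So the sum of the components does not grow, and for sums
  that do not grow the pairing increases strictly with its first component.\<close>

lemma key_less: "c' < c \<Longrightarrow> E' \<le> E + 3 \<Longrightarrow> key c' E' < key c E"
proof -
  assume "c' < c" "E' \<le> E + 3"
  then have "c' + (E' + c4 c') \<le> c + (E + c4 c)" by (simp add: c4_def)
  from triangle_mono[OF this] show ?thesis using \<open>c' < c\<close> by (simp add: key_def prod_encode_def)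
qed

lemma key_simps [simp]: "p0 (key c E) = c" "p1 (key c E) - c4 c = E"
  by (simp_all add: key_def)

lemma rec1_key: "rec1 f \<Longrightarrow> rec1 g \<Longrightarrow> rec1 (\<lambda>x. key (f x) (g x))" "rec1 f \<Longrightarrow> rec1 (\<lambda>x. c4 (f x))"
  unfolding key_def c4_def by (assumption | rule rec1_basic)+

text \<open>The listed numbers code the constants with a function argument: bounded sum, product,
  minimum and maximum, the two courses of values, and the continued product.\<close>

definition ckl :: "nat \<Rightarrow> nat" where
  "ckl n = (if n = 15 then 1 else if n = 16 then 1 else if n = 17 then 1 else if n = 18 then 1 else
     if n = 23 then 1 else if n = 24 then 1 else if n = 26 then 1 else 0)"

lemma ckl_gn: "ckl (gn_klc k) = 1 \<longleftrightarrow> arity_klc k = (1, 1)"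
  by (cases k) (auto simp: ckl_def)

lemma cg_recursive: "\<exists>F. rec1 F \<and> (\<forall>c. F (gn_cst c) = gn_fm (cg c))"
proof -
  obtain P where P: "rec1 P" "\<And>d. P (gn_prd d) = gn_fm (pg d)" using pg_recursive by blast
  define F where "F x = (if p0 x = 0 then gn_fm (NVar 0 \<doteq> \<^bold>0) else if p0 x = 1 then P (p1 x)
    else if p0 x = 2 then (if ckl (p1 x) = 1
      then tag 0 (pe (gn_trm (NVar 0)) (tag 1 (pe x (pe (list_encode [gn_trm (fapp 0 \<^bold>0)]) (list_encode [gn_fct (FVar 1)])))))
      else tag 0 (pe (gn_trm (NVar 0)) (tag 1 (pe x (pe (list_encode [gn_trm (fapp 0 \<^bold>0), gn_trm (fapp 0 \<^bold>1)]) (list_encode []))))))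
    else gn_fm (cg Rec))" for x
  have "rec1 (\<lambda>x. F x)"
    unfolding F_def ckl_def by (intro rec1_tag rec1_basic rec1_trans[OF P(1)])
  moreover have "F (gn_cst c) = gn_fm (cg c)" for c
  proof (cases c)
    case Zero then show ?thesis by (simp add: F_def)
  next
    case (Fn d) then show ?thesis by (simp add: F_def P(2))
  next
    case (Kl k) then show ?thesis using ckl_gn[of k] by (simp add: F_def)
  next
    case Rec then show ?thesis unfolding F_def by (simp del: cg.simps)
  qed
  ultimately show ?thesis by blast
qed

lemma fcg_recursive: "\<exists>F. rec1 F \<and> (\<forall>c. F (gn_cst c) = gn_fm (fcg c))"
proof -
  obtain P where P: "rec1 P" "\<And>d. P (gn_prd d) = gn_fm (pg d)" using pg_recursive by blast
  define F where "F x = (if p0 x = 1 then tag 8 (tag 2 (pe (gn_fm (fapp 0 \<^bold>0 \<doteq> NVar 1)) (P (p1 x))))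
    else if p0 x = 2 then tag 0 (pe (gn_trm (NVar 0)) (tag 2 (pe (tag 1 x) (gn_trm (NVar 1)))))
    else ceq0)" for x
  have "rec1 (\<lambda>x. F x)"
    unfolding F_def by (intro rec1_tag rec1_basic rec1_trans[OF P(1)])
  moreover have "F (gn_cst c) = gn_fm (fcg c)" for c
    by (cases c) (simp_all add: F_def P(2) fcg_def)
  ultimately show ?thesis by blast
qed

text \<open>The value at \<open>key c E\<close> is the pair of the codes of \<open>gr E t\<close> and \<open>gf E u\<close>, where \<open>t\<close> and \<open>u\<close> are the
  term and the functor with the code \<open>c\<close>. The keys of the recursive calls are smaller, although \<open>E\<close>
  increases.\<close>

definition stepG :: "(nat \<Rightarrow> nat) \<Rightarrow> (nat \<Rightarrow> nat) \<Rightarrow> (nat \<Rightarrow> nat \<Rightarrow> nat) \<Rightarrow> nat \<Rightarrow> nat \<Rightarrow> nat" where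
  "stepG C D \<Phi> c E = pe
     (if p0 c = 0 then tag 0 (pe (gn_trm (NVar 0)) (tag 2 (pe (gn_fct (FVar 0)) (cnum (p1 c)))))
      else if p0 c = 1 then tag 8 (tag 2 (pe
        (if p1 (p1 (p1 c)) = 0 then ceq0 else
          tag 5 (tag 8 (tag 2 (pe (gn_fm (All0 (fapp 0 (NVar 0) \<doteq> fapp 2 (NVar 0))))
            (tag 6 (tag 2 (pe (gn_fm (NVar 0 \<doteq> fapp 1 (NVar 1))) (p1 (\<Phi> (hdc (p1 (p1 (p1 c)))) (E + 2))))))))))
        (tag 8 (tag 2 (pe (foldri (\<lambda>i t r. tag 2 (pe (cargc 3 i (p0 (\<Phi> t (E + 3)))) r)) ceq0 0 (list_decode (p0 (p1 (p1 c)))))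
          (C (p0 (p1 c))))))))
      else tag 6 (tag 2 (pe (p0 (\<Phi> (p1 (p1 c)) E))
        (tag 6 (tag 2 (pe (gn_fm (NVar 0 \<doteq> NVar 2)) (p1 (\<Phi> (p0 (p1 c)) E))))))))
     (if p0 c = 0 then tag 0 (pe (gn_trm (NVar 0)) (tag 2 (pe (tag 0 (p1 c + E)) (gn_trm (NVar 1)))))
      else if p0 c = 1 then D (p1 c)
      else tag 8 (tag 2 (pe (gn_fm (fapp 0 \<^bold>0 \<doteq> NVar 1)) (tag 2 (pe
        (gn_fm (All0 (fapp 0 (succ (NVar 0)) \<doteq> fapp 1 (NVar 0)))) (p0 (\<Phi> (p1 c) (E + 1))))))))"

lemma gr_recursive:
  "\<exists>F. rec1 F \<and> (\<forall>E t. p0 (F (key (gn_trm t) E)) = gn_fm (gr E t)) \<and> (\<forall>E u. p1 (F (key (gn_fct u) E)) = gn_fm (gf E u))"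
proof -
  obtain C where C: "rec1 C" "\<And>c. C (gn_cst c) = gn_fm (cg c)" using cg_recursive by blast
  obtain D where D: "rec1 D" "\<And>c. D (gn_cst c) = gn_fm (fcg c)" using fcg_recursive by blast
  \<comment> \<open>The offset is recovered from the key by removing the weight of the code.\<close>
  define H where "H \<Phi> z = stepG C D (\<lambda>c E. \<Phi> (key c E)) (p0 z) (p1 z - c4 (p0 z))" for \<Phi> z
  have "rec1 (\<lambda>z. H (look (p1 z) (p0 z)) (p0 z))"
    unfolding H_def stepG_def
    by (intro rec1_tag rec1_key rec1_foldri rec1_cnum rec1_cargc rec1_list rec1_look rec1_basic rec1_trans[OF C(1)] rec1_trans[OF D(1)])
  from rec1_cov[of H, OF this] obtain F where F: "rec1 F" and
    eq0: "\<And>x. F x = H (\<lambda>y. if y < x then F y else 0) x" by blast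
  let ?\<Phi> = "\<lambda>c E c' E'. if key c' E' < key c E then F (key c' E') else 0"
  have eq: "F (key c E) = stepG C D (?\<Phi> c E) c E" for c E
    unfolding eq0[of "key c E"] H_def key_simps ..
  have "p0 (F (key (gn_trm t) E)) = gn_fm (gr E t)" "p1 (F (key (gn_fct u) E)) = gn_fm (gf E u)" for t u E
  proof (induct t and u arbitrary: E and E rule: trm.induct fct.induct)
    case (Cst c ts us)
    let ?x = "gn_trm (Cst c ts us)"
    have t: "gn_trm t < ?x" if "t \<in> set ts" for t
      unfolding gn_trm.simps by (intro tag_less le_pe(2) le_pe(1) le_list_encode) (use that in auto)
    have u: "gn_fct t < ?x" if "t \<in> set us" for t
      unfolding gn_trm.simps by (intro tag_less le_pe(2) le_list_encode) (use that in auto)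
    define \<Phi> where "\<Phi> = ?\<Phi> ?x E"
    have e: "F (key ?x E) = stepG C D \<Phi> ?x E" unfolding \<Phi>_def by (rule eq)
    have T: "p0 (\<Phi> (gn_trm s) (E + 3)) = gn_fm (gr (E + 3) s)" if "s \<in> set ts" for s
      using Cst(1)[OF that] key_less[OF t[OF that]] unfolding \<Phi>_def by simp
    have ts: "foldri (\<lambda>i t r. tag 2 (pe (cargc 3 i (p0 (\<Phi> t (E + 3)))) r)) ceq0 0 (map gn_trm ts) =
        gn_fm (argcs 3 0 (map (gr (E + 3)) ts))"
      unfolding gn_argcs foldri_map by (rule foldri_cong) (simp only: T)
    have us: "p1 (\<Phi> (gn_fct v) (E + 2)) = gn_fm (gf (E + 2) v)" if "us = v # vs" for v vs
      using Cst(2)[of v] key_less[OF u[of v]] that unfolding \<Phi>_def by simp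
    show ?case
    proof (cases us)
      case Nil
      then show ?thesis unfolding e stepG_def using ts C(2) by simp
    next
      case (Cons v vs)
      then show ?thesis unfolding e stepG_def using ts us[OF Cons] C(2) by (simp add: hdc_def)
    qed
  next
    case (App u t)
    have "gn_trm t < gn_trm (App u t)" "gn_fct u < gn_trm (App u t)" by (auto simp: tag_less le_pe)
    then show ?case using App key_less unfolding eq[of "gn_trm (App u t)" E] by (simp add: stepG_def)
  next
    case (Lam t)
    have "gn_trm t < gn_fct (Lam t)" by (auto intro!: tag_less)
    then show ?case using Lam key_less unfolding eq[of "gn_fct (Lam t)" E] by (simp add: stepG_def consf_def)
  qed (simp_all add: eq[of "tag _ _"] stepG_def D(2))
  with F show ?thesis by blast
qed

definition cenvc :: "nat \<Rightarrow> nat" where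
  "cenvc n = rec_nat ceq0 (\<lambda>k r. tag 2 (pe (tag 0 (pe (tag 2 (pe (gn_fct (FVar 0)) (cnum k))) (tag 0 k))) r)) n"

lemma gn_envc: "gn_fm (envc n) = cenvc n"
  by (induct n) (auto simp: cenvc_def)

lemma rec1_cenvc: "rec1 f \<Longrightarrow> rec1 (\<lambda>x. cenvc (f x))"
  unfolding cenvc_def by (intro rec1_rec rec1_tag rec1_cnum rec1_basic)

theorem effective_tr: "effective_on X tr"
proof -
  obtain G where G: "rec1 G" "\<And>E t. p0 (G (key (gn_trm t) E)) = gn_fm (gr E t)" using gr_recursive by blast
  obtain M where M: "rec1 M" "\<And>t. p0 (M (gn_trm t)) = (if mt t then 1 else 0)" using mt_recursive by blast
  \<comment> \<open>The nested conditional is a conjunction. Once tags 0 and 1 are settled,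
    \<open>p0 x - 4 = 0\<close> singles out the binary connectives, and the remaining tags are the
    quantifiers, which keep their tag.\<close>
  define H where "H \<Phi> x = (if p0 x = 0 then
       (if (if p0 (M (p0 (p1 x))) = 1 then p0 (M (p1 (p1 x))) else 0) = 1 then x
        else tag 8 (tag 2 (pe (cenvc (Suc x)) (tag 6 (tag 2 (pe (p0 (G (key (p0 (p1 x)) 1))) (p0 (G (key (p1 (p1 x)) 1)))))))))
     else if p0 x = 1 then tag 1 (\<Phi> (p1 x))
     else if p0 x - 4 = 0 then tag (p0 x) (pe (\<Phi> (p0 (p1 x))) (\<Phi> (p1 (p1 x))))
     else tag (p0 x) (\<Phi> (p1 x)))" for \<Phi> x
  have "rec1 (\<lambda>z. H (look (p1 z) (p0 z)) (p0 z))"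
    unfolding H_def
    by (intro rec1_tag rec1_key rec1_cenvc rec1_look rec1_basic rec1_trans[OF G(1)] rec1_trans[OF M(1)])
  from rec1_cov[of H, OF this] obtain F where F: "rec1 F" and
    eq: "\<And>x. F x = H (\<lambda>y. if y < x then F y else 0) x" by blast
  have 1: "gn_fm A < tag k (gn_fm A)" if "0 < k" for A k using that by (intro tag_less) auto
  have 2: "gn_fm A < tag k (pe (gn_fm A) (gn_fm B))" "gn_fm B < tag k (pe (gn_fm A) (gn_fm B))" if "0 < k" for A B k
    using that by (auto simp: tag_less le_pe)
  have "F (gn_fm A) = gn_fm (tr A)" for A
  proof (induct A)
    case (Eq s t)
    have "F (gn_fm (s \<doteq> t)) = (if mt s \<and> mt t then gn_fm (s \<doteq> t) else
        tag 8 (tag 2 (pe (gn_fm (envc (Suc (gn_fm (s \<doteq> t))))) (tag 6 (tag 2 (pe (gn_fm (gr 1 s)) (gn_fm (gr 1 t))))))))"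
      unfolding eq[of "gn_fm (s \<doteq> t)"] gn_envc H_def by (simp add: G(2)[simplified] M(2))
    then show ?case by (simp del: envc.simps)
  qed (simp_all add: eq[of "tag _ _"] H_def 1 2)
  moreover obtain F' where "recursive 1 F'" "\<And>xs. length xs = 1 \<Longrightarrow> F' xs = F (xs ! 0)"
    using F unfolding rec1_def recn_def by blast
  then have "recursive 1 F'" "\<And>x. F' [x] = F x" by simp_all
  ultimately show ?thesis unfolding effective_on_def by metis
qed

theorem theorem5p1:
  shows "conservative_extension sys_EL_plus_CFd sys_M \<and> definitional_extension sys_EL_plus_CFd sys_M"
proof -
  have d: "deriv sys_M (tr ` \<Gamma>) (tr E)"
    if "\<Gamma> \<subseteq> formulas sys_EL_plus_CFd" "deriv sys_EL_plus_CFd \<Gamma> E" for \<Gamma> E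
    by (rule deriv_tr[OF that])
  have M: "tr E = E" if "E \<in> formulas sys_M" for E
    using that tr_M by (simp add: formulas_def)
  have "theorems sys_EL_plus_CFd \<inter> formulas sys_M = theorems sys_M"
  proof
    show "theorems sys_EL_plus_CFd \<inter> formulas sys_M \<subseteq> theorems sys_M"
      using d[of "{}"] M by (auto simp: theorems_def) metis
    show "theorems sys_M \<subseteq> theorems sys_EL_plus_CFd \<inter> formulas sys_M"
      using E_M deriv_wf[of sys_M "{}"] by (auto simp: extension_def theorems_def formulas_def)
  qed
  moreover have "tr ` formulas sys_EL_plus_CFd \<subseteq> formulas sys_M"
    using wf_tr by (auto simp: formulas_def)
  moreover have "\<forall>E\<in>formulas sys_EL_plus_CFd. (tr E \<^bold>\<longleftrightarrow> E) \<in> theorems sys_EL_plus_CFd"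
    using tr_equiv by (simp add: formulas_def)
  moreover have "commutes_with_logic (formulas sys_EL_plus_CFd) tr"
    by (simp add: commutes_with_logic_def)
  ultimately show ?thesis
    unfolding conservative_extension_def definitional_extension_def
    using E_M effective_tr[of "formulas sys_EL_plus_CFd"] M d by blast
qed

end
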